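(* Let $d \geq 2$ and $\beta > \frac{1-d}{2}$, and let $$\mathbf{C}(d) = \frac{2^{2-4d} \pi^{\frac{2-5d}{2}}}{\Gamma(\frac{d}{2})}.$$ Then $$\|\, |\mathfrak{D}|^\beta(uv)\|_{L^2(\mathbb{R}^{1+d})}^2 \leq 2^{-2\beta} \mathbf{C}(d) \int_{\mathbb{R}^{2d}} |\widehat{u}_0(\zeta)|^2|\widehat{v}_0(\eta)|^2 |\zeta - \eta|^{4\beta+d-2} \, \mathrm{d}\zeta\, \mathrm{d}\eta$$ for all solutions $u$ and $v$ of the free Schrödinger equation $i\partial_t u + \Delta u = 0$ on $\mathbb{R}^{1+d}$ with initial data $u(0)=u_0$, $v(0)=v_0$ such that $(u_0,v_0) \in \Upsilon_\beta$. The constant is optimal, and it is attained by a pair of nonzero initial data $(u_0,v_0)\in\Upsilon_\beta$ (that is, equality holds) if and only if $\widehat{u}_0 \in \mathfrak{G}$ and $v_0$ is a (nonzero) scalar multiple of $u_0$.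
   Context: The Fourier transform is $\widehat{f}(\xi) = \int_{\mathbb{R}^d} f(x) e^{-ix \cdot \xi}\,\mathrm{d}x$. The solution of $i\partial_t u+\Delta u=0$, $u(0)=u_0$ is $u(t,\cdot)=e^{it\Delta}u_0$, i.e. the spatial Fourier transform of $u(t,\cdot)$ is $e^{-it|\xi|^2}\widehat{u}_0(\xi)$. Here $\mathfrak{D} = i\partial_t + \frac{1}{2}\Delta$, and $|\mathfrak{D}|^\beta$ is the space-time Fourier multiplier operator with multiplier $|\tau + \frac{1}{2}|\xi|^2|^\beta$, with respect to the space-time Fourier transform $\widetilde{F}(\tau,\xi) = \int_{\mathbb{R}^{1+d}} F(t,x) e^{-i(t\tau + x \cdot \xi)}\, \mathrm{d}t\, \mathrm{d}x$. For $\lambda\in\mathbb{R}$, $$I_\lambda(f,g) := \int_{\mathbb{R}^{2d}} |\widehat{f}(\zeta)|^2 |\widehat{g}(\eta)|^2 |\zeta - \eta|^{4\lambda+d-2} \, \mathrm{d}\zeta\, \mathrm{d}\eta,$$ $$\Upsilon_\lambda := \{ (f,g) : f,g : \mathbb{R}^d \to \mathbb{C} \text{ measurable and } I_\lambda(f,g) < \infty\}.$$ $\mathfrak{G}$ is the class of Gaussian functions on $\mathbb{R}^d$ of the form $\eta\mapsto\exp(a|\eta|^2 + b \cdot \eta + c)$ with $a, c \in \mathbb{C}$, $b \in \mathbb{C}^d$ and $\mathrm{Re}(a) < 0$. Functions are identified when equal almost everywhere. *)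

theory Defs
  imports "HOL-Analysis.Analysis"
begin

section \<open>Schwartz functions and the Fourier transform of tempered distributions\<close>

text \<open>Iterated partial derivatives; the list records the directions (basis vectors).\<close>

primrec iter_deriv :: "'a list \<Rightarrow> ('a::euclidean_space \<Rightarrow> complex) \<Rightarrow> 'a \<Rightarrow> complex" where
  "iter_deriv [] f = f"
| "iter_deriv (b # bs) f = (\<lambda>x. frechet_derivative (iter_deriv bs f) (at x) b)"

text \<open>Differentiability of every iterated partial derivative is equivalent to smoothness, since it
  makes all partial derivatives of all orders continuous.\<close>

definition schwartz :: "('a::euclidean_space \<Rightarrow> complex) \<Rightarrow> bool" where
  "schwartz f \<longleftrightarrow> (\<forall>bs\<in>lists Basis.
     (\<forall>x. iter_deriv bs f differentiable (at x)) \<and>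
     (\<forall>N::nat. bounded (range (\<lambda>x. (1 + norm x) ^ N *\<^sub>R iter_deriv bs f x))))"

definition fourier_integral :: "('a::euclidean_space \<Rightarrow> complex) \<Rightarrow> 'a \<Rightarrow> complex" where
  "fourier_integral f \<xi> = (LINT x|lborel. f x * exp (- \<i> * of_real (x \<bullet> \<xi>)))"

text \<open>Measurable functions that define a tempered distribution \<open>distr_of f\<close>.
  Distributions are functionals, of which only the values on Schwartz functions are used.\<close>

definition tempered :: "('a::euclidean_space \<Rightarrow> complex) \<Rightarrow> bool" where
  "tempered f \<longleftrightarrow> f \<in> borel_measurable lborel \<and>
     (\<forall>\<phi>. schwartz \<phi> \<longrightarrow> integrable lborel (\<lambda>x. f x * \<phi> x))"

definition distr_of :: "('a::euclidean_space \<Rightarrow> complex) \<Rightarrow> ('a \<Rightarrow> complex) \<Rightarrow> complex" where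
  "distr_of f \<phi> = (LINT x|lborel. f x * \<phi> x)"

text \<open>The Fourier transform of the distribution \<open>T\<close> is (given by) the function \<open>F\<close>. For
  \<open>T = distr_of f\<close> with \<open>f\<close> in \<open>L\<^sup>1\<close> or \<open>L\<^sup>2\<close> this is the classical Fourier transform of \<open>f\<close>.
  On \<open>real \<times> 'a\<close> it is the space-time transform, as \<open>(t, x) \<bullet> (\<tau>, \<xi>) = t * \<tau> + x \<bullet> \<xi>\<close>.\<close>

definition has_fourier ::
    "(('a::euclidean_space \<Rightarrow> complex) \<Rightarrow> complex) \<Rightarrow> ('a \<Rightarrow> complex) \<Rightarrow> bool" where
  "has_fourier T F \<longleftrightarrow> tempered F \<and>
     (\<forall>\<phi>. schwartz \<phi> \<longrightarrow> T (fourier_integral \<phi>) = distr_of F \<phi>)"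

text \<open>The choice is unique up to equality almost everywhere.\<close>

definition fourier :: "('a::euclidean_space \<Rightarrow> complex) \<Rightarrow> 'a \<Rightarrow> complex" where
  "fourier f = (SOME F. has_fourier (distr_of f) F)"


section \<open>The class of initial data\<close>

definition I_fun ::
    "real \<Rightarrow> ('a::euclidean_space \<Rightarrow> complex) \<Rightarrow> ('a \<Rightarrow> complex) \<Rightarrow> ennreal" where
  "I_fun l f g = (\<integral>\<^sup>+ (\<zeta>, \<eta>). ennreal ((norm (fourier f \<zeta>))\<^sup>2 * (norm (fourier g \<eta>))\<^sup>2 *
       norm (\<zeta> - \<eta>) powr (4 * l + real DIM('a) - 2)) \<partial>lborel)"

text \<open>For the integral to make sense, \<open>f\<close> and \<open>g\<close> have to be tempered with Fourier transforms that
  are functions; they need not be in \<open>L\<^sup>2\<close>.\<close>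

definition Upsilon ::
    "real \<Rightarrow> (('a::euclidean_space \<Rightarrow> complex) \<times> ('a \<Rightarrow> complex)) set" where
  "Upsilon l = {(f, g). tempered f \<and> (\<exists>F. has_fourier (distr_of f) F) \<and>
     tempered g \<and> (\<exists>G. has_fourier (distr_of g) G) \<and> I_fun l f g < \<infinity>}"


section \<open>Solutions of the free Schroedinger equation and their products\<close>

text \<open>The solution whose spatial Fourier transform at time \<open>t\<close> is
  \<open>\<xi> \<mapsto> exp (- \<i> t \<bar>\<xi>\<bar>\<^sup>2) U \<xi>\<close>, by Fourier inversion, for integrable \<open>U\<close>.\<close>

definition free_solution :: "('a::euclidean_space \<Rightarrow> complex) \<Rightarrow> real \<times> 'a \<Rightarrow> complex" where
  "free_solution U = (\<lambda>(t, x). of_real ((2 * pi) powr (- real DIM('a))) *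
     (LINT \<xi>|lborel. exp (\<i> * of_real (x \<bullet> \<xi>)) * (exp (- \<i> * of_real (t * (norm \<xi>)\<^sup>2)) * U \<xi>)))"

definition cutoff :: "real \<Rightarrow> ('a::euclidean_space \<Rightarrow> complex) \<Rightarrow> 'a \<Rightarrow> complex" where
  "cutoff R U = (\<lambda>\<xi>. if norm \<xi> \<le> R then U \<xi> else 0)"

text \<open>The product \<open>u v\<close> of the solutions with initial data \<open>u0\<close>, \<open>v0\<close>, as a space-time
  distribution. When the exponent \<open>4 * l + d - 2\<close> is negative, data in \<open>Upsilon l\<close> may fail to be
  square integrable and \<open>u\<close>, \<open>v\<close> are in general not functions, so the product is taken as the
  limit of the pointwise products of the (smooth, bounded) solutions with frequencies truncated
  to \<open>\<bar>\<xi>\<bar> \<le> R\<close>. The limit exists for all \<open>u0\<close>, \<open>v0\<close> whose Fourier transforms are tempered functions,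
  because \<open>\<tau> = - \<bar>\<zeta>\<bar>\<^sup>2 - \<bar>\<eta>\<bar>\<^sup>2\<close> controls both frequencies. For integrable Fourier transforms it is
  the pointwise product, see \<open>solution_product_eq\<close> below.\<close>

definition solution_product ::
    "('a::euclidean_space \<Rightarrow> complex) \<Rightarrow> ('a \<Rightarrow> complex) \<Rightarrow> (real \<times> 'a \<Rightarrow> complex) \<Rightarrow> complex" where
  "solution_product u0 v0 \<phi> = Lim at_top (\<lambda>R. distr_of
     (\<lambda>z. free_solution (cutoff R (fourier u0)) z * free_solution (cutoff R (fourier v0)) z) \<phi>)"


section \<open>The multiplier operator\<close>

definition D_multiplier :: "real \<Rightarrow> real \<times> 'a::euclidean_space \<Rightarrow> real" where
  "D_multiplier b = (\<lambda>(\<tau>, \<xi>). \<bar>\<tau> + (norm \<xi>)\<^sup>2 / 2\<bar> powr b)"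

text \<open>\<open>G\<close> is the function \<open>\<bar>D\<bar>\<^sup>b T\<close>.\<close>

definition has_D_power :: "real \<Rightarrow> ((real \<times> 'a::euclidean_space \<Rightarrow> complex) \<Rightarrow> complex) \<Rightarrow>
    (real \<times> 'a \<Rightarrow> complex) \<Rightarrow> bool" where
  "has_D_power b T G \<longleftrightarrow> tempered G \<and>
     (\<exists>W. has_fourier T W \<and> has_fourier (distr_of G) (\<lambda>z. of_real (D_multiplier b z) * W z))"

text \<open>The squared \<open>L\<^sup>2\<close> norm of \<open>\<bar>D\<bar>\<^sup>b T\<close>. The function \<open>G\<close> is unique up to equality almost
  everywhere, so the infimum is over at most one value; it is \<open>\<infinity>\<close> if there is no such function.\<close>

definition D_power_norm_sq ::
    "real \<Rightarrow> ((real \<times> 'a::euclidean_space \<Rightarrow> complex) \<Rightarrow> complex) \<Rightarrow> ennreal" where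
  "D_power_norm_sq b T =
     (INF G\<in>{G. has_D_power b T G}. \<integral>\<^sup>+ z. ennreal ((norm (G z))\<^sup>2) \<partial>lborel)"


section \<open>Gaussians and the constant\<close>

definition gaussians :: "(real ^ 'n::finite \<Rightarrow> complex) set" where
  "gaussians = {h. \<exists>(a::complex) (b::complex ^ 'n) (c::complex). Re a < 0 \<and>
     h = (\<lambda>\<eta>. exp (a * of_real ((norm \<eta>)\<^sup>2) + (\<Sum>i\<in>UNIV. b $ i * of_real (\<eta> $ i)) + c))}"

definition sharp_const :: "nat \<Rightarrow> real" where
  "sharp_const d =
     2 powr (2 - 4 * real d) * pi powr ((2 - 5 * real d) / 2) / Gamma (real d / 2)"


section \<open>The product of solutions with integrable Fourier transforms\<close>

lemma free_solution_measurable: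
  fixes U :: "'a::euclidean_space \<Rightarrow> complex"
  assumes [measurable]: "U \<in> borel_measurable lborel"
  shows "free_solution U \<in> borel_measurable lborel"
proof -
  have [measurable]: "U \<in> borel_measurable borel" using assms by simp
  have "(\<lambda>z::real \<times> 'a. LINT \<xi>|lborel. exp (\<i> * of_real (snd z \<bullet> \<xi>)) *
      (exp (- \<i> * of_real (fst z * (norm \<xi>)\<^sup>2)) * U \<xi>)) \<in>
      borel_measurable (borel \<Otimes>\<^sub>M borel)"
    by (rule lborel.borel_measurable_lebesgue_integral) measurable
  then show ?thesis
    unfolding free_solution_def by (simp add: split_def borel_prod)
qed

lemma free_solution_norm_le:
  fixes U :: "'a::euclidean_space \<Rightarrow> complex"
  shows "norm (free_solution U z) \<le>
    (2 * pi) powr (- real DIM('a)) * (LINT \<xi>|lborel. norm (U \<xi>))"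
proof -
  have "norm (LINT \<xi>|lborel. exp (\<i> * of_real (snd z \<bullet> \<xi>)) *
      (exp (- \<i> * of_real (fst z * (norm \<xi>)\<^sup>2)) * U \<xi>)) \<le>
      (LINT \<xi>|lborel. norm (exp (\<i> * of_real (snd z \<bullet> \<xi>)) *
      (exp (- \<i> * of_real (fst z * (norm \<xi>)\<^sup>2)) * U \<xi>)))"
    by (rule integral_norm_bound)
  also have "\<dots> = (LINT \<xi>|lborel. norm (U \<xi>))"
    by (simp add: norm_mult norm_exp_eq_Re)
  finally show ?thesis
    unfolding free_solution_def
    by (simp add: split_def norm_mult mult_left_mono)
qed

lemma cutoff_measurable:
  assumes "U \<in> borel_measurable lborel"
  shows "cutoff R U \<in> borel_measurable lborel"
proof -
  have [measurable]: "U \<in> borel_measurable borel" using assms by simp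
  show ?thesis unfolding cutoff_def by simp
qed

lemma cutoff_integrable:
  assumes "integrable lborel U"
  shows "integrable lborel (cutoff R U)"
  by (rule Bochner_Integration.integrable_bound[OF assms
      cutoff_measurable[OF borel_measurable_integrable[OF assms]]])
    (simp add: cutoff_def)

lemma cutoff_tendsto: "((\<lambda>R. cutoff R U \<xi>) \<longlongrightarrow> U \<xi>) at_top"
  by (rule tendsto_eventually)
    (use eventually_ge_at_top[of "norm \<xi>"] in eventually_elim, simp add: cutoff_def)

lemma free_solution_cutoff_tendsto:
  fixes U :: "'a::euclidean_space \<Rightarrow> complex"
  assumes U: "integrable lborel U"
  shows "((\<lambda>R. free_solution (cutoff R U) z) \<longlongrightarrow> free_solution U z) at_top"
proof -
  let ?e = "\<lambda>\<xi>. exp (\<i> * of_real (snd z \<bullet> \<xi>))"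
  let ?s = "\<lambda>\<xi>::'a. exp (- \<i> * of_real (fst z * (norm \<xi>)\<^sup>2))"
  have [measurable]: "U \<in> borel_measurable borel"
    using borel_measurable_integrable[OF U] by simp
  have [measurable]: "cutoff R U \<in> borel_measurable borel" for R
    using cutoff_measurable[of U R] by simp
  have "((\<lambda>R. LINT \<xi>|lborel. ?e \<xi> * (?s \<xi> * cutoff R U \<xi>)) \<longlongrightarrow>
      (LINT \<xi>|lborel. ?e \<xi> * (?s \<xi> * U \<xi>))) at_top"
  proof (rule integral_dominated_convergence_at_top[where w = "\<lambda>\<xi>. norm (U \<xi>)"])
    show "\<forall>\<^sub>F R in at_top. AE \<xi> in lborel. norm (?e \<xi> * (?s \<xi> * cutoff R U \<xi>)) \<le> norm (U \<xi>)"
      by (simp add: norm_mult norm_exp_eq_Re cutoff_def)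
    show "AE \<xi> in lborel.
        ((\<lambda>R. ?e \<xi> * (?s \<xi> * cutoff R U \<xi>)) \<longlongrightarrow> ?e \<xi> * (?s \<xi> * U \<xi>)) at_top"
      by (intro AE_I2 tendsto_intros cutoff_tendsto)
  qed (use U in \<open>auto\<close>)
  then show ?thesis
    unfolding free_solution_def split_def by (intro tendsto_intros)
qed

lemma solution_product_eq:
  fixes u0 v0 :: "'a::euclidean_space \<Rightarrow> complex"
  assumes U: "integrable lborel (fourier u0)" and V: "integrable lborel (fourier v0)"
    and \<phi>: "integrable lborel \<phi>"
  shows "solution_product u0 v0 \<phi> =
    distr_of (\<lambda>z. free_solution (fourier u0) z * free_solution (fourier v0) z) \<phi>"
proof -
  let ?U = "fourier u0" and ?V = "fourier v0"
  let ?c = "(2 * pi) powr (- real DIM('a))"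
  have bd: "norm (free_solution (cutoff R F) z) \<le> ?c * (LINT \<xi>|lborel. norm (F \<xi>))"
    if F: "integrable lborel F" for R z and F :: "'a \<Rightarrow> complex"
  proof -
    have "(LINT \<xi>|lborel. norm (cutoff R F \<xi>)) \<le> (LINT \<xi>|lborel. norm (F \<xi>))"
      by (intro integral_mono integrable_norm cutoff_integrable F) (simp add: cutoff_def)
    then show ?thesis
      using free_solution_norm_le[of "cutoff R F" z]
      by (smt (verit) mult_left_mono powr_ge_zero)
  qed
  have [measurable]: "?U \<in> borel_measurable borel" "?V \<in> borel_measurable borel"
      "\<phi> \<in> borel_measurable borel"
    using borel_measurable_integrable[OF U] borel_measurable_integrable[OF V]
      borel_measurable_integrable[OF \<phi>] by simp_all
  have [measurable]: "free_solution (cutoff R F) \<in> borel_measurable borel"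
    "free_solution F \<in> borel_measurable borel"
    if "F \<in> borel_measurable borel" for R and F :: "'a \<Rightarrow> complex"
    using that free_solution_measurable[of F]
      free_solution_measurable[OF cutoff_measurable, of F R] by simp_all
  let ?w = "\<lambda>z. (?c * (LINT \<xi>|lborel. norm (?U \<xi>))) * (?c * (LINT \<xi>|lborel. norm (?V \<xi>))) *
      norm (\<phi> z)"
  have "((\<lambda>R. LINT z|lborel. free_solution (cutoff R ?U) z * free_solution (cutoff R ?V) z * \<phi> z)
      \<longlongrightarrow> (LINT z|lborel. free_solution ?U z * free_solution ?V z * \<phi> z)) at_top"
  proof (rule integral_dominated_convergence_at_top[where w = ?w])
    show "\<forall>\<^sub>F R in at_top. AE z in lborel.
        norm (free_solution (cutoff R ?U) z * free_solution (cutoff R ?V) z * \<phi> z) \<le> ?w z"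
      unfolding norm_mult
      by (intro always_eventually allI AE_I2 mult_right_mono mult_mono bd U V) auto
    show "AE z in lborel.
        ((\<lambda>R. free_solution (cutoff R ?U) z * free_solution (cutoff R ?V) z * \<phi> z) \<longlongrightarrow>
         free_solution ?U z * free_solution ?V z * \<phi> z) at_top"
      by (intro AE_I2 tendsto_intros free_solution_cutoff_tendsto U V)
    show "integrable lborel ?w"
      using \<phi> by auto
  qed auto
  then show ?thesis
    unfolding solution_product_def distr_of_def by (intro tendsto_Lim) auto
qed

end

theory Submission imports Defs "HOL-Probability.Probability"
begin

text \<open>
  Taking Fourier transforms in space and time, the product of two solutions becomes the image of
  \<open>u0^ \<otimes> v0^\<close> under \<open>(\<zeta>, \<eta>) \<mapsto> (- |\<zeta>|\<^sup>2 - |\<eta>|\<^sup>2, \<zeta> + \<eta>)\<close>. The fibre over \<open>(\<tau>, \<xi>)\<close> is the sphere with centre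
  \<open>(\<xi>, \<xi>) / 2\<close> on which \<open>|\<zeta> - \<eta>|\<^sup>2 = - 2 \<tau> - |\<xi>|\<^sup>2\<close>, so both the multiplier and the weight \<open>|\<zeta> - \<eta>|\<close> are constant
  on fibres. By Plancherel and polar coordinates the left-hand side is an integral over the fibres of the squared modulus of the
  mean of \<open>u0^ \<otimes> v0^\<close>, the right-hand side that of the mean of its squared modulus, and the inequality is
  Cauchy-Schwarz on spheres. Equality holds iff \<open>u0^(\<zeta>) v0^(\<eta>)\<close> depends on \<open>|\<zeta>|\<^sup>2 + |\<eta>|\<^sup>2\<close> and \<open>\<zeta> + \<eta>\<close> only, for
  almost all \<open>\<zeta>\<close>, \<open>\<eta>\<close>. This Maxwell-Boltzmann equation is preserved by multiplication with a Gaussian and by the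
  Fourier transform, hence the general case reduces to continuous solutions, whose logarithms are quadratic polynomials.
\<close>

section \<open>Gaussian integrals\<close>

text \<open>The hypothesis \<beta> > (1 - d) / 2 says that the exponent 4 \<beta> + d - 2 exceeds -
  d. It makes the weight locally integrable, so that Gaussians have finite energy, and it excludes
  quadratic exponentials without decay from the extremisers. For negative exponents finite energy
  gives only a weighted L^2 bound for each factor; hence the distributional Fourier transform, and
  the damping before a classical transform is taken. Damping respects the functional equation
  because two equal Gaussian factors multiply to a function of |\<zeta>|^2 + |\<eta>|^2; the Fourier
  transform respects it because reflections of \<zeta> - \<eta> preserve the fibres. The transform
  is taken twice: once to reach an equation between continuous functions, and once more to return to
  the data, where the same equation takes the place of an explicit transform of complex Gaussians.
  The constant collects the square of (2 \<pi>)^(1 - d) from the transform of the product, the area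
  of the unit sphere and powers of 2 from polar coordinates, and (2 \<pi>)^(-1 - d) from Plancherel
  in space-time.\<close>

lemma lborel_prod_Basis:
  fixes f :: "'a::euclidean_space \<Rightarrow> real \<Rightarrow> complex"
  assumes f: "\<And>b. b \<in> Basis \<Longrightarrow> integrable lborel (f b)"
  shows integrable_lborel_prod: "integrable lborel (\<lambda>x::'a. \<Prod>b\<in>Basis. f b (x \<bullet> b))"
    and integral_lborel_prod:
      "(LINT x|lborel. (\<Prod>b\<in>Basis. f b (x \<bullet> b))) = (\<Prod>b\<in>Basis. (LINT x|lborel. f b x))"
proof -
  interpret product_sigma_finite "\<lambda>_::'a. lborel :: real measure" ..
  have m: "(\<lambda>p. \<Sum>b\<in>Basis. p b *\<^sub>R b) \<in> (\<Pi>\<^sub>M b\<in>(Basis::'a set). lborel) \<rightarrow>\<^sub>M (borel :: 'a measure)"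
    by measurable
  have [measurable]: "f b \<in> borel_measurable borel" if "b \<in> Basis" for b
    using borel_measurable_integrable[OF f[OF that]] by simp
  have mf: "(\<lambda>x::'a. \<Prod>b\<in>Basis. f b (x \<bullet> b)) \<in> borel_measurable borel"
    by measurable
  have eq: "(\<Prod>b\<in>Basis. f b ((\<Sum>c\<in>Basis. p c *\<^sub>R c) \<bullet> b)) = (\<Prod>b\<in>Basis. f b (p b))" for p :: "'a \<Rightarrow> real"
    by (intro prod.cong refl) simp
  show "integrable lborel (\<lambda>x::'a. \<Prod>b\<in>Basis. f b (x \<bullet> b))"
    by (subst lborel_eq, subst integrable_distr_eq[OF m mf])
      (simp only: eq, rule product_integrable_prod, use f in auto)
  show "(LINT x|lborel. (\<Prod>b\<in>Basis. f b (x \<bullet> b))) = (\<Prod>b\<in>Basis. (LINT x|lborel. f b x))"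
    by (subst lborel_eq, subst integral_distr[OF m mf])
      (simp only: eq, rule product_integral_prod, use f in auto)
qed

lemma nn_integral_lborel_affine:
  fixes f :: "'a::euclidean_space \<Rightarrow> ennreal"
  assumes [measurable]: "f \<in> borel_measurable borel" and c: "c \<noteq> 0"
  shows "(\<integral>\<^sup>+x. f x \<partial>lborel) = ennreal (\<bar>c\<bar> ^ DIM('a)) * (\<integral>\<^sup>+x. f (t + c *\<^sub>R x) \<partial>lborel)"
  by (subst lborel_affine[OF c, of t])
    (simp add: nn_integral_density nn_integral_distr nn_integral_cmult ennreal_power)

lemma lborel_integrable_affine_iff:
  fixes f :: "'a::euclidean_space \<Rightarrow> 'b::{banach, second_countable_topology}"
  assumes c: "c \<noteq> 0"
  shows "integrable lborel (\<lambda>x. f (t + c *\<^sub>R x)) \<longleftrightarrow> integrable lborel f"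
proof -
  have *: "integrable lborel (\<lambda>x. f (t + c *\<^sub>R x))"
    if f: "integrable lborel f" and "c \<noteq> 0" for f :: "'a \<Rightarrow> 'b" and c t
  proof -
    have [measurable]: "f \<in> borel_measurable borel" using borel_measurable_integrable[OF f] by simp
    show ?thesis
      using f unfolding integrable_iff_bounded
      by (subst (asm) nn_integral_lborel_affine[where c=c and t=t])
        (auto simp: ennreal_mult_less_top \<open>c \<noteq> 0\<close>)
  qed
  from *[of f c t] *[of "\<lambda>x. f (t + c *\<^sub>R x)" "1/c" "-(1/c) *\<^sub>R t"] c show ?thesis
    by (auto simp: scaleR_right_diff_distrib algebra_simps)
qed

lemma lborel_integral_affine:
  fixes f :: "'a::euclidean_space \<Rightarrow> complex"
  assumes c: "c \<noteq> 0"
  shows "(LINT x|lborel. f x) = of_real (\<bar>c\<bar> ^ DIM('a)) * (LINT x|lborel. f (t + c *\<^sub>R x))"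
proof cases
  assume f[measurable]: "integrable lborel f" then show ?thesis
    using c f f[THEN borel_measurable_integrable] f[THEN lborel_integrable_affine_iff[OF c, of f t, THEN iffD2]]
    by (subst lborel_affine[OF c, of t]) (simp add: integral_density integral_distr scaleR_conv_of_real)
next
  assume "\<not> integrable lborel f" with c show ?thesis
    by (simp add: lborel_integrable_affine_iff not_integrable_integral_eq)
qed

lemma lborel_integral_translate:
  fixes f :: "'a::euclidean_space \<Rightarrow> complex"
  shows "(LINT x|lborel. f (t + x)) = (LINT x|lborel. f x)"
  using lborel_integral_affine[of 1 f t] by simp

lemma lborel_integrable_translate:
  fixes f :: "'a::euclidean_space \<Rightarrow> complex"
  shows "integrable lborel (\<lambda>x. f (t + x)) \<longleftrightarrow> integrable lborel f"
  using lborel_integrable_affine_iff[of 1 f t] by simp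

text \<open>Rescaling by \<open>sqrt e\<close> reduces both claims to the characteristic function of
  the standard normal distribution.\<close>

lemma gaussian_fourier_real:
  assumes e: "e > (0::real)"
  shows "integrable lborel (\<lambda>t. exp (of_real (- (e * t\<^sup>2 / 2)) + \<i> * of_real (t * c)))"
    and "(LINT t|lborel. exp (of_real (- (e * t\<^sup>2 / 2)) + \<i> * of_real (t * c))) =
      of_real (sqrt (2 * pi / e) * exp (- c\<^sup>2 / (2 * e)))"
proof -
  let ?g = "\<lambda>s x. std_normal_density x *\<^sub>R exp (\<i> * of_real (s * x))"
  have int: "integrable lborel (?g s)" for s
    by (rule Bochner_Integration.integrable_bound[of _ "std_normal_density"])
      (auto simp: norm_exp_eq_Re)
  have val: "(LINT x|lborel. ?g s x) = of_real (exp (- (s^2) / 2))" for s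
    using fun_cong[OF char_std_normal_distribution, of s] unfolding char_def
    by (subst (asm) integral_density) auto
  let ?f = "\<lambda>t. exp (of_real (- (e * t\<^sup>2 / 2)) + \<i> * of_real (t * c))"
  have eq: "?f t = of_real (sqrt (2 * pi)) * ?g (c / sqrt e) (0 + sqrt e * t)" for t
    using e unfolding exp_add by (simp add: std_normal_density_def scaleR_conv_of_real exp_of_real power_mult_distrib
        real_sqrt_mult field_simps flip: exp_of_real of_real_mult of_real_divide)
  show "integrable lborel ?f"
    unfolding eq by (intro integrable_mult_right lborel_integrable_real_affine int) (use e in auto)
  have "(LINT t|lborel. ?f t) = of_real (sqrt (2 * pi)) * (LINT t|lborel. ?g (c / sqrt e) (0 + sqrt e * t))"
    unfolding eq by (rule integral_mult_right_zero)
  also have "(LINT t|lborel. ?g (c / sqrt e) (0 + sqrt e * t)) = (1 / sqrt e) *\<^sub>R of_real (exp (- ((c / sqrt e)^2) / 2))"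
    using lborel_integral_real_affine[of "sqrt e" "?g (c / sqrt e)" 0] e unfolding val
    by (simp add: field_simps)
  finally show "(LINT t|lborel. ?f t) = of_real (sqrt (2 * pi / e) * exp (- c\<^sup>2 / (2 * e)))"
    using e by (simp add: scaleR_conv_of_real real_sqrt_divide power_divide field_simps)
qed

text \<open>The integrand is a product of functions of the single coordinates, each of which is the
  one-dimensional case.\<close>

lemma gaussian_fourier:
  fixes x :: "'a::euclidean_space"
  assumes e: "e > 0"
  shows "integrable lborel (\<lambda>\<xi>::'a. exp (of_real (- (e * (norm \<xi>)\<^sup>2 / 2)) + \<i> * of_real (\<xi> \<bullet> x)))"
    and "(LINT \<xi>|lborel. exp (of_real (- (e * (norm \<xi>)\<^sup>2 / 2)) + \<i> * of_real (\<xi> \<bullet> x))) =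
      of_real ((2 * pi / e) powr (DIM('a) / 2) * exp (- (norm x)\<^sup>2 / (2 * e)))"
proof -
  let ?f = "\<lambda>b t. exp (of_real (- (e * t\<^sup>2 / 2)) + \<i> * of_real (t * (x \<bullet> b)))"
  have eq: "exp (of_real (- (e * (norm \<xi>)\<^sup>2 / 2)) + \<i> * of_real (\<xi> \<bullet> x)) =
      (\<Prod>b\<in>Basis. ?f b (\<xi> \<bullet> b))" for \<xi> :: 'a
    unfolding exp_sum[OF finite_Basis, symmetric] sum.distrib sum_distrib_left[symmetric]
      of_real_sum[symmetric] sum_negf sum_divide_distrib[symmetric]
    by (subst euclidean_inner[of \<xi> x], subst power2_norm_eq_inner, subst euclidean_inner[of \<xi> \<xi>])
      (simp add: power2_eq_square)
  show "integrable lborel (\<lambda>\<xi>::'a. exp (of_real (- (e * (norm \<xi>)\<^sup>2 / 2)) + \<i> * of_real (\<xi> \<bullet> x)))"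
    unfolding eq by (rule integrable_lborel_prod) (rule gaussian_fourier_real[OF e])
  have "(LINT \<xi>|lborel. exp (of_real (- (e * (norm \<xi>)\<^sup>2 / 2)) + \<i> * of_real (\<xi> \<bullet> x))) =
     (\<Prod>b\<in>Basis. of_real (sqrt (2 * pi / e) * exp (- (x \<bullet> b)\<^sup>2 / (2 * e))))"
    unfolding eq using integral_lborel_prod[of ?f, OF gaussian_fourier_real(1)[OF e]] gaussian_fourier_real(2)[OF e]
    by (simp only:)
  also have "\<dots> = of_real (sqrt (2 * pi / e) ^ DIM('a) * exp (\<Sum>b\<in>Basis. - (x \<bullet> b)\<^sup>2 / (2 * e)))"
    by (simp add: exp_sum prod.distrib)
  also have "(\<Sum>b\<in>Basis. - (x \<bullet> b)\<^sup>2 / (2 * e)) = - (norm x)\<^sup>2 / (2 * e)"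
    unfolding sum_divide_distrib[symmetric] sum_negf
    by (subst power2_norm_eq_inner, subst euclidean_inner[of x x]) (simp add: power2_eq_square)
  also have "sqrt (2 * pi / e) ^ DIM('a) = (2 * pi / e) powr (DIM('a) / 2)"
    using e by (simp add: powr_half_sqrt[symmetric] powr_realpow[symmetric] powr_powr)
  finally show "(LINT \<xi>|lborel. exp (of_real (- (e * (norm \<xi>)\<^sup>2 / 2)) + \<i> * of_real (\<xi> \<bullet> x))) =
      of_real ((2 * pi / e) powr (DIM('a) / 2) * exp (- (norm x)\<^sup>2 / (2 * e)))" .
qed

lemma integrable_gaussian:
  assumes "e > 0"
  shows "integrable lborel (\<lambda>\<xi>::'a::euclidean_space. exp (- (e * (norm \<xi>)\<^sup>2 / 2)))"
    "(LINT \<xi>|lborel. exp (- (e * (norm (\<xi>::'a))\<^sup>2 / 2))) = (2 * pi / e) powr (DIM('a) / 2)"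
proof -
  have "complex_integrable lborel (\<lambda>\<xi>::'a. of_real (exp (- (e * (norm \<xi>)\<^sup>2 / 2))))"
    using gaussian_fourier(1)[OF assms, of "0::'a"] by (simp add: exp_of_real flip: of_real_minus)
  then show "integrable lborel (\<lambda>\<xi>::'a. exp (- (e * (norm \<xi>)\<^sup>2 / 2)))"
    by (subst (asm) complex_of_real_integrable_eq)
  have "(LINT \<xi>|lborel. complex_of_real (exp (- (e * (norm (\<xi>::'a))\<^sup>2 / 2)))) = of_real ((2 * pi / e) powr (DIM('a) / 2))"
    using gaussian_fourier(2)[OF assms, of "0::'a"] by (simp add: exp_of_real flip: of_real_minus)
  then show "(LINT \<xi>|lborel. exp (- (e * (norm (\<xi>::'a))\<^sup>2 / 2))) = (2 * pi / e) powr (DIM('a) / 2)"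
    by (simp only: integral_complex_of_real of_real_eq_iff)
qed

section \<open>The Fourier integral\<close>

lemma norm_fourier_kernel [simp]:
  "norm (exp (- \<i> * complex_of_real r)) = 1" "norm (exp (- (\<i> * complex_of_real r))) = 1"
  "norm (exp (\<i> * complex_of_real r)) = 1"
  by (simp_all add: norm_exp_eq_Re)

lemma fourier_integrand_integrable:
  fixes f :: "'a::euclidean_space \<Rightarrow> complex"
  assumes f: "integrable lborel f"
  shows "integrable lborel (\<lambda>x. f x * exp (- \<i> * of_real (x \<bullet> \<xi>)))"
proof -
  have [measurable]: "f \<in> borel_measurable borel" using borel_measurable_integrable[OF f] by simp
  show ?thesis by (rule Bochner_Integration.integrable_bound[OF f]) (auto simp: norm_mult)
qed

lemma fourier_integral_measurable [measurable]:
  fixes f :: "'a::euclidean_space \<Rightarrow> complex"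
  assumes [measurable]: "f \<in> borel_measurable borel"
  shows "fourier_integral f \<in> borel_measurable borel"
proof -
  have "(\<lambda>\<xi>. LINT x|lborel. f x * exp (- \<i> * of_real (x \<bullet> \<xi>))) \<in> borel_measurable borel"
    by (rule lborel.borel_measurable_lebesgue_integral) measurable
  then show ?thesis unfolding fourier_integral_def .
qed

lemma norm_fourier_integral_le:
  fixes f :: "'a::euclidean_space \<Rightarrow> complex"
  shows "norm (fourier_integral f \<xi>) \<le> (LINT x|lborel. norm (f x))"
proof -
  have "norm (fourier_integral f \<xi>) \<le> (LINT x|lborel. norm (f x * exp (- \<i> * of_real (x \<bullet> \<xi>))))"
    unfolding fourier_integral_def by (rule integral_norm_bound)
  then show ?thesis by (simp add: norm_mult)
qed

lemma continuous_fourier_integral: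
  fixes f :: "'a::euclidean_space \<Rightarrow> complex"
  assumes f: "integrable lborel f"
  shows "continuous_on UNIV (fourier_integral f)"
  unfolding continuous_on_sequentially comp_def
proof safe
  fix X :: "nat \<Rightarrow> 'a" and a assume X: "X \<longlonglongrightarrow> a"
  have [measurable]: "f \<in> borel_measurable borel" using borel_measurable_integrable[OF f] by simp
  show "(\<lambda>n. fourier_integral f (X n)) \<longlonglongrightarrow> fourier_integral f a"
    unfolding fourier_integral_def
  proof (rule integral_dominated_convergence[where w="\<lambda>x. norm (f x)"])
    show "AE x in lborel. (\<lambda>n. f x * exp (- \<i> * complex_of_real (x \<bullet> X n)))
        \<longlonglongrightarrow> f x * exp (- \<i> * complex_of_real (x \<bullet> a))"
      by (intro AE_I2 tendsto_intros X)
  qed (use f in \<open>auto simp: norm_mult\<close>)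
qed

lemma integrable_mult_bounded:
  fixes f g :: "'a::euclidean_space \<Rightarrow> complex"
  assumes "integrable lborel f" "g \<in> borel_measurable borel" "\<And>x. norm (g x) \<le> C"
  shows "integrable lborel (\<lambda>x. f x * g x)"
proof -
  note borel_measurable_integrable[OF assms(1), simplified, measurable] assms(2)[measurable]
  show ?thesis
  proof (rule Bochner_Integration.integrable_bound[of _ "\<lambda>x. C * norm (f x)"])
    show "AE x in lborel. norm (f x * g x) \<le> norm (C * norm (f x))"
    proof (intro AE_I2)
      fix x
      have "norm (f x * g x) \<le> norm (f x) * C" unfolding norm_mult by (intro mult_left_mono assms) auto
      also have "\<dots> \<le> norm (C * norm (f x))" by (simp add: mult.commute)
      finally show "norm (f x * g x) \<le> norm (C * norm (f x))" .
    qed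
  qed (use assms(1) in \<open>auto\<close>)
qed

lemma integrable_pair_times:
  fixes f :: "'a::euclidean_space \<Rightarrow> complex" and g :: "'b::euclidean_space \<Rightarrow> complex"
  assumes f: "integrable lborel f" and g: "integrable lborel g"
  shows "integrable (lborel \<Otimes>\<^sub>M lborel) (\<lambda>(x, y). f x * g y)"
proof -
  note borel_measurable_integrable[OF f, simplified, measurable] borel_measurable_integrable[OF g, simplified, measurable]
  show ?thesis
  proof (rule lborel_pair.Fubini_integrable)
    have "(\<lambda>x. LINT y|lborel. norm (f x * g y)) = (\<lambda>x. norm (f x) * (LINT y|lborel. norm (g y)))"
      by (simp add: norm_mult)
    then show "integrable lborel (\<lambda>x. LINT y|lborel. norm (case (x, y) of (x, y) \<Rightarrow> f x * g y))"
      using f by simp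
  qed (use f g in \<open>auto\<close>)
qed

text \<open>Fubini, as the kernel is symmetric in its two arguments. This identity is what makes the
  distributional transform extend the classical one.\<close>

lemma fourier_multiplication_formula:
  fixes f g :: "'a::euclidean_space \<Rightarrow> complex"
  assumes f: "integrable lborel f" and g: "integrable lborel g"
  shows "(LINT x|lborel. fourier_integral f x * g x) = (LINT x|lborel. f x * fourier_integral g x)"
proof -
  note borel_measurable_integrable[OF f, simplified, measurable] borel_measurable_integrable[OF g, simplified, measurable]
  have int: "integrable (lborel \<Otimes>\<^sub>M lborel) (\<lambda>(x, y). f x * g y * exp (- \<i> * of_real (x \<bullet> y)))"
    by (rule Bochner_Integration.integrable_bound[OF integrable_pair_times[OF f g]])
      (auto simp: norm_mult split_def)
  have "(LINT y|lborel. fourier_integral f y * g y) =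
      (LINT y|lborel. LINT x|lborel. f x * g y * exp (- \<i> * of_real (x \<bullet> y)))"
    unfolding fourier_integral_def
    by (intro Bochner_Integration.integral_cong refl, subst integral_mult_left_zero[symmetric])
      (simp only: ac_simps)
  also have "\<dots> = (LINT x|lborel. LINT y|lborel. f x * g y * exp (- \<i> * of_real (x \<bullet> y)))"
    by (rule lborel_pair.Fubini_integral[OF int])
  also have "\<dots> = (LINT x|lborel. f x * fourier_integral g x)"
    unfolding fourier_integral_def
    by (intro Bochner_Integration.integral_cong refl, subst integral_mult_right_zero[symmetric])
      (simp add: mult.assoc inner_commute)
  finally show ?thesis .
qed

text \<open>Normalised to be an eigenfunction of the Fourier integral, with eigenvalue
  \<open>(2 * pi) powr (DIM('a) / 2)\<close>. It serves as mollifier, damping factor, test function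
  and extremiser.\<close>

definition gaussian :: "'a::euclidean_space \<Rightarrow> real" where
  "gaussian z = exp (- (norm z)\<^sup>2 / 2)"

lemma gaussian_measurable [measurable]: "gaussian \<in> borel_measurable borel"
  unfolding gaussian_def by measurable

lemma gaussian_pos: "gaussian z > 0"
  by (simp add: gaussian_def)

lemma gaussian_integrable: "integrable lborel (gaussian :: 'a::euclidean_space \<Rightarrow> real)"
  and gaussian_integral: "(LINT z|lborel. gaussian (z :: 'a::euclidean_space)) = (2 * pi) powr (DIM('a) / 2)"
  using integrable_gaussian[of 1, where 'a='a] by (simp_all add: gaussian_def[abs_def])

lemma gaussian_of_real_integrable:
  "integrable lborel (\<lambda>z::'a::euclidean_space. complex_of_real (gaussian z))"
  by (intro integrable_of_real gaussian_integrable)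

section \<open>Fourier inversion and Plancherel\<close>

text \<open>The multiplication formula with a damped plane wave, whose transform is a narrow
  Gaussian centred at y. The substitution x = y + \<delta> z moves the scale into the argument of f,
  and the powers of \<delta> cancel.\<close>

lemma fourier_gaussian_regularised:
  fixes f :: "'a::euclidean_space \<Rightarrow> complex"
  assumes f: "integrable lborel f" and d: "\<delta> > 0"
  shows "(LINT \<xi>|lborel. fourier_integral f \<xi> * (exp (\<i> * of_real (\<xi> \<bullet> y)) * of_real (gaussian (\<delta> *\<^sub>R \<xi>)))) =
    of_real ((2 * pi) powr (DIM('a) / 2)) * (LINT z|lborel. f (y + \<delta> *\<^sub>R z) * of_real (gaussian z))"
proof -
  have d2: "\<delta>\<^sup>2 > 0" using d by simp
  let ?g = "\<lambda>\<xi>. exp (\<i> * of_real (\<xi> \<bullet> y)) * of_real (gaussian (\<delta> *\<^sub>R \<xi>))"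
  have geq: "?g \<xi> * exp (- \<i> * of_real (\<xi> \<bullet> x)) =
      exp (of_real (- (\<delta>\<^sup>2 * (norm \<xi>)\<^sup>2 / 2)) + \<i> * of_real (\<xi> \<bullet> (y - x)))" for x \<xi>
    by (simp add: gaussian_def power_mult_distrib mult_exp_exp flip: exp_of_real)
      (simp add: algebra_simps inner_diff_right)
  have g: "integrable lborel ?g"
    using gaussian_fourier(1)[OF d2, of y] geq[of _ 0] by simp
  have gh: "fourier_integral ?g x = of_real ((2 * pi / \<delta>\<^sup>2) powr (DIM('a) / 2) * exp (- (norm (y - x))\<^sup>2 / (2 * \<delta>\<^sup>2)))" for x
    unfolding fourier_integral_def geq by (rule gaussian_fourier(2)[OF d2])
  have "(LINT \<xi>|lborel. fourier_integral f \<xi> * ?g \<xi>) =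
     (LINT x|lborel. f x * of_real ((2 * pi / \<delta>\<^sup>2) powr (DIM('a) / 2) * exp (- (norm (y - x))\<^sup>2 / (2 * \<delta>\<^sup>2))))"
    unfolding fourier_multiplication_formula[OF f g] gh ..
  also have "\<dots> = of_real (\<bar>\<delta>\<bar> ^ DIM('a)) * (LINT z|lborel. f (y + \<delta> *\<^sub>R z) *
      of_real ((2 * pi / \<delta>\<^sup>2) powr (DIM('a) / 2) * exp (- (norm (y - (y + \<delta> *\<^sub>R z)))\<^sup>2 / (2 * \<delta>\<^sup>2))))"
    by (rule lborel_integral_affine) (use d in simp)
  also have "(\<lambda>z. exp (- (norm (y - (y + \<delta> *\<^sub>R z)))\<^sup>2 / (2 * \<delta>\<^sup>2))) = gaussian"
    using d by (auto simp: gaussian_def fun_eq_iff power_mult_distrib)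
  also have "(LINT z|lborel. f (y + \<delta> *\<^sub>R z) * of_real ((2 * pi / \<delta>\<^sup>2) powr (DIM('a) / 2) * gaussian z)) =
      of_real ((2 * pi / \<delta>\<^sup>2) powr (DIM('a) / 2)) * (LINT z|lborel. f (y + \<delta> *\<^sub>R z) * of_real (gaussian z))"
    by (subst integral_mult_right_zero[symmetric]) (simp only: of_real_mult ac_simps)
  also have "of_real (\<bar>\<delta>\<bar> ^ DIM('a)) * (of_real ((2 * pi / \<delta>\<^sup>2) powr (DIM('a) / 2)) * X) =
     complex_of_real ((2 * pi) powr (DIM('a) / 2)) * X" for X
  proof -
    have "(\<delta>\<^sup>2) powr (real DIM('a) / 2) = \<delta> ^ DIM('a)"
    proof -
      have "(\<delta>\<^sup>2) powr (real DIM('a) / 2) = (\<delta> powr 2) powr (real DIM('a) / 2)"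
        using d by (simp add: powr_numeral)
      also have "\<dots> = \<delta> powr real DIM('a)" by (simp add: powr_powr)
      finally show ?thesis using d by (simp add: powr_realpow)
    qed
    then have "\<bar>\<delta>\<bar> ^ DIM('a) * (2 * pi / \<delta>\<^sup>2) powr (DIM('a) / 2) = (2 * pi) powr (DIM('a) / 2)"
      using d by (simp add: powr_divide)
    then show ?thesis by (metis mult.assoc of_real_mult)
  qed
  finally show ?thesis .
qed

definition inv_fourier :: "('a::euclidean_space \<Rightarrow> complex) \<Rightarrow> 'a \<Rightarrow> complex" where
  "inv_fourier f x = of_real ((2 * pi) powr (- real DIM('a))) * (LINT \<xi>|lborel. f \<xi> * exp (\<i> * of_real (\<xi> \<bullet> x)))"

lemma inv_fourier_eq:
  fixes f :: "'a::euclidean_space \<Rightarrow> complex"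
  shows "inv_fourier f x = of_real ((2 * pi) powr (- real DIM('a))) * fourier_integral f (- x)"
  by (simp add: inv_fourier_def fourier_integral_def)

section \<open>Functions determined by their integrals over boxes\<close>

lemma indicator_tendsto_off_frontier:
  fixes S :: "'a::euclidean_space set"
  assumes "x \<notin> frontier S" "X \<longlonglongrightarrow> x"
  shows "(\<lambda>n. indicator S (X n) :: complex) \<longlonglongrightarrow> indicator S x"
proof -
  have "isCont (indicat_real S) x"
    using assms(1) isCont_indicator by blast
  then have "(\<lambda>n. complex_of_real (indicat_real S (X n))) \<longlonglongrightarrow> of_real (indicat_real S x)"
    using assms(2) isCont_tendsto_compose tendsto_of_real by blast
  then show ?thesis by (simp add: of_real_indicator)
qed

text \<open>For real g the positive and the negative part are densities of two measures that agree
  on boxes. Boxes are stable under intersection and generate the Borel sets, so the measures agree,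
  the densities agree almost everywhere, and g vanishes there. Real and imaginary parts are treated
  separately.\<close>

lemma AE_eq_0_if_box_integrals_0_integrable:
  fixes f :: "'a::euclidean_space \<Rightarrow> complex"
  assumes f: "integrable lborel f"
    and "\<And>a b. (LINT x|lborel. indicator (box a b) x * f x) = 0"
  shows "AE x in lborel. f x = 0"
proof -
  have [measurable]: "f \<in> borel_measurable borel" using borel_measurable_integrable[OF f] by simp
  have real: "AE x in lborel. g x = 0"
    if g: "integrable lborel g" and z: "\<And>a b. (LINT x|lborel. indicator (box a b) x * g x) = 0"
    for g :: "'a \<Rightarrow> real"
  proof -
    have [measurable]: "g \<in> borel_measurable borel" using borel_measurable_integrable[OF g] by simp
    let ?p = "\<lambda>x. ennreal (g x)" and ?m = "\<lambda>x. ennreal (- g x)"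
    have "density lborel ?p = density lborel ?m"
    proof (rule measure_eqI_generator_eq[where E="range (\<lambda>(a, b). box a b :: 'a set)" and \<Omega>=UNIV
          and A="\<lambda>n::nat. box (- (real n *\<^sub>R One)) (real n *\<^sub>R One)"])
      show "Int_stable (range (\<lambda>(a, b). box a b :: 'a set))"
        by (auto simp: Int_stable_def box_Int_box)
      show "sets (density lborel ?p) = sigma_sets UNIV (range (\<lambda>(a, b). box a b :: 'a set))"
        "sets (density lborel ?m) = sigma_sets UNIV (range (\<lambda>(a, b). box a b :: 'a set))"
        by (simp_all add: borel_eq_box)
      show "(\<Union>n. box (- (real n *\<^sub>R One)) (real n *\<^sub>R One)) = (UNIV :: 'a set)"
        by (rule UN_box_eq_UNIV)
      have fin: "(\<integral>\<^sup>+x. ennreal (g x) \<partial>lborel) < \<infinity>" "(\<integral>\<^sup>+x. ennreal (- g x) \<partial>lborel) < \<infinity>"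
        using g by (auto simp: real_integrable_def less_top)
      have bx: "emeasure (density lborel ?p) (box a b) < \<infinity>" "emeasure (density lborel ?m) (box a b) < \<infinity>" for a b
        using le_less_trans[OF nn_integral_mono fin(1), of "\<lambda>x. ennreal (g x) * indicator (box a b) x"]
          le_less_trans[OF nn_integral_mono fin(2), of "\<lambda>x. ennreal (- g x) * indicator (box a b) x"]
        by (auto simp: emeasure_density indicator_def)
      show "emeasure (density lborel ?p) (box (- (real n *\<^sub>R One)) (real n *\<^sub>R One)) \<noteq> \<infinity>" for n
        using bx by (simp add: less_top[symmetric])
      fix X assume "X \<in> range (\<lambda>(a, b). box a b :: 'a set)"
      then obtain a b where X: "X = box a b" by auto
      have i: "integrable lborel (\<lambda>x. indicator (box a b) x * g x)"
        using integrable_mult_indicator[OF _ g, of "box a b"] by simp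
      have "0 = (LINT x|lborel. indicator (box a b) x * g x)" by (simp add: z)
      also have "\<dots> = enn2real (\<integral>\<^sup>+x. ennreal (indicator (box a b) x * g x) \<partial>lborel)
        - enn2real (\<integral>\<^sup>+x. ennreal (- (indicator (box a b) x * g x)) \<partial>lborel)"
        by (rule real_lebesgue_integral_def[OF i])
      also have "(\<integral>\<^sup>+x. ennreal (indicator (box a b) x * g x) \<partial>lborel) = emeasure (density lborel ?p) X"
        by (auto simp: emeasure_density X intro!: nn_integral_cong split: split_indicator)
      also have "(\<integral>\<^sup>+x. ennreal (- (indicator (box a b) x * g x)) \<partial>lborel) = emeasure (density lborel ?m) X"
        by (auto simp: emeasure_density X intro!: nn_integral_cong split: split_indicator)
      finally show "emeasure (density lborel ?p) X = emeasure (density lborel ?m) X"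
        using bx[of a b] unfolding X
        by (metis diff_eq_eq add_0 ennreal_enn2real infinity_ennreal_def)
    qed auto
    then have "AE x in lborel. ?p x = ?m x"
      by (intro sigma_finite_measure.density_unique[OF lborel.sigma_finite_measure_axioms]) auto
    then show ?thesis
    proof eventually_elim
      case (elim x) then show ?case
        by (cases "g x \<ge> 0") (auto simp: ennreal_neg ennreal_eq_0_iff dest: sym)
    qed
  qed
  have i: "integrable lborel (\<lambda>x. indicator (box a b) x * f x)" for a b
    by (rule Bochner_Integration.integrable_bound[OF f]) (auto split: split_indicator)
  have "AE x in lborel. Re (f x) = 0"
  proof (rule real)
    show "(LINT x|lborel. indicator (box a b) x * Re (f x)) = 0" for a b
    proof -
      have "(LINT x|lborel. indicator (box a b) x * Re (f x)) = (LINT x|lborel. Re (indicator (box a b) x * f x))"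
        by (intro Bochner_Integration.integral_cong refl) (auto split: split_indicator)
      then show ?thesis by (simp only: integral_Re[OF i] integral_Im[OF i] assms(2) zero_complex.sel)
    qed
  qed (use f in simp)
  moreover have "AE x in lborel. Im (f x) = 0"
  proof (rule real)
    show "(LINT x|lborel. indicator (box a b) x * Im (f x)) = 0" for a b
    proof -
      have "(LINT x|lborel. indicator (box a b) x * Im (f x)) = (LINT x|lborel. Im (indicator (box a b) x * f x))"
        by (intro Bochner_Integration.integral_cong refl) (auto split: split_indicator)
      then show ?thesis by (simp only: integral_Re[OF i] integral_Im[OF i] assms(2) zero_complex.sel)
    qed
  qed (use f in simp)
  ultimately show ?thesis by eventually_elim (simp add: complex_eq_iff)
qed

lemma AE_eq_0_if_box_integrals_0:
  fixes f :: "'a::euclidean_space \<Rightarrow> complex"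
  assumes f: "\<And>a b. integrable lborel (\<lambda>x. indicator (box a b) x * f x)"
    and z: "\<And>a b. (LINT x|lborel. indicator (box a b) x * f x) = 0"
  shows "AE x in lborel. f x = 0"
proof -
  let ?B = "\<lambda>n::nat. box (- (real n *\<^sub>R One)) (real n *\<^sub>R One) :: 'a set"
  have "AE x in lborel. indicator (?B n) x * f x = 0" for n
  proof (rule AE_eq_0_if_box_integrals_0_integrable[OF f])
    fix a b :: 'a
    have "(indicator (box a b) x * (indicator (?B n) x * f x) :: complex) = indicator (box a b \<inter> ?B n) x * f x" for x
      by (auto split: split_indicator)
    then show "(LINT x|lborel. indicator (box a b) x * (indicator (?B n) x * f x)) = 0"
      by (simp only: box_Int_box z)
  qed
  then have "AE x in lborel. \<forall>n. indicator (?B n) x * f x = 0"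
    by (subst AE_all_countable) blast
  then show ?thesis
  proof eventually_elim
    case (elim x)
    obtain n where "x \<in> ?B n" using UN_box_eq_UNIV by blast
    then show ?case using elim by (auto dest: spec[of _ n])
  qed
qed

lemma frontier_box_null: "frontier (box a b :: 'a::euclidean_space set) \<in> null_sets lborel"
proof -
  have "frontier (box a b :: 'a set) \<in> null_sets lebesgue"
    using negligible_convex_frontier[of "box a b"] convex_box negligible_iff_null_sets by blast
  then show ?thesis by (subst (asm) null_sets_completion_iff) auto
qed

section \<open>Gaussian mollification and Fourier inversion\<close>

abbreviation delta_seq :: "nat \<Rightarrow> real" where "delta_seq n \<equiv> 1 / real (Suc n)"

lemma delta_seq_tendsto: "delta_seq \<longlonglongrightarrow> 0"
  using LIMSEQ_inverse_real_of_nat by (simp add: inverse_eq_divide)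

lemma gaussian_delta_tendsto: "(\<lambda>n. complex_of_real (gaussian (delta_seq n *\<^sub>R \<xi>))) \<longlonglongrightarrow> 1"
proof -
  have "(\<lambda>n. complex_of_real (exp (- (norm (delta_seq n *\<^sub>R \<xi>))\<^sup>2 / 2))) \<longlonglongrightarrow> of_real (exp (- (norm (0 *\<^sub>R \<xi>))\<^sup>2 / 2))"
    by (intro tendsto_intros delta_seq_tendsto) auto
  then show ?thesis by (simp add: gaussian_def)
qed

lemma gaussian_le_1: "gaussian z \<le> 1"
  by (simp add: gaussian_def)

text \<open>After Fubini and a translation the shift falls on h instead of f. Dominated convergence
  then asks only for integrability of f, while continuity is required of the bounded function h, and
  only almost everywhere: this admits indicators of boxes.\<close>

lemma approximate_identity:
  fixes f h :: "'a::euclidean_space \<Rightarrow> complex"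
  assumes f: "integrable lborel f" and hm[measurable]: "h \<in> borel_measurable borel" and hC: "\<And>x. norm (h x) \<le> C"
    and cont: "AE x in lborel. \<forall>X. X \<longlonglongrightarrow> x \<longrightarrow> (\<lambda>n. h (X n)) \<longlonglongrightarrow> h x"
  shows "(\<lambda>n. LINT y|lborel. h y * (LINT z|lborel. f (y + delta_seq n *\<^sub>R z) * of_real (gaussian z)))
    \<longlonglongrightarrow> of_real ((2 * pi) powr (DIM('a) / 2)) * (LINT x|lborel. h x * f x)"
proof -
  note [measurable] = borel_measurable_integrable[OF f, simplified]
  have C: "C \<ge> 0" using hC[of 0] norm_ge_zero order_trans by blast
  have hf: "integrable lborel (\<lambda>x. h (x - c) * f x)" for c
    using integrable_mult_bounded[OF f, of "\<lambda>x. h (x - c)" C] hC by (simp add: mult.commute)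
  have fh: "integrable lborel (\<lambda>y. h y * f (y + c))" for c
    using hf[of c] lborel_integrable_translate[of "\<lambda>x. h (x - c) * f x" c] by (simp add: add.commute)
  have tr: "(LINT y|lborel. h y * f (y + c)) = (LINT x|lborel. h (x - c) * f x)" for c
    using lborel_integral_translate[of "\<lambda>x. h (x - c) * f x" c] by (simp add: add.commute)
  have bd: "norm (LINT x|lborel. h (x - c) * f x) \<le> C * (LINT x|lborel. norm (f x))" for c
  proof -
    have "norm (LINT x|lborel. h (x - c) * f x) \<le> (LINT x|lborel. norm (h (x - c) * f x))"
      by (rule integral_norm_bound)
    also have "\<dots> \<le> (LINT x|lborel. C * norm (f x))"
      by (intro integral_mono integrable_norm hf) (use f in \<open>auto simp: norm_mult intro!: mult_right_mono hC\<close>)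
    finally show ?thesis by simp
  qed
  have step: "(LINT y|lborel. h y * (LINT z|lborel. f (y + d *\<^sub>R z) * of_real (gaussian z))) =
     (LINT z|lborel. of_real (gaussian z) * (LINT x|lborel. h (x - d *\<^sub>R z) * f x))" for d
  proof -
    let ?F = "\<lambda>z y. of_real (gaussian z) * (h y * f (y + d *\<^sub>R z))"
    have int: "integrable (lborel \<Otimes>\<^sub>M lborel) (\<lambda>(z, y). ?F z y)"
    proof (rule lborel_pair.Fubini_integrable)
      have nn: "(LINT y|lborel. norm (?F z y)) = gaussian z * (LINT y|lborel. norm (h y * f (y + d *\<^sub>R z)))" for z
        by (simp add: norm_mult gaussian_pos less_imp_le)
      show "integrable lborel (\<lambda>z. LINT y|lborel. norm (case (z, y) of (z, y) \<Rightarrow> ?F z y))"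
      proof (rule Bochner_Integration.integrable_bound)
        show "integrable lborel (\<lambda>z::'a. gaussian z * (C * (LINT x|lborel. norm (f x))))"
          by (intro integrable_mult_left gaussian_integrable)
        show "AE z in lborel. norm (LINT y|lborel. norm (case (z, y) of (z, y) \<Rightarrow> ?F z y))
            \<le> norm (gaussian z * (C * (LINT x|lborel. norm (f x))))"
        proof (intro AE_I2)
          \<comment> \<open>Uniformly in z, the inner integral is at most C times the integral of
            |f|, so the Gaussian weight makes the double integral finite.\<close>
          fix z
          have "(LINT y|lborel. norm (h y * f (y + d *\<^sub>R z))) \<le> (LINT y|lborel. C * norm (f (y + d *\<^sub>R z)))"
          proof (intro integral_mono integrable_norm integrable_mult_right fh)
            show "integrable lborel (\<lambda>y. f (y + d *\<^sub>R z))"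
              using lborel_integrable_translate[of f "d *\<^sub>R z"] f by (simp add: add.commute)
          qed (auto simp: norm_mult intro!: mult_right_mono hC)
          also have "\<dots> = C * (LINT y|lborel. norm (f y))"
            using lborel_integral_translate[of "\<lambda>x. complex_of_real (norm (f x))" "d *\<^sub>R z"]
            by (simp add: add.commute)
          finally show "norm (LINT y|lborel. norm (case (z, y) of (z, y) \<Rightarrow> ?F z y))
            \<le> norm (gaussian z * (C * (LINT x|lborel. norm (f x))))"
            using C by (simp add: nn gaussian_pos less_imp_le abs_mult integral_nonneg mult_left_mono del: norm_mult)
        qed
      qed measurable
      show "AE z in lborel. integrable lborel (\<lambda>y. case (z, y) of (z, y) \<Rightarrow> ?F z y)"
        by (intro AE_I2) (simp add: fh)
    qed measurable
    have "(LINT y|lborel. h y * (LINT z|lborel. f (y + d *\<^sub>R z) * of_real (gaussian z))) =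
       (LINT y|lborel. LINT z|lborel. ?F z y)"
      by (intro Bochner_Integration.integral_cong refl, subst integral_mult_right_zero[symmetric])
        (simp only: ac_simps)
    also have "\<dots> = (LINT z|lborel. LINT y|lborel. ?F z y)"
      by (rule lborel_pair.Fubini_integral[OF int])
    finally show ?thesis by (simp add: tr)
  qed
  have inner: "(\<lambda>n. LINT x|lborel. h (x - delta_seq n *\<^sub>R z) * f x) \<longlonglongrightarrow> (LINT x|lborel. h x * f x)" for z
  proof (rule integral_dominated_convergence[where w="\<lambda>x. C * norm (f x)"])
    show "AE x in lborel. (\<lambda>n. h (x - delta_seq n *\<^sub>R z) * f x) \<longlonglongrightarrow> h x * f x"
      using cont
    proof eventually_elim
      case (elim x)
      have "(\<lambda>n. x - delta_seq n *\<^sub>R z) \<longlonglongrightarrow> x - 0 *\<^sub>R z"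
        by (intro tendsto_intros delta_seq_tendsto)
      then have "(\<lambda>n. h (x - delta_seq n *\<^sub>R z)) \<longlonglongrightarrow> h x" using elim by simp
      then show ?case by (intro tendsto_intros)
    qed
    show "AE x in lborel. norm (h (x - delta_seq n *\<^sub>R z) * f x) \<le> C * norm (f x)" for n
      by (auto simp: norm_mult intro!: mult_right_mono hC)
  qed (use f in auto)
  have "(\<lambda>n. LINT z|lborel. of_real (gaussian z) * (LINT x|lborel. h (x - delta_seq n *\<^sub>R z) * f x))
    \<longlonglongrightarrow> (LINT z|lborel. of_real (gaussian (z::'a)) * (LINT x|lborel. h x * f x))"
  proof (rule integral_dominated_convergence[where w="\<lambda>z. gaussian z * (C * (LINT x|lborel. norm (f x)))"])
    show "AE z in lborel. (\<lambda>n. of_real (gaussian z) * (LINT x|lborel. h (x - delta_seq n *\<^sub>R z) * f x))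
      \<longlonglongrightarrow> of_real (gaussian z) * (LINT x|lborel. h x * f x)"
      by (intro AE_I2 tendsto_intros inner)
    show "AE z in lborel. norm (of_real (gaussian z) * (LINT x|lborel. h (x - delta_seq n *\<^sub>R z) * f x))
      \<le> gaussian z * (C * (LINT x|lborel. norm (f x)))" for n
      unfolding norm_mult by (intro AE_I2 mult_mono bd) (auto simp: gaussian_pos less_imp_le)
    show "integrable lborel (\<lambda>z::'a. gaussian z * (C * (LINT x|lborel. norm (f x))))"
      by (intro integrable_mult_left gaussian_integrable)
  qed measurable
  also have "(LINT z|lborel. of_real (gaussian (z::'a)) * (LINT x|lborel. h x * f x)) =
      of_real ((2 * pi) powr (DIM('a) / 2)) * (LINT x|lborel. h x * f x)"
    using gaussian_integral[where 'a='a] by simp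
  finally show ?thesis unfolding step .
qed

lemma two_pi_powr_half: "(2 * pi) powr (real n / 2) * (2 * pi) powr (real n / 2) = (2 * pi) powr real n"
  by (simp flip: powr_add)

text \<open>Both sides are integrated over boxes. The damped inversion integrals \<open>?A\<close>
  tend to the full one, dominated by the transform of f; by the regularised formula they are also
  Gaussian averages of f, which converge weakly to f. The two factors
  \<open>(2 * pi) powr (DIM('a) / 2)\<close> come from the regularisation and from the mass of the
  Gaussian.\<close>

theorem fourier_inversion_AE:
  fixes f :: "'a::euclidean_space \<Rightarrow> complex"
  assumes f: "integrable lborel f" and fh: "integrable lborel (fourier_integral f)"
  shows "AE x in lborel. f x = inv_fourier (fourier_integral f) x"
proof -
  note [measurable] = borel_measurable_integrable[OF f, simplified]
  let ?c = "(2 * pi) powr real DIM('a)"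
  define g where "g y = (LINT \<xi>|lborel. fourier_integral f \<xi> * exp (\<i> * of_real (\<xi> \<bullet> y)))" for y
  let ?M = "LINT \<xi>|lborel. norm (fourier_integral f \<xi>)"
  have [measurable]: "g \<in> borel_measurable borel"
    unfolding g_def by (rule lborel.borel_measurable_lebesgue_integral) measurable
  have gM: "norm (g y) \<le> ?M" for y
  proof -
    have "norm (g y) \<le> (LINT \<xi>|lborel. norm (fourier_integral f \<xi> * exp (\<i> * of_real (\<xi> \<bullet> y))))"
      unfolding g_def by (rule integral_norm_bound)
    then show ?thesis by (simp add: norm_mult)
  qed
  let ?A = "\<lambda>n y. LINT \<xi>|lborel. fourier_integral f \<xi> * (exp (\<i> * of_real (\<xi> \<bullet> y)) * of_real (gaussian (delta_seq n *\<^sub>R \<xi>)))"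
  have AM: "norm (?A n y) \<le> ?M" for n y
  proof -
    have "norm (?A n y) \<le> (LINT \<xi>|lborel. norm (fourier_integral f \<xi> * (exp (\<i> * of_real (\<xi> \<bullet> y)) * of_real (gaussian (delta_seq n *\<^sub>R \<xi>)))))"
      by (rule integral_norm_bound)
    also have "\<dots> \<le> ?M"
    proof (rule integral_mono)
      show "integrable lborel (\<lambda>\<xi>. norm (fourier_integral f \<xi> * (exp (\<i> * of_real (\<xi> \<bullet> y)) * of_real (gaussian (delta_seq n *\<^sub>R \<xi>)))))"
        by (intro integrable_norm integrable_mult_bounded[OF fh, where C=1])
          (auto simp: norm_mult gaussian_pos less_imp_le gaussian_le_1)
    qed (use fh in \<open>auto simp: norm_mult gaussian_pos less_imp_le gaussian_le_1 intro!: mult_left_le\<close>)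
    finally show ?thesis .
  qed
  have A: "(\<lambda>n. ?A n y) \<longlonglongrightarrow> g y" for y
    unfolding g_def
  proof (rule integral_dominated_convergence[where w="\<lambda>\<xi>. norm (fourier_integral f \<xi>)"])
    show "AE \<xi> in lborel. (\<lambda>n. fourier_integral f \<xi> * (exp (\<i> * of_real (\<xi> \<bullet> y)) * of_real (gaussian (delta_seq n *\<^sub>R \<xi>))))
        \<longlonglongrightarrow> fourier_integral f \<xi> * exp (\<i> * of_real (\<xi> \<bullet> y))"
    proof (intro AE_I2)
      fix \<xi> :: 'a
      have "(\<lambda>n. fourier_integral f \<xi> * (exp (\<i> * of_real (\<xi> \<bullet> y)) * of_real (gaussian (delta_seq n *\<^sub>R \<xi>))))
        \<longlonglongrightarrow> fourier_integral f \<xi> * (exp (\<i> * of_real (\<xi> \<bullet> y)) * 1)"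
        by (intro tendsto_intros gaussian_delta_tendsto)
      then show "(\<lambda>n. fourier_integral f \<xi> * (exp (\<i> * of_real (\<xi> \<bullet> y)) * of_real (gaussian (delta_seq n *\<^sub>R \<xi>))))
        \<longlonglongrightarrow> fourier_integral f \<xi> * exp (\<i> * of_real (\<xi> \<bullet> y))" by simp
    qed
  qed (use fh in \<open>auto simp: norm_mult gaussian_pos less_imp_le gaussian_le_1 intro!: mult_left_le\<close>)
  have box: "(LINT x|lborel. indicator (box a b) x * g x) = of_real ?c * (LINT x|lborel. indicator (box a b) x * f x)" for a b
  proof -
    have "(\<lambda>n. LINT y|lborel. indicator (box a b) y * ?A n y) \<longlonglongrightarrow> (LINT y|lborel. indicator (box a b) y * g y)"
    proof (rule integral_dominated_convergence[where w="\<lambda>y. indicator (box a b) y * ?M"])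
      show "AE y in lborel. (\<lambda>n. indicator (box a b) y * ?A n y) \<longlonglongrightarrow> indicator (box a b) y * g y"
        by (intro AE_I2 tendsto_intros A)
      show "AE y in lborel. norm (indicator (box a b) y * ?A n y) \<le> indicator (box a b) y * ?M" for n
        using AM by (auto simp: norm_mult split: split_indicator)
      show "integrable lborel (\<lambda>y. indicator (box a b) y * ?M)"
        by (intro integrable_mult_left) (auto intro!: integrable_real_indicator simp: emeasure_lborel_box_eq)
    qed measurable
    moreover have "(\<lambda>n. LINT y|lborel. indicator (box a b) y * ?A n y) \<longlonglongrightarrow>
        of_real ((2 * pi) powr (DIM('a) / 2)) * (of_real ((2 * pi) powr (DIM('a) / 2)) * (LINT x|lborel. indicator (box a b) x * f x))"
    proof -
      have "(LINT y|lborel. indicator (box a b) y * ?A n y) = of_real ((2 * pi) powr (DIM('a) / 2)) *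
        (LINT y|lborel. indicator (box a b) y * (LINT z|lborel. f (y + delta_seq n *\<^sub>R z) * of_real (gaussian z)))" for n
        by (subst fourier_gaussian_regularised[OF f], simp, subst integral_mult_right_zero[symmetric])
          (simp only: mult.left_commute)
      moreover have "AE x in lborel. \<forall>X. X \<longlonglongrightarrow> x \<longrightarrow> (\<lambda>n. indicator (box a b) (X n) :: complex) \<longlonglongrightarrow> indicator (box a b) x"
        using AE_not_in[OF frontier_box_null[of a b]]
        by eventually_elim (auto intro: indicator_tendsto_off_frontier)
      ultimately show ?thesis
        by (simp only:) (intro tendsto_mult tendsto_const approximate_identity[OF f, where C=1], auto split: split_indicator)
    qed
    ultimately show ?thesis
      using LIMSEQ_unique two_pi_powr_half[of "DIM('a)"]
      by (metis (no_types, lifting) mult.assoc of_real_mult)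
  qed
  have ig: "integrable lborel (\<lambda>x. indicator (box a b) x * g x)" for a b
    by (rule Bochner_Integration.integrable_bound[of _ "\<lambda>x. indicator (box a b) x * ?M"])
      (use gM in \<open>auto simp: norm_mult emeasure_lborel_box_eq split: split_indicator intro: order_trans[OF _ abs_ge_self] intro!: integrable_mult_left integrable_real_indicator\<close>)
  have if': "integrable lborel (\<lambda>x. indicator (box a b) x * f x)" for a b
    by (rule Bochner_Integration.integrable_bound[OF f]) (auto split: split_indicator)
  have "AE x in lborel. g x - of_real ?c * f x = 0"
  proof (rule AE_eq_0_if_box_integrals_0)
    fix a b :: 'a
    have eq: "(indicator (box a b) x * (g x - of_real ?c * f x)) = indicator (box a b) x * g x - of_real ?c * (indicator (box a b) x * f x)" for x
      by (simp add: algebra_simps)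
    show "integrable lborel (\<lambda>x. indicator (box a b) x * (g x - of_real ?c * f x))"
      unfolding eq by (intro Bochner_Integration.integrable_diff ig integrable_mult_right if')
    show "(LINT x|lborel. indicator (box a b) x * (g x - of_real ?c * f x)) = 0"
      unfolding eq by (subst Bochner_Integration.integral_diff) (auto intro!: ig if' simp: box)
  qed
  then show ?thesis
    by eventually_elim
      (simp add: inv_fourier_def g_def[symmetric] powr_minus field_simps)
qed

lemma fourier_integral_injective:
  fixes f :: "'a::euclidean_space \<Rightarrow> complex"
  assumes f: "integrable lborel f" and "\<And>\<xi>. fourier_integral f \<xi> = 0"
  shows "AE x in lborel. f x = 0"
proof -
  have "fourier_integral f = (\<lambda>_. 0)" using assms(2) by auto
  then show ?thesis using fourier_inversion_AE[OF f] by (simp add: inv_fourier_def)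
qed

lemma cnj_measurable [measurable]: "cnj \<in> borel_measurable borel"
  by (intro borel_measurable_continuous_onI continuous_intros)

text \<open>The damped square norm of the transform is the pairing of \<open>cnj (g y)\<close> with
  a Gaussian average of g. Continuity of g is what lets \<open>approximate_identity\<close> take the
  limit with \<open>cnj g\<close> as the bounded function.\<close>

lemma plancherel_continuous:
  fixes g :: "'a::euclidean_space \<Rightarrow> complex"
  assumes g: "integrable lborel g" and cont: "continuous_on UNIV g" and gC: "\<And>x. norm (g x) \<le> C"
  shows "(\<integral>\<^sup>+\<xi>. ennreal ((norm (fourier_integral g \<xi>))\<^sup>2) \<partial>lborel) =
    ennreal ((2 * pi) powr real DIM('a)) * (\<integral>\<^sup>+x. ennreal ((norm (g x))\<^sup>2) \<partial>lborel)"
proof -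
  note [measurable] = borel_measurable_integrable[OF g, simplified]
  let ?h = "fourier_integral g"
  let ?M = "LINT x|lborel. norm (g x)"
  let ?r = "(2 * pi) powr (DIM('a) / 2)"
  have gs: "integrable lborel (\<lambda>\<xi>::'a. gaussian (delta_seq n *\<^sub>R \<xi>))" for n
    using integrable_gaussian(1)[of "(delta_seq n)\<^sup>2", where 'a='a] by (simp add: gaussian_def[abs_def] power_mult_distrib power_divide)
  have hg: "integrable lborel (\<lambda>\<xi>. ?h \<xi> * of_real (gaussian (delta_seq n *\<^sub>R \<xi>)))" for n
    using integrable_mult_bounded[OF integrable_of_real[OF gs[of n]] _ norm_fourier_integral_le[of g]] by (simp add: mult.commute)
  have hhg: "integrable lborel (\<lambda>\<xi>. (norm (?h \<xi>))\<^sup>2 * gaussian (delta_seq n *\<^sub>R \<xi>))" for n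
  proof (rule Bochner_Integration.integrable_bound[of _ "\<lambda>\<xi>. ?M\<^sup>2 * gaussian (delta_seq n *\<^sub>R \<xi>)"])
    show "AE x in lborel. norm ((norm (?h x))\<^sup>2 * gaussian (delta_seq n *\<^sub>R x)) \<le> norm (?M\<^sup>2 * gaussian (delta_seq n *\<^sub>R x))"
      by (auto simp: abs_mult gaussian_pos less_imp_le intro!: mult_right_mono power_mono norm_fourier_integral_le)
  qed (use gs in auto)
  have eq: "complex_of_real (LINT \<xi>|lborel. (norm (?h \<xi>))\<^sup>2 * gaussian (delta_seq n *\<^sub>R \<xi>)) =
      of_real ?r * (LINT y|lborel. cnj (g y) * (LINT z|lborel. g (y + delta_seq n *\<^sub>R z) * of_real (gaussian z)))" for n
  proof -
    have cg: "integrable lborel (\<lambda>x. cnj (g x))" using g by simp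

    let ?F = "\<lambda>\<xi> y. ?h \<xi> * of_real (gaussian (delta_seq n *\<^sub>R \<xi>)) * (cnj (g y) * exp (\<i> * of_real (\<xi> \<bullet> y)))"
    have cnj: "cnj (?h \<xi>) = (LINT y|lborel. cnj (g y) * exp (\<i> * of_real (\<xi> \<bullet> y)))" for \<xi>
    proof -
      have "cnj (?h \<xi>) = (LINT y|lborel. cnj (g y * exp (- \<i> * of_real (y \<bullet> \<xi>))))"
        unfolding fourier_integral_def by (rule Bochner_Integration.integral_cnj[symmetric])
      then show ?thesis by (simp add: exp_cnj inner_commute)
    qed
    have int: "integrable (lborel \<Otimes>\<^sub>M lborel) (\<lambda>(\<xi>, y). ?F \<xi> y)"
      by (rule Bochner_Integration.integrable_bound[OF integrable_pair_times[OF hg[of n] cg]])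
        (auto simp: norm_mult split_def)
    have "complex_of_real (LINT \<xi>|lborel. (norm (?h \<xi>))\<^sup>2 * gaussian (delta_seq n *\<^sub>R \<xi>)) =
      (LINT \<xi>|lborel. ?h \<xi> * cnj (?h \<xi>) * of_real (gaussian (delta_seq n *\<^sub>R \<xi>)))"
      unfolding integral_complex_of_real[symmetric]
      by (intro Bochner_Integration.integral_cong refl) (simp add: complex_norm_square[symmetric])
    also have "\<dots> = (LINT \<xi>|lborel. LINT y|lborel. ?F \<xi> y)"
      by (intro Bochner_Integration.integral_cong refl) (simp only: integral_mult_right_zero cnj[symmetric], simp only: ac_simps)
    also have "\<dots> = (LINT y|lborel. LINT \<xi>|lborel. ?F \<xi> y)"
      by (rule lborel_pair.Fubini_integral[OF int, symmetric])
    also have "\<dots> = (LINT y|lborel. cnj (g y) * (LINT \<xi>|lborel. ?h \<xi> * (exp (\<i> * of_real (\<xi> \<bullet> y)) * of_real (gaussian (delta_seq n *\<^sub>R \<xi>)))))"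
      by (intro Bochner_Integration.integral_cong refl, subst integral_mult_right_zero[symmetric]) (simp only: ac_simps)
    also have "\<dots> = of_real ?r * (LINT y|lborel. cnj (g y) * (LINT z|lborel. g (y + delta_seq n *\<^sub>R z) * of_real (gaussian z)))"
      by (subst fourier_gaussian_regularised[OF g], simp, subst integral_mult_right_zero[symmetric])
          (simp only: mult.left_commute)
    finally show ?thesis .
  qed
  have g2: "integrable lborel (\<lambda>x. (norm (g x))\<^sup>2)"
  proof (rule Bochner_Integration.integrable_bound[of _ "\<lambda>x. C * norm (g x)"])
    show "AE x in lborel. norm ((norm (g x))\<^sup>2) \<le> norm (C * norm (g x))"
    proof (intro AE_I2)
      fix x
      have "(norm (g x))\<^sup>2 \<le> C * norm (g x)"
        unfolding power2_eq_square by (intro mult_right_mono gC) auto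
      then show "norm ((norm (g x))\<^sup>2) \<le> norm (C * norm (g x))" by simp
    qed
  qed (use g in auto)
  have "(\<lambda>n. LINT y|lborel. cnj (g y) * (LINT z|lborel. g (y + delta_seq n *\<^sub>R z) * of_real (gaussian z)))
    \<longlonglongrightarrow> of_real ?r * (LINT x|lborel. cnj (g x) * g x)"
  proof (rule approximate_identity[OF g])
    show "AE x in lborel. \<forall>X. X \<longlonglongrightarrow> x \<longrightarrow> (\<lambda>n. cnj (g (X n))) \<longlonglongrightarrow> cnj (g x)"
      using cont by (auto simp: continuous_on_eq_continuous_at intro!: tendsto_cnj isCont_tendsto_compose[of _ g])
  qed (use gC in auto)
  then have "(\<lambda>n. complex_of_real (LINT \<xi>|lborel. (norm (?h \<xi>))\<^sup>2 * gaussian (delta_seq n *\<^sub>R \<xi>))) \<longlonglongrightarrow>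
      of_real ?r * (of_real ?r * (LINT x|lborel. cnj (g x) * g x))"
    unfolding eq by (intro tendsto_mult tendsto_const)
  also have "(LINT x|lborel. cnj (g x) * g x) = of_real (LINT x|lborel. (norm (g x))\<^sup>2)"
    unfolding integral_complex_of_real[symmetric] by (simp only: complex_norm_square mult.commute)
  also have "of_real ?r * (of_real ?r * complex_of_real X) = of_real ((2 * pi) powr real DIM('a) * X)" for X
    by (metis mult.assoc of_real_mult two_pi_powr_half)
  finally have "(\<lambda>n. LINT \<xi>|lborel. (norm (?h \<xi>))\<^sup>2 * gaussian (delta_seq n *\<^sub>R \<xi>)) \<longlonglongrightarrow>
      (2 * pi) powr real DIM('a) * (LINT x|lborel. (norm (g x))\<^sup>2)"
    by (simp only: tendsto_of_real_iff)
  then have "(\<lambda>n. ennreal (LINT \<xi>|lborel. (norm (?h \<xi>))\<^sup>2 * gaussian (delta_seq n *\<^sub>R \<xi>))) \<longlonglongrightarrow>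
      ennreal ((2 * pi) powr real DIM('a) * (LINT x|lborel. (norm (g x))\<^sup>2))"
    by (rule tendsto_ennrealI)
  moreover have "ennreal (LINT \<xi>|lborel. (norm (?h \<xi>))\<^sup>2 * gaussian (delta_seq n *\<^sub>R \<xi>)) =
      (\<integral>\<^sup>+\<xi>. ennreal ((norm (?h \<xi>))\<^sup>2 * gaussian (delta_seq n *\<^sub>R \<xi>)) \<partial>lborel)" for n
    by (rule nn_integral_eq_integral[symmetric, OF hhg]) (auto simp: gaussian_pos less_imp_le)
  \<comment> \<open>Monotone convergence, since square integrability of the transform is part of the
    claim and no integrable majorant is at hand.\<close>
  moreover have "(\<lambda>n. \<integral>\<^sup>+\<xi>. ennreal ((norm (?h \<xi>))\<^sup>2 * gaussian (delta_seq n *\<^sub>R \<xi>)) \<partial>lborel) \<longlonglongrightarrow>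
      (\<integral>\<^sup>+\<xi>. ennreal ((norm (?h \<xi>))\<^sup>2) \<partial>lborel)"
  proof (rule nn_integral_LIMSEQ)
    show "incseq (\<lambda>n \<xi>. ennreal ((norm (?h \<xi>))\<^sup>2 * gaussian (delta_seq n *\<^sub>R \<xi>)))"
    proof (intro incseq_SucI le_funI ennreal_leI mult_left_mono)
      fix n and \<xi> :: 'a
      have "(norm (delta_seq (Suc n) *\<^sub>R \<xi>))\<^sup>2 \<le> (norm (delta_seq n *\<^sub>R \<xi>))\<^sup>2"
        by (intro power_mono) (auto simp: divide_simps intro!: mult_left_mono)
      then show "gaussian (delta_seq n *\<^sub>R \<xi>) \<le> gaussian (delta_seq (Suc n) *\<^sub>R \<xi>)"
        unfolding gaussian_def by simp
    qed auto
    show "(\<lambda>n. ennreal ((norm (?h \<xi>))\<^sup>2 * gaussian (delta_seq n *\<^sub>R \<xi>))) \<longlonglongrightarrow> ennreal ((norm (?h \<xi>))\<^sup>2)" for \<xi>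
    proof (rule tendsto_ennrealI)
      have "(\<lambda>n. gaussian (delta_seq n *\<^sub>R \<xi>)) \<longlonglongrightarrow> 1"
        using gaussian_delta_tendsto[of \<xi>] by (metis of_real_1 tendsto_of_real_iff)
      then show "(\<lambda>n. (norm (?h \<xi>))\<^sup>2 * gaussian (delta_seq n *\<^sub>R \<xi>)) \<longlonglongrightarrow> (norm (?h \<xi>))\<^sup>2"
        by (auto intro!: tendsto_eq_intros)
    qed
  qed auto
  ultimately have "(\<integral>\<^sup>+\<xi>. ennreal ((norm (?h \<xi>))\<^sup>2) \<partial>lborel) = ennreal ((2 * pi) powr real DIM('a) * (LINT x|lborel. (norm (g x))\<^sup>2))"
    using LIMSEQ_unique by auto
  also have "\<dots> = ennreal ((2 * pi) powr real DIM('a)) * ennreal (LINT x|lborel. (norm (g x))\<^sup>2)"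
    by (rule ennreal_mult) auto
  also have "ennreal (LINT x|lborel. (norm (g x))\<^sup>2) = (\<integral>\<^sup>+x. ennreal ((norm (g x))\<^sup>2) \<partial>lborel)"
    by (rule nn_integral_eq_integral[symmetric, OF g2]) auto
  finally show ?thesis .
qed

section \<open>Schwartz functions\<close>

text \<open>Complex polynomials in the coordinates. The class is closed under directional
  derivatives and multiplication, so every iterated derivative of a Gaussian is such a polynomial
  times the same Gaussian.\<close>

inductive cpoly :: "('a::euclidean_space \<Rightarrow> complex) \<Rightarrow> bool" where
  const: "cpoly (\<lambda>_. c)"
| inner: "cpoly (\<lambda>x. of_real (x \<bullet> b))"
| add: "cpoly p \<Longrightarrow> cpoly q \<Longrightarrow> cpoly (\<lambda>x. p x + q x)"
| mult: "cpoly p \<Longrightarrow> cpoly q \<Longrightarrow> cpoly (\<lambda>x. p x * q x)"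

lemma cpoly_has_derivative:
  assumes "cpoly p"
  shows "\<exists>D. (\<forall>x. (p has_derivative D x) (at x)) \<and> (\<forall>h. cpoly (\<lambda>x. D x h))"
  using assms
proof induction
  case (const c)
  show ?case by (rule exI[of _ "\<lambda>x h. 0"]) (auto intro: cpoly.const)
next
  case (inner b)
  have "cpoly (\<lambda>x::'a. of_real (h \<bullet> b))" for h by (rule cpoly.const)
  moreover have "((\<lambda>x. complex_of_real (x \<bullet> b)) has_derivative (\<lambda>h. of_real (h \<bullet> b))) (at x)" for x
    by (auto intro!: derivative_eq_intros)
  ultimately show ?case by (intro exI[of _ "\<lambda>x h. of_real (h \<bullet> b)"]) auto
next
  case (add p q)
  then obtain D E where "\<forall>x. (p has_derivative D x) (at x)" "\<forall>h. cpoly (\<lambda>x. D x h)"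
    "\<forall>x. (q has_derivative E x) (at x)" "\<forall>h. cpoly (\<lambda>x. E x h)" by blast
  then show ?case
    by (intro exI[of _ "\<lambda>x h. D x h + E x h"]) (auto intro!: has_derivative_add cpoly.add)
next
  case (mult p q)
  then obtain D E where "\<forall>x. (p has_derivative D x) (at x)" "\<forall>h. cpoly (\<lambda>x. D x h)"
    "\<forall>x. (q has_derivative E x) (at x)" "\<forall>h. cpoly (\<lambda>x. E x h)" by blast
  then show ?case using mult
    by (intro exI[of _ "\<lambda>x h. p x * E x h + D x h * q x"])
      (auto intro!: has_derivative_mult cpoly.add cpoly.mult)
qed

lemma cpoly_bound:
  assumes "cpoly p"
  shows "\<exists>C k. C \<ge> 0 \<and> (\<forall>x. norm (p x) \<le> C * (1 + norm x) ^ k)"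
  using assms
proof induction
  case (const c)
  show ?case by (rule exI[of _ "norm c"], rule exI[of _ 0]) simp
next
  case (inner b)
  have "norm (complex_of_real (x \<bullet> b)) \<le> norm b * (1 + norm x) ^ 1" for x
  proof -
    have "norm (complex_of_real (x \<bullet> b)) \<le> norm b * norm x"
      using Cauchy_Schwarz_ineq2[of x b] by (simp add: mult.commute)
    also have "\<dots> \<le> norm b * (1 + norm x) ^ 1" by (intro mult_left_mono) auto
    finally show ?thesis .
  qed
  then show ?case by (intro exI[of _ "norm b"] exI[of _ 1]) auto
next
  case (add p q)
  then obtain C k C' k' where 1: "C \<ge> 0" "\<And>x. norm (p x) \<le> C * (1 + norm x) ^ k"
    "C' \<ge> 0" "\<And>x. norm (q x) \<le> C' * (1 + norm x) ^ k'" by blast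
  have "norm (p x + q x) \<le> (C + C') * (1 + norm x) ^ (max k k')" for x
  proof -
    have "norm (p x + q x) \<le> C * (1 + norm x) ^ k + C' * (1 + norm x) ^ k'"
      using norm_triangle_ineq[of "p x" "q x"] 1(2)[of x] 1(4)[of x] by linarith
    also have "\<dots> \<le> C * (1 + norm x) ^ (max k k') + C' * (1 + norm x) ^ (max k k')"
      by (intro add_mono mult_left_mono power_increasing 1) auto
    finally show ?thesis by (simp add: algebra_simps)
  qed
  then show ?case using 1 by (intro exI[of _ "C + C'"] exI[of _ "max k k'"]) auto
next
  case (mult p q)
  then obtain C k C' k' where 1: "C \<ge> 0" "\<And>x. norm (p x) \<le> C * (1 + norm x) ^ k"
    "C' \<ge> 0" "\<And>x. norm (q x) \<le> C' * (1 + norm x) ^ k'" by blast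
  have "norm (p x * q x) \<le> (C * C') * (1 + norm x) ^ (k + k')" for x
  proof -
    have "norm (p x * q x) \<le> (C * (1 + norm x) ^ k) * (C' * (1 + norm x) ^ k')"
      unfolding norm_mult by (intro mult_mono 1) (auto intro!: mult_nonneg_nonneg 1)
    then show ?thesis by (simp add: power_add algebra_simps)
  qed
  then show ?case using 1 by (intro exI[of _ "C * C'"] exI[of _ "k + k'"]) auto
qed

text \<open>With u = 0 this is a modulated Gaussian; with v = 0 it is, up to a constant, a
  translated one, and its Fourier integral is again a modulated Gaussian. These two families are all
  the test functions that the uniqueness results use.\<close>

definition cgaussian :: "'a::euclidean_space \<Rightarrow> 'a \<Rightarrow> 'a \<Rightarrow> complex" where
  "cgaussian u v x = exp (of_real (- (x \<bullet> x) / 2 + x \<bullet> u) + \<i> * of_real (x \<bullet> v))"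

lemma cgaussian_has_derivative:
  "(cgaussian u v has_derivative (\<lambda>h. cgaussian u v x * (of_real (- (x \<bullet> h) + h \<bullet> u) + \<i> * of_real (h \<bullet> v)))) (at x)"
proof -
  let ?g = "\<lambda>x. complex_of_real (- (x \<bullet> x) / 2 + x \<bullet> u) + \<i> * of_real (x \<bullet> v)"
  have "(?g has_derivative (\<lambda>h. of_real (- (x \<bullet> h) + h \<bullet> u) + \<i> * of_real (h \<bullet> v))) (at x)"
    by (auto intro!: derivative_eq_intros simp: inner_commute algebra_simps)
  moreover have "(exp has_derivative (*) (exp (?g x))) (at (?g x))"
    using DERIV_exp unfolding has_field_derivative_def .
  ultimately show ?thesis
    unfolding cgaussian_def by (rule has_derivative_compose)
qed

lemma iter_deriv_cpoly_cgaussian: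
  fixes p :: "'a::euclidean_space \<Rightarrow> complex"
  assumes p: "cpoly p"
  shows "\<exists>q. cpoly q \<and> iter_deriv bs (\<lambda>x. p x * cgaussian u v x) = (\<lambda>x. q x * cgaussian u v x)"
proof (induction bs)
  case Nil
  then show ?case using p by auto
next
  case (Cons b bs)
  then obtain q where q: "cpoly q" and eq: "iter_deriv bs (\<lambda>x. p x * cgaussian u v x) = (\<lambda>x. q x * cgaussian u v x)"
    by blast
  obtain D where D: "\<And>x. (q has_derivative D x) (at x)" "\<And>h. cpoly (\<lambda>x. D x h)"
    using cpoly_has_derivative[OF q] by blast
  have "((\<lambda>x. q x * cgaussian u v x) has_derivative (\<lambda>h. q x * (cgaussian u v x * (of_real (- (x \<bullet> h) + h \<bullet> u) + \<i> * of_real (h \<bullet> v))) +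
      D x h * cgaussian u v x)) (at x)" for x
    by (rule has_derivative_mult[OF D(1) cgaussian_has_derivative])
  then have fr: "frechet_derivative (\<lambda>x. q x * cgaussian u v x) (at x) b =
      (q x * (of_real (- 1) * of_real (x \<bullet> b) + (of_real (b \<bullet> u) + \<i> * of_real (b \<bullet> v))) + D x b) * cgaussian u v x" for x
    by (subst frechet_derivative_at[symmetric], assumption) (simp add: algebra_simps)
  show ?case
    by (intro exI[of _ "\<lambda>x. q x * (of_real (- 1) * of_real (x \<bullet> b) + (of_real (b \<bullet> u) + \<i> * of_real (b \<bullet> v))) + D x b"] conjI)
      (auto simp: eq fr intro!: cpoly.intros q D simp del: of_real_minus of_real_1)
qed

text \<open>\<open>(1 + norm x) ^ N / fact N\<close> is one term of the exponential series at
  \<open>1 + norm x\<close>. Completing the square at \<open>norm x = 1 + norm u\<close> bounds the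
  total exponent.\<close>

lemma cgaussian_decay:
  fixes x u v :: "'a::euclidean_space"
  shows "(1 + norm x) ^ N * norm (cgaussian u v x) \<le> fact N * exp (1 + (1 + norm u)\<^sup>2 / 2)"
proof -
  let ?r = "norm x"
  have "(1 + ?r) ^ N / fact N \<le> exp (1 + ?r)"
    using sum_le_suminf[OF summable_exp_generic[of "1 + ?r"], of "{N}"] sums_unique[OF exp_converges[of "1 + ?r"]]
    by (simp add: divide_inverse mult.commute)
  then have 1: "(1 + ?r) ^ N \<le> fact N * exp (1 + ?r)" by (simp add: field_simps)
  have "x \<bullet> u \<le> ?r * norm u" by (rule norm_cauchy_schwarz)
  then have 2: "norm (cgaussian u v x) \<le> exp (- (?r)\<^sup>2 / 2 + ?r * norm u)"
    by (simp add: cgaussian_def norm_exp_eq_Re power2_norm_eq_inner)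
  have "(1 + ?r) ^ N * norm (cgaussian u v x) \<le> (fact N * exp (1 + ?r)) * exp (- (?r)\<^sup>2 / 2 + ?r * norm u)"
    by (intro mult_mono 1 2) auto
  also have "\<dots> = fact N * exp (1 + ?r + (- (?r)\<^sup>2 / 2 + ?r * norm u))"
    by (simp add: exp_add)
  also have "\<dots> \<le> fact N * exp (1 + (1 + norm u)\<^sup>2 / 2)"
  proof -
    have "0 \<le> (?r - (1 + norm u))\<^sup>2" by simp
    then have "1 + ?r + (- (?r)\<^sup>2 / 2 + ?r * norm u) \<le> 1 + (1 + norm u)\<^sup>2 / 2"
      by (simp add: power2_eq_square field_simps)
    then show ?thesis by simp
  qed
  finally show ?thesis .
qed

lemma schwartz_cgaussian: "schwartz (cgaussian u v)"
  unfolding schwartz_def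
proof (intro ballI conjI allI)
  fix bs :: "'a list" assume "bs \<in> lists Basis"
  obtain q where q: "cpoly q" and "iter_deriv bs (\<lambda>x. 1 * cgaussian u v x) = (\<lambda>x. q x * cgaussian u v x)"
    using iter_deriv_cpoly_cgaussian[OF cpoly.const[of 1]] by blast
  then have eq: "iter_deriv bs (cgaussian u v) = (\<lambda>x. q x * cgaussian u v x)" by simp
  show "iter_deriv bs (cgaussian u v) differentiable at x" for x
    unfolding eq using cpoly_has_derivative[OF q] cgaussian_has_derivative
    by (intro differentiable_mult) (auto simp: differentiable_def)
  obtain C k where C: "C \<ge> 0" "\<And>x. norm (q x) \<le> C * (1 + norm x) ^ k"
    using cpoly_bound[OF q] by blast
  fix N
  show "bounded (range (\<lambda>x. (1 + norm x) ^ N *\<^sub>R iter_deriv bs (cgaussian u v) x))"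
    unfolding bounded_iff eq
  proof (intro exI ballI, safe)
    fix x
    have "norm ((1 + norm x) ^ N *\<^sub>R (q x * cgaussian u v x)) = (1 + norm x) ^ N * norm (q x) * norm (cgaussian u v x)"
      by (simp add: norm_mult)
    also have "\<dots> \<le> (1 + norm x) ^ N * (C * (1 + norm x) ^ k) * norm (cgaussian u v x)"
      by (intro mult_right_mono mult_left_mono C) auto
    also have "\<dots> = C * ((1 + norm x) ^ (N + k) * norm (cgaussian u v x))"
      by (simp add: power_add)
    also have "\<dots> \<le> C * (fact (N + k) * exp (1 + (1 + norm u)\<^sup>2 / 2))"
      by (intro mult_left_mono C cgaussian_decay)
    finally show "norm ((1 + norm x) ^ N *\<^sub>R (q x * cgaussian u v x)) \<le> C * (fact (N + k) * exp (1 + (1 + norm u)\<^sup>2 / 2))" .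
  qed
qed

section \<open>Decay and integrability of Schwartz functions\<close>

lemma schwartz_decay:
  assumes "schwartz \<phi>" "bs \<in> lists Basis"
  obtains C where "C > 0" "\<And>x. norm (iter_deriv bs \<phi> x) \<le> C / (1 + norm x) ^ N"
proof -
  have "bounded (range (\<lambda>x. (1 + norm x) ^ N *\<^sub>R iter_deriv bs \<phi> x))"
    using assms unfolding schwartz_def by blast
  then obtain C where C: "C > 0" "\<And>x. norm ((1 + norm x) ^ N *\<^sub>R iter_deriv bs \<phi> x) \<le> C"
    unfolding bounded_pos by auto
  have "norm (iter_deriv bs \<phi> x) \<le> C / (1 + norm x) ^ N" for x
  proof -
    have "1 + norm x > 0" using norm_ge_zero[of x] by linarith
    then show ?thesis using C(2)[of x] by (simp add: pos_le_divide_eq mult.commute)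
  qed
  then show ?thesis using C(1) that by blast
qed

text \<open>Each coordinate satisfies
  \<open>1 + (x \<bullet> b)\<^sup>2 \<le> (1 + norm x)\<^sup>2\<close>; multiplying over the basis
  compares the function with a product of one-dimensional integrable functions, which is where the
  exponent 2 d comes from.\<close>

lemma integrable_polynomial_decay:
  "integrable lborel (\<lambda>x::'a::euclidean_space. 1 / (1 + norm x) ^ (2 * DIM('a)))"
proof -
  have "integrable lborel (\<lambda>x::real. inverse (1 + x\<^sup>2))"
    using integrable_inverse_1_plus_square by (simp add: set_integrable_def einterval_eq_UNIV)
  then have "integrable lborel (\<lambda>x::real. complex_of_real (inverse (1 + x\<^sup>2)))"
    by (rule integrable_of_real)
  then have i: "integrable lborel (\<lambda>x::'a. \<Prod>b\<in>Basis. complex_of_real (inverse (1 + (x \<bullet> b)\<^sup>2)))"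
    by (intro integrable_lborel_prod)
  show ?thesis
  proof (rule Bochner_Integration.integrable_bound[OF i])
    show "AE x in lborel. norm (1 / (1 + norm (x::'a)) ^ (2 * DIM('a))) \<le> norm (\<Prod>b\<in>Basis. complex_of_real (inverse (1 + (x \<bullet> b)\<^sup>2)))"
    proof (intro AE_I2)
      fix x :: 'a
      have pos: "1 + (x \<bullet> b)\<^sup>2 > 0" for b by (simp add: add_pos_nonneg)
      have p1: "1 + norm x > 0" using norm_ge_zero[of x] by linarith
      have "(\<Prod>b\<in>(Basis::'a set). 1 + (x \<bullet> b)\<^sup>2) \<le> (\<Prod>b\<in>(Basis::'a set). (1 + norm x)\<^sup>2)"
      proof (intro prod_mono conjI)
        fix b :: 'a assume "b \<in> Basis"
        then have "(x \<bullet> b)\<^sup>2 \<le> (norm x)\<^sup>2" using Basis_le_norm[of b x] by (metis abs_le_square_iff abs_norm_cancel)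
        also have "1 + (norm x)\<^sup>2 \<le> (1 + norm x)\<^sup>2" by (simp add: power2_eq_square algebra_simps)
        finally show "1 + (x \<bullet> b)\<^sup>2 \<le> (1 + norm x)\<^sup>2" by simp
      qed (use pos in \<open>auto intro: less_imp_le\<close>)
      also have "\<dots> = (1 + norm x) ^ (2 * DIM('a))" by (simp add: power_mult)
      finally have "1 / (1 + norm x) ^ (2 * DIM('a)) \<le> 1 / (\<Prod>b\<in>(Basis::'a set). 1 + (x \<bullet> b)\<^sup>2)"
        using pos p1 by (intro divide_left_mono) (auto intro!: mult_pos_pos prod_pos)
      also have "\<dots> = norm (\<Prod>b\<in>Basis. complex_of_real (inverse (1 + (x \<bullet> b)\<^sup>2)))"
        unfolding prod_norm[symmetric] norm_of_real using pos
        by (simp add: abs_of_pos prod_dividef inverse_eq_divide)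
      finally show "norm (1 / (1 + norm x) ^ (2 * DIM('a))) \<le> norm (\<Prod>b\<in>Basis. complex_of_real (inverse (1 + (x \<bullet> b)\<^sup>2)))"
        using p1 by simp
    qed
  qed measurable
qed

lemma schwartz_continuous:
  assumes "schwartz \<phi>" "bs \<in> lists Basis"
  shows "continuous_on UNIV (iter_deriv bs \<phi>)"
  using assms unfolding schwartz_def continuous_on_eq_continuous_at[OF open_UNIV]
  using differentiable_imp_continuous_within by blast

lemma schwartz_measurable:
  assumes "schwartz \<phi>" "bs \<in> lists Basis"
  shows "iter_deriv bs \<phi> \<in> borel_measurable borel"
  using schwartz_continuous[OF assms] by (rule borel_measurable_continuous_onI)

lemma schwartz_integrable:
  fixes \<phi> :: "'a::euclidean_space \<Rightarrow> complex"
  assumes "schwartz \<phi>" "bs \<in> lists Basis"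
  shows "integrable lborel (iter_deriv bs \<phi>)"
proof -
  note [measurable] = schwartz_measurable[OF assms]
  obtain C where C: "C > 0" "\<And>x. norm (iter_deriv bs \<phi> x) \<le> C / (1 + norm x) ^ (2 * DIM('a))"
    using schwartz_decay[OF assms] by blast
  show ?thesis
  proof (rule Bochner_Integration.integrable_bound)
    show "integrable lborel (\<lambda>x::'a. C * (1 / (1 + norm x) ^ (2 * DIM('a))))"
      by (intro integrable_mult_right integrable_polynomial_decay)
  qed (use C in \<open>auto intro: order_trans[OF _ abs_ge_self]\<close>)
qed

section \<open>Fourier integrals of derivatives and inversion on Schwartz functions\<close>

lemma vector_derivative_sequence:
  fixes g :: "real \<Rightarrow> 'a::real_normed_vector"
  assumes "(g has_vector_derivative v) (at 0)"
  shows "(\<lambda>n. (g (delta_seq n) - g 0) /\<^sub>R delta_seq n) \<longlonglongrightarrow> v"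
proof -
  have "((\<lambda>h. norm (g (0 + h) - g 0 - h *\<^sub>R v) / norm h) \<longlongrightarrow> 0) (at 0)"
    using assms unfolding has_vector_derivative_def has_derivative_at by blast
  moreover have "filterlim delta_seq (at 0) sequentially"
    unfolding filterlim_at using delta_seq_tendsto by simp
  ultimately have "(\<lambda>n. norm (g (0 + delta_seq n) - g 0 - delta_seq n *\<^sub>R v) / norm (delta_seq n)) \<longlonglongrightarrow> 0"
    by (rule filterlim_compose)
  moreover have "norm (g (0 + delta_seq n) - g 0 - delta_seq n *\<^sub>R v) / norm (delta_seq n) =
      norm ((g (delta_seq n) - g 0) /\<^sub>R delta_seq n - v)" for n
  proof -
    have "(g (delta_seq n) - g 0) /\<^sub>R delta_seq n - v = (g (0 + delta_seq n) - g 0 - delta_seq n *\<^sub>R v) /\<^sub>R delta_seq n"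
      by (simp only: scaleR_right_diff_distrib scaleR_scaleR) simp
    then show ?thesis by (simp only: norm_scaleR norm_inverse) (simp add: field_simps)
  qed
  ultimately show ?thesis
    by (simp only: tendsto_norm_zero_iff LIM_zero_iff)
qed

text \<open>Difference quotients take the place of integration by parts: by translation invariance
  the transform of the quotient with step h is exactly (exp(i h b \<bullet> \<xi>) - 1) / h times
  the transform, and both sides pass to the limit along \<open>delta_seq\<close>.\<close>

lemma fourier_integral_iter_deriv:
  fixes \<phi> :: "'a::euclidean_space \<Rightarrow> complex"
  assumes \<phi>: "schwartz \<phi>" and bs: "bs \<in> lists Basis" and b: "b \<in> Basis"
  shows "fourier_integral (iter_deriv (b # bs) \<phi>) \<xi> = \<i> * of_real (\<xi> \<bullet> b) * fourier_integral (iter_deriv bs \<phi>) \<xi>"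
proof -
  define f where "f = iter_deriv bs \<phi>"
  define f' where "f' = iter_deriv (b # bs) \<phi>"
  have bbs: "b # bs \<in> lists Basis" using b bs by simp
  note [measurable] = schwartz_measurable[OF \<phi> bs, folded f_def] schwartz_measurable[OF \<phi> bbs, folded f'_def]
  have fi: "integrable lborel f" unfolding f_def by (rule schwartz_integrable[OF \<phi> bs])
  have nb: "norm b = 1" using b by simp
  let ?N = "2 * DIM('a)"
  obtain C where C: "C > 0" "\<And>x. norm (f' x) \<le> C / (1 + norm x) ^ ?N"
    unfolding f'_def using schwartz_decay[OF \<phi> bbs] by blast
  have der: "(f has_derivative frechet_derivative f (at x)) (at x)" for x
    using \<phi> bs unfolding schwartz_def f_def by (simp add: frechet_derivative_works)
  have line: "((\<lambda>s. f (x + s *\<^sub>R b)) has_vector_derivative f' (x + s *\<^sub>R b)) (at s)" for x s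
  proof -
    have "((\<lambda>s. x + s *\<^sub>R b) has_derivative (\<lambda>t. t *\<^sub>R b)) (at s)"
      by (auto intro!: derivative_eq_intros)
    from has_derivative_compose[OF this der]
    have "((\<lambda>s. f (x + s *\<^sub>R b)) has_derivative (\<lambda>t. frechet_derivative f (at (x + s *\<^sub>R b)) (t *\<^sub>R b))) (at s)" .
    moreover have "frechet_derivative f (at (x + s *\<^sub>R b)) (t *\<^sub>R b) = t *\<^sub>R f' (x + s *\<^sub>R b)" for t
      using linear_scale[OF has_derivative_linear[OF der]] by (simp add: f'_def f_def)
    ultimately show ?thesis by (simp add: has_vector_derivative_def)
  qed
  let ?e = "\<lambda>x. exp (- \<i> * complex_of_real (x \<bullet> \<xi>))"
  let ?q = "\<lambda>n x. (f (x + delta_seq n *\<^sub>R b) - f x) / of_real (delta_seq n)"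
  \<comment> \<open>The mean value bound on a segment of length at most 1. There
    \<open>1 + norm (x + s *\<^sub>R b)\<close> is at least half of \<open>1 + norm x\<close>, at
    the price of the factor \<open>2 ^ ?N\<close>, and the majorant does not depend on n.\<close>
  have bound: "norm (?q n x) \<le> C * 2 ^ ?N * (1 / (1 + norm x) ^ ?N)" for n x
  proof -
    let ?h = "delta_seq n"
    have h: "0 < ?h" "?h \<le> 1" by auto
    have "norm (f (x + ?h *\<^sub>R b) - f (x + 0 *\<^sub>R b)) \<le> (C * 2 ^ ?N * (1 / (1 + norm x) ^ ?N)) * norm (?h - 0)"
    proof (rule differentiable_bound[of "{0..?h}"])
      fix s assume s: "s \<in> {0..?h}"
      show "((\<lambda>s. f (x + s *\<^sub>R b)) has_derivative (\<lambda>t. t *\<^sub>R f' (x + s *\<^sub>R b))) (at s within {0..?h})"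
        using line[of x s] unfolding has_vector_derivative_def by (rule has_derivative_at_withinI)
      have "norm (f' (x + s *\<^sub>R b)) \<le> C / (1 + norm (x + s *\<^sub>R b)) ^ ?N" by (rule C)
      also have "\<dots> \<le> C / ((1 + norm x) / 2) ^ ?N"
      proof (intro divide_left_mono power_mono)
        have "norm x \<le> norm (x + s *\<^sub>R b) + norm (s *\<^sub>R b)"
          using norm_triangle_ineq4[of "x + s *\<^sub>R b" "s *\<^sub>R b"] by simp
        moreover have "norm (s *\<^sub>R b) \<le> 1" using s order_trans[OF _ h(2), of s] nb by simp
        moreover have "(1 + a) / 2 \<le> 1 + c" if "a \<le> c + e" "e \<le> 1" "0 \<le> c" for a c e :: real
          using that by argo
        ultimately show "(1 + norm x) / 2 \<le> 1 + norm (x + s *\<^sub>R b)" using norm_ge_zero by blast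
        show "0 < (1 + norm (x + s *\<^sub>R b)) ^ ?N * ((1 + norm x) / 2) ^ ?N"
          by (intro mult_pos_pos zero_less_power) (auto intro: add_pos_nonneg)
      qed (use C in auto)
      also have "\<dots> = C * 2 ^ ?N * (1 / (1 + norm x) ^ ?N)" by (simp add: power_divide)
      finally have B: "norm (f' (x + s *\<^sub>R b)) \<le> C * 2 ^ ?N * (1 / (1 + norm x) ^ ?N)" .
      show "onorm (\<lambda>t. t *\<^sub>R f' (x + s *\<^sub>R b)) \<le> C * 2 ^ ?N * (1 / (1 + norm x) ^ ?N)"
      proof (rule onorm_le)
        fix t :: real
        have "norm t * norm (f' (x + s *\<^sub>R b)) \<le> norm t * (C * 2 ^ ?N * (1 / (1 + norm x) ^ ?N))"
          by (intro mult_left_mono B) auto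
        then show "norm (t *\<^sub>R f' (x + s *\<^sub>R b)) \<le> C * 2 ^ ?N * (1 / (1 + norm x) ^ ?N) * norm t"
          by (simp only: norm_scaleR real_norm_def mult.commute)
      qed
    qed (use h in auto)
    then have "norm (f (x + ?h *\<^sub>R b) - f x) \<le> (C * 2 ^ ?N * (1 / (1 + norm x) ^ ?N)) * ?h"
      by (simp only: scaleR_zero_left add_0_right diff_zero real_norm_def abs_of_pos[OF h(1)])
    then show ?thesis
      by (simp only: norm_divide norm_of_real abs_of_pos[OF h(1)] pos_divide_le_eq[OF h(1)])
  qed
  have lim: "(\<lambda>n. ?q n x) \<longlonglongrightarrow> f' x" for x
    using vector_derivative_sequence[OF line[of x 0]]
    by (simp add: scaleR_conv_of_real divide_inverse mult.commute)
  have l1: "(\<lambda>n. LINT x|lborel. ?q n x * ?e x) \<longlonglongrightarrow> (LINT x|lborel. f' x * ?e x)"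
  proof (rule integral_dominated_convergence[where w="\<lambda>x. C * 2 ^ ?N * (1 / (1 + norm x) ^ ?N)"])
    show "AE x in lborel. (\<lambda>n. ?q n x * ?e x) \<longlonglongrightarrow> f' x * ?e x"
      by (intro AE_I2 tendsto_mult tendsto_const lim)
    show "AE x in lborel. norm (?q n x * ?e x) \<le> C * 2 ^ ?N * (1 / (1 + norm x) ^ ?N)" for n
      unfolding norm_mult norm_fourier_kernel mult_1_right by (intro AE_I2 bound)
    show "integrable lborel (\<lambda>x::'a. C * 2 ^ ?N * (1 / (1 + norm x) ^ ?N))"
      by (intro integrable_mult_right integrable_polynomial_decay)
  qed measurable
  have l2: "(LINT x|lborel. ?q n x * ?e x) = (exp (\<i> * of_real (delta_seq n * (b \<bullet> \<xi>))) - 1) / of_real (delta_seq n) * fourier_integral f \<xi>" for n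
  proof -
    let ?h = "delta_seq n"
    have i1: "integrable lborel (\<lambda>x. f x * ?e x)" by (rule fourier_integrand_integrable[OF fi])
    have i2: "integrable lborel (\<lambda>x. f (x + ?h *\<^sub>R b) * ?e (x + ?h *\<^sub>R b))"
      using lborel_integrable_translate[of "\<lambda>x. f x * ?e x" "?h *\<^sub>R b"] i1 by (simp only: add.commute)
    have e: "?e x = ?e (x + ?h *\<^sub>R b) * exp (\<i> * of_real (?h * (b \<bullet> \<xi>)))" for x
      by (simp add: mult_exp_exp inner_add_left algebra_simps)
    have "(LINT x|lborel. ?q n x * ?e x) = (LINT x|lborel. (exp (\<i> * of_real (?h * (b \<bullet> \<xi>))) / of_real ?h) * (f (x + ?h *\<^sub>R b) * ?e (x + ?h *\<^sub>R b)) - (1 / of_real ?h) * (f x * ?e x))"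
    proof (intro Bochner_Integration.integral_cong refl)
      fix x
      have "?q n x * ?e x = f (x + ?h *\<^sub>R b) / of_real ?h * ?e x - f x / of_real ?h * ?e x"
        by (simp only: diff_divide_distrib left_diff_distrib)
      also have "f (x + ?h *\<^sub>R b) / of_real ?h * ?e x = f (x + ?h *\<^sub>R b) / of_real ?h * (?e (x + ?h *\<^sub>R b) * exp (\<i> * of_real (?h * (b \<bullet> \<xi>))))"
        by (simp only: e[symmetric])
      finally show "?q n x * ?e x = (exp (\<i> * of_real (?h * (b \<bullet> \<xi>))) / of_real ?h) * (f (x + ?h *\<^sub>R b) * ?e (x + ?h *\<^sub>R b)) - (1 / of_real ?h) * (f x * ?e x)"
        by (simp only: divide_inverse mult_1_left ac_simps)
    qed
    also have "\<dots> = (exp (\<i> * of_real (?h * (b \<bullet> \<xi>))) / of_real ?h) * (LINT x|lborel. f (x + ?h *\<^sub>R b) * ?e (x + ?h *\<^sub>R b)) - (1 / of_real ?h) * (LINT x|lborel. f x * ?e x)"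
      by (subst Bochner_Integration.integral_diff) (intro integrable_mult_right i1 i2 | simp only: integral_mult_right_zero)+
    also have "(LINT x|lborel. f (x + ?h *\<^sub>R b) * ?e (x + ?h *\<^sub>R b)) = fourier_integral f \<xi>"
      unfolding fourier_integral_def using lborel_integral_translate[of "\<lambda>x. f x * ?e x" "?h *\<^sub>R b"] by (simp only: add.commute)
    finally show ?thesis by (simp only: fourier_integral_def[symmetric] diff_divide_distrib left_diff_distrib)
  qed
  have l3: "(\<lambda>n. (exp (\<i> * of_real (delta_seq n * (b \<bullet> \<xi>))) - 1) / of_real (delta_seq n) * fourier_integral f \<xi>)
     \<longlonglongrightarrow> (\<i> * of_real (b \<bullet> \<xi>)) * fourier_integral f \<xi>"
  proof -
    have "((\<lambda>s. exp (s *\<^sub>R (\<i> * of_real (b \<bullet> \<xi>)))) has_vector_derivative (exp (0 *\<^sub>R (\<i> * of_real (b \<bullet> \<xi>))) * (\<i> * of_real (b \<bullet> \<xi>)))) (at (0::real))"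
      by (rule exp_scaleR_has_vector_derivative_right)
    from vector_derivative_sequence[OF this]
    have "(\<lambda>n. (exp (\<i> * of_real (delta_seq n * (b \<bullet> \<xi>))) - 1) / of_real (delta_seq n)) \<longlonglongrightarrow> \<i> * of_real (b \<bullet> \<xi>)"
      by (simp add: scaleR_conv_of_real divide_inverse mult.commute mult.left_commute)
    then show ?thesis by (intro tendsto_mult tendsto_const)
  qed
  from LIMSEQ_unique[OF l1 l3[folded l2]] show ?thesis
    unfolding fourier_integral_def[of "iter_deriv (b # bs) \<phi>"] f'_def f_def by (simp only: inner_commute[of b])
qed

lemma fourier_integral_iter_deriv_power:
  fixes \<phi> :: "'a::euclidean_space \<Rightarrow> complex"
  assumes \<phi>: "schwartz \<phi>" and b: "b \<in> Basis"
  shows "fourier_integral (iter_deriv (replicate N b) \<phi>) \<xi> = (\<i> * of_real (\<xi> \<bullet> b)) ^ N * fourier_integral \<phi> \<xi>"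
proof (induction N)
  case (Suc N)
  have "replicate N b \<in> lists Basis" using b by (induction N) auto
  from fourier_integral_iter_deriv[OF \<phi> this b, of \<xi>] Suc show ?case by simp
qed simp

text \<open>Differentiating N times in direction b multiplies the transform by the N-th power of
  \<open>\<xi> \<bullet> b\<close> in modulus, and the result is bounded by an L^1 norm. It suffices
  to use the direction of the largest coordinate.\<close>

lemma fourier_schwartz_decay:
  fixes \<phi> :: "'a::euclidean_space \<Rightarrow> complex"
  assumes \<phi>: "schwartz \<phi>"
  shows "\<exists>C>0. \<forall>\<xi>. norm (fourier_integral \<phi> \<xi>) \<le> C / (1 + norm \<xi>) ^ N"
proof -
  define K where "K b = (LINT x|lborel. norm (iter_deriv (replicate N b) \<phi> x))" for b :: 'a
  define L where "L = (LINT x|lborel. norm (\<phi> x))"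
  have K0: "K b \<ge> 0" for b unfolding K_def by simp
  have L0: "L \<ge> 0" unfolding L_def by simp
  let ?d = "real DIM('a) + 1"
  let ?C = "?d ^ N * (L + (\<Sum>b\<in>Basis. K b)) + 1"
  have "norm (fourier_integral \<phi> \<xi>) * (1 + norm \<xi>) ^ N \<le> ?C" for \<xi>
  proof -
    let ?F = "norm (fourier_integral \<phi> \<xi>)"
    have FL: "?F \<le> L" unfolding L_def by (rule norm_fourier_integral_le)
    have FK: "\<bar>\<xi> \<bullet> b\<bar> ^ N * ?F \<le> K b" if "b \<in> Basis" for b
      using norm_fourier_integral_le[of "iter_deriv (replicate N b) \<phi>" \<xi>]
      unfolding fourier_integral_iter_deriv_power[OF \<phi> that] K_def by (simp add: norm_mult norm_power)
    \<comment> \<open>Inserting 1 into the maximum covers small \<xi>, where the undifferentiated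
      bound is used, and gives 1 + |\<xi>| \<le> (d + 1) M.\<close>
    define M where "M = Max (insert 1 ((\<lambda>b. \<bar>\<xi> \<bullet> b\<bar>) ` Basis))"
    have M1: "1 \<le> M" unfolding M_def by (rule Max_ge) auto
    have Mb: "\<bar>\<xi> \<bullet> b\<bar> \<le> M" if "b \<in> Basis" for b
      unfolding M_def by (rule Max_ge) (use that in auto)
    have "norm \<xi> \<le> (\<Sum>b\<in>Basis. \<bar>\<xi> \<bullet> b\<bar>)" by (rule norm_le_l1)
    also have "\<dots> \<le> (\<Sum>b\<in>(Basis::'a set). M)" by (intro sum_mono Mb)
    finally have "1 + norm \<xi> \<le> ?d * M" using M1 by (simp add: algebra_simps)
    then have "(1 + norm \<xi>) ^ N \<le> ?d ^ N * M ^ N" unfolding power_mult_distrib[symmetric]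
      by (intro power_mono) auto
    then have "?F * (1 + norm \<xi>) ^ N \<le> ?d ^ N * (M ^ N * ?F)"
      using mult_left_mono[of "(1 + norm \<xi>) ^ N" "?d ^ N * M ^ N" ?F] by (simp only: ac_simps norm_ge_zero)
    also have "M ^ N * ?F \<le> L + (\<Sum>b\<in>Basis. K b)"
    proof -
      have "M \<in> insert 1 ((\<lambda>b. \<bar>\<xi> \<bullet> b\<bar>) ` Basis)" unfolding M_def by (rule Max_in) auto
      then consider "M = 1" | b where "b \<in> Basis" "M = \<bar>\<xi> \<bullet> b\<bar>" by auto
      then show ?thesis
      proof cases
        case 1 then show ?thesis using FL sum_nonneg[of Basis K] K0 by simp
      next
        case 2
        have "K b \<le> (\<Sum>b\<in>Basis. K b)" using 2 K0 by (intro member_le_sum) auto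
        then show ?thesis using FK[of b] 2 L0 by simp
      qed
    qed
    finally show ?thesis by (simp add: mult_left_mono)
  qed
  moreover have "?C > 0" using K0 L0 by (intro add_nonneg_pos mult_nonneg_nonneg add_nonneg_nonneg sum_nonneg) auto
  moreover have "1 + norm \<xi> > 0" for \<xi> :: 'a using norm_ge_zero[of \<xi>] by linarith
  ultimately show ?thesis by (intro exI[of _ ?C]) (simp add: pos_le_divide_eq)
qed

lemma schwartz_integrable0:
  fixes \<phi> :: "'a::euclidean_space \<Rightarrow> complex"
  assumes "schwartz \<phi>"
  shows "integrable lborel \<phi>" "\<phi> \<in> borel_measurable borel" "continuous_on UNIV \<phi>"
  using schwartz_integrable[OF assms, of "[]"] schwartz_measurable[OF assms, of "[]"] schwartz_continuous[OF assms, of "[]"] by simp_all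

lemma schwartz_decay0:
  assumes "schwartz \<phi>"
  obtains C where "C > 0" "\<And>x. norm (\<phi> x) \<le> C / (1 + norm x) ^ N"
  using schwartz_decay[OF assms, of "[]" N] by auto

lemma fourier_schwartz_integrable:
  fixes \<phi> :: "'a::euclidean_space \<Rightarrow> complex"
  assumes \<phi>: "schwartz \<phi>"
  shows "integrable lborel (fourier_integral \<phi>)"
proof -
  note [measurable] = schwartz_integrable0(2)[OF \<phi>]
  obtain C where C: "C > 0" "\<And>x. norm (fourier_integral \<phi> x) \<le> C / (1 + norm x) ^ (2 * DIM('a))"
    using fourier_schwartz_decay[OF \<phi>] by blast
  show ?thesis
  proof (rule Bochner_Integration.integrable_bound)
    show "integrable lborel (\<lambda>x::'a. C * (1 / (1 + norm x) ^ (2 * DIM('a))))"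
      by (intro integrable_mult_right integrable_polynomial_decay)
  qed (use C in \<open>auto intro: order_trans[OF _ abs_ge_self]\<close>)
qed

text \<open>The set where f and g differ is open and null, and a nonempty open set is not
  null.\<close>

lemma continuous_AE_eq:
  fixes f g :: "'a::euclidean_space \<Rightarrow> 'b::{real_normed_vector, second_countable_topology}"
  assumes "continuous_on UNIV f" "continuous_on UNIV g" "AE x in lborel. f x = g x"
  shows "f = g"
proof -
  have "open {x. f x - g x \<noteq> 0}"
    by (intro open_Collect_neq continuous_intros assms)
  moreover have "AE x in lborel. x \<notin> {x. f x - g x \<noteq> 0}" using assms(3) by eventually_elim simp
  then have "{x. f x - g x \<noteq> 0} \<in> null_sets lborel"
    by (subst AE_iff_null_sets) (use \<open>open _\<close> in auto)
  then have "negligible {x. f x - g x \<noteq> 0}"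
    using negligible_iff_null_sets null_sets_completionI by blast
  ultimately have "{x. f x - g x \<noteq> 0} = {}" using open_not_negligible by blast
  then show ?thesis by auto
qed

lemma inv_fourier_continuous:
  fixes f :: "'a::euclidean_space \<Rightarrow> complex"
  assumes "integrable lborel f"
  shows "continuous_on UNIV (inv_fourier f)"
proof -
  have "continuous_on UNIV (\<lambda>x. of_real ((2 * pi) powr (- real DIM('a))) * fourier_integral f (- x))"
    by (intro continuous_intros continuous_on_compose2[OF continuous_fourier_integral[OF assms]]) auto
  then show ?thesis unfolding inv_fourier_eq[symmetric] .
qed

theorem schwartz_inversion:
  fixes \<phi> :: "'a::euclidean_space \<Rightarrow> complex"
  assumes \<phi>: "schwartz \<phi>"
  shows "inv_fourier (fourier_integral \<phi>) = \<phi>"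
  by (rule continuous_AE_eq[symmetric])
    (intro schwartz_integrable0 \<phi> inv_fourier_continuous fourier_schwartz_integrable fourier_inversion_AE)+

section \<open>Tempered functions\<close>

lemma fourier_cgaussian_modulated:
  "cgaussian 0 v x = of_real (gaussian x) * exp (\<i> * of_real (x \<bullet> v))"
  unfolding cgaussian_def exp_add by (simp add: gaussian_def power2_norm_eq_inner flip: exp_of_real)

text \<open>Completing the square: translation by v centres the Gaussian, leaving the constant
  \<open>exp ((norm v)\<^sup>2 / 2)\<close> and a phase.\<close>

lemma fourier_integral_cgaussian_shift:
  fixes v \<xi> :: "'a::euclidean_space"
  shows "fourier_integral (cgaussian v 0) \<xi> =
    of_real (exp ((norm v)\<^sup>2 / 2) * (2 * pi) powr (DIM('a) / 2)) * (of_real (gaussian \<xi>) * exp (- \<i> * of_real (\<xi> \<bullet> v)))"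
proof -
  let ?g = "\<lambda>x. cgaussian v 0 x * exp (- \<i> * of_real (x \<bullet> \<xi>))"
  have eq: "?g (v + x) = of_real (exp ((norm v)\<^sup>2 / 2)) * exp (- \<i> * of_real (\<xi> \<bullet> v)) *
      exp (of_real (- (1 * (norm x)\<^sup>2 / 2)) + \<i> * of_real (x \<bullet> (- \<xi>)))" for x :: 'a
    by (simp add: cgaussian_def mult_exp_exp power2_norm_eq_inner flip: exp_of_real)
      (simp add: inner_add inner_commute algebra_simps add_divide_distrib diff_divide_distrib)
  have "fourier_integral (cgaussian v 0) \<xi> = (LINT x|lborel. ?g (v + x))"
    unfolding fourier_integral_def by (rule lborel_integral_translate[symmetric])
  also have "\<dots> = (LINT x|lborel. of_real (exp ((norm v)\<^sup>2 / 2)) * exp (- \<i> * of_real (\<xi> \<bullet> v)) *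
      exp (of_real (- (1 * (norm x)\<^sup>2 / 2)) + \<i> * of_real (x \<bullet> (- \<xi>))))"
    unfolding eq ..
  also have "(LINT x|lborel. of_real (exp ((norm v)\<^sup>2 / 2)) * exp (- \<i> * of_real (\<xi> \<bullet> v)) *
      exp (of_real (- (1 * (norm x)\<^sup>2 / 2)) + \<i> * of_real (x \<bullet> (- \<xi>)))) =
     of_real (exp ((norm v)\<^sup>2 / 2)) * exp (- \<i> * of_real (\<xi> \<bullet> v)) *
      of_real ((2 * pi / 1) powr (DIM('a) / 2) * exp (- (norm (- \<xi>))\<^sup>2 / (2 * 1)))"
    by (subst integral_mult_right_zero, subst gaussian_fourier(2)) simp_all
  finally show ?thesis by (simp add: gaussian_def)
qed

lemma tempered_measurable: "tempered f \<Longrightarrow> f \<in> borel_measurable borel"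
  by (simp add: tempered_def)

lemma temperedD: "tempered f \<Longrightarrow> schwartz \<phi> \<Longrightarrow> integrable lborel (\<lambda>x. f x * \<phi> x)"
  by (simp add: tempered_def)

text \<open>The difference of the two integrals is the Fourier integral at v of (F - G) times the
  Gaussian. This product is integrable even if F and G are not; it vanishes by injectivity, and the
  Gaussian has no zeros.\<close>

lemma AE_eq_if_gaussian_integrals:
  fixes F G :: "'a::euclidean_space \<Rightarrow> complex"
  assumes F: "integrable lborel (\<lambda>x. F x * of_real (gaussian x))" and G: "integrable lborel (\<lambda>x. G x * of_real (gaussian x))"
    and eq: "\<And>v. (LINT x|lborel. F x * (of_real (gaussian x) * exp (- \<i> * of_real (x \<bullet> v)))) =
      (LINT x|lborel. G x * (of_real (gaussian x) * exp (- \<i> * of_real (x \<bullet> v))))"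
  shows "AE x in lborel. F x = G x"
proof -
  have "AE x in lborel. F x * of_real (gaussian x) - G x * of_real (gaussian x) = 0"
  proof (rule fourier_integral_injective)
    show "integrable lborel (\<lambda>x. F x * of_real (gaussian x) - G x * of_real (gaussian x))"
      by (intro Bochner_Integration.integrable_diff F G)
    fix v
    have "fourier_integral (\<lambda>x. F x * of_real (gaussian x) - G x * of_real (gaussian x)) v =
       (LINT x|lborel. F x * of_real (gaussian x) * exp (- \<i> * of_real (x \<bullet> v)) - G x * of_real (gaussian x) * exp (- \<i> * of_real (x \<bullet> v)))"
      unfolding fourier_integral_def by (simp only: left_diff_distrib)
    also have "\<dots> = (LINT x|lborel. F x * of_real (gaussian x) * exp (- \<i> * of_real (x \<bullet> v))) - (LINT x|lborel. G x * of_real (gaussian x) * exp (- \<i> * of_real (x \<bullet> v)))"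
      by (intro Bochner_Integration.integral_diff fourier_integrand_integrable F G)
    also have "\<dots> = 0" using eq[of v] by (simp add: mult.assoc)
    finally show "fourier_integral (\<lambda>x. F x * of_real (gaussian x) - G x * of_real (gaussian x)) v = 0" .
  qed
  then show ?thesis by eventually_elim (auto simp: gaussian_pos less_imp_neq[OF gaussian_pos, symmetric])
qed

lemma cgaussian_0_0: "cgaussian 0 0 = (\<lambda>x. of_real (gaussian x))"
  using fourier_cgaussian_modulated[of 0] by auto

lemma tempered_gaussian_integrable:
  assumes "tempered F"
  shows "integrable lborel (\<lambda>x. F x * of_real (gaussian x))"
  using temperedD[OF assms schwartz_cgaussian[of 0 0]] by (simp add: cgaussian_0_0)

lemma tempered_eq_AE:
  fixes F G :: "'a::euclidean_space \<Rightarrow> complex"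
  assumes F: "tempered F" and G: "tempered G"
    and eq: "\<And>\<phi>. schwartz \<phi> \<Longrightarrow> distr_of F \<phi> = distr_of G \<phi>"
  shows "AE x in lborel. F x = G x"
proof (rule AE_eq_if_gaussian_integrals[OF F[THEN tempered_gaussian_integrable] G[THEN tempered_gaussian_integrable]])
  show "(LINT x|lborel. F x * (of_real (gaussian x) * exp (- \<i> * of_real (x \<bullet> v)))) =
      (LINT x|lborel. G x * (of_real (gaussian x) * exp (- \<i> * of_real (x \<bullet> v))))" for v
    using eq[OF schwartz_cgaussian[of 0 "- v"]]
    unfolding distr_of_def fourier_cgaussian_modulated by simp
qed

lemma has_fourier_unique:
  assumes "has_fourier T F" "has_fourier T G"
  shows "AE x in lborel. F x = G x"
  using assms unfolding has_fourier_def by (intro tempered_eq_AE) auto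

text \<open>The counterpart of \<open>tempered_eq_AE\<close> on the other side of the transform: it
  shows that the Fourier transform is injective on tempered functions. Translated Gaussians are the
  test functions because their transforms are the modulated ones.\<close>

lemma fourier_unique_preimage:
  fixes F G :: "'a::euclidean_space \<Rightarrow> complex"
  assumes F: "tempered F" and G: "tempered G"
    and eq: "\<And>\<phi>. schwartz \<phi> \<Longrightarrow> distr_of F (fourier_integral \<phi>) = distr_of G (fourier_integral \<phi>)"
  shows "AE x in lborel. F x = G x"
proof (rule AE_eq_if_gaussian_integrals[OF F[THEN tempered_gaussian_integrable] G[THEN tempered_gaussian_integrable]])
  fix v :: 'a
  let ?c = "complex_of_real (exp ((norm v)\<^sup>2 / 2) * (2 * pi) powr (DIM('a) / 2))"
  have "?c \<noteq> 0" by simp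
  have f: "fourier_integral (cgaussian v 0) = (\<lambda>x. ?c * (of_real (gaussian x) * exp (- \<i> * of_real (x \<bullet> v))))"
    by (rule ext) (rule fourier_integral_cgaussian_shift)
  have "?c * (LINT x|lborel. F x * (of_real (gaussian x) * exp (- \<i> * of_real (x \<bullet> v)))) =
     ?c * (LINT x|lborel. G x * (of_real (gaussian x) * exp (- \<i> * of_real (x \<bullet> v))))"
    using eq[OF schwartz_cgaussian[of v 0]] unfolding distr_of_def f
    by (simp only: mult.left_commute[of _ ?c] integral_mult_right_zero)
  then show "(LINT x|lborel. F x * (of_real (gaussian x) * exp (- \<i> * of_real (x \<bullet> v)))) =
      (LINT x|lborel. G x * (of_real (gaussian x) * exp (- \<i> * of_real (x \<bullet> v))))"
    using \<open>?c \<noteq> 0\<close> mult_left_cancel by blast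
qed

lemma has_fourier_fourier:
  assumes "\<exists>F. has_fourier (distr_of f) F"
  shows "has_fourier (distr_of f) (fourier f)"
  unfolding fourier_def using assms by (rule someI_ex)

lemma tempered_bounded:
  fixes f :: "'a::euclidean_space \<Rightarrow> complex"
  assumes [measurable]: "f \<in> borel_measurable borel" and "\<And>x. norm (f x) \<le> C"
  shows "tempered f"
  unfolding tempered_def
proof (intro conjI allI impI)
  fix \<phi> :: "'a \<Rightarrow> complex" assume "schwartz \<phi>"
  from integrable_mult_bounded[OF schwartz_integrable0(1)[OF this] assms]
  show "integrable lborel (\<lambda>x. f x * \<phi> x)" by (simp add: mult.commute)
qed simp

lemma has_fourier_integrable:
  fixes f :: "'a::euclidean_space \<Rightarrow> complex"
  assumes f: "integrable lborel f"
  shows "has_fourier (distr_of f) (fourier_integral f)"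
proof -
  note [measurable] = borel_measurable_integrable[OF f, simplified]
  show ?thesis
    unfolding has_fourier_def distr_of_def
    by (intro conjI allI impI tempered_bounded[OF fourier_integral_measurable norm_fourier_integral_le]
        fourier_multiplication_formula[symmetric] f schwartz_integrable0(1)) measurable
qed

lemma has_fourier_cong_AE:
  assumes "has_fourier T F" "AE x in lborel. F x = G x" and [measurable]: "G \<in> borel_measurable borel"
  shows "has_fourier T G"
proof -
  have F[measurable]: "F \<in> borel_measurable borel" using assms(1) by (simp add: has_fourier_def tempered_def)
  have [measurable]: "\<phi> \<in> borel_measurable borel" if "schwartz \<phi>" for \<phi> :: "'a \<Rightarrow> complex" using that by (rule schwartz_integrable0)
  have 1: "integrable lborel (\<lambda>x. G x * \<phi> x) \<longleftrightarrow> integrable lborel (\<lambda>x. F x * \<phi> x)" if [measurable]: "schwartz \<phi>" for \<phi>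
    using assms(2) by (intro integrable_cong_AE) (use that in \<open>auto\<close>)
  have "(LINT x|lborel. F x * \<phi> x) = (LINT x|lborel. G x * \<phi> x)" if [measurable]: "schwartz \<phi>" for \<phi>
    using assms(2) by (intro integral_cong_AE) (use that in \<open>auto\<close>)
  then show ?thesis using assms(1) 1 by (auto simp: has_fourier_def tempered_def distr_of_def)
qed

section \<open>Square-integrable functions\<close>

lemma square_integrable_mult:
  fixes f g :: "'a \<Rightarrow> complex"
  assumes [measurable]: "f \<in> borel_measurable M" "g \<in> borel_measurable M"
    and "(\<integral>\<^sup>+x. ennreal ((norm (f x))\<^sup>2) \<partial>M) < \<infinity>" "(\<integral>\<^sup>+x. ennreal ((norm (g x))\<^sup>2) \<partial>M) < \<infinity>"
  shows "integrable M (\<lambda>x. f x * g x)"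
proof -
  have i: "integrable M (\<lambda>x. (norm (f x))\<^sup>2)" "integrable M (\<lambda>x. (norm (g x))\<^sup>2)"
    using assms by (auto simp: integrable_iff_bounded)
  show ?thesis
  proof (rule Bochner_Integration.integrable_bound[OF Bochner_Integration.integrable_add[OF i]])
    show "AE x in M. norm (f x * g x) \<le> norm ((norm (f x))\<^sup>2 + (norm (g x))\<^sup>2)"
    proof (intro AE_I2)
      fix x
      have "2 * (norm (f x) * norm (g x)) \<le> (norm (f x))\<^sup>2 + (norm (g x))\<^sup>2"
        using sum_squares_bound[of "norm (f x)" "norm (g x)"] by (simp add: mult.assoc)
      moreover have "0 \<le> norm (f x) * norm (g x)" by simp
      ultimately show "norm (f x * g x) \<le> norm ((norm (f x))\<^sup>2 + (norm (g x))\<^sup>2)"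
        unfolding norm_mult real_norm_def by linarith
    qed
  qed measurable
qed

lemma bounded_integrable_square:
  fixes f :: "'a::euclidean_space \<Rightarrow> complex"
  assumes f: "integrable lborel f" and C: "\<And>x. norm (f x) \<le> C"
  shows "(\<integral>\<^sup>+x. ennreal ((norm (f x))\<^sup>2) \<partial>lborel) < \<infinity>"
proof -
  have "(\<integral>\<^sup>+x. ennreal ((norm (f x))\<^sup>2) \<partial>lborel) \<le> (\<integral>\<^sup>+x. ennreal (norm (C * norm (f x))) \<partial>lborel)"
  proof (intro nn_integral_mono ennreal_leI)
    fix x
    have "(norm (f x))\<^sup>2 \<le> C * norm (f x)" unfolding power2_eq_square by (intro mult_right_mono C) auto
    then show "(norm (f x))\<^sup>2 \<le> norm (C * norm (f x))" by simp
  qed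
  also have "integrable lborel (\<lambda>x. C * norm (f x))" using f by (intro integrable_mult_right integrable_norm)
  then have "(\<integral>\<^sup>+ x. ennreal (norm (C * norm (f x))) \<partial>lborel) < \<infinity>"
    unfolding integrable_iff_bounded by blast
  finally show ?thesis .
qed

lemma schwartz_square_integrable:
  fixes \<phi> :: "'a::euclidean_space \<Rightarrow> complex"
  assumes \<phi>: "schwartz \<phi>"
  shows "(\<integral>\<^sup>+x. ennreal ((norm (\<phi> x))\<^sup>2) \<partial>lborel) < \<infinity>"
    "(\<integral>\<^sup>+x. ennreal ((norm (fourier_integral \<phi> x))\<^sup>2) \<partial>lborel) < \<infinity>"
proof -
  obtain C where "\<And>x. norm (\<phi> x) \<le> C / (1 + norm x) ^ 0" using schwartz_decay0[OF \<phi>] by blast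
  then show "(\<integral>\<^sup>+x. ennreal ((norm (\<phi> x))\<^sup>2) \<partial>lborel) < \<infinity>"
    by (intro bounded_integrable_square[OF schwartz_integrable0(1)[OF \<phi>]]) simp
  show "(\<integral>\<^sup>+x. ennreal ((norm (fourier_integral \<phi> x))\<^sup>2) \<partial>lborel) < \<infinity>"
    by (rule bounded_integrable_square[OF fourier_schwartz_integrable[OF \<phi>] norm_fourier_integral_le])
qed

lemma tempered_square_integrable:
  fixes H :: "'a::euclidean_space \<Rightarrow> complex"
  assumes [measurable]: "H \<in> borel_measurable borel" and "(\<integral>\<^sup>+x. ennreal ((norm (H x))\<^sup>2) \<partial>lborel) < \<infinity>"
  shows "tempered H"
  unfolding tempered_def
proof (intro conjI allI impI)
  fix \<phi> :: "'a \<Rightarrow> complex" assume \<phi>: "schwartz \<phi>"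
  show "integrable lborel (\<lambda>x. H x * \<phi> x)"
    by (rule square_integrable_mult)
      (use \<phi> assms schwartz_square_integrable(1) schwartz_integrable0(2) in auto)
qed simp

section \<open>The L^2 norm\<close>

definition sq_int :: "('a::euclidean_space \<Rightarrow> complex) \<Rightarrow> bool" where
  "sq_int f \<longleftrightarrow> f \<in> borel_measurable borel \<and> integrable lborel (\<lambda>x. (norm (f x))\<^sup>2)"

text \<open>A real number rather than an \<open>ennreal\<close>, so that differences and limits of
  norms can be formed; it carries its meaning only together with \<open>sq_int\<close>.\<close>

definition l2norm :: "('a::euclidean_space \<Rightarrow> complex) \<Rightarrow> real" where
  "l2norm f = sqrt (LINT x|lborel. (norm (f x))\<^sup>2)"

lemma sq_int_iff:
  "sq_int f \<longleftrightarrow> f \<in> borel_measurable borel \<and> (\<integral>\<^sup>+x. ennreal ((norm (f x))\<^sup>2) \<partial>lborel) < \<infinity>"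
  by (auto simp: sq_int_def integrable_iff_bounded)

lemma sq_int_measurable: "sq_int f \<Longrightarrow> f \<in> borel_measurable borel"
  by (simp add: sq_int_def)

lemma l2norm_nonneg: "l2norm f \<ge> 0"
  by (simp add: l2norm_def)

lemma l2norm_power2: "(l2norm f)\<^sup>2 = (LINT x|lborel. (norm (f x))\<^sup>2)"
  by (simp add: l2norm_def)

lemma nn_integral_sq_int:
  assumes "sq_int f"
  shows "(\<integral>\<^sup>+x. ennreal ((norm (f x))\<^sup>2) \<partial>lborel) = ennreal ((l2norm f)\<^sup>2)"
  unfolding l2norm_power2 using assms by (intro nn_integral_eq_integral) (auto simp: sq_int_def)

lemma l2norm_leI:
  assumes "f \<in> borel_measurable borel" "(\<integral>\<^sup>+x. ennreal ((norm (f x))\<^sup>2) \<partial>lborel) \<le> ennreal (c\<^sup>2)" "c \<ge> 0"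
  shows "sq_int f" "l2norm f \<le> c"
proof -
  show f: "sq_int f" using assms by (auto simp: sq_int_iff intro: le_less_trans)
  have "(l2norm f)\<^sup>2 \<le> c\<^sup>2" using assms(2) unfolding nn_integral_sq_int[OF f] by simp
  then show "l2norm f \<le> c" using assms(3) by (rule power2_le_imp_le)
qed

lemma sq_int_Cauchy_Schwarz:
  fixes f g :: "'a::euclidean_space \<Rightarrow> complex"
  assumes f: "sq_int f" and g: "sq_int g"
  shows "integrable lborel (\<lambda>x. f x * g x)" "(LINT x|lborel. norm (f x) * norm (g x)) \<le> l2norm f * l2norm g"
proof -
  note [measurable] = sq_int_measurable[OF f] sq_int_measurable[OF g]
  show i: "integrable lborel (\<lambda>x. f x * g x)"
    using f g by (intro square_integrable_mult) (auto simp: sq_int_iff)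
  have i': "integrable lborel (\<lambda>x. norm (f x) * norm (g x))"
    using integrable_norm[OF i] by (simp add: norm_mult)
  have "ennreal ((LINT x|lborel. norm (f x) * norm (g x))\<^sup>2) = (\<integral>\<^sup>+x. ennreal (norm (f x)) * ennreal (norm (g x)) \<partial>lborel)\<^sup>2"
    by (simp add: ennreal_mult[symmetric] nn_integral_eq_integral[OF i'] ennreal_power)
  also have "\<dots> \<le> (\<integral>\<^sup>+x. ennreal (norm (f x)) ^ 2 \<partial>lborel) * (\<integral>\<^sup>+x. ennreal (norm (g x)) ^ 2 \<partial>lborel)"
    by (rule Cauchy_Schwarz_nn_integral) measurable
  also have "\<dots> = ennreal ((l2norm f * l2norm g)\<^sup>2)"
    by (simp add: ennreal_power nn_integral_sq_int f g power_mult_distrib ennreal_mult[symmetric])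
  finally have "(LINT x|lborel. norm (f x) * norm (g x))\<^sup>2 \<le> (l2norm f * l2norm g)\<^sup>2"
    by (simp add: l2norm_nonneg)
  then show "(LINT x|lborel. norm (f x) * norm (g x)) \<le> l2norm f * l2norm g"
    by (rule power2_le_imp_le) (simp add: l2norm_nonneg)
qed

text \<open>Expanding the square bounds the sum pointwise, and Cauchy-Schwarz bounds the mixed
  term.\<close>

lemma sq_int_add:
  fixes f g :: "'a::euclidean_space \<Rightarrow> complex"
  assumes f: "sq_int f" and g: "sq_int g"
  shows "sq_int (\<lambda>x. f x + g x)" "l2norm (\<lambda>x. f x + g x) \<le> l2norm f + l2norm g"
proof -
  note [measurable] = sq_int_measurable[OF f] sq_int_measurable[OF g]
  have i: "integrable lborel (\<lambda>x. norm (f x) * norm (g x))"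
    using integrable_norm[OF sq_int_Cauchy_Schwarz(1)[OF f g]] by (simp add: norm_mult)
  have f2: "integrable lborel (\<lambda>x. (norm (f x))\<^sup>2)" and g2: "integrable lborel (\<lambda>x. (norm (g x))\<^sup>2)"
    using f g by (auto simp: sq_int_def)
  let ?s = "\<lambda>x. (norm (f x))\<^sup>2 + 2 * (norm (f x) * norm (g x)) + (norm (g x))\<^sup>2"
  have le: "(norm (f x + g x))\<^sup>2 \<le> ?s x" for x
  proof -
    have "(norm (f x + g x))\<^sup>2 \<le> (norm (f x) + norm (g x))\<^sup>2"
      by (intro power_mono norm_triangle_ineq) auto
    then show ?thesis by (simp add: power2_sum)
  qed
  have isum: "integrable lborel ?s"
    by (intro Bochner_Integration.integrable_add integrable_mult_right f2 g2 i)
  show sq: "sq_int (\<lambda>x. f x + g x)"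
    unfolding sq_int_def
  proof
    show "integrable lborel (\<lambda>x. (norm (f x + g x))\<^sup>2)"
      by (rule Bochner_Integration.integrable_bound[OF isum]) (use le in \<open>auto intro: order_trans[OF _ abs_ge_self]\<close>)
  qed measurable
  have "(l2norm (\<lambda>x. f x + g x))\<^sup>2 \<le> (LINT x|lborel. ?s x)"
    unfolding l2norm_power2 by (intro integral_mono isum le) (use sq in \<open>simp add: sq_int_def\<close>)
  also have "\<dots> = (l2norm f)\<^sup>2 + 2 * (LINT x|lborel. norm (f x) * norm (g x)) + (l2norm g)\<^sup>2"
    by (simp add: l2norm_power2 f2 g2 i)
  also have "\<dots> \<le> (l2norm f + l2norm g)\<^sup>2"
    using sq_int_Cauchy_Schwarz(2)[OF f g] by (simp add: power2_sum)
  finally show "l2norm (\<lambda>x. f x + g x) \<le> l2norm f + l2norm g"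
    by (rule power2_le_imp_le) (simp add: l2norm_nonneg)
qed

lemma sq_int_uminus:
  assumes "sq_int f" shows "sq_int (\<lambda>x. - f x)" "l2norm (\<lambda>x. - f x) = l2norm f"
  using assms by (auto simp: sq_int_def l2norm_def)

lemma sq_int_diff:
  fixes f g :: "'a::euclidean_space \<Rightarrow> complex"
  assumes f: "sq_int f" and g: "sq_int g"
  shows "sq_int (\<lambda>x. f x - g x)" "l2norm (\<lambda>x. f x - g x) \<le> l2norm f + l2norm g"
  using sq_int_add[OF f sq_int_uminus(1)[OF g]] sq_int_uminus(2)[OF g] by auto

lemma l2norm_diff_commute: "l2norm (\<lambda>x. f x - g x) = l2norm (\<lambda>x. g x - f x)"
  by (simp add: l2norm_def norm_minus_commute)

lemma l2norm_diff_triangle: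
  fixes f g h :: "'a::euclidean_space \<Rightarrow> complex"
  assumes "sq_int f" "sq_int g" "sq_int h"
  shows "l2norm (\<lambda>x. f x - h x) \<le> l2norm (\<lambda>x. f x - g x) + l2norm (\<lambda>x. g x - h x)"
  using sq_int_add(2)[OF sq_int_diff(1)[OF assms(1,2)] sq_int_diff(1)[OF assms(2,3)]] by simp

lemma l2norm_abs_diff_le:
  fixes f g :: "'a::euclidean_space \<Rightarrow> complex"
  assumes f: "sq_int f" and g: "sq_int g"
  shows "\<bar>l2norm f - l2norm g\<bar> \<le> l2norm (\<lambda>x. f x - g x)"
  using sq_int_add(2)[OF sq_int_diff(1)[OF f g] g] sq_int_add(2)[OF sq_int_diff(1)[OF g f] f]
    l2norm_diff_commute[of f g] by simp

lemma l2_tendsto_norm: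
  fixes f :: "nat \<Rightarrow> 'a::euclidean_space \<Rightarrow> complex"
  assumes "\<And>k. sq_int (f k)" "sq_int g" "(\<lambda>k. l2norm (\<lambda>x. f k x - g x)) \<longlonglongrightarrow> 0"
  shows "(\<lambda>k. l2norm (f k)) \<longlonglongrightarrow> l2norm g"
proof (subst LIM_zero_iff[symmetric], rule tendsto_rabs_zero_cancel, rule tendsto_sandwich[OF _ _ tendsto_const assms(3)])
  show "\<forall>\<^sub>F n in sequentially. \<bar>l2norm (f n) - l2norm g\<bar> \<le> l2norm (\<lambda>x. f n x - g x)"
    using l2norm_abs_diff_le[OF assms(1,2)] by auto
qed auto

lemma l2_tendsto_pairing:
  fixes f :: "nat \<Rightarrow> 'a::euclidean_space \<Rightarrow> complex"
  assumes f: "\<And>k. sq_int (f k)" and g: "sq_int g" and h: "sq_int h" and l: "(\<lambda>k. l2norm (\<lambda>x. f k x - g x)) \<longlonglongrightarrow> 0"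
  shows "(\<lambda>k. LINT x|lborel. f k x * h x) \<longlonglongrightarrow> (LINT x|lborel. g x * h x)"
proof (subst LIM_zero_iff[symmetric], rule tendsto_norm_zero_cancel, rule tendsto_sandwich[OF _ _ tendsto_const])
  show "(\<lambda>k. l2norm (\<lambda>x. f k x - g x) * l2norm h) \<longlonglongrightarrow> 0" using tendsto_mult_left_zero[OF l] .
  show "\<forall>\<^sub>F n in sequentially. norm ((LINT x|lborel. f n x * h x) - (LINT x|lborel. g x * h x)) \<le> l2norm (\<lambda>x. f n x - g x) * l2norm h"
  proof (intro always_eventually allI)
    fix n
    have "(LINT x|lborel. f n x * h x) - (LINT x|lborel. g x * h x) = (LINT x|lborel. (f n x - g x) * h x)"
      unfolding left_diff_distrib by (rule Bochner_Integration.integral_diff[symmetric]) (intro sq_int_Cauchy_Schwarz f g h)+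
    also have "norm \<dots> \<le> (LINT x|lborel. norm ((f n x - g x) * h x))" by (rule integral_norm_bound)
    also have "\<dots> \<le> l2norm (\<lambda>x. f n x - g x) * l2norm h"
      unfolding norm_mult by (rule sq_int_Cauchy_Schwarz[OF sq_int_diff(1)[OF f g] h])
    finally show "norm ((LINT x|lborel. f n x * h x) - (LINT x|lborel. g x * h x)) \<le> l2norm (\<lambda>x. f n x - g x) * l2norm h" .
  qed
qed auto

section \<open>Completeness, and density of bounded continuous functions\<close>

text \<open>The squared increments have integrals of order 16^(-k), so they remain summable after
  multiplication by 4^k. Hence almost everywhere the increments are bounded by a multiple of 2^(-k)
  and the sequence converges. Fatou's lemma turns the Cauchy bound into the rate of
  convergence.\<close>

lemma l2_complete:
  fixes G :: "nat \<Rightarrow> 'a::euclidean_space \<Rightarrow> complex"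
  assumes G: "\<And>k. sq_int (G k)" and C: "C \<ge> 0" and cauchy: "\<And>k l. k \<le> l \<Longrightarrow> l2norm (\<lambda>x. G l x - G k x) \<le> C * (1/4) ^ k"
  shows "\<exists>g. sq_int g \<and> (\<forall>k. l2norm (\<lambda>x. G k x - g x) \<le> C * (1/4) ^ k)"
proof -
  have [measurable]: "G k \<in> borel_measurable borel" for k by (rule sq_int_measurable[OF G])
  define d where "d k x = G (Suc k) x - G k x" for k x
  have d: "sq_int (d k)" for k unfolding d_def by (rule sq_int_diff(1)[OF G G])
  have [measurable]: "d k \<in> borel_measurable borel" for k by (rule sq_int_measurable[OF d])
  have "(\<integral>\<^sup>+x. (\<Sum>k. ennreal (4 ^ k * (norm (d k x))\<^sup>2)) \<partial>lborel) = (\<Sum>k. \<integral>\<^sup>+x. ennreal (4 ^ k * (norm (d k x))\<^sup>2) \<partial>lborel)"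
    by (rule nn_integral_suminf) measurable
  also have "\<dots> \<le> (\<Sum>k. ennreal (C\<^sup>2 * (1/4) ^ k))"
  proof (intro suminf_le summableI)
    fix k
    have "(\<integral>\<^sup>+x. ennreal (4 ^ k * (norm (d k x))\<^sup>2) \<partial>lborel) = ennreal (4 ^ k * (l2norm (d k))\<^sup>2)"
      by (simp add: ennreal_mult nn_integral_cmult nn_integral_sq_int[OF d])
    also have "\<dots> \<le> ennreal (4 ^ k * (C * (1/4) ^ k)\<^sup>2)"
      using cauchy[of k "Suc k"] by (intro ennreal_leI mult_left_mono power_mono l2norm_nonneg) (auto simp: d_def[abs_def])
    also have "4 ^ k * (C * (1/4) ^ k)\<^sup>2 = C\<^sup>2 * (1/4) ^ k"
      by (simp add: power2_eq_square power_divide)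
    finally show "(\<integral>\<^sup>+x. ennreal (4 ^ k * (norm (d k x))\<^sup>2) \<partial>lborel) \<le> ennreal (C\<^sup>2 * (1/4) ^ k)" .
  qed
  also have "\<dots> = ennreal (\<Sum>k. C\<^sup>2 * (1/4) ^ k)"
    by (intro suminf_ennreal2 summable_mult summable_geometric) auto
  finally have "(\<integral>\<^sup>+x. (\<Sum>k. ennreal (4 ^ k * (norm (d k x))\<^sup>2)) \<partial>lborel) \<noteq> \<infinity>"
    by (metis ennreal_less_top infinity_ennreal_def leD order.refl top.extremum_unique neq_top_trans)
  then have "AE x in lborel. (\<Sum>k. ennreal (4 ^ k * (norm (d k x))\<^sup>2)) \<noteq> \<infinity>"
    by (intro nn_integral_PInf_AE) measurable
  then have conv: "AE x in lborel. convergent (\<lambda>k. G k x)"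
  proof eventually_elim
    case (elim x)
    then obtain B where B: "(\<Sum>k. ennreal (4 ^ k * (norm (d k x))\<^sup>2)) = ennreal B" "B \<ge> 0"
    proof (cases "\<Sum>k. ennreal (4 ^ k * (norm (d k x))\<^sup>2)" rule: ennreal_cases)
      case (real r)
      then show ?thesis using that by blast
    next
      case top
      then show ?thesis using elim unfolding infinity_ennreal_def by blast
    qed
    have dle: "norm (d k x) \<le> sqrt B * (1/2) ^ k" for k
    proof -
      have "ennreal (4 ^ k * (norm (d k x))\<^sup>2) \<le> ennreal B"
      proof -
        have "F k \<le> suminf F" for F :: "nat \<Rightarrow> ennreal"
          using sum_le_suminf[of F "{k}"] by (simp add: summableI)
        from this[of "\<lambda>k. ennreal (4 ^ k * (norm (d k x))\<^sup>2)"] show ?thesis unfolding B(1) .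
      qed
      then have "4 ^ k * (norm (d k x))\<^sup>2 \<le> B" using B(2) by simp
      then have "(norm (d k x))\<^sup>2 \<le> B * (1/4) ^ k" by (simp add: power_divide field_simps)
      also have "(1/4) ^ k = ((1/2::real) ^ k)\<^sup>2"
      proof -
        have "((1/2::real) ^ k)\<^sup>2 = ((1/2)\<^sup>2) ^ k" by (simp only: power_mult[symmetric] mult.commute)
        then show ?thesis by (simp add: power2_eq_square)
      qed
      also have "B * ((1/2::real) ^ k)\<^sup>2 = (sqrt B * (1/2) ^ k)\<^sup>2" using B(2)
        by (simp add: power_mult_distrib)
      finally show ?thesis by (rule power2_le_imp_le) (intro mult_nonneg_nonneg real_sqrt_ge_zero B(2) zero_le_power, simp)
    qed
    have "summable (\<lambda>k. sqrt B * (1/2) ^ k)" by (intro summable_mult summable_geometric) auto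
    then have "summable (\<lambda>k. d k x)"
      by (rule summable_comparison_test'[where N=0]) (rule dle)
    then have "convergent (\<lambda>n. \<Sum>k<n. d k x)" by (simp only: summable_iff_convergent)
    then have "convergent (\<lambda>n. G n x - G 0 x)" unfolding d_def using sum_lessThan_telescope[of "\<lambda>k. G k x"] by simp
    then have "convergent (\<lambda>n. (G n x - G 0 x) + G 0 x)" by (intro convergent_add convergent_const)
    then show ?case by simp
  qed
  define g where "g x = lim (\<lambda>k. G k x)" for x
  have [measurable]: "g \<in> borel_measurable borel" unfolding g_def by measurable
  have lim: "AE x in lborel. (\<lambda>k. G k x) \<longlonglongrightarrow> g x"
    using conv by eventually_elim (simp add: g_def convergent_LIMSEQ_iff)
  have le: "(\<integral>\<^sup>+x. ennreal ((norm (g x - G k x))\<^sup>2) \<partial>lborel) \<le> ennreal ((C * (1/4) ^ k)\<^sup>2)" for k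
  proof -
    have "(\<integral>\<^sup>+x. ennreal ((norm (g x - G k x))\<^sup>2) \<partial>lborel) = (\<integral>\<^sup>+x. liminf (\<lambda>l. ennreal ((norm (G l x - G k x))\<^sup>2)) \<partial>lborel)"
      using lim by (intro nn_integral_cong_AE, eventually_elim)
        (intro lim_imp_Liminf[symmetric] tendsto_ennrealI tendsto_intros, auto)
    also have "\<dots> \<le> liminf (\<lambda>l. \<integral>\<^sup>+x. ennreal ((norm (G l x - G k x))\<^sup>2) \<partial>lborel)"
      by (rule nn_integral_liminf) measurable
    also have "\<dots> \<le> liminf (\<lambda>l::nat. ennreal ((C * (1/4) ^ k)\<^sup>2))"
    proof (rule Liminf_mono)
      show "\<forall>\<^sub>F l in sequentially. (\<integral>\<^sup>+x. ennreal ((norm (G l x - G k x))\<^sup>2) \<partial>lborel) \<le> ennreal ((C * (1/4) ^ k)\<^sup>2)"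
        using eventually_ge_at_top[of k]
        by eventually_elim (auto simp: nn_integral_sq_int[OF sq_int_diff(1)[OF G G]] intro!: ennreal_leI power_mono cauchy l2norm_nonneg)
    qed
    finally show ?thesis by (simp add: Liminf_const)
  qed
  have dk: "sq_int (\<lambda>x. g x - G k x)" "l2norm (\<lambda>x. g x - G k x) \<le> C * (1/4) ^ k" for k
    using l2norm_leI[OF _ le[of k]] C by auto
  have "sq_int g" using sq_int_add(1)[OF dk(1)[of 0] G[of 0]] by simp
  then show ?thesis using dk(2) by (auto simp: l2norm_diff_commute[of _ g])
qed

lemma l2_tendsto_dominated:
  fixes f :: "nat \<Rightarrow> 'a::euclidean_space \<Rightarrow> complex"
  assumes [measurable]: "\<And>k. f k \<in> borel_measurable borel" "g \<in> borel_measurable borel"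
    and w: "integrable lborel w" and bd: "\<And>k. AE x in lborel. (norm (f k x - g x))\<^sup>2 \<le> w x"
    and lim: "AE x in lborel. (\<lambda>k. f k x) \<longlonglongrightarrow> g x"
  shows "(\<lambda>k. l2norm (\<lambda>x. f k x - g x)) \<longlonglongrightarrow> 0"
proof -
  have "(\<lambda>k. LINT x|lborel. (norm (f k x - g x))\<^sup>2) \<longlonglongrightarrow> (LINT x|(lborel :: 'a measure). (0::real))"
  proof (rule integral_dominated_convergence[where w=w and f="\<lambda>_. 0::real" and s="\<lambda>k x. (norm (f k x - g x))\<^sup>2"])
    show "AE x in lborel. (\<lambda>k. (norm (f k x - g x))\<^sup>2) \<longlonglongrightarrow> 0"
      using lim by eventually_elim (auto intro!: tendsto_eq_intros simp: LIM_zero_iff tendsto_norm_zero_iff)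
  qed (use w bd in auto)
  then have "(\<lambda>k. sqrt (LINT x|lborel. (norm (f k x - g x))\<^sup>2)) \<longlonglongrightarrow> sqrt 0"
    by (intro tendsto_real_sqrt) simp
  then show ?thesis by (simp add: l2norm_def)
qed

text \<open>A measurable function is an almost everywhere limit of continuous ones. Clipping their
  values and cutting off their supports gives a common integrable majorant, so that the convergence
  also holds in L^2.\<close>

lemma l2_approx_bounded_support:
  fixes f :: "'a::euclidean_space \<Rightarrow> complex"
  assumes [measurable]: "f \<in> borel_measurable borel" and K: "\<And>x. norm (f x) \<le> K" "K > 0" and R: "\<And>x. norm x > R \<Longrightarrow> f x = 0"
    and e: "e > 0"
  shows "\<exists>g. continuous_on UNIV g \<and> integrable lborel g \<and> (\<forall>x. norm (g x) \<le> K) \<and> sq_int g \<and> l2norm (\<lambda>x. g x - f x) < e"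
proof -
  have "f measurable_on UNIV"
    by (rule lebesgue_measurable_imp_measurable_on) (auto intro: measurable_completion)
  then obtain N g where N: "negligible N" and gc: "\<And>n::nat. continuous_on UNIV (g n)"
    and gl: "\<And>x. x \<notin> N \<Longrightarrow> (\<lambda>n. g n x) \<longlonglongrightarrow> f x"
    unfolding measurable_on_def by auto
  \<comment> \<open>The radial retraction of the plane onto the disc of radius K: it is continuous
    and fixes the values of f.\<close>
  define cl where "cl z = z * of_real (K / max K (norm z))" for z :: complex
  have cl_le: "norm (cl z) \<le> K" for z
    using K(2) by (simp add: cl_def norm_mult norm_divide divide_simps max_def mult_left_mono)
  have cl_id: "cl z = z" if "norm z \<le> K" for z
    using that K(2) by (simp add: cl_def max_def)
  have cl_cont: "continuous_on UNIV cl"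
    unfolding cl_def using K(2) by (intro continuous_intros) (auto simp: max_def)
  \<comment> \<open>A continuous cutoff, equal to 1 on the ball of radius R outside which f
    vanishes, and to 0 beyond radius R + 1.\<close>
  define ch where "ch x = max 0 (min 1 (R + 1 - norm x))" for x :: 'a
  have ch: "0 \<le> ch x" "ch x \<le> 1" "norm x \<le> R \<Longrightarrow> ch x = 1" "norm x > R + 1 \<Longrightarrow> ch x = 0" for x
    by (auto simp: ch_def)
  define h where "h n x = of_real (ch x) * cl (g n x)" for n x
  have hc: "continuous_on UNIV (h n)" for n
    unfolding h_def ch_def
    by (intro continuous_intros continuous_on_compose2[OF cl_cont gc]) auto
  have [measurable]: "h n \<in> borel_measurable borel" for n by (rule borel_measurable_continuous_onI[OF hc])
  have hK: "norm (h n x) \<le> K * indicator (cball 0 (R + 1)) x" for n x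
    using ch[of x] cl_le[of "g n x"] mult_mono[of "ch x" 1 "norm (cl (g n x))" K]
    by (cases "norm x > R + 1") (auto simp: h_def norm_mult indicator_def)
  have hi: "integrable lborel (h n)" for n
  proof (rule Bochner_Integration.integrable_bound)
    show "integrable lborel (\<lambda>x::'a. K * indicator (cball 0 (R + 1)) x :: real)"
      by (intro integrable_mult_right) (auto intro!: integrable_real_indicator simp: emeasure_bounded_finite[OF bounded_cball, simplified])
    show "AE x in lborel. norm (h n x) \<le> norm (K * indicator (cball 0 (R + 1)) x :: real)"
      using hK K(2) by (auto simp: abs_mult)
  qed measurable
  have hK': "norm (h n x) \<le> K" for n x
    using hK[of n x] K(2) by (cases "norm x \<le> R + 1") auto
  have fK: "norm (f x) \<le> K * indicator (cball 0 (R + 1)) x" for x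
    using K R[of x] by (auto simp: indicator_def)
  have "(\<lambda>k. l2norm (\<lambda>x. h k x - f x)) \<longlonglongrightarrow> 0"
  proof (rule l2_tendsto_dominated)
    show "integrable lborel (\<lambda>x::'a. (2 * K)\<^sup>2 * indicator (cball 0 (R + 1)) x :: real)"
      by (intro integrable_mult_right) (auto intro!: integrable_real_indicator simp: emeasure_bounded_finite[OF bounded_cball, simplified])
    show "AE x in lborel. (norm (h k x - f x))\<^sup>2 \<le> (2 * K)\<^sup>2 * indicator (cball 0 (R + 1)) x" for k
    proof (intro AE_I2)
      fix x
      have "norm (h k x - f x) \<le> 2 * K * indicator (cball 0 (R + 1)) x"
        using norm_triangle_ineq4[of "h k x" "f x"] hK[of k x] fK[of x] by linarith
      then have "(norm (h k x - f x))\<^sup>2 \<le> (2 * K * indicator (cball 0 (R + 1)) x)\<^sup>2"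
        by (intro power_mono) auto
      then show "(norm (h k x - f x))\<^sup>2 \<le> (2 * K)\<^sup>2 * indicator (cball 0 (R + 1)) x"
        by (cases "norm x \<le> R + 1") (auto simp: power_mult_distrib)
    qed
    have "AE x in lebesgue. x \<notin> N" using N AE_not_in negligible_iff_null_sets by blast
    then have "AE x in lborel. x \<notin> N" by (simp only: AE_completion_iff)
    then show "AE x in lborel. (\<lambda>k. h k x) \<longlonglongrightarrow> f x"
    proof eventually_elim
      case (elim x)
      have "(\<lambda>k. cl (g k x)) \<longlonglongrightarrow> cl (f x)"
        using gl[OF elim] cl_cont by (intro continuous_on_tendsto_compose[OF cl_cont]) auto
      then have "(\<lambda>k. h k x) \<longlonglongrightarrow> of_real (ch x) * f x"
        unfolding h_def using cl_id[OF K(1)[of x]] by (intro tendsto_intros) simp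
      moreover have "of_real (ch x) * f x = f x" using ch(3)[of x] R[of x] by (cases "norm x \<le> R") auto
      ultimately show ?case by simp
    qed
  qed measurable
  then have "\<forall>\<^sub>F k in sequentially. l2norm (\<lambda>x. h k x - f x) < e"
    using e by (intro order_tendstoD) auto
  then obtain k where k: "l2norm (\<lambda>x. h k x - f x) < e" by (auto simp: eventually_sequentially)
  have "sq_int (h k)" unfolding sq_int_iff using bounded_integrable_square[OF hi hK'] by auto
  then show ?thesis using k hc hi hK' by blast
qed

lemma l2_dense:
  fixes f :: "'a::euclidean_space \<Rightarrow> complex"
  assumes f: "sq_int f" and e: "e > 0"
  shows "\<exists>g C. continuous_on UNIV g \<and> integrable lborel g \<and> (\<forall>x. norm (g x) \<le> C) \<and> sq_int g \<and> l2norm (\<lambda>x. g x - f x) < e"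
proof -
  note [measurable] = sq_int_measurable[OF f]
  define h where "h k x = (if norm x \<le> real k \<and> norm (f x) \<le> real k then f x else 0)" for k x
  have [measurable]: "h k \<in> borel_measurable borel" for k unfolding h_def by measurable
  have "(\<lambda>k. l2norm (\<lambda>x. h k x - f x)) \<longlonglongrightarrow> 0"
  proof (rule l2_tendsto_dominated)
    show "integrable lborel (\<lambda>x. (norm (f x))\<^sup>2)" using f by (simp add: sq_int_def)
    show "AE x in lborel. (\<lambda>k. h k x) \<longlonglongrightarrow> f x"
    proof (intro AE_I2 tendsto_eventually)
      fix x
      obtain n where "max (norm x) (norm (f x)) \<le> real n" using real_arch_simple by blast
      then show "\<forall>\<^sub>F k in sequentially. h k x = f x"
        unfolding eventually_sequentially h_def by (intro exI[of _ n]) auto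
    qed
  qed (auto simp: h_def)
  then have "\<forall>\<^sub>F k in sequentially. l2norm (\<lambda>x. h k x - f x) < e / 2"
    using e by (intro order_tendstoD) auto
  then obtain k where k: "l2norm (\<lambda>x. h k x - f x) < e / 2" by (auto simp: eventually_sequentially)
  have sh: "sq_int (h k)" unfolding sq_int_def
    by (auto intro!: Bochner_Integration.integrable_bound[of _ "\<lambda>x. (norm (f x))\<^sup>2"] f[unfolded sq_int_def, THEN conjunct2] simp: h_def)
  \<comment> \<open>The bound is \<open>real k + 1\<close> because the lemma asks for a positive
    bound and k may be 0.\<close>
  have "\<exists>g. continuous_on UNIV g \<and> integrable lborel g \<and> (\<forall>x. norm (g x) \<le> real k + 1) \<and> sq_int g \<and> l2norm (\<lambda>x. g x - h k x) < e / 2"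
    by (rule l2_approx_bounded_support[where R="real k"]) (use e in \<open>auto simp: h_def intro: add_nonneg_nonneg\<close>)
  then obtain g where g: "continuous_on UNIV g" "integrable lborel g" "\<forall>x. norm (g x) \<le> real k + 1" "sq_int g" "l2norm (\<lambda>x. g x - h k x) < e / 2"
    by blast
  have "l2norm (\<lambda>x. g x - f x) < e" using l2norm_diff_triangle[OF g(4) sh f] g(5) k by linarith
  then show ?thesis using g by blast
qed

section \<open>The inverse Fourier transform on L^2\<close>

lemma inv_fourier_multiplication_formula:
  fixes f g :: "'a::euclidean_space \<Rightarrow> complex"
  assumes f: "integrable lborel f" and g: "integrable lborel g"
  shows "(LINT x|lborel. inv_fourier f x * g x) = (LINT x|lborel. f x * inv_fourier g x)"
proof -
  let ?c = "complex_of_real ((2 * pi) powr (- real DIM('a)))"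
  have gm: "integrable lborel (\<lambda>x. g (- x))"
    using lborel_integrable_affine_iff[of "-1" g 0] g by simp
  have fi: "fourier_integral f (- x) = fourier_integral f (0 + (-1) *\<^sub>R x)" for x by simp
  have "(LINT x|lborel. inv_fourier f x * g x) = ?c * (LINT x|lborel. fourier_integral f (- x) * g x)"
    by (simp add: inv_fourier_eq mult.assoc)
  also have "(LINT x|lborel. fourier_integral f (- x) * g x) = (LINT x|lborel. fourier_integral f x * g (- x))"
    using lborel_integral_affine[of "-1" "\<lambda>x. fourier_integral f x * g (- x)" 0] by simp
  also have "\<dots> = (LINT x|lborel. f x * fourier_integral (\<lambda>x. g (- x)) x)"
    by (rule fourier_multiplication_formula[OF f gm])
  also have "fourier_integral (\<lambda>x. g (- x)) = (\<lambda>x. fourier_integral g (- x))"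
    unfolding fourier_integral_def
    using lborel_integral_affine[of "-1" "\<lambda>y. g (- y) * exp (- \<i> * of_real (y \<bullet> x))" 0 for x] by (auto simp: fun_eq_iff)
  also have "?c * (LINT x|lborel. f x * fourier_integral g (- x)) = (LINT x|lborel. f x * inv_fourier g x)"
    unfolding inv_fourier_eq by (subst integral_mult_right_zero[symmetric]) (simp only: mult.left_commute)
  finally show ?thesis .
qed

lemma plancherel_inv_continuous:
  fixes g :: "'a::euclidean_space \<Rightarrow> complex"
  assumes g: "integrable lborel g" "continuous_on UNIV g" "\<And>x. norm (g x) \<le> C" "sq_int g"
  shows "sq_int (inv_fourier g)" "(2 * pi) powr (DIM('a) / 2) * l2norm (inv_fourier g) = l2norm g"
proof -
  note [measurable] = sq_int_measurable[OF g(4)]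
  let ?c = "(2 * pi) powr (- real DIM('a))"
  have m[measurable]: "inv_fourier g \<in> borel_measurable borel"
    by (intro borel_measurable_continuous_onI inv_fourier_continuous g)
  have "(\<integral>\<^sup>+x. ennreal ((norm (inv_fourier g x))\<^sup>2) \<partial>lborel) = (\<integral>\<^sup>+x. ennreal (?c\<^sup>2) * ennreal ((norm (fourier_integral g (- x)))\<^sup>2) \<partial>lborel)"
    by (intro nn_integral_cong) (simp add: inv_fourier_eq norm_mult power_mult_distrib ennreal_mult)
  also have "\<dots> = ennreal (?c\<^sup>2) * (\<integral>\<^sup>+x. ennreal ((norm (fourier_integral g (- x)))\<^sup>2) \<partial>lborel)"
    by (rule nn_integral_cmult) measurable
  also have "(\<integral>\<^sup>+x. ennreal ((norm (fourier_integral g (- x)))\<^sup>2) \<partial>lborel) = (\<integral>\<^sup>+x. ennreal ((norm (fourier_integral g x))\<^sup>2) \<partial>lborel)"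
    using nn_integral_lborel_affine[of "\<lambda>x. ennreal ((norm (fourier_integral g x))\<^sup>2)" "-1" 0] by simp
  also have "\<dots> = ennreal ((2 * pi) powr real DIM('a)) * ennreal ((l2norm g)\<^sup>2)"
    unfolding plancherel_continuous[OF g(1-3)] nn_integral_sq_int[OF g(4)] ..
  finally have eq: "(\<integral>\<^sup>+x. ennreal ((norm (inv_fourier g x))\<^sup>2) \<partial>lborel) = ennreal (?c\<^sup>2 * ((2 * pi) powr real DIM('a) * (l2norm g)\<^sup>2))"
    by (simp add: ennreal_mult)
  then show s: "sq_int (inv_fourier g)" by (auto simp: sq_int_iff)
  from eq have "(l2norm (inv_fourier g))\<^sup>2 = ?c\<^sup>2 * ((2 * pi) powr real DIM('a) * (l2norm g)\<^sup>2)"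
    unfolding nn_integral_sq_int[OF s] by (subst (asm) ennreal_inj) auto
  also have "?c\<^sup>2 * ((2 * pi) powr real DIM('a) * (l2norm g)\<^sup>2) = (?c * (?c * (2 * pi) powr real DIM('a))) * (l2norm g)\<^sup>2"
    by (simp add: power2_eq_square)
  also have "?c * (2 * pi) powr real DIM('a) = 1" by (simp flip: powr_add)
  finally have "(2 * pi) powr real DIM('a) * (l2norm (inv_fourier g))\<^sup>2 = (l2norm g)\<^sup>2"
    by (simp add: powr_minus field_simps)
  then have "((2 * pi) powr (DIM('a) / 2) * l2norm (inv_fourier g))\<^sup>2 = (l2norm g)\<^sup>2"
    by (simp add: power_mult_distrib power2_eq_square[of "(2 * pi) powr _"] flip: two_pi_powr_half)
  then show "(2 * pi) powr (DIM('a) / 2) * l2norm (inv_fourier g) = l2norm g"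
    by (rule power2_eq_imp_eq) (auto simp: l2norm_nonneg)
qed

text \<open>Approximate H by bounded continuous integrable functions with error (1/4)^k. Plancherel
  makes their inverse transforms a Cauchy sequence, and the limit G inherits both the norm identity
  and, by continuity of the pairing with test functions, the distributional identity. It is used to
  produce the function defined by a square-integrable multiplier side.\<close>

theorem l2_inverse_fourier:
  fixes H :: "'a::euclidean_space \<Rightarrow> complex"
  assumes H: "sq_int H"
  shows "\<exists>G. sq_int G \<and> has_fourier (distr_of G) H \<and> (2 * pi) powr (DIM('a) / 2) * l2norm G = l2norm H"
proof -
  have "\<forall>k::nat. \<exists>g C. continuous_on UNIV g \<and> integrable lborel g \<and> (\<forall>x. norm (g x) \<le> C) \<and> sq_int g \<and> l2norm (\<lambda>x. g x - H x) < (1/4) ^ k"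
    by (intro allI l2_dense[OF H]) simp
  then obtain g C where g: "\<And>k. continuous_on UNIV (g k)" "\<And>k. integrable lborel (g k)" "\<And>k x. norm (g k x) \<le> C k" "\<And>k. sq_int (g k)"
    "\<And>k. l2norm (\<lambda>x. g k x - H x) < (1/4) ^ k" by metis
  let ?r = "(2 * pi) powr (DIM('a) / 2)"
  have r: "?r > 0" by simp
  let ?G = "\<lambda>k. inv_fourier (g k)"
  have G: "sq_int (?G k)" "?r * l2norm (?G k) = l2norm (g k)" for k
    using plancherel_inv_continuous[OF g(2) g(1) g(3) g(4)] by auto
  have cauchy: "l2norm (\<lambda>x. ?G l x - ?G k x) \<le> (2 / ?r) * (1/4) ^ k" if "k \<le> l" for k l
  proof -
    have eq: "(\<lambda>x. ?G l x - ?G k x) = inv_fourier (\<lambda>x. g l x - g k x)"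
    proof
      fix x
      have i: "integrable lborel (\<lambda>y. g k y * exp (\<i> * of_real (y \<bullet> x)))" for k
        using fourier_integrand_integrable[OF g(2), of k "- x"] by simp
      show "?G l x - ?G k x = inv_fourier (\<lambda>x. g l x - g k x) x"
        unfolding inv_fourier_def by (simp only: left_diff_distrib Bochner_Integration.integral_diff[OF i i] right_diff_distrib)
    qed
    have "?r * l2norm (\<lambda>x. ?G l x - ?G k x) = l2norm (\<lambda>x. g l x - g k x)"
      unfolding eq
    proof (rule plancherel_inv_continuous(2))
      show "norm (g l x - g k x) \<le> C l + C k" for x
        using norm_triangle_ineq4[of "g l x" "g k x"] g(3)[of l x] g(3)[of k x] by linarith
    qed (intro Bochner_Integration.integrable_diff continuous_intros sq_int_diff g)+
    also have "\<dots> \<le> l2norm (\<lambda>x. g l x - H x) + l2norm (\<lambda>x. H x - g k x)"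
      by (rule l2norm_diff_triangle[OF g(4) H g(4)])
    also have "\<dots> \<le> (1/4) ^ l + (1/4) ^ k"
      using g(5)[of l] g(5)[of k] l2norm_diff_commute[of H "g k"] by linarith
    also have "\<dots> \<le> 2 * (1/4) ^ k"
      using power_decreasing[OF that, of "1/4::real"] by simp
    finally show ?thesis using r by (simp add: field_simps)
  qed
  obtain G where sG: "sq_int G" and Gk: "\<And>k. l2norm (\<lambda>x. ?G k x - G x) \<le> (2 / ?r) * (1/4) ^ k"
    using l2_complete[OF G(1) _ cauchy] by auto
  have geo: "(\<lambda>k. (1/4::real) ^ k) \<longlonglongrightarrow> 0" by (rule LIMSEQ_realpow_zero) auto
  have limG: "(\<lambda>k. l2norm (\<lambda>x. ?G k x - G x)) \<longlonglongrightarrow> 0"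
    by (rule tendsto_sandwich[OF _ _ tendsto_const, of _ _ _ "\<lambda>k. (2 / ?r) * (1/4) ^ k"])
      (use Gk tendsto_mult_right_zero[OF geo] in \<open>auto simp: l2norm_nonneg\<close>)
  have limg: "(\<lambda>k. l2norm (\<lambda>x. g k x - H x)) \<longlonglongrightarrow> 0"
    by (rule tendsto_sandwich[OF _ _ tendsto_const geo]) (use g(5) in \<open>auto simp: l2norm_nonneg less_imp_le\<close>)
  have n: "?r * l2norm G = l2norm H"
  proof (rule LIMSEQ_unique)
    show "(\<lambda>k. l2norm (g k)) \<longlonglongrightarrow> l2norm H" by (rule l2_tendsto_norm[OF g(4) H limg])
    show "(\<lambda>k. l2norm (g k)) \<longlonglongrightarrow> ?r * l2norm G"
      unfolding G(2)[symmetric] by (intro tendsto_mult tendsto_const l2_tendsto_norm G sG limG)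
  qed
  have "has_fourier (distr_of G) H"
    unfolding has_fourier_def
  proof (intro conjI allI impI)
    show "tempered H" using H by (intro tempered_square_integrable) (auto simp: sq_int_iff)
    fix \<phi> :: "'a \<Rightarrow> complex" assume \<phi>: "schwartz \<phi>"
    have s\<phi>: "sq_int \<phi>" "sq_int (fourier_integral \<phi>)"
      using schwartz_square_integrable[OF \<phi>] schwartz_integrable0(2)[OF \<phi>] by (auto simp: sq_int_iff)
    have eq: "(LINT x|lborel. ?G k x * fourier_integral \<phi> x) = (LINT x|lborel. g k x * \<phi> x)" for k
      using inv_fourier_multiplication_formula[OF g(2) fourier_schwartz_integrable[OF \<phi>]]
      unfolding schwartz_inversion[OF \<phi>] .
    show "distr_of G (fourier_integral \<phi>) = distr_of H \<phi>"
      unfolding distr_of_def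
    proof (rule LIMSEQ_unique)
      show "(\<lambda>k. LINT x|lborel. ?G k x * fourier_integral \<phi> x) \<longlonglongrightarrow> (LINT x|lborel. G x * fourier_integral \<phi> x)"
        by (rule l2_tendsto_pairing[OF G(1) sG s\<phi>(2) limG])
      show "(\<lambda>k. LINT x|lborel. ?G k x * fourier_integral \<phi> x) \<longlonglongrightarrow> (LINT x|lborel. H x * \<phi> x)"
        unfolding eq by (rule l2_tendsto_pairing[OF g(4) H s\<phi>(1) limg])
    qed
  qed
  then show ?thesis using sG n by blast
qed

section \<open>Polar coordinates\<close>

text \<open>The normalised surface measure of the unit sphere, as the distribution of the direction
  of a uniform random point of the ball. The origin, where \<open>sgn\<close> is 0, is a null
  set.\<close>

definition sphere_measure :: "'a::euclidean_space measure" where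
  "sphere_measure = distr (uniform_measure lborel (cball 0 1)) borel sgn"

text \<open>The density of the image of Lebesgue measure on \<open>\<real>\<^sup>n\<close> under \<open>y \<mapsto> 2 |y|\<^sup>2\<close>.\<close>

definition radial_density :: "real \<Rightarrow> real \<Rightarrow> real" where
  "radial_density n s = (if s > 0 then unit_ball_vol n * (n / 4) * (s / 2) powr (n / 2 - 1) else 0)"

lemma sgn_measurable [measurable]: "(sgn :: 'a::euclidean_space \<Rightarrow> 'a) \<in> borel_measurable borel"
  unfolding sgn_div_norm by measurable

lemma prob_space_sphere_measure: "prob_space (sphere_measure :: 'a::euclidean_space measure)"
proof -
  have "prob_space (uniform_measure lborel (cball (0::'a) 1))"
    by (rule prob_space_uniform_measure) (auto simp: emeasure_cball ennreal_eq_0_iff not_le less_imp_neq[OF unit_ball_vol_pos, symmetric])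
  then show ?thesis unfolding sphere_measure_def
    by (rule prob_space.prob_space_distr) simp
qed

lemma sets_sphere_measure [simp, measurable_cong]: "sets sphere_measure = sets borel"
  by (simp add: sphere_measure_def)

lemma space_sphere_measure [simp]: "space sphere_measure = UNIV"
  by (simp add: sphere_measure_def)

lemma emeasure_sphere_measure:
  fixes B :: "'a::euclidean_space set"
  assumes [measurable]: "B \<in> sets borel"
  shows "ennreal (unit_ball_vol DIM('a)) * emeasure sphere_measure B = emeasure lborel {y. norm y \<le> 1 \<and> sgn y \<in> B}"
proof -
  have [measurable]: "sgn -` B \<in> sets borel"
    using measurable_sets[OF sgn_measurable assms] by simp
  have "emeasure sphere_measure B = emeasure (uniform_measure lborel (cball (0::'a) 1)) (sgn -` B)"
    unfolding sphere_measure_def by (subst emeasure_distr) auto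
  also have "\<dots> = emeasure lborel (cball 0 1 \<inter> sgn -` B) / ennreal (unit_ball_vol DIM('a))"
    by (subst emeasure_uniform_measure) (auto simp: emeasure_cball)
  also have "cball 0 1 \<inter> sgn -` B = {y. norm y \<le> 1 \<and> sgn y \<in> B}" by auto
  finally have "emeasure sphere_measure B = emeasure lborel {y. norm y \<le> 1 \<and> sgn y \<in> B} / ennreal (unit_ball_vol DIM('a))" .
  moreover have "c * (x / c) = x" if "c \<noteq> 0" "c \<noteq> \<top>" for c x :: ennreal
    using that by (metis ennreal_mult_divide_eq ennreal_times_divide mult.commute)
  moreover have "ennreal (unit_ball_vol DIM('a)) \<noteq> 0"
    using unit_ball_vol_pos[of "real DIM('a)"] by (simp add: ennreal_eq_0_iff not_le)
  ultimately show ?thesis by simp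
qed

lemma radial_density_nonneg: "n \<ge> 0 \<Longrightarrow> radial_density n s \<ge> 0"
  by (auto simp: radial_density_def intro!: mult_nonneg_nonneg)

lemma radial_density_measurable [measurable]: "radial_density n \<in> borel_measurable borel"
  unfolding radial_density_def by measurable

text \<open>For n = d the right-hand side is the volume of the set where 2 |y|^2 \<le> s, and the
  density is its derivative in s.\<close>

lemma nn_integral_radial_density:
  assumes n: "n > 0" and s: "s \<ge> 0"
  shows "(\<integral>\<^sup>+u. ennreal (radial_density n u) * indicator {..s} u \<partial>lborel) = ennreal (unit_ball_vol n * (s / 2) powr (n / 2))"
proof -
  let ?a = "n / 2 - 1"
  let ?c = "unit_ball_vol n * (n / 4) / 2 powr ?a"
  have "((\<lambda>x. ?c * x powr ?a) has_integral (?c * (s powr (?a + 1) / (?a + 1)))) {0..s}"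
    by (intro has_integral_mult_right has_integral_powr_from_0) (use n s in auto)
  then have "(\<integral>\<^sup>+u. ennreal (indicator {0..s} u * (?c * u powr ?a)) \<partial>lborel) = ennreal (?c * (s powr (?a + 1) / (?a + 1)))"
    using n by (intro nn_integral_has_integral_lebesgue) (auto intro!: mult_nonneg_nonneg divide_nonneg_nonneg)
  also have "(\<integral>\<^sup>+u. ennreal (indicator {0..s} u * (?c * u powr ?a)) \<partial>lborel) = (\<integral>\<^sup>+u. ennreal (radial_density n u) * indicator {..s} u \<partial>lborel)"
  proof (rule nn_integral_cong_AE)
    show "AE u in lborel. ennreal (indicator {0..s} u * (?c * u powr ?a)) = ennreal (radial_density n u) * indicator {..s} u"
      using AE_lborel_singleton[of "0::real"]
      by eventually_elim (auto simp: radial_density_def powr_divide indicator_def)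
  qed
  also have "?c * (s powr (?a + 1) / (?a + 1)) = unit_ball_vol n * (s / 2) powr (n / 2)"
  proof -
    have "2 powr (n / 2) = 2 powr ?a * 2" by (simp add: powr_diff)
    then show ?thesis using n s by (simp add: powr_divide field_simps)
  qed
  finally show ?thesis .
qed

lemma emeasure_cone:
  fixes B :: "'a::euclidean_space set"
  assumes [measurable]: "B \<in> sets borel" and s: "s > 0"
  shows "emeasure lborel {y. 2 * (norm y)\<^sup>2 \<le> s \<and> sgn y \<in> B} = ennreal ((s / 2) powr (DIM('a) / 2)) * emeasure lborel {y. norm y \<le> 1 \<and> sgn y \<in> B}"
proof -
  let ?r = "sqrt (s / 2)"
  have r: "?r > 0" using s by simp
  have le: "2 * (norm y)\<^sup>2 \<le> s \<longleftrightarrow> norm y \<le> ?r" for y :: 'a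
    using real_sqrt_le_iff[of "(norm y)\<^sup>2" "s / 2"] by auto
  have mA: "{y. 2 * (norm y)\<^sup>2 \<le> s \<and> sgn y \<in> B} \<in> sets borel" "{y. norm y \<le> 1 \<and> sgn y \<in> B} \<in> sets borel"
    by measurable
  have "emeasure lborel {y. 2 * (norm y)\<^sup>2 \<le> s \<and> sgn y \<in> B} = (\<integral>\<^sup>+y. indicator {y. 2 * (norm y)\<^sup>2 \<le> s \<and> sgn y \<in> B} y \<partial>lborel)"
    using mA by simp
  also have "\<dots> = ennreal (\<bar>?r\<bar> ^ DIM('a)) * (\<integral>\<^sup>+y. indicator {y. 2 * (norm y)\<^sup>2 \<le> s \<and> sgn y \<in> B} (0 + ?r *\<^sub>R y) \<partial>lborel)"
    by (rule nn_integral_lborel_affine) (use mA r in auto)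
  also have "(\<lambda>y::'a. indicator {y. 2 * (norm y)\<^sup>2 \<le> s \<and> sgn y \<in> B} (0 + ?r *\<^sub>R y) :: ennreal) = indicator {y. norm y \<le> 1 \<and> sgn y \<in> B}"
    using r by (auto simp: indicator_def le sgn_scaleR fun_eq_iff mult_le_cancel_left_pos[of _ _ 1, simplified])
  also have "(\<integral>\<^sup>+y. indicator {y. norm y \<le> 1 \<and> sgn y \<in> B} y \<partial>lborel) = emeasure lborel {y. norm y \<le> 1 \<and> sgn y \<in> B}"
    using mA by simp
  also have "\<bar>?r\<bar> ^ DIM('a) = (s / 2) powr (DIM('a) / 2)"
    using s r by (simp add: powr_half_sqrt[symmetric] powr_realpow[symmetric] powr_powr)
  finally show ?thesis .
qed

text \<open>On rectangles A \<times> B: for fixed B both sides are measures in A, and on half-lines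
  they agree by the scaling of cones. The radial variable is 2 |y|^2 since |\<zeta>|^2 + |\<eta>|^2
  = |\<xi>|^2 / 2 + 2 |y|^2 for \<xi> = \<zeta> + \<eta> and y = (\<zeta> - \<eta>) / 2, so it
  becomes the value of \<open>shell\<close>.\<close>

lemma polar_measure:
  "density lborel (\<lambda>s. ennreal (radial_density DIM('a) s)) \<Otimes>\<^sub>M sphere_measure =
   distr lborel (borel \<Otimes>\<^sub>M borel) (\<lambda>y::'a::euclidean_space. (2 * (norm y)\<^sup>2, sgn y))"
proof (rule pair_measure_eqI)
  interpret prob_space "sphere_measure :: 'a measure" by (rule prob_space_sphere_measure)
  show "sigma_finite_measure (sphere_measure :: 'a measure)" by unfold_locales
  show "sigma_finite_measure (density lborel (\<lambda>s. ennreal (radial_density DIM('a) s)))"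
    by (subst sigma_finite_measure.sigma_finite_iff_density_finite'[OF lborel.sigma_finite_measure_axioms]) auto
  show "sets (density lborel (\<lambda>s. ennreal (radial_density DIM('a) s)) \<Otimes>\<^sub>M (sphere_measure :: 'a measure)) =
    sets (distr lborel (borel \<Otimes>\<^sub>M borel) (\<lambda>y::'a. (2 * (norm y)\<^sup>2, sgn y)))"
    by (simp cong: sets_pair_measure_cong)
  fix A :: "real set" and B :: "'a set"
  assume "A \<in> sets (density lborel (\<lambda>s. ennreal (radial_density DIM('a) s)))" "B \<in> sets sphere_measure"
  then have [measurable]: "A \<in> sets borel" "B \<in> sets borel" by simp_all
  let ?B = "{y::'a. sgn y \<in> B}"
  have [measurable]: "?B \<in> sets borel" by measurable
  let ?m1 = "density lborel (\<lambda>s. ennreal (radial_density DIM('a) s) * emeasure sphere_measure B)"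
  let ?m2 = "distr (density lborel (indicator ?B)) borel (\<lambda>y::'a. 2 * (norm y)\<^sup>2)"
  have m2: "emeasure ?m2 X = emeasure lborel {y. 2 * (norm y)\<^sup>2 \<in> X \<and> sgn y \<in> B}" if [measurable]: "X \<in> sets borel" for X
  proof -
    have [measurable]: "(\<lambda>y::'a. 2 * (norm y)\<^sup>2) -` X \<in> sets borel"
      using measurable_sets[of "\<lambda>y::'a. 2 * (norm y)\<^sup>2" borel borel X] that by simp
    have "emeasure ?m2 X = emeasure (density lborel (indicator ?B)) ((\<lambda>y::'a. 2 * (norm y)\<^sup>2) -` X)"
      by (subst emeasure_distr) auto
    also have "\<dots> = (\<integral>\<^sup>+y. indicator ?B y * indicator ((\<lambda>y::'a. 2 * (norm y)\<^sup>2) -` X) y \<partial>lborel)"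
      by (subst emeasure_density) auto
    also have "\<dots> = (\<integral>\<^sup>+y. indicator {y. 2 * (norm y)\<^sup>2 \<in> X \<and> sgn y \<in> B} y \<partial>lborel)"
      by (intro nn_integral_cong) (auto simp: indicator_def)
    also have "\<dots> = emeasure lborel {y. 2 * (norm y)\<^sup>2 \<in> X \<and> sgn y \<in> B}"
      by (rule nn_integral_indicator) measurable
    finally show ?thesis .
  qed
  have eq: "?m1 = ?m2"
  proof (rule measure_eqI_generator_eq[where E="range atMost" and \<Omega>=UNIV and A="\<lambda>n::nat. {..real n}"])
    show "Int_stable (range (atMost :: real \<Rightarrow> real set))"
      by (auto simp: Int_stable_def intro!: rangeI)
    show "sets ?m1 = sigma_sets UNIV (range atMost)" "sets ?m2 = sigma_sets UNIV (range atMost)"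
      by (simp_all add: borel_eq_atMost)
    show "(\<Union>n::nat. {..real n}) = UNIV" by (auto simp: real_arch_simple)
    have m1s: "emeasure ?m1 {..s} = ennreal (unit_ball_vol DIM('a) * (s / 2) powr (DIM('a) / 2)) * emeasure sphere_measure B"
      if "s \<ge> 0" for s
    proof -
      have "emeasure ?m1 {..s} = (\<integral>\<^sup>+u. emeasure sphere_measure B * (ennreal (radial_density DIM('a) u) * indicator {..s} u) \<partial>lborel)"
        by (subst emeasure_density) (auto simp: ac_simps)
      also have "\<dots> = emeasure sphere_measure B * (\<integral>\<^sup>+u. ennreal (radial_density DIM('a) u) * indicator {..s} u \<partial>lborel)"
        by (rule nn_integral_cmult) measurable
      finally show ?thesis by (subst (asm) nn_integral_radial_density) (use that in \<open>auto simp: mult.commute\<close>)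
    qed
    show "emeasure ?m1 {..real n} \<noteq> \<infinity>" for n
      by (subst m1s) (auto simp: ennreal_mult_eq_top_iff emeasure_eq_measure)
    fix X assume "X \<in> range (atMost :: real \<Rightarrow> real set)"
    then obtain s where X: "X = {..s}" by auto
    show "emeasure ?m1 X = emeasure ?m2 X"
    proof (cases "s > 0")
      case True
      have "emeasure ?m2 X = emeasure lborel {y::'a. 2 * (norm y)\<^sup>2 \<le> s \<and> sgn y \<in> B}"
        unfolding X by (subst m2) auto
      also have "\<dots> = ennreal ((s / 2) powr (DIM('a) / 2)) * (ennreal (unit_ball_vol DIM('a)) * emeasure sphere_measure B)"
        unfolding emeasure_cone[OF \<open>B \<in> sets borel\<close> True] emeasure_sphere_measure[OF \<open>B \<in> sets borel\<close>] ..
      also have "\<dots> = emeasure ?m1 X"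
        unfolding X using True by (subst m1s) (auto simp: ennreal_mult mult_ac)
      finally show ?thesis ..
    next
      \<comment> \<open>For s \<le> 0 the density vanishes on the half-line, and the set on the
        other side contains at most the origin.\<close>
      case False
      have z: "ennreal (radial_density DIM('a) u) * emeasure sphere_measure B * indicator {..s} u = 0" for u
        using False by (auto simp: radial_density_def indicator_def)
      have "emeasure ?m1 X = (\<integral>\<^sup>+u. ennreal (radial_density DIM('a) u) * emeasure sphere_measure B * indicator {..s} u \<partial>lborel)"
        unfolding X by (rule emeasure_density) auto
      then have "emeasure ?m1 X = 0" unfolding z by simp
      moreover have "emeasure ?m2 X \<le> emeasure lborel {0::'a}"
      proof -
        have "y = 0" if "2 * (norm y)\<^sup>2 \<le> s" for y :: 'a
        proof -
          have "(norm y)\<^sup>2 \<le> 0" using that False by linarith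
          then show ?thesis by simp
        qed
        then have "{y::'a. 2 * (norm y)\<^sup>2 \<in> {..s} \<and> sgn y \<in> B} \<subseteq> {0}" by auto
        then show ?thesis unfolding X by (subst m2, simp) (rule emeasure_mono, auto)
      qed
      ultimately show ?thesis by simp
    qed
  qed auto
  have "emeasure (density lborel (\<lambda>s. ennreal (radial_density DIM('a) s))) A * emeasure sphere_measure B = emeasure ?m1 A"
    by (simp add: emeasure_density, subst nn_integral_multc[symmetric]) (simp_all add: mult_ac)
  also have "\<dots> = emeasure lborel {y::'a. 2 * (norm y)\<^sup>2 \<in> A \<and> sgn y \<in> B}"
    unfolding eq by (rule m2) simp
  also have "\<dots> = emeasure (distr lborel (borel \<Otimes>\<^sub>M borel) (\<lambda>y::'a. (2 * (norm y)\<^sup>2, sgn y))) (A \<times> B)"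
    by (subst emeasure_distr) (auto simp: vimage_def intro!: arg_cong[where f="emeasure lborel"])
  finally show "emeasure (density lborel (\<lambda>s. ennreal (radial_density DIM('a) s))) A * emeasure sphere_measure B =
    emeasure (distr lborel (borel \<Otimes>\<^sub>M borel) (\<lambda>y::'a. (2 * (norm y)\<^sup>2, sgn y))) (A \<times> B)" .
qed

lemma nn_integral_polar:
  fixes f :: "'a::euclidean_space \<Rightarrow> ennreal"
  assumes [measurable]: "f \<in> borel_measurable borel"
  shows "(\<integral>\<^sup>+y. f y \<partial>lborel) =
    (\<integral>\<^sup>+s. ennreal (radial_density DIM('a) s) * (\<integral>\<^sup>+w. f (sqrt (s / 2) *\<^sub>R w) \<partial>sphere_measure) \<partial>lborel)"
proof -
  interpret S: prob_space "sphere_measure :: 'a measure" by (rule prob_space_sphere_measure)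
  have y: "sqrt (2 * (norm y)\<^sup>2 / 2) *\<^sub>R sgn y = y" for y :: 'a
    by (cases "y = 0") (auto simp: sgn_div_norm)
  have "(\<integral>\<^sup>+y. f y \<partial>lborel) = (\<integral>\<^sup>+y. (\<lambda>(s, w). f (sqrt (s / 2) *\<^sub>R w)) (2 * (norm y)\<^sup>2, sgn y) \<partial>lborel)"
    by (simp only: split y)
  also have "\<dots> = (\<integral>\<^sup>+p. (\<lambda>(s, w). f (sqrt (s / 2) *\<^sub>R w)) p \<partial>distr lborel (borel \<Otimes>\<^sub>M borel) (\<lambda>y::'a. (2 * (norm y)\<^sup>2, sgn y)))"
    by (rule nn_integral_distr[symmetric]) measurable
  also have "\<dots> = (\<integral>\<^sup>+p. (\<lambda>(s, w). f (sqrt (s / 2) *\<^sub>R w)) p \<partial>(density lborel (\<lambda>s. ennreal (radial_density DIM('a) s)) \<Otimes>\<^sub>M sphere_measure))"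
    unfolding polar_measure ..
  also have "\<dots> = (\<integral>\<^sup>+s. \<integral>\<^sup>+w. f (sqrt (s / 2) *\<^sub>R w) \<partial>sphere_measure \<partial>density lborel (\<lambda>s. ennreal (radial_density DIM('a) s)))"
    by (subst S.nn_integral_fst[symmetric]) (auto cong: measurable_cong_sets)
  also have "\<dots> = (\<integral>\<^sup>+s. ennreal (radial_density DIM('a) s) * (\<integral>\<^sup>+w. f (sqrt (s / 2) *\<^sub>R w) \<partial>sphere_measure) \<partial>lborel)"
    by (rule nn_integral_density) measurable
  finally show ?thesis .
qed

section \<open>Frequency pairs with given sum and energy\<close>

text \<open>The pairs \<open>(\<zeta>, \<eta>)\<close> with \<open>(- |\<zeta>|\<^sup>2 - |\<eta>|\<^sup>2, \<zeta> + \<eta>) = z\<close> are the \<open>shell_pair z w\<close> with \<open>|w| = 1\<close>; they satisfy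
  \<open>|\<zeta> - \<eta>|\<^sup>2 = 2 * shell z\<close>.\<close>

definition shell :: "real \<times> 'a::euclidean_space \<Rightarrow> real" where
  "shell z = - fst z - (norm (snd z))\<^sup>2 / 2"

text \<open>The Jacobian factor of the disintegration of Lebesgue measure along the fibres. It
  vanishes exactly where the fibre is empty or a single point.\<close>

definition shell_density :: "real \<times> 'a::euclidean_space \<Rightarrow> real" where
  "shell_density z = radial_density DIM('a) (shell z)"

definition shell_pair :: "real \<times> 'a::euclidean_space \<Rightarrow> 'a \<Rightarrow> 'a \<times> 'a" where
  "shell_pair z w = (snd z /\<^sub>R 2 + sqrt (shell z / 2) *\<^sub>R w, snd z /\<^sub>R 2 - sqrt (shell z / 2) *\<^sub>R w)"

lemma shell_measurable [measurable]: "shell \<in> borel_measurable borel"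
  unfolding shell_def by (intro borel_measurable_continuous_onI continuous_intros) auto

lemma shell_density_measurable [measurable]: "shell_density \<in> borel_measurable borel"
  unfolding shell_density_def by measurable

lemma shell_density_nonneg: "shell_density z \<ge> 0"
  by (simp add: shell_density_def radial_density_nonneg)

lemma shell_pair_measurable [measurable]:
  "case_prod shell_pair \<in> (borel \<Otimes>\<^sub>M borel) \<rightarrow>\<^sub>M (borel :: ('a::euclidean_space \<times> 'a) measure)"
  unfolding shell_pair_def shell_def split_def borel_prod
  by (intro borel_measurable_continuous_onI continuous_intros) auto

text \<open>Sum and half difference as coordinates. The change is made by translations in one
  variable at a time, so no Jacobian factor appears.\<close>

lemma nn_integral_centre:
  fixes f :: "'a::euclidean_space \<times> 'a \<Rightarrow> ennreal"
  assumes f[measurable]: "f \<in> borel_measurable borel"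
  shows "(\<integral>\<^sup>+p. f p \<partial>lborel) = (\<integral>\<^sup>+\<xi>. \<integral>\<^sup>+y. f ((1 / 2) *\<^sub>R \<xi> + y, (1 / 2) *\<^sub>R \<xi> - y) \<partial>lborel \<partial>lborel)"
proof -
  have fm: "f \<in> borel_measurable (borel \<Otimes>\<^sub>M borel)" using f by (simp add: borel_prod)
  note [measurable] = fm
  have "(\<integral>\<^sup>+p. f p \<partial>lborel) = (\<integral>\<^sup>+x. \<integral>\<^sup>+y. f (x, y) \<partial>lborel \<partial>lborel)"
    unfolding lborel_prod[symmetric] by (rule lborel.nn_integral_fst[symmetric]) measurable
  also have "\<dots> = (\<integral>\<^sup>+x. \<integral>\<^sup>+\<xi>. f (x, \<xi> - x) \<partial>lborel \<partial>lborel)"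
  proof (rule nn_integral_cong)
    fix x
    show "(\<integral>\<^sup>+y. f (x, y) \<partial>lborel) = (\<integral>\<^sup>+\<xi>. f (x, \<xi> - x) \<partial>lborel)"
      using nn_integral_lborel_affine[of "\<lambda>y. f (x, y)" 1 "- x"] by simp
  qed
  also have "\<dots> = (\<integral>\<^sup>+\<xi>. \<integral>\<^sup>+x. f (x, \<xi> - x) \<partial>lborel \<partial>lborel)"
    by (rule lborel_pair.Fubini') measurable
  also have "\<dots> = (\<integral>\<^sup>+\<xi>. \<integral>\<^sup>+y. f ((1 / 2) *\<^sub>R \<xi> + y, (1 / 2) *\<^sub>R \<xi> - y) \<partial>lborel \<partial>lborel)"
  proof (rule nn_integral_cong)
    fix \<xi> :: 'a
    have "\<xi> - (1 / 2) *\<^sub>R \<xi> = (1 / 2) *\<^sub>R \<xi>" using scaleR_left_diff_distrib[of 1 "1 / 2" \<xi>] by simp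
    then have h: "\<xi> - ((1 / 2) *\<^sub>R \<xi> + y) = (1 / 2) *\<^sub>R \<xi> - y" for y
      by (simp add: diff_add_eq_diff_diff_swap)
    show "(\<integral>\<^sup>+x. f (x, \<xi> - x) \<partial>lborel) = (\<integral>\<^sup>+y. f ((1 / 2) *\<^sub>R \<xi> + y, (1 / 2) *\<^sub>R \<xi> - y) \<partial>lborel)"
      using nn_integral_lborel_affine[of "\<lambda>x. f (x, \<xi> - x)" 1 "(1 / 2) *\<^sub>R \<xi>"] by (simp add: h)
  qed
  finally show ?thesis .
qed

lemma nn_integral_pair_shell:
  fixes f :: "'a::euclidean_space \<times> 'a \<Rightarrow> ennreal"
  assumes f[measurable]: "f \<in> borel_measurable borel"
  shows "(\<integral>\<^sup>+p. f p \<partial>lborel) = (\<integral>\<^sup>+z. ennreal (shell_density z) * (\<integral>\<^sup>+w. f (shell_pair z w) \<partial>sphere_measure) \<partial>lborel)"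
proof -
  interpret S: prob_space "sphere_measure :: 'a measure" by (rule prob_space_sphere_measure)
  have fm: "f \<in> borel_measurable (borel \<Otimes>\<^sub>M borel)" using f by (simp add: borel_prod)
  note [measurable] = fm
  have "(\<integral>\<^sup>+p. f p \<partial>lborel) = (\<integral>\<^sup>+\<xi>. \<integral>\<^sup>+y. f ((1 / 2) *\<^sub>R \<xi> + y, (1 / 2) *\<^sub>R \<xi> - y) \<partial>lborel \<partial>lborel)"
    by (rule nn_integral_centre[OF f])
  also have "\<dots> = (\<integral>\<^sup>+\<xi>. \<integral>\<^sup>+\<tau>. ennreal (shell_density (\<tau>, \<xi>)) * (\<integral>\<^sup>+w. f (shell_pair (\<tau>, \<xi>) w) \<partial>sphere_measure) \<partial>lborel \<partial>lborel)"
  proof (rule nn_integral_cong)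
    fix \<xi> :: 'a
    have "(\<integral>\<^sup>+y. f ((1 / 2) *\<^sub>R \<xi> + y, (1 / 2) *\<^sub>R \<xi> - y) \<partial>lborel) = (\<integral>\<^sup>+s. ennreal (radial_density DIM('a) s) *
        (\<integral>\<^sup>+w. f ((1 / 2) *\<^sub>R \<xi> + sqrt (s / 2) *\<^sub>R w, (1 / 2) *\<^sub>R \<xi> - sqrt (s / 2) *\<^sub>R w) \<partial>sphere_measure) \<partial>lborel)"
      by (rule nn_integral_polar) measurable
    \<comment> \<open>The substitution s = - \<tau> - |\<xi>|^2 / 2, which makes s the value of
      \<open>shell\<close> at (\<tau>, \<xi>).\<close>
    also have "\<dots> = (\<integral>\<^sup>+\<tau>. ennreal (shell_density (\<tau>, \<xi>)) * (\<integral>\<^sup>+w. f (shell_pair (\<tau>, \<xi>) w) \<partial>sphere_measure) \<partial>lborel)"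
      by (subst nn_integral_real_affine[where c="-1" and t="- (norm \<xi>)\<^sup>2 / 2"])
        (simp_all add: shell_density_def shell_pair_def shell_def algebra_simps)
    finally show "(\<integral>\<^sup>+y. f ((1 / 2) *\<^sub>R \<xi> + y, (1 / 2) *\<^sub>R \<xi> - y) \<partial>lborel) = (\<integral>\<^sup>+\<tau>. ennreal (shell_density (\<tau>, \<xi>)) * (\<integral>\<^sup>+w. f (shell_pair (\<tau>, \<xi>) w) \<partial>sphere_measure) \<partial>lborel)" .
  qed
  also have "\<dots> = (\<integral>\<^sup>+z. ennreal (shell_density z) * (\<integral>\<^sup>+w. f (shell_pair z w) \<partial>sphere_measure) \<partial>lborel)"
  proof -
    have "(\<lambda>z::real \<times> 'a. ennreal (shell_density z) * (\<integral>\<^sup>+w. f (shell_pair z w) \<partial>sphere_measure)) \<in> borel_measurable borel"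
      by measurable
    then show ?thesis
      using lborel_pair.nn_integral_snd[of "\<lambda>z::real \<times> 'a. ennreal (shell_density z) * (\<integral>\<^sup>+w. f (shell_pair z w) \<partial>sphere_measure)"]
      by (simp add: lborel_prod)
  qed
  finally show ?thesis .
qed

text \<open>The same disintegration as an identity of measures, from which integrability and complex
  integrals transfer.\<close>

lemma shell_measure:
  "distr (density lborel (\<lambda>z. ennreal (shell_density z)) \<Otimes>\<^sub>M sphere_measure) borel (case_prod shell_pair) =
    (lborel :: ('a::euclidean_space \<times> 'a) measure)"
proof (rule measure_eqI)
  interpret S: prob_space "sphere_measure :: 'a measure" by (rule prob_space_sphere_measure)
  fix A assume "A \<in> sets (distr (density lborel (\<lambda>z. ennreal (shell_density z)) \<Otimes>\<^sub>M sphere_measure) borel (case_prod shell_pair :: (real \<times> 'a) \<times> 'a \<Rightarrow> 'a \<times> 'a))"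
  then have [measurable]: "A \<in> sets borel" by simp
  have m: "case_prod shell_pair \<in> (density lborel (\<lambda>z. ennreal (shell_density z)) \<Otimes>\<^sub>M sphere_measure) \<rightarrow>\<^sub>M (borel :: ('a \<times> 'a) measure)"
    using shell_pair_measurable by (simp cong: measurable_cong_sets sets_pair_measure_cong)
  have "emeasure lborel A = (\<integral>\<^sup>+p. indicator A p \<partial>lborel)" by simp
  also have "\<dots> = (\<integral>\<^sup>+z. ennreal (shell_density z) * (\<integral>\<^sup>+w. indicator A (shell_pair z w) \<partial>sphere_measure) \<partial>lborel)"
    by (rule nn_integral_pair_shell) measurable
  also have "\<dots> = (\<integral>\<^sup>+z. \<integral>\<^sup>+w. indicator A (shell_pair z w) \<partial>sphere_measure \<partial>density lborel (\<lambda>z. ennreal (shell_density z)))"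
    by (rule nn_integral_density[symmetric]) measurable
  also have "\<dots> = (\<integral>\<^sup>+p. indicator A (case_prod shell_pair p) \<partial>(density lborel (\<lambda>z. ennreal (shell_density z)) \<Otimes>\<^sub>M sphere_measure))"
    by (subst S.nn_integral_fst[symmetric]) (use m in \<open>auto simp: split_def\<close>)
  also have "\<dots> = (\<integral>\<^sup>+p. indicator A p \<partial>distr (density lborel (\<lambda>z. ennreal (shell_density z)) \<Otimes>\<^sub>M sphere_measure) borel (case_prod shell_pair))"
    by (rule nn_integral_distr[symmetric, OF m]) measurable
  finally show "emeasure (distr (density lborel (\<lambda>z. ennreal (shell_density z)) \<Otimes>\<^sub>M sphere_measure) borel (case_prod shell_pair)) A = emeasure lborel A"
    by simp
qed simp

lemma integral_pair_shell:
  fixes f :: "'a::euclidean_space \<times> 'a \<Rightarrow> complex"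
  assumes f: "integrable lborel f"
  shows "integrable lborel (\<lambda>z. of_real (shell_density z) * (LINT w|sphere_measure. f (shell_pair z w)))"
    "(LINT p|lborel. f p) = (LINT z|lborel. of_real (shell_density z) * (LINT w|sphere_measure. f (shell_pair z w)))"
proof -
  interpret S: prob_space "sphere_measure :: 'a measure" by (rule prob_space_sphere_measure)
  let ?D = "density lborel (\<lambda>z::real \<times> 'a. ennreal (shell_density z))"
  have sfD: "sigma_finite_measure ?D"
    by (subst sigma_finite_measure.sigma_finite_iff_density_finite'[OF lborel.sigma_finite_measure_axioms]) auto
  interpret P: pair_sigma_finite ?D "sphere_measure :: 'a measure"
    by (intro pair_sigma_finite.intro sfD) unfold_locales
  have m: "case_prod shell_pair \<in> (?D \<Otimes>\<^sub>M sphere_measure) \<rightarrow>\<^sub>M (borel :: ('a \<times> 'a) measure)"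
    using shell_pair_measurable by (simp cong: measurable_cong_sets sets_pair_measure_cong)
  have [measurable]: "f \<in> borel_measurable borel" using borel_measurable_integrable[OF f] by simp
  have [measurable]: "(\<lambda>z. LINT w|sphere_measure. f (shell_pair z w)) \<in> borel_measurable borel"
    by (rule S.borel_measurable_lebesgue_integral) measurable
  have i: "integrable (?D \<Otimes>\<^sub>M sphere_measure) (\<lambda>p. f (case_prod shell_pair p))"
    using f unfolding shell_measure[symmetric, where 'a='a]
    by (subst (asm) integrable_distr_eq[OF m]) auto
  then have i': "integrable (?D \<Otimes>\<^sub>M sphere_measure) (\<lambda>(z, w). f (shell_pair z w))" by (simp add: split_def)
  have "integrable ?D (\<lambda>z. LINT w|sphere_measure. f (shell_pair z w))"
    using P.integrable_fst'[OF i] by simp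
  then show "integrable lborel (\<lambda>z. of_real (shell_density z) * (LINT w|sphere_measure. f (shell_pair z w)))"
    by (subst (asm) integrable_density) (auto simp: shell_density_nonneg scaleR_conv_of_real)
  have "(LINT p|lborel. f p) = (LINT p|(?D \<Otimes>\<^sub>M sphere_measure). f (case_prod shell_pair p))"
    by (subst shell_measure[symmetric, where 'a='a], subst integral_distr[OF m]) auto
  also have "\<dots> = (LINT z|?D. LINT w|sphere_measure. f (shell_pair z w))"
    using P.integral_fst'[OF i] by simp
  also have "\<dots> = (LINT z|lborel. of_real (shell_density z) * (LINT w|sphere_measure. f (shell_pair z w)))"
    by (subst integral_density) (auto simp: shell_density_nonneg scaleR_conv_of_real)
  finally show "(LINT p|lborel. f p) = (LINT z|lborel. of_real (shell_density z) * (LINT w|sphere_measure. f (shell_pair z w)))" .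
qed

section \<open>The Fourier transform of a product of solutions\<close>

text \<open>On the ball of radius R the Gaussian is at least \<open>exp (- R\<^sup>2 / 2)\<close>,
  and F times the Gaussian is integrable.\<close>

lemma tempered_cutoff_integrable:
  fixes F :: "'a::euclidean_space \<Rightarrow> complex"
  assumes F: "tempered F"
  shows "integrable lborel (cutoff R F)"
proof (rule Bochner_Integration.integrable_bound)
  show "integrable lborel (\<lambda>x. of_real (exp (R\<^sup>2 / 2)) * (F x * of_real (gaussian x)))"
    by (intro integrable_mult_right tempered_gaussian_integrable F)
  show "cutoff R F \<in> borel_measurable lborel"
    using tempered_measurable[OF F] by (intro cutoff_measurable) simp
  show "AE x in lborel. norm (cutoff R F x) \<le> norm (of_real (exp (R\<^sup>2 / 2)) * (F x * of_real (gaussian x)))"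
  proof (intro AE_I2)
    fix x
    show "norm (cutoff R F x) \<le> norm (of_real (exp (R\<^sup>2 / 2)) * (F x * of_real (gaussian x)))"
    proof (cases "norm x \<le> R")
      case True
      then have "(norm x)\<^sup>2 \<le> R\<^sup>2" by (intro power_mono) auto
      then have "1 \<le> exp (R\<^sup>2 / 2 + - (norm x)\<^sup>2 / 2)" by simp
      then have "1 \<le> exp (R\<^sup>2 / 2) * gaussian x" unfolding gaussian_def exp_add .
      then have "norm (F x) * 1 \<le> norm (F x) * (exp (R\<^sup>2 / 2) * gaussian x)" by (intro mult_left_mono) auto
      then show ?thesis using True by (simp add: cutoff_def norm_mult gaussian_pos less_imp_le mult_ac)
    qed (simp add: cutoff_def)
  qed
qed

definition frequency :: "'a::euclidean_space \<times> 'a \<Rightarrow> real \<times> 'a" where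
  "frequency p = (- (norm (fst p))\<^sup>2 - (norm (snd p))\<^sup>2, fst p + snd p)"

lemma frequency_measurable [measurable]: "frequency \<in> borel_measurable borel"
  unfolding frequency_def by (intro borel_measurable_continuous_onI continuous_intros)

text \<open>The phases of two plane-wave solutions with frequencies \<zeta> and \<eta> add up to the
  pairing of z with \<open>frequency (\<zeta>, \<eta>)\<close>.\<close>

lemma free_solution_product_eq:
  fixes U V :: "'a::euclidean_space \<Rightarrow> complex"
  assumes U: "integrable lborel U" and V: "integrable lborel V"
  shows "free_solution U z * free_solution V z = of_real ((2 * pi) powr (- 2 * real DIM('a))) *
    (LINT p|lborel. (U (fst p) * V (snd p)) * exp (\<i> * of_real (frequency p \<bullet> z)))"
proof -
  obtain t x where z: "z = (t, x)" by (cases z)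
  let ?c = "complex_of_real ((2 * pi) powr (- real DIM('a)))"
  let ?e = "\<lambda>\<xi>::'a. exp (\<i> * of_real (x \<bullet> \<xi> - t * (norm \<xi>)\<^sup>2))"
  note borel_measurable_integrable[OF U, simplified, measurable] borel_measurable_integrable[OF V, simplified, measurable]
  have fs: "free_solution F z = ?c * (LINT \<xi>|lborel. F \<xi> * ?e \<xi>)" for F
  proof -
    have "exp (\<i> * of_real (x \<bullet> \<xi>)) * (exp (- \<i> * of_real (t * (norm \<xi>)\<^sup>2)) * F \<xi>) = F \<xi> * ?e \<xi>" for \<xi>
      by (simp add: algebra_simps exp_diff exp_minus field_simps)
    then show ?thesis by (simp only: free_solution_def z prod.case)
  qed
  have e1: "norm (?e \<xi>) \<le> 1" for \<xi> by simp
  have iU: "integrable lborel (\<lambda>\<xi>. U \<xi> * ?e \<xi>)" by (rule integrable_mult_bounded[OF U _ e1]) measurable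
  have iV: "integrable lborel (\<lambda>\<xi>. V \<xi> * ?e \<xi>)" by (rule integrable_mult_bounded[OF V _ e1]) measurable
  have ip: "integrable (lborel \<Otimes>\<^sub>M lborel) (\<lambda>(\<zeta>, \<eta>). (U \<zeta> * ?e \<zeta>) * (V \<eta> * ?e \<eta>))"
    by (rule integrable_pair_times[OF iU iV])
  have "(LINT \<xi>|lborel. U \<xi> * ?e \<xi>) * (LINT \<xi>|lborel. V \<xi> * ?e \<xi>) =
    (LINT \<zeta>|lborel. LINT \<eta>|lborel. (U \<zeta> * ?e \<zeta>) * (V \<eta> * ?e \<eta>))"
    by (simp only: integral_mult_right_zero integral_mult_left_zero)
  also have "\<dots> = (LINT p|(lborel \<Otimes>\<^sub>M lborel). (case p of (\<zeta>, \<eta>) \<Rightarrow> (U \<zeta> * ?e \<zeta>) * (V \<eta> * ?e \<eta>)))"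
    using lborel_pair.integral_fst'[OF ip] by simp
  also have "\<dots> = (LINT p|lborel. (U (fst p) * V (snd p)) * exp (\<i> * of_real (frequency p \<bullet> z)))"
    unfolding lborel_prod
  proof (rule Bochner_Integration.integral_cong[OF refl])
    fix p :: "'a \<times> 'a"
    have "?e (fst p) * ?e (snd p) = exp (\<i> * of_real (frequency p \<bullet> z))"
      by (simp add: mult_exp_exp frequency_def z inner_add_left inner_commute[of x]) (simp add: algebra_simps)
    then have "(U (fst p) * ?e (fst p)) * (V (snd p) * ?e (snd p)) = (U (fst p) * V (snd p)) * exp (\<i> * of_real (frequency p \<bullet> z))"
      by (simp only: mult_ac)
    then show "(case p of (\<zeta>, \<eta>) \<Rightarrow> (U \<zeta> * ?e \<zeta>) * (V \<eta> * ?e \<eta>)) = (U (fst p) * V (snd p)) * exp (\<i> * of_real (frequency p \<bullet> z))"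
      by (simp only: split_def)
  qed
  finally have "free_solution U z * free_solution V z = (?c * ?c) * (LINT p|lborel. (U (fst p) * V (snd p)) * exp (\<i> * of_real (frequency p \<bullet> z)))"
    unfolding fs by (simp only: mult_ac)
  also have "?c * ?c = of_real ((2 * pi) powr (- 2 * real DIM('a)))"
    by (simp flip: of_real_mult powr_add)
  finally show ?thesis .
qed

text \<open>By Fubini the integral over z is an inverse transform in dimension 1 + d and returns
  \<phi> at the frequency of the pair. The two free solutions contribute (2 \<pi>)^(-2 d) and the
  inversion (2 \<pi>)^(1 + d), whence the exponent 1 - d.\<close>

lemma distr_of_free_solution_product:
  fixes U V :: "'a::euclidean_space \<Rightarrow> complex"
  assumes U: "integrable lborel U" and V: "integrable lborel V" and \<phi>: "schwartz \<phi>"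
  shows "distr_of (\<lambda>z. free_solution U z * free_solution V z) (fourier_integral \<phi>) =
    of_real ((2 * pi) powr (1 - real DIM('a))) * (LINT p|lborel. U (fst p) * V (snd p) * \<phi> (frequency p))"
proof -
  let ?c = "complex_of_real ((2 * pi) powr (- 2 * real DIM('a)))"
  let ?h = "fourier_integral \<phi>"
  note borel_measurable_integrable[OF U, simplified, measurable] borel_measurable_integrable[OF V, simplified, measurable]
    schwartz_integrable0(2)[OF \<phi>, measurable]
  have hi: "integrable lborel ?h" by (rule fourier_schwartz_integrable[OF \<phi>])
  have UV: "integrable lborel (\<lambda>p. U (fst p) * V (snd p))"
    using integrable_pair_times[OF U V] by (simp add: split_def lborel_prod)
  let ?F = "\<lambda>z p. ?h z * (U (fst p) * V (snd p)) * exp (\<i> * of_real (frequency p \<bullet> z))"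
  have [measurable]: "(\<lambda>x. U (fst (snd x)) * V (snd (snd x))) \<in> borel_measurable (lborel \<Otimes>\<^sub>M (lborel :: ('a \<times> 'a) measure))"
    using borel_measurable_integrable[OF UV] by measurable
  have int: "integrable (lborel \<Otimes>\<^sub>M lborel) (\<lambda>(z, p). ?F z p)"
    by (rule Bochner_Integration.integrable_bound[OF integrable_pair_times[OF hi UV]])
      (auto simp: norm_mult split_def)
  have "distr_of (\<lambda>z. free_solution U z * free_solution V z) ?h = (LINT z|lborel. ?c * (LINT p|lborel. ?F z p))"
    unfolding distr_of_def free_solution_product_eq[OF U V]
  proof (rule Bochner_Integration.integral_cong[OF refl])
    fix z
    show "?c * (LINT p|lborel. U (fst p) * V (snd p) * exp (\<i> * of_real (frequency p \<bullet> z))) * ?h z = ?c * (LINT p|lborel. ?F z p)"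
      unfolding mult.assoc[of "?h z"] integral_mult_right_zero by (simp only: ac_simps)
  qed
  also have "\<dots> = ?c * (LINT z|lborel. LINT p|lborel. ?F z p)" by (rule integral_mult_right_zero)
  also have "(LINT z|lborel. LINT p|lborel. ?F z p) = (LINT p|lborel. LINT z|lborel. ?F z p)"
    by (rule lborel_pair.Fubini_integral[OF int, symmetric])
  also have "\<dots> = (LINT p|lborel. (U (fst p) * V (snd p)) * (LINT z|lborel. ?h z * exp (\<i> * of_real (z \<bullet> frequency p))))"
    by (intro Bochner_Integration.integral_cong refl, subst integral_mult_right_zero[symmetric])
      (simp only: ac_simps inner_commute)
  also have "\<dots> = (LINT p|lborel. of_real ((2 * pi) powr (1 + real DIM('a))) * (U (fst p) * V (snd p) * \<phi> (frequency p)))"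
  proof (rule Bochner_Integration.integral_cong[OF refl])
    fix p :: "'a \<times> 'a"
    have "\<phi> (frequency p) = of_real ((2 * pi) powr - (1 + real DIM('a))) * (LINT z|lborel. ?h z * exp (\<i> * of_real (z \<bullet> frequency p)))"
      using fun_cong[OF schwartz_inversion[OF \<phi>], of "frequency p"] unfolding inv_fourier_def by simp
    then have "of_real ((2 * pi) powr (1 + real DIM('a))) * \<phi> (frequency p) =
       of_real ((2 * pi) powr (1 + real DIM('a)) * (2 * pi) powr - (1 + real DIM('a))) * (LINT z|lborel. ?h z * exp (\<i> * of_real (z \<bullet> frequency p)))"
      by (simp only: of_real_mult mult.assoc)
    also have "(2 * pi) powr (1 + real DIM('a)) * (2 * pi) powr - (1 + real DIM('a)) = 1"
      by (simp flip: powr_add)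
    finally have "(LINT z|lborel. ?h z * exp (\<i> * of_real (z \<bullet> frequency p))) = of_real ((2 * pi) powr (1 + real DIM('a))) * \<phi> (frequency p)"
      by simp
    then show "(U (fst p) * V (snd p)) * (LINT z|lborel. ?h z * exp (\<i> * of_real (z \<bullet> frequency p))) =
      of_real ((2 * pi) powr (1 + real DIM('a))) * (U (fst p) * V (snd p) * \<phi> (frequency p))"
      by (simp only: ac_simps)
  qed
  also have "\<dots> = of_real ((2 * pi) powr (1 + real DIM('a))) * (LINT p|lborel. U (fst p) * V (snd p) * \<phi> (frequency p))"
    by (rule integral_mult_right_zero)
  also have "?c * (of_real ((2 * pi) powr (1 + real DIM('a))) * X) = of_real ((2 * pi) powr (1 - real DIM('a))) * X" for X
  proof -
    have "(2 * pi) powr (- 2 * real DIM('a)) * (2 * pi) powr (1 + real DIM('a)) = (2 * pi) powr (1 - real DIM('a))"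
      by (subst powr_add[symmetric]) (simp add: algebra_simps)
    then show ?thesis by (metis mult.assoc of_real_mult)
  qed
  finally show ?thesis .
qed

text \<open>A condition on the tensor product rather than on each factor: if one factor vanishes
  almost everywhere, finite energy gives no bound for the other.\<close>

definition pair_growth :: "('a::euclidean_space \<Rightarrow> complex) \<Rightarrow> ('a \<Rightarrow> complex) \<Rightarrow> bool" where
  "pair_growth U V \<longleftrightarrow> (\<exists>N. integrable lborel (\<lambda>p. U (fst p) * V (snd p) / of_real ((1 + norm (fst p)) ^ N * (1 + norm (snd p)) ^ N)))"

text \<open>The time frequency is - |\<zeta>|^2 - |\<eta>|^2, so decay of \<phi> in z controls both
  \<zeta> and \<eta>.\<close>

lemma pair_growth_integrable:
  fixes U V :: "'a::euclidean_space \<Rightarrow> complex"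
  assumes g: "pair_growth U V" and [measurable]: "U \<in> borel_measurable borel" "V \<in> borel_measurable borel" and \<phi>: "schwartz \<phi>"
  shows "integrable lborel (\<lambda>p. U (fst p) * V (snd p) * \<phi> (frequency p))"
proof -
  note [measurable] = schwartz_integrable0(2)[OF \<phi>]
  have m[measurable]: "(\<lambda>p. U (fst p) * V (snd p)) \<in> borel_measurable (borel :: ('a \<times> 'a) measure)"
    unfolding borel_prod[symmetric] by measurable
  obtain N where N: "integrable lborel (\<lambda>p. U (fst p) * V (snd p) / of_real ((1 + norm (fst p)) ^ N * (1 + norm (snd p)) ^ N))"
    using g unfolding pair_growth_def by blast
  obtain C where C: "C > 0" "\<And>z. norm (\<phi> z) \<le> C / (1 + norm z) ^ N"
    using schwartz_decay0[OF \<phi>] by blast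
  have bd: "norm (\<phi> (frequency p)) \<le> C * 2 ^ N / ((1 + norm (fst p)) ^ N * (1 + norm (snd p)) ^ N)" for p :: "'a \<times> 'a"
  proof -
    let ?a = "norm (fst p)" and ?b = "norm (snd p)"
    have "?a\<^sup>2 + ?b\<^sup>2 = norm (fst (frequency p))" by (simp add: frequency_def)
    also have "\<dots> \<le> norm (frequency p)" by (metis norm_fst_le prod.collapse)
    finally have 1: "?a\<^sup>2 + ?b\<^sup>2 \<le> norm (frequency p)" .
    \<comment> \<open>This sum of squares gives (1 + a)(1 + b) \<le> 2 (1 + a^2 + b^2), which is the
      origin of the factor \<open>2 ^ N\<close>.\<close>
    have "0 \<le> (?a - 1)\<^sup>2 + (?b - 1)\<^sup>2 + (?a - ?b)\<^sup>2" by simp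
    then have h: "?a + ?b + ?a * ?b \<le> 1 + ?a\<^sup>2 + ?b\<^sup>2"
      by (simp add: power2_eq_square algebra_simps)
    have "(1 + ?a) * (1 + ?b) = 1 + ?a + ?b + ?a * ?b" by (simp add: algebra_simps)
    also have "\<dots> \<le> 2 * (1 + (?a\<^sup>2 + ?b\<^sup>2))"
      using h zero_le_power2[of ?a] zero_le_power2[of ?b] by argo
    also have "\<dots> \<le> 2 * (1 + norm (frequency p))" using 1 by simp
    finally have "((1 + ?a) * (1 + ?b)) ^ N \<le> (2 * (1 + norm (frequency p))) ^ N"
      by (intro power_mono) auto
    then have 2: "(1 + ?a) ^ N * (1 + ?b) ^ N / 2 ^ N \<le> (1 + norm (frequency p)) ^ N"
      by (simp only: power_mult_distrib pos_divide_le_eq zero_less_power zero_less_numeral mult.commute mult.left_commute)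
    have p: "0 < (1 + ?a) ^ N * (1 + ?b) ^ N" by (intro mult_pos_pos zero_less_power add_pos_nonneg) auto
    have "C / (1 + norm (frequency p)) ^ N \<le> C / ((1 + ?a) ^ N * (1 + ?b) ^ N / 2 ^ N)"
      using C(1) p by (intro divide_left_mono 2 mult_pos_pos zero_less_power) (auto intro: add_pos_nonneg)
    then show ?thesis using C(2)[of "frequency p"] by (simp add: mult_ac)
  qed
  show ?thesis
  proof (rule Bochner_Integration.integrable_bound)
    show "integrable lborel (\<lambda>p. of_real (C * 2 ^ N) * (U (fst p) * V (snd p) / of_real ((1 + norm (fst p)) ^ N * (1 + norm (snd p)) ^ N)))"
      by (intro integrable_mult_right N)
    show "AE p in lborel. norm (U (fst p) * V (snd p) * \<phi> (frequency p)) \<le>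
      norm (of_real (C * 2 ^ N) * (U (fst p) * V (snd p) / of_real ((1 + norm (fst p)) ^ N * (1 + norm (snd p)) ^ N)))"
    proof (intro AE_I2)
      fix p :: "'a \<times> 'a"
      have p: "0 < (1 + norm (fst p)) ^ N * (1 + norm (snd p)) ^ N" by (intro mult_pos_pos zero_less_power add_pos_nonneg) auto
      have "norm (U (fst p) * V (snd p) * \<phi> (frequency p)) \<le> norm (U (fst p) * V (snd p)) * (C * 2 ^ N / ((1 + norm (fst p)) ^ N * (1 + norm (snd p)) ^ N))"
        unfolding norm_mult[of _ "\<phi> _"] by (intro mult_left_mono bd) auto
      also have "\<dots> = norm (of_real (C * 2 ^ N) * (U (fst p) * V (snd p) / of_real ((1 + norm (fst p)) ^ N * (1 + norm (snd p)) ^ N)))"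
        using C(1) p by (simp only: norm_mult norm_divide norm_of_real abs_of_pos[OF p] abs_of_pos[OF mult_pos_pos[OF C(1), of "2 ^ N"]] zero_less_power zero_less_numeral) (simp add: abs_of_pos mult_ac)
      finally show "norm (U (fst p) * V (snd p) * \<phi> (frequency p)) \<le>
        norm (of_real (C * 2 ^ N) * (U (fst p) * V (snd p) / of_real ((1 + norm (fst p)) ^ N * (1 + norm (snd p)) ^ N)))" .
    qed
  qed measurable
qed

text \<open>For each R the truncated transforms are integrable, so the formula for the pointwise
  product applies; the untruncated integrand dominates the limit in R.\<close>

lemma solution_product_fourier:
  fixes u0 v0 :: "'a::euclidean_space \<Rightarrow> complex"
  defines "U \<equiv> fourier u0" and "V \<equiv> fourier v0"
  assumes U: "tempered U" and V: "tempered V" and g: "pair_growth U V" and \<phi>: "schwartz \<phi>"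
  shows "solution_product u0 v0 (fourier_integral \<phi>) =
    of_real ((2 * pi) powr (1 - real DIM('a))) * (LINT p|lborel. U (fst p) * V (snd p) * \<phi> (frequency p))"
proof -
  note [measurable] = tempered_measurable[OF U] tempered_measurable[OF V] schwartz_integrable0(2)[OF \<phi>]
  have [measurable]: "(\<lambda>p. U (fst p) * V (snd p)) \<in> borel_measurable (borel :: ('a \<times> 'a) measure)"
    unfolding borel_prod[symmetric] by measurable
  have [measurable]: "(\<lambda>p. cutoff R U (fst p) * cutoff R V (snd p)) \<in> borel_measurable (borel :: ('a \<times> 'a) measure)" for R
    unfolding borel_prod[symmetric] cutoff_def by measurable
  have i: "integrable lborel (\<lambda>p. U (fst p) * V (snd p) * \<phi> (frequency p))"
    by (rule pair_growth_integrable[OF g _ _ \<phi>]) measurable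
  have "((\<lambda>R. LINT p|lborel. cutoff R U (fst p) * cutoff R V (snd p) * \<phi> (frequency p)) \<longlongrightarrow>
      (LINT p|lborel. U (fst p) * V (snd p) * \<phi> (frequency p))) at_top"
  proof (rule integral_dominated_convergence_at_top[where w="\<lambda>p. norm (U (fst p) * V (snd p) * \<phi> (frequency p))"])
    show "\<forall>\<^sub>F R in at_top. AE p in lborel. norm (cutoff R U (fst p) * cutoff R V (snd p) * \<phi> (frequency p)) \<le> norm (U (fst p) * V (snd p) * \<phi> (frequency p))"
      by (intro always_eventually allI AE_I2) (simp add: cutoff_def)
    show "AE p in lborel. ((\<lambda>R. cutoff R U (fst p) * cutoff R V (snd p) * \<phi> (frequency p)) \<longlongrightarrow> U (fst p) * V (snd p) * \<phi> (frequency p)) at_top"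
      by (intro AE_I2 tendsto_mult tendsto_const cutoff_tendsto)
  qed (use i in auto)
  then have "((\<lambda>R. of_real ((2 * pi) powr (1 - real DIM('a))) * (LINT p|lborel. cutoff R U (fst p) * cutoff R V (snd p) * \<phi> (frequency p))) \<longlongrightarrow>
      of_real ((2 * pi) powr (1 - real DIM('a))) * (LINT p|lborel. U (fst p) * V (snd p) * \<phi> (frequency p))) at_top"
    by (intro tendsto_mult tendsto_const)
  then show ?thesis
    unfolding solution_product_def
      distr_of_free_solution_product[OF tempered_cutoff_integrable[OF U] tempered_cutoff_integrable[OF V] \<phi>, unfolded U_def V_def]
      U_def V_def
    by (intro tendsto_Lim) auto
qed

lemma AE_sphere_measure_norm: "AE w in sphere_measure. norm (w :: 'a::euclidean_space) = 1"
proof -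
  have "AE y in uniform_measure lborel (cball (0::'a) 1). norm (sgn y) = 1"
  proof (rule AE_uniform_measureI)
    show "AE y in lborel. y \<in> cball (0::'a) 1 \<longrightarrow> norm (sgn y) = 1"
      using AE_lborel_singleton[of "0::'a"] by eventually_elim (simp add: norm_sgn)
  qed simp
  then show ?thesis unfolding sphere_measure_def
    by (subst AE_distr_iff) auto
qed

text \<open>The parallelogram law: the squared norms of the two members sum to |\<xi>|^2 / 2 plus
  the value of \<open>shell\<close>.\<close>

lemma frequency_shell_pair:
  assumes "norm w = 1" "shell z > 0"
  shows "frequency (shell_pair z w) = z"
proof -
  obtain t x where z: "z = (t, x)" by (cases z)
  let ?r = "sqrt (shell z / 2)"
  have s: "?r\<^sup>2 = shell z / 2" using assms(2) by simp
  have "(norm (x /\<^sub>R 2 + ?r *\<^sub>R w))\<^sup>2 + (norm (x /\<^sub>R 2 - ?r *\<^sub>R w))\<^sup>2 = 2 * (norm (x /\<^sub>R 2))\<^sup>2 + 2 * (norm (?r *\<^sub>R w))\<^sup>2"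
    unfolding power2_norm_eq_inner by (simp add: inner_add inner_diff algebra_simps)
  also have "\<dots> = (norm x)\<^sup>2 / 2 + shell z"
    using assms(1) s by (simp add: power_mult_distrib power2_eq_square[of "norm x"] power_divide)
  also have "\<dots> = - t" by (simp add: shell_def z)
  finally have "- (norm (x /\<^sub>R 2 + ?r *\<^sub>R w))\<^sup>2 - (norm (x /\<^sub>R 2 - ?r *\<^sub>R w))\<^sup>2 = t" by simp
  moreover have "(x /\<^sub>R 2 + ?r *\<^sub>R w) + (x /\<^sub>R 2 - ?r *\<^sub>R w) = x"
    using scaleR_half_double[of x] by (simp add: scaleR_2[symmetric])
  ultimately show ?thesis by (simp add: frequency_def shell_pair_def z)
qed

definition shell_mean :: "('a::euclidean_space \<Rightarrow> complex) \<Rightarrow> ('a \<Rightarrow> complex) \<Rightarrow> real \<times> 'a \<Rightarrow> complex" where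
  "shell_mean U V z = (LINT w|sphere_measure. U (fst (shell_pair z w)) * V (snd (shell_pair z w)))"

text \<open>Up to the power of 2 \<pi>, the density of the image of U(\<zeta>) V(\<eta>) d\<zeta>
  d\<eta> under \<open>frequency\<close>; it turns out to be the space-time Fourier transform of the
  product.\<close>

definition product_fourier :: "('a::euclidean_space \<Rightarrow> complex) \<Rightarrow> ('a \<Rightarrow> complex) \<Rightarrow> real \<times> 'a \<Rightarrow> complex" where
  "product_fourier U V z = of_real ((2 * pi) powr (1 - real DIM('a)) * shell_density z) * shell_mean U V z"

lemma shell_mean_measurable [measurable]:
  fixes U V :: "'a::euclidean_space \<Rightarrow> complex"
  assumes [measurable]: "U \<in> borel_measurable borel" "V \<in> borel_measurable borel"
  shows "shell_mean U V \<in> borel_measurable borel"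
proof -
  interpret S: prob_space "sphere_measure :: 'a measure" by (rule prob_space_sphere_measure)
  have [measurable]: "(\<lambda>p. U (fst p) * V (snd p)) \<in> borel_measurable (borel :: ('a \<times> 'a) measure)"
    unfolding borel_prod[symmetric] by measurable
  have "(\<lambda>z. LINT w|sphere_measure. (\<lambda>p. U (fst p) * V (snd p)) (shell_pair z w)) \<in> borel_measurable borel"
    by (rule S.borel_measurable_lebesgue_integral) measurable
  then show ?thesis unfolding shell_mean_def .
qed

lemma product_fourier_measurable [measurable]:
  assumes [measurable]: "U \<in> borel_measurable borel" "V \<in> borel_measurable borel"
  shows "product_fourier U V \<in> borel_measurable borel"
  unfolding product_fourier_def by measurable

lemma shell_density_pos_iff: "shell_density (z :: real \<times> 'a::euclidean_space) > 0 \<longleftrightarrow> shell z > 0"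
  by (auto simp: shell_density_def radial_density_def)

lemma shell_integral_schwartz:
  fixes U V :: "'a::euclidean_space \<Rightarrow> complex"
  assumes [measurable]: "U \<in> borel_measurable borel" "V \<in> borel_measurable borel" "\<phi> \<in> borel_measurable borel"
  shows "of_real (shell_density z) * (LINT w|sphere_measure. U (fst (shell_pair z w)) * V (snd (shell_pair z w)) * \<phi> (frequency (shell_pair z w)))
    = of_real (shell_density z) * (shell_mean U V z * \<phi> z)"
proof (cases "shell z > 0")
  case True
  have "(LINT w|sphere_measure. U (fst (shell_pair z w)) * V (snd (shell_pair z w)) * \<phi> (frequency (shell_pair z w))) =
     (LINT w|sphere_measure. U (fst (shell_pair z w)) * V (snd (shell_pair z w)) * \<phi> z)"
  proof -
    have "AE w in sphere_measure. U (fst (shell_pair z w)) * V (snd (shell_pair z w)) * \<phi> (frequency (shell_pair z w)) =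
      U (fst (shell_pair z w)) * V (snd (shell_pair z w)) * \<phi> z"
      using AE_sphere_measure_norm by eventually_elim (simp add: frequency_shell_pair True)
    moreover have [measurable]: "(\<lambda>p. U (fst p) * V (snd p)) \<in> borel_measurable (borel :: ('a \<times> 'a) measure)"
      unfolding borel_prod[symmetric] by measurable
    have "(\<lambda>w. (\<lambda>p. U (fst p) * V (snd p)) (shell_pair z w)) \<in> borel_measurable (sphere_measure :: 'a measure)"
      by measurable
    then have m1: "(\<lambda>w. U (fst (shell_pair z w)) * V (snd (shell_pair z w))) \<in> borel_measurable (sphere_measure :: 'a measure)" .
    have m2: "(\<lambda>w. \<phi> (frequency (shell_pair z w))) \<in> borel_measurable (sphere_measure :: 'a measure)"
      by measurable
    ultimately show ?thesis
      by (intro integral_cong_AE borel_measurable_times[OF m1 m2] borel_measurable_times[OF m1 borel_measurable_const])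
  qed
  then show ?thesis by (simp add: shell_mean_def)
next
  case False
  then have "shell_density z = 0" using shell_density_pos_iff[of z] shell_density_nonneg[of z] by linarith
  then show ?thesis by simp
qed

text \<open>Disintegrate the integral over pairs along \<open>frequency\<close>; the test function
  is constant on each fibre and leaves the inner integral.\<close>

lemma has_fourier_solution_product:
  fixes u0 v0 :: "'a::euclidean_space \<Rightarrow> complex"
  defines "U \<equiv> fourier u0" and "V \<equiv> fourier v0"
  assumes U: "tempered U" and V: "tempered V" and g: "pair_growth U V"
  shows "has_fourier (solution_product u0 v0) (product_fourier U V)"
proof -
  note [measurable] = tempered_measurable[OF U] tempered_measurable[OF V]
  have key: "integrable lborel (\<lambda>z. product_fourier U V z * \<phi> z) \<and>
     solution_product u0 v0 (fourier_integral \<phi>) = (LINT z|lborel. product_fourier U V z * \<phi> z)" if \<phi>: "schwartz \<phi>" for \<phi>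
  proof -
    let ?c = "complex_of_real ((2 * pi) powr (1 - real DIM('a)))"
    let ?f = "\<lambda>p. U (fst p) * V (snd p) * \<phi> (frequency p)"
    have i: "integrable lborel ?f"
      by (rule pair_growth_integrable[OF g _ _ \<phi>]) measurable
    note [measurable] = schwartz_integrable0(2)[OF \<phi>]
    have eq: "product_fourier U V z * \<phi> z = ?c * (of_real (shell_density z) * (LINT w|sphere_measure. ?f (shell_pair z w)))" for z
      by (subst shell_integral_schwartz) (simp_all add: product_fourier_def)
    show ?thesis
      unfolding eq
    proof
      show "integrable lborel (\<lambda>z. ?c * (of_real (shell_density z) * (LINT w|sphere_measure. ?f (shell_pair z w))))"
        by (intro integrable_mult_right integral_pair_shell(1)[OF i])
      show "solution_product u0 v0 (fourier_integral \<phi>) = (LINT z|lborel. ?c * (of_real (shell_density z) * (LINT w|sphere_measure. ?f (shell_pair z w))))"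
        unfolding integral_mult_right_zero integral_pair_shell(2)[OF i, symmetric]
        using solution_product_fourier[OF U[unfolded U_def] V[unfolded V_def] g[unfolded U_def V_def] \<phi>] unfolding U_def V_def .
    qed
  qed
  have "product_fourier U V \<in> borel_measurable lborel" by measurable
  then show ?thesis using key unfolding has_fourier_def tempered_def distr_of_def by blast
qed

section \<open>The sharp inequality\<close>

text \<open>The power of \<open>2 * shell z\<close> is the value on the fibre over z of |\<zeta> -
  \<eta>|^(4 b + d - 2); the exponent is halved because \<open>2 * shell z\<close> is the square of
  the distance.\<close>

definition shell_weight :: "real \<Rightarrow> real \<times> 'a::euclidean_space \<Rightarrow> real" where
  "shell_weight b z = shell_density z * (2 * shell z) powr (2 * b + DIM('a) / 2 - 1)"

text \<open>Up to a constant, the squared L^2 norm of the multiplied transform. In fibre coordinates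
  \<open>pair_energy\<close> has the same weight and differs only in that the modulus is squared
  before the mean is taken.\<close>

definition product_energy :: "real \<Rightarrow> ('a::euclidean_space \<Rightarrow> complex) \<Rightarrow> ('a \<Rightarrow> complex) \<Rightarrow> ennreal" where
  "product_energy b U V = (\<integral>\<^sup>+z. ennreal (shell_weight b z) * ennreal ((norm (shell_mean U V z))\<^sup>2) \<partial>lborel)"

definition pair_energy :: "real \<Rightarrow> ('a::euclidean_space \<Rightarrow> complex) \<Rightarrow> ('a \<Rightarrow> complex) \<Rightarrow> ennreal" where
  "pair_energy b U V = (\<integral>\<^sup>+ (\<zeta>, \<eta>). ennreal ((norm (U \<zeta>))\<^sup>2 * (norm (V \<eta>))\<^sup>2 *
       norm (\<zeta> - \<eta>) powr (4 * b + real DIM('a) - 2)) \<partial>lborel)"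

lemma I_fun_eq: "I_fun b f g = pair_energy b (fourier f) (fourier g)"
  by (simp add: I_fun_def pair_energy_def)

lemma shell_weight_measurable [measurable]: "shell_weight b \<in> borel_measurable borel"
  unfolding shell_weight_def by measurable

lemma shell_weight_nonneg: "shell_weight b z \<ge> 0"
  by (simp add: shell_weight_def shell_density_nonneg)

lemma shell_weight_pos_iff: "shell_weight b z > 0 \<longleftrightarrow> shell z > 0"
  using shell_density_pos_iff[of z] shell_density_nonneg[of z]
  by (auto simp: shell_weight_def zero_less_mult_iff not_less[symmetric])

lemma tensor_measurable [measurable]:
  fixes U V :: "'a::euclidean_space \<Rightarrow> complex"
  assumes [measurable]: "U \<in> borel_measurable borel" "V \<in> borel_measurable borel"
  shows "(\<lambda>p. U (fst p) * V (snd p)) \<in> borel_measurable (borel :: ('a \<times> 'a) measure)"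
  unfolding borel_prod[symmetric] by measurable

lemma pair_energy_shell:
  fixes U V :: "'a::euclidean_space \<Rightarrow> complex"
  assumes [measurable]: "U \<in> borel_measurable borel" "V \<in> borel_measurable borel"
  shows "pair_energy b U V = (\<integral>\<^sup>+z. ennreal (shell_weight b z) *
    (\<integral>\<^sup>+w. ennreal ((norm (U (fst (shell_pair z w)) * V (snd (shell_pair z w))))\<^sup>2) \<partial>sphere_measure) \<partial>lborel)"
proof -
  let ?\<gamma> = "4 * b + real DIM('a) - 2"
  let ?f = "\<lambda>p. ennreal ((norm (U (fst p) * V (snd p)))\<^sup>2)"
  let ?g = "\<lambda>p::'a \<times> 'a. ennreal (norm (fst p - snd p) powr ?\<gamma>)"
  have [measurable]: "?g \<in> borel_measurable borel"
    unfolding borel_prod[symmetric] by measurable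
  have "pair_energy b U V = (\<integral>\<^sup>+p. ?f p * ?g p \<partial>lborel)"
    unfolding pair_energy_def by (intro nn_integral_cong) (auto simp: norm_mult power_mult_distrib ennreal_mult split_def)
  also have "\<dots> = (\<integral>\<^sup>+z. ennreal (shell_density z) * (\<integral>\<^sup>+w. ?f (shell_pair z w) * ?g (shell_pair z w) \<partial>sphere_measure) \<partial>lborel)"
    by (rule nn_integral_pair_shell) measurable
  also have "\<dots> = (\<integral>\<^sup>+z. ennreal (shell_weight b z) * (\<integral>\<^sup>+w. ?f (shell_pair z w) \<partial>sphere_measure) \<partial>lborel)"
  proof (rule nn_integral_cong)
    fix z :: "real \<times> 'a"
    show "ennreal (shell_density z) * (\<integral>\<^sup>+w. ?f (shell_pair z w) * ?g (shell_pair z w) \<partial>sphere_measure) =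
      ennreal (shell_weight b z) * (\<integral>\<^sup>+w. ?f (shell_pair z w) \<partial>sphere_measure)"
    proof (cases "shell z > 0")
      case True
      let ?c = "(2 * shell z) powr (2 * b + DIM('a) / 2 - 1)"
      have g: "?g (shell_pair z w) = ennreal ?c" if "norm w = 1" for w
      proof -
        have "fst (shell_pair z w) - snd (shell_pair z w) = (2 * sqrt (shell z / 2)) *\<^sub>R w"
          by (simp add: shell_pair_def scaleR_2[symmetric])
        then have "norm (fst (shell_pair z w) - snd (shell_pair z w)) = 2 * sqrt (shell z / 2)"
          using True that by simp
        also have "\<dots> = sqrt (2 * shell z)"
          using True by (simp add: real_sqrt_mult real_sqrt_divide field_simps)
        finally have "norm (fst (shell_pair z w) - snd (shell_pair z w)) = (2 * shell z) powr (1 / 2)"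
          using True by (simp add: powr_half_sqrt)
        then show ?thesis by (simp add: powr_powr field_simps)
      qed
      have "(\<integral>\<^sup>+w. ?f (shell_pair z w) * ?g (shell_pair z w) \<partial>sphere_measure) = (\<integral>\<^sup>+w. ennreal ?c * ?f (shell_pair z w) \<partial>sphere_measure)"
      proof (rule nn_integral_cong_AE)
        show "AE w in sphere_measure. ?f (shell_pair z w) * ?g (shell_pair z w) = ennreal ?c * ?f (shell_pair z w)"
          using AE_sphere_measure_norm by eventually_elim (subst g, assumption, rule mult.commute)
      qed
      also have "\<dots> = ennreal ?c * (\<integral>\<^sup>+w. ?f (shell_pair z w) \<partial>sphere_measure)"
      proof (rule nn_integral_cmult)
        have "?f \<in> borel_measurable borel" by measurable
        then show "(\<lambda>w. ?f (shell_pair z w)) \<in> borel_measurable sphere_measure"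
          by (rule measurable_compose[rotated]) measurable
      qed
      finally show ?thesis by (simp add: shell_weight_def ennreal_mult shell_density_nonneg mult.assoc)
    next
      case False
      then have "shell_density z = 0" using shell_density_pos_iff[of z] shell_density_nonneg[of z] by linarith
      then show ?thesis by (simp add: shell_weight_def)
    qed
  qed
  finally show ?thesis .
qed

text \<open>Apply the disintegration to the indicator of the exceptional set; the density is
  positive exactly for \<open>shell z > 0\<close>.\<close>

lemma AE_shell:
  fixes P :: "'a::euclidean_space \<times> 'a \<Rightarrow> bool"
  assumes [measurable]: "Measurable.pred borel P"
  shows "(AE p in lborel. P p) \<longleftrightarrow> (AE z in lborel. shell z > 0 \<longrightarrow> (AE w in sphere_measure. P (shell_pair z w)))"
proof -
  interpret S: prob_space "sphere_measure :: 'a measure" by (rule prob_space_sphere_measure)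
  have m: "Measurable.pred (sphere_measure :: 'a measure) (\<lambda>w. P (shell_pair z w))" for z
    by (rule measurable_compose[OF _ assms]) measurable
  have [measurable]: "(\<lambda>p. indicator {p. \<not> P p} p :: ennreal) \<in> borel_measurable borel" by measurable
  have "(AE p in lborel. P p) \<longleftrightarrow> (\<integral>\<^sup>+p. indicator {p. \<not> P p} p \<partial>lborel) = 0"
    by (subst nn_integral_0_iff_AE) (auto simp: indicator_def)
  also have "\<dots> \<longleftrightarrow> (\<integral>\<^sup>+z. ennreal (shell_density z) * (\<integral>\<^sup>+w. indicator {p. \<not> P p} (shell_pair z w) \<partial>sphere_measure) \<partial>lborel) = 0"
    by (subst nn_integral_pair_shell) auto
  also have "\<dots> \<longleftrightarrow> (AE z in lborel. ennreal (shell_density z) * (\<integral>\<^sup>+w. indicator {p. \<not> P p} (shell_pair z w) \<partial>sphere_measure) = 0)"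
    by (rule nn_integral_0_iff_AE) measurable
  also have "\<dots> \<longleftrightarrow> (AE z in lborel. shell z > 0 \<longrightarrow> (AE w in sphere_measure. P (shell_pair z w)))"
  proof (rule AE_cong)
    fix z :: "real \<times> 'a"
    have "(\<integral>\<^sup>+w. indicator {p. \<not> P p} (shell_pair z w) \<partial>sphere_measure) = (0::ennreal) \<longleftrightarrow> (AE w in sphere_measure. P (shell_pair z w))"
      using m[of z] by (subst nn_integral_0_iff_AE) (auto simp: indicator_def)
    then show "(ennreal (shell_density z) * (\<integral>\<^sup>+w. indicator {p. \<not> P p} (shell_pair z w) \<partial>sphere_measure) = 0) \<longleftrightarrow>
      (shell z > 0 \<longrightarrow> (AE w in sphere_measure. P (shell_pair z w)))"
      using shell_density_pos_iff[of z] shell_density_nonneg[of z] by (auto simp: ennreal_eq_0_iff not_le)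
  qed
  finally show ?thesis .
qed

section \<open>Cauchy-Schwarz on the fibres and its equality case\<close>

lemma (in prob_space) norm_expectation_power2_le:
  fixes f :: "'a \<Rightarrow> complex"
  assumes [measurable]: "f \<in> borel_measurable M"
  shows "ennreal ((norm (LINT x|M. f x))\<^sup>2) \<le> (\<integral>\<^sup>+x. ennreal ((norm (f x))\<^sup>2) \<partial>M)"
proof (cases "integrable M f")
  case True
  have "ennreal (norm (LINT x|M. f x)) \<le> (\<integral>\<^sup>+x. ennreal (norm (f x)) * 1 \<partial>M)"
    using integral_norm_bound_ennreal[OF True] by simp
  then have "ennreal (norm (LINT x|M. f x)) ^ 2 \<le> (\<integral>\<^sup>+x. ennreal (norm (f x)) * 1 \<partial>M) ^ 2"
    by (intro power_mono) auto
  also have "\<dots> \<le> (\<integral>\<^sup>+x. ennreal (norm (f x)) ^ 2 \<partial>M) * (\<integral>\<^sup>+x. 1 ^ 2 \<partial>M)"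
    by (rule Cauchy_Schwarz_nn_integral) measurable
  finally show ?thesis by (simp add: ennreal_power emeasure_space_1)
\<comment> \<open>If f is not integrable, its integral is 0 by convention and the bound is
  trivial.\<close>
qed (simp add: not_integrable_integral_eq)

text \<open>Equality means that the variance is zero. The hypothesis makes the second moment finite,
  hence f integrable, so that the variance can be expanded.\<close>

lemma (in prob_space) AE_eq_expectation:
  fixes f :: "'a \<Rightarrow> complex"
  assumes [measurable]: "f \<in> borel_measurable M"
    and eq: "(\<integral>\<^sup>+x. ennreal ((norm (f x))\<^sup>2) \<partial>M) = ennreal ((norm (LINT x|M. f x))\<^sup>2)"
  shows "AE x in M. f x = (LINT x|M. f x)"
proof -
  define m where "m = (LINT x|M. f x)"
  have f2: "integrable M (\<lambda>x. (norm (f x))\<^sup>2)"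
    unfolding integrable_iff_bounded using eq by (simp add: ennreal_less_top)
  have f1: "integrable M f"
  proof (rule Bochner_Integration.integrable_bound[of _ "\<lambda>x. 1 + (norm (f x))\<^sup>2"])
    show "AE x in M. norm (f x) \<le> norm (1 + (norm (f x))\<^sup>2)"
    proof (intro AE_I2)
      fix x
      have "0 \<le> (norm (f x) - 1)\<^sup>2 + (norm (f x))\<^sup>2 + 1" by simp
      then have "norm (f x) \<le> 1 + (norm (f x))\<^sup>2" by (simp add: power2_eq_square algebra_simps)
      then show "norm (f x) \<le> norm (1 + (norm (f x))\<^sup>2)" by simp
    qed
  qed (use f2 in auto)
  have fm: "(LINT x|M. (norm (f x))\<^sup>2) = (norm m)\<^sup>2"
  proof -
    have "ennreal (LINT x|M. (norm (f x))\<^sup>2) = ennreal ((norm m)\<^sup>2)"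
      using eq unfolding m_def by (subst (asm) nn_integral_eq_integral[OF f2]) auto
    then show ?thesis by simp
  qed
  have e: "(norm (f x - m))\<^sup>2 = (norm (f x))\<^sup>2 + (norm m)\<^sup>2 - 2 * Re (f x * cnj m)" for x
    by (simp only: cmod_power2) (simp add: power2_eq_square algebra_simps)
  have i: "integrable M (\<lambda>x. (norm (f x - m))\<^sup>2)"
    unfolding e using f1 f2 by auto
  have fc: "integrable M (\<lambda>x. f x * cnj m)" using f1 by simp
  have irf: "integrable M (\<lambda>x. Re (f x * cnj m))" using fc by (rule integrable_Re)
  have fr: "(LINT x|M. Re (f x * cnj m)) = Re (m * cnj m)"
    using integral_Re[OF fc] by (simp only: integral_mult_left_zero m_def)
  have ic: "integrable M (\<lambda>x. (norm m)\<^sup>2)" by simp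
  have "(LINT x|M. (norm (f x - m))\<^sup>2) = (LINT x|M. (norm (f x))\<^sup>2) + (LINT x|M. (norm m)\<^sup>2) - 2 * Re (m * cnj m)"
    unfolding e
    by (simp only: Bochner_Integration.integral_diff[OF Bochner_Integration.integrable_add[OF f2 ic] integrable_mult_right[OF irf]]
        Bochner_Integration.integral_add[OF f2 ic] integral_mult_right_zero fr)
  also have "(LINT x|M. (norm m)\<^sup>2) = (norm m)\<^sup>2" by (simp add: prob_space)
  also have "(LINT x|M. (norm (f x))\<^sup>2) + (norm m)\<^sup>2 - 2 * Re (m * cnj m) = 0"
    unfolding fm by (simp only: cmod_power2) (simp add: power2_eq_square)
  finally have "AE x in M. (norm (f x - m))\<^sup>2 = 0"
    using integral_nonneg_eq_0_iff_AE[OF i] by simp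
  then show ?thesis unfolding m_def by eventually_elim simp
qed

lemma shell_tensor_measurable:
  fixes U V :: "'a::euclidean_space \<Rightarrow> complex"
  assumes [measurable]: "U \<in> borel_measurable borel" "V \<in> borel_measurable borel"
  shows "(\<lambda>w. U (fst (shell_pair z w)) * V (snd (shell_pair z w))) \<in> borel_measurable sphere_measure"
    "(\<lambda>z. \<integral>\<^sup>+w. ennreal ((norm (U (fst (shell_pair z w)) * V (snd (shell_pair z w))))\<^sup>2) \<partial>sphere_measure) \<in> borel_measurable borel"
proof -
  interpret S: prob_space "sphere_measure :: 'a measure" by (rule prob_space_sphere_measure)
  let ?t = "\<lambda>p. U (fst p) * V (snd p)"
  have "?t \<in> borel_measurable borel" by measurable
  then show "(\<lambda>w. U (fst (shell_pair z w)) * V (snd (shell_pair z w))) \<in> borel_measurable sphere_measure"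
    by (rule measurable_compose[rotated]) measurable
  have "(\<lambda>p. ennreal ((norm (?t p))\<^sup>2)) \<in> borel_measurable borel" by measurable
  then have [measurable]: "(\<lambda>x. ennreal ((norm (?t (case_prod shell_pair x)))\<^sup>2)) \<in> borel_measurable (borel \<Otimes>\<^sub>M borel)"
    by (rule measurable_compose[rotated]) measurable
  then have "(\<lambda>(z, w). ennreal ((norm (?t (shell_pair z w)))\<^sup>2)) \<in> borel_measurable (borel \<Otimes>\<^sub>M sphere_measure)"
    by (simp add: split_def cong: measurable_cong_sets sets_pair_measure_cong)
  then show "(\<lambda>z. \<integral>\<^sup>+w. ennreal ((norm (U (fst (shell_pair z w)) * V (snd (shell_pair z w))))\<^sup>2) \<partial>sphere_measure) \<in> borel_measurable borel"
    using S.borel_measurable_nn_integral_fst by fastforce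
qed

lemma product_energy_le:
  fixes U V :: "'a::euclidean_space \<Rightarrow> complex"
  assumes m[measurable]: "U \<in> borel_measurable borel" "V \<in> borel_measurable borel"
  shows "product_energy b U V \<le> pair_energy b U V"
  unfolding pair_energy_shell[OF m] product_energy_def shell_mean_def
  by (intro nn_integral_mono mult_left_mono prob_space.norm_expectation_power2_le[OF prob_space_sphere_measure] shell_tensor_measurable m) auto

text \<open>If the energies agree, the fibrewise Cauchy-Schwarz inequality is an equality on almost
  every fibre, so the tensor product equals its mean there; the mean, as a function of the
  frequency, is the required L. Conversely a function of the frequency equals its own mean on each
  fibre.\<close>

lemma product_energy_eq_iff:
  fixes U V :: "'a::euclidean_space \<Rightarrow> complex"
  assumes m[measurable]: "U \<in> borel_measurable borel" "V \<in> borel_measurable borel" and fin: "pair_energy b U V < \<infinity>"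
  shows "product_energy b U V = pair_energy b U V \<longleftrightarrow>
    (\<exists>L. L \<in> borel_measurable borel \<and> (AE p in lborel. U (fst p) * V (snd p) = L (frequency p)))"
proof
  assume eq: "product_energy b U V = pair_energy b U V"
  let ?Q = "\<lambda>z. \<integral>\<^sup>+w. ennreal ((norm (U (fst (shell_pair z w)) * V (snd (shell_pair z w))))\<^sup>2) \<partial>sphere_measure"
  let ?M = "shell_mean U V"
  let ?k = "\<lambda>z. ennreal (shell_weight b z)"
  note [measurable] = shell_tensor_measurable(2)[OF m]
  have le: "ennreal ((norm (?M z))\<^sup>2) \<le> ?Q z" for z
    unfolding shell_mean_def
    by (intro prob_space.norm_expectation_power2_le[OF prob_space_sphere_measure] shell_tensor_measurable m)
  \<comment> \<open>Finiteness of the energy excludes \<infinity> - \<infinity> here, and below it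
    makes the integrand finite on almost every fibre.\<close>
  have "(\<integral>\<^sup>+z. ?k z * ?Q z - ?k z * ennreal ((norm (?M z))\<^sup>2) \<partial>lborel) = pair_energy b U V - product_energy b U V"
    unfolding pair_energy_shell[OF m] product_energy_def
  proof (rule nn_integral_diff)
    show "(\<integral>\<^sup>+z. ?k z * ennreal ((norm (?M z))\<^sup>2) \<partial>lborel) \<noteq> \<infinity>"
      using eq fin unfolding product_energy_def by auto
    show "AE z in lborel. ?k z * ennreal ((norm (?M z))\<^sup>2) \<le> ?k z * ?Q z"
      by (intro AE_I2 mult_left_mono le) auto
  qed measurable
  also have "\<dots> = 0" using eq fin by simp
  finally have "AE z in lborel. ?k z * ?Q z - ?k z * ennreal ((norm (?M z))\<^sup>2) = 0"
    by (subst (asm) nn_integral_0_iff_AE) auto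
  moreover have "(\<integral>\<^sup>+z. ?k z * ?Q z \<partial>lborel) \<noteq> \<infinity>"
    using fin unfolding pair_energy_shell[OF m] by simp
  then have "AE z in lborel. ?k z * ?Q z \<noteq> \<infinity>" by (intro nn_integral_PInf_AE) auto
  ultimately have "AE z in lborel. shell z > 0 \<longrightarrow> (AE w in sphere_measure. U (fst (shell_pair z w)) * V (snd (shell_pair z w)) = ?M (frequency (shell_pair z w)))"
  proof eventually_elim
    case (elim z)
    show ?case
    proof
      assume s: "shell z > 0"
      \<comment> \<open>The weight is positive and finite on nondegenerate fibres, so it can be
        cancelled.\<close>
      then have k: "?k z \<noteq> 0" "?k z \<noteq> \<top>" using shell_weight_pos_iff[of b z] by (auto simp: ennreal_eq_0_iff)
      have "?k z * ?Q z \<le> ?k z * ennreal ((norm (?M z))\<^sup>2)"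
        using elim(1) by (simp add: diff_eq_0_iff_ennreal)
      then have "?k z * ?Q z = ?k z * ennreal ((norm (?M z))\<^sup>2)"
        using mult_left_mono[OF le[of z], of "?k z"] by (intro antisym) auto
      then have "?Q z = ennreal ((norm (?M z))\<^sup>2)"
        using k by (simp add: ennreal_mult_cancel_left)
      then have "AE w in sphere_measure. U (fst (shell_pair z w)) * V (snd (shell_pair z w)) = ?M z"
        unfolding shell_mean_def
        by (intro prob_space.AE_eq_expectation[OF prob_space_sphere_measure] shell_tensor_measurable m)
      then show "AE w in sphere_measure. U (fst (shell_pair z w)) * V (snd (shell_pair z w)) = ?M (frequency (shell_pair z w))"
        using AE_sphere_measure_norm by eventually_elim (simp add: frequency_shell_pair s)
    qed
  qed
  then have "AE p in lborel. U (fst p) * V (snd p) = ?M (frequency p)"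
    by (subst AE_shell) auto
  then show "\<exists>L. L \<in> borel_measurable borel \<and> (AE p in lborel. U (fst p) * V (snd p) = L (frequency p))"
    by (intro exI[of _ ?M] conjI shell_mean_measurable m)
next
  assume "\<exists>L. L \<in> borel_measurable borel \<and> (AE p in lborel. U (fst p) * V (snd p) = L (frequency p))"
  then obtain L where [measurable]: "L \<in> borel_measurable borel" and "AE p in lborel. U (fst p) * V (snd p) = L (frequency p)" by blast
  then have AE: "AE z in lborel. shell z > 0 \<longrightarrow> (AE w in sphere_measure. U (fst (shell_pair z w)) * V (snd (shell_pair z w)) = L (frequency (shell_pair z w)))"
    by (subst (asm) AE_shell) auto
  interpret S: prob_space "sphere_measure :: 'a measure" by (rule prob_space_sphere_measure)
  show "product_energy b U V = pair_energy b U V"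
    unfolding pair_energy_shell[OF m] product_energy_def
  proof (rule nn_integral_cong_AE, use AE in eventually_elim)
    case (elim z)
    show ?case
    proof (cases "shell z > 0")
      case True
      have AE': "AE w in sphere_measure. U (fst (shell_pair z w)) * V (snd (shell_pair z w)) = L z"
        using elim[rule_format, OF True] AE_sphere_measure_norm by eventually_elim (simp add: frequency_shell_pair True)
      have "shell_mean U V z = (LINT w|(sphere_measure :: 'a measure). L z)"
        unfolding shell_mean_def by (intro integral_cong_AE AE' shell_tensor_measurable m) simp
      also have "\<dots> = L z" using S.prob_space by simp
      finally have "ennreal ((norm (shell_mean U V z))\<^sup>2) = (\<integral>\<^sup>+w. ennreal ((norm (L z))\<^sup>2) \<partial>(sphere_measure :: 'a measure))"
        using S.emeasure_space_1 by simp
      also have "\<dots> = (\<integral>\<^sup>+w. ennreal ((norm (U (fst (shell_pair z w)) * V (snd (shell_pair z w))))\<^sup>2) \<partial>sphere_measure)"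
        by (rule nn_integral_cong_AE[OF eventually_mono[OF AE']]) simp
      finally show ?thesis by simp
    next
      case False
      then have "shell_weight b z = 0" using shell_weight_pos_iff[of b z] shell_weight_nonneg[of b z] by linarith
      then show ?thesis by simp
    qed
  qed
qed

section \<open>The constant and the norm of the product\<close>

text \<open>One of the two density factors is written out as a power of s and merged with the
  multiplier; the other one stays as part of \<open>shell_weight\<close>. All remaining factors are
  constants.\<close>

lemma multiplier_constant:
  fixes b s n :: real
  assumes "s > 0" "n > 0"
  shows "(s powr b)\<^sup>2 * ((2 * pi) powr (1 - n) * radial_density n s)\<^sup>2 =
    ((2 * pi) powr (2 - 2 * n) * unit_ball_vol n * n * 2 powr (- n - 2 * b)) * (radial_density n s * (2 * s) powr (2 * b + n / 2 - 1))"
proof -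
  have r: "radial_density n s = unit_ball_vol n * (n / 4) * (s / 2) powr (n / 2 - 1)"
    using assms by (simp add: radial_density_def)
  have "(s powr b)\<^sup>2 = s powr (2 * b)" using assms by (simp add: power2_eq_square flip: powr_add)
  moreover have "((2 * pi) powr (1 - n))\<^sup>2 = (2 * pi) powr (2 - 2 * n)" by (simp add: power2_eq_square flip: powr_add)
  moreover have "s powr (2 * b) * radial_density n s = unit_ball_vol n * n * 2 powr (- n - 2 * b) * (2 * s) powr (2 * b + n / 2 - 1)"
  proof -
    have 2: "(2::real) powr (- n - 2 * b) * 2 powr (2 * b + n / 2 - 1) = (1 / 4) * (1 / 2 powr (n / 2 - 1))"
    proof -
      have "(2::real) powr (- n - 2 * b) * 2 powr (2 * b + n / 2 - 1) = 2 powr (- 2 + - (n / 2 - 1))"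
        unfolding powr_add[symmetric] by (rule arg_cong[where f="\<lambda>x. 2 powr x"]) (simp add: field_simps)
      also have "\<dots> = 2 powr (- 2) * 2 powr (- (n / 2 - 1))" by (rule powr_add)
      finally show ?thesis by (simp add: powr_minus field_simps powr_numeral)
    qed
    have "s powr (2 * b) * radial_density n s = unit_ball_vol n * n * ((1 / 4) * (1 / 2 powr (n / 2 - 1))) * (s powr (2 * b) * s powr (n / 2 - 1))"
      unfolding r using assms by (simp add: powr_divide)
    also have "s powr (2 * b) * s powr (n / 2 - 1) = s powr (2 * b + n / 2 - 1)"
      by (subst powr_add[symmetric]) (simp only: add_diff_eq)
    finally show ?thesis unfolding 2[symmetric] using assms by (simp add: powr_mult)
  qed
  ultimately show ?thesis
    by (simp add: power_mult_distrib power2_eq_square[of "radial_density n s"])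
qed

text \<open>\<open>unit_ball_vol d * d\<close> is the area 2 \<pi>^(d/2) / \<Gamma>(d/2) of the unit
  sphere; the rest is bookkeeping of powers of 2 and \<pi>. The factor
  \<open>(2 * pi) powr (1 + real d)\<close> on the left is the Plancherel factor of
  space-time.\<close>

lemma sharp_const_eq:
  fixes b :: real
  assumes "d > 0"
  shows "2 powr (- 2 * b) * sharp_const d * (2 * pi) powr (1 + real d) =
    (2 * pi) powr (2 - 2 * real d) * unit_ball_vol (real d) * real d * 2 powr (- real d - 2 * b)"
proof -
  let ?n = "real d"
  have G: "Gamma (?n / 2 + 1) = ?n / 2 * Gamma (?n / 2)"
    using assms by (intro Gamma_plus1) auto
  have Gp: "Gamma (?n / 2) > 0" using assms by (intro Gamma_real_pos) auto
  have v: "unit_ball_vol ?n * ?n = 2 * pi powr (?n / 2) / Gamma (?n / 2)"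
    unfolding unit_ball_vol_def G using assms Gp by (simp add: field_simps)
  have 2: "(2::real) powr (- 2 * b) * 2 powr (2 - 4 * ?n) * 2 powr (1 + ?n) = 2 powr (2 - 2 * ?n) * 2 * 2 powr (- ?n - 2 * b)"
  proof -
    have "(2::real) powr (- 2 * b) * 2 powr (2 - 4 * ?n) * 2 powr (1 + ?n) = 2 powr (2 - 2 * ?n) * 2 powr 1 * 2 powr (- ?n - 2 * b)"
      unfolding powr_add[symmetric] by (rule arg_cong[where f="\<lambda>x. 2 powr x"]) (simp add: algebra_simps)
    then show ?thesis by simp
  qed
  have p: "pi powr ((2 - 5 * ?n) / 2) * pi powr (1 + ?n) = pi powr (2 - 2 * ?n) * pi powr (?n / 2)"
    unfolding powr_add[symmetric] by (rule arg_cong[where f="\<lambda>x. pi powr x"]) (simp add: field_simps)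
  have "2 powr (- 2 * b) * sharp_const d * (2 * pi) powr (1 + ?n) =
     (2 powr (- 2 * b) * 2 powr (2 - 4 * ?n) * 2 powr (1 + ?n)) * (pi powr ((2 - 5 * ?n) / 2) * pi powr (1 + ?n)) / Gamma (?n / 2)"
    by (simp add: sharp_const_def powr_mult)
  also have "\<dots> = (2 * pi) powr (2 - 2 * ?n) * (2 * pi powr (?n / 2) / Gamma (?n / 2)) * 2 powr (- ?n - 2 * b)"
    unfolding 2 p by (simp add: powr_mult)
  also have "\<dots> = (2 * pi) powr (2 - 2 * ?n) * unit_ball_vol ?n * ?n * 2 powr (- ?n - 2 * b)"
    unfolding v[symmetric] by simp
  finally show ?thesis .
qed

lemma D_multiplier_eq: "D_multiplier b z = \<bar>shell z\<bar> powr b"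
proof -
  have "shell z = - (fst z + (norm (snd z))\<^sup>2 / 2)" by (simp add: shell_def)
  then show ?thesis by (simp only: D_multiplier_def split_def abs_minus_cancel)
qed

lemma D_multiplier_measurable [measurable]: "D_multiplier b \<in> borel_measurable borel"
  unfolding D_multiplier_eq[abs_def] by measurable

lemma nn_integral_multiplier:
  fixes U V :: "'a::euclidean_space \<Rightarrow> complex"
  assumes [measurable]: "U \<in> borel_measurable borel" "V \<in> borel_measurable borel"
  shows "(\<integral>\<^sup>+z. ennreal ((norm (of_real (D_multiplier b z) * product_fourier U V z))\<^sup>2) \<partial>lborel) =
    ennreal (2 powr (- 2 * b) * sharp_const DIM('a) * (2 * pi) powr (1 + real DIM('a))) * product_energy b U V"
proof -
  let ?A = "(2 * pi) powr (2 - 2 * real DIM('a)) * unit_ball_vol (real DIM('a)) * real DIM('a) * 2 powr (- real DIM('a) - 2 * b)"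
  have A: "?A \<ge> 0" by (intro mult_nonneg_nonneg) auto
  have "ennreal ((norm (of_real (D_multiplier b z) * product_fourier U V z))\<^sup>2) =
     ennreal ?A * (ennreal (shell_weight b z) * ennreal ((norm (shell_mean U V z))\<^sup>2))" for z :: "real \<times> 'a"
  proof (cases "shell z > 0")
    case True
    have "(norm (of_real (D_multiplier b z) * product_fourier U V z))\<^sup>2 =
      ((shell z powr b)\<^sup>2 * ((2 * pi) powr (1 - real DIM('a)) * radial_density DIM('a) (shell z))\<^sup>2) * (norm (shell_mean U V z))\<^sup>2"
      using True by (simp add: D_multiplier_eq product_fourier_def norm_mult power_mult_distrib shell_density_def)
    also have "\<dots> = ?A * (shell_weight b z * (norm (shell_mean U V z))\<^sup>2)"
      by (subst multiplier_constant[OF True]) (simp_all add: shell_weight_def shell_density_def)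
    finally show ?thesis
      using A by (simp add: ennreal_mult shell_weight_nonneg)
  next
    case False
    then have "shell_density z = 0" using shell_density_pos_iff[of z] shell_density_nonneg[of z] by linarith
    then show ?thesis by (simp add: shell_weight_def product_fourier_def)
  qed
  then show ?thesis
    unfolding product_energy_def sharp_const_eq[OF DIM_positive] by (simp add: nn_integral_cmult)
qed

text \<open>The multiplied transform is square integrable, so it has an L^2 preimage. Uniqueness of
  transforms and of preimages leaves one value in the infimum, and Plancherel evaluates it.\<close>

theorem D_power_norm_sq_solution_product:
  fixes u0 v0 :: "'a::euclidean_space \<Rightarrow> complex"
  defines "U \<equiv> fourier u0" and "V \<equiv> fourier v0"
  assumes U: "tempered U" and V: "tempered V" and g: "pair_growth U V" and fin: "product_energy b U V < \<infinity>"
  shows "D_power_norm_sq b (solution_product u0 v0) = ennreal (2 powr (- 2 * b) * sharp_const DIM('a)) * product_energy b U V"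
proof -
  note [measurable] = tempered_measurable[OF U] tempered_measurable[OF V]
  let ?T = "solution_product u0 v0"
  let ?W = "product_fourier U V"
  let ?H = "\<lambda>z. of_real (D_multiplier b z) * ?W z"
  let ?B = "2 powr (- 2 * b) * sharp_const DIM('a)" and ?c = "(2 * pi) powr (1 + real DIM('a))"
  have B: "?B \<ge> 0" unfolding sharp_const_def by (intro mult_nonneg_nonneg divide_nonneg_nonneg Gamma_real_nonneg) auto
  have W: "has_fourier ?T ?W"
    unfolding U_def V_def by (rule has_fourier_solution_product[OF U[unfolded U_def] V[unfolded V_def] g[unfolded U_def V_def]])
  have H: "sq_int ?H"
    unfolding sq_int_iff nn_integral_multiplier[OF tempered_measurable[OF U] tempered_measurable[OF V]]
    using fin by (auto simp: ennreal_mult_less_top)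
  obtain G where G: "sq_int G" "has_fourier (distr_of G) ?H" "(2 * pi) powr (DIM(real \<times> 'a) / 2) * l2norm G = l2norm ?H"
    using l2_inverse_fourier[OF H] by blast
  have tG: "tempered G" using G(1) by (intro tempered_square_integrable) (auto simp: sq_int_iff)
  have hG: "has_D_power b ?T G" unfolding has_D_power_def using tG W G(2) by blast
  \<comment> \<open>Another witness may use another transform W' of the product, but W' agrees with
    \<open>?W\<close> almost everywhere, and so do the multiplied transforms and their
    preimages.\<close>
  have uniq: "(\<integral>\<^sup>+z. ennreal ((norm (G' z))\<^sup>2) \<partial>lborel) = (\<integral>\<^sup>+z. ennreal ((norm (G z))\<^sup>2) \<partial>lborel)" if "has_D_power b ?T G'" for G'
  proof -
    from that obtain W' where t': "tempered G'" and W': "has_fourier ?T W'" and H': "has_fourier (distr_of G') (\<lambda>z. of_real (D_multiplier b z) * W' z)"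
      unfolding has_D_power_def by blast
    have [measurable]: "W' \<in> borel_measurable borel" using W' by (simp add: has_fourier_def tempered_def)
    have "AE z in lborel. W' z = ?W z" by (rule has_fourier_unique[OF W' W])
    then have AE: "AE z in lborel. of_real (D_multiplier b z) * W' z = ?H z" by eventually_elim simp
    have H'': "has_fourier (distr_of G') ?H"
      by (rule has_fourier_cong_AE[OF H' AE]) measurable
    have "AE z in lborel. G' z = G z"
      using H'' G(2) by (intro fourier_unique_preimage t' tG) (simp add: has_fourier_def)
    then show ?thesis by (rule nn_integral_cong_AE[OF eventually_mono]) simp
  qed
  have "D_power_norm_sq b ?T = (INF G'\<in>{G. has_D_power b ?T G}. (\<integral>\<^sup>+z. ennreal ((norm (G z))\<^sup>2) \<partial>lborel))"
    unfolding D_power_norm_sq_def by (intro INF_cong refl) (simp add: uniq)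
  also have "\<dots> = (\<integral>\<^sup>+z. ennreal ((norm (G z))\<^sup>2) \<partial>lborel)"
    using hG by (intro cINF_const) auto
  finally have D: "D_power_norm_sq b ?T = ennreal ((l2norm G)\<^sup>2)" unfolding nn_integral_sq_int[OF G(1)] .
  have "ennreal (?c * (l2norm G)\<^sup>2) = ennreal ((l2norm ?H)\<^sup>2)"
  proof -
    have "(l2norm ?H)\<^sup>2 = ((2 * pi) powr (DIM(real \<times> 'a) / 2))\<^sup>2 * (l2norm G)\<^sup>2"
      unfolding G(3)[symmetric] power_mult_distrib ..
    also have "((2 * pi) powr (DIM(real \<times> 'a) / 2))\<^sup>2 = ?c"
      unfolding power2_eq_square two_pi_powr_half by simp
    finally show ?thesis by simp
  qed
  also have "\<dots> = ennreal (?B * ?c) * product_energy b U V"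
    unfolding nn_integral_sq_int[OF H, symmetric] by (rule nn_integral_multiplier) measurable
  also have "ennreal (?B * ?c) = ennreal ?B * ennreal ?c" by (rule ennreal_mult[OF B]) simp
  also have "ennreal (?c * (l2norm G)\<^sup>2) = ennreal ?c * ennreal ((l2norm G)\<^sup>2)" by (rule ennreal_mult) auto
  finally have e: "ennreal ?c * ennreal ((l2norm G)\<^sup>2) = ennreal ?c * (ennreal ?B * product_energy b U V)"
    by (simp only: mult_ac)
  have "ennreal ((l2norm G)\<^sup>2) = ennreal ?B * product_energy b U V"
    using e by (subst (asm) ennreal_mult_cancel_left) (auto simp: ennreal_eq_0_iff)
  then show ?thesis unfolding D .
qed

section \<open>Growth of the data\<close>

lemma pair_energy_iterated:
  fixes U V :: "'a::euclidean_space \<Rightarrow> complex"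
  assumes [measurable]: "U \<in> borel_measurable borel" "V \<in> borel_measurable borel"
  shows "pair_energy b U V = (\<integral>\<^sup>+\<zeta>. \<integral>\<^sup>+\<eta>. ennreal ((norm (U \<zeta>))\<^sup>2 * (norm (V \<eta>))\<^sup>2 *
       norm (\<zeta> - \<eta>) powr (4 * b + real DIM('a) - 2)) \<partial>lborel \<partial>lborel)"
  unfolding pair_energy_def lborel_prod[symmetric]
  by (subst lborel.nn_integral_fst[symmetric]) auto

lemma pair_energy_commute:
  fixes U V :: "'a::euclidean_space \<Rightarrow> complex"
  assumes [measurable]: "U \<in> borel_measurable borel" "V \<in> borel_measurable borel"
  shows "pair_energy b U V = pair_energy b V U"
proof -
  have "pair_energy b U V = (\<integral>\<^sup>+\<eta>. \<integral>\<^sup>+\<zeta>. ennreal ((norm (U \<zeta>))\<^sup>2 * (norm (V \<eta>))\<^sup>2 *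
       norm (\<zeta> - \<eta>) powr (4 * b + real DIM('a) - 2)) \<partial>lborel \<partial>lborel)"
    unfolding pair_energy_iterated[OF assms] by (rule lborel_pair.Fubini') measurable
  also have "\<dots> = pair_energy b V U"
    unfolding pair_energy_iterated[OF assms(2,1)]
    by (intro nn_integral_cong) (simp add: mult_ac norm_minus_commute)
  finally show ?thesis .
qed

text \<open>Integrate over \<open>\<eta>\<close> in a bounded set of positive measure on which \<open>|V|\<close> is bounded below, avoiding a small ball around \<open>\<zeta>\<close>.\<close>

lemma weighted_square_integrable:
  fixes U V :: "'a::euclidean_space \<Rightarrow> complex"
  assumes m[measurable]: "U \<in> borel_measurable borel" "V \<in> borel_measurable borel"
    and V: "\<not> (AE x in lborel. V x = 0)" and fin: "pair_energy b U V < \<infinity>"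
  shows "(\<integral>\<^sup>+x. ennreal ((norm (U x))\<^sup>2 * (1 + norm x) powr (min (4 * b + real DIM('a) - 2) 0)) \<partial>lborel) < \<infinity>"
proof -
  let ?\<gamma> = "4 * b + real DIM('a) - 2"
  define E where "E k = {x::'a. norm x \<le> real k \<and> 1 \<le> real k * norm (V x)}" for k :: nat
  have [measurable]: "E k \<in> sets borel" for k unfolding E_def by measurable
  have "\<exists>k. emeasure lborel (E k) \<noteq> 0"
  proof (rule ccontr)
    assume "\<nexists>k. emeasure lborel (E k) \<noteq> 0"
    then have "E k \<in> null_sets lborel" for k by (auto simp: null_sets_def)
    then have "AE x in lborel. \<forall>k. x \<notin> E k" by (subst AE_all_countable) (auto intro: AE_not_in)
    then have "AE x in lborel. V x = 0"
    proof eventually_elim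
      case (elim x)
      show ?case
      proof (rule ccontr)
        assume "V x \<noteq> 0"
        obtain k where k: "max (norm x) (1 / norm (V x)) \<le> real k" using real_arch_simple by blast
        then have "1 \<le> real k * norm (V x)" using \<open>V x \<noteq> 0\<close> by (simp add: pos_divide_le_eq)
        then show False using elim k by (auto simp: E_def)
      qed
    qed
    then show False using V by blast
  qed
  then obtain k where k: "emeasure lborel (E k) \<noteq> 0" by blast
  have "bounded (E k)" unfolding E_def by (rule boundedI[of _ "real k"]) auto
  then have "emeasure lborel (E k) < \<infinity>" by (rule emeasure_bounded_finite)
  then obtain e where e: "emeasure lborel (E k) = ennreal e" "e > 0"
    using k by (cases "emeasure lborel (E k)" rule: ennreal_cases) (auto simp: less_le ennreal_eq_0_iff)
  have k0: "k > 0" using k by (cases k) (auto simp: E_def)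
  let ?v = "unit_ball_vol (real DIM('a))"
  \<comment> \<open>Chosen so that a ball of radius \<rho> has at most half the measure of
    \<open>E k\<close>; as \<rho> \<le> 1, its power d is at most \<rho>.\<close>
  define \<rho> where "\<rho> = min 1 (e / (2 * ?v))"
  have v: "?v > 0" by simp
  have \<rho>: "0 < \<rho>" "\<rho> \<le> 1" using e v by (auto simp: \<rho>_def)
  have ball: "?v * \<rho> ^ DIM('a) \<le> e / 2"
  proof -
    have "\<rho> ^ DIM('a) \<le> \<rho> ^ 1" using \<rho> by (intro power_decreasing) (auto simp: Suc_le_eq)
    also have "\<dots> \<le> e / (2 * ?v)" by (simp add: \<rho>_def)
    finally show ?thesis using v by (simp add: field_simps)
  qed
  \<comment> \<open>For a nonnegative exponent the weight is smallest near x, and the distance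
    \<rho> bounds it below. For a negative exponent it is smallest far away, where the distance is
    at most (1 + k)(1 + |x|); this accounts for the minimum with 0 in the weight.\<close>
  define c where "c = (if ?\<gamma> \<ge> 0 then \<rho> powr ?\<gamma> else (1 + real k) powr ?\<gamma>)"
  have c: "c > 0" using \<rho> by (simp add: c_def)
  let ?w = "\<lambda>x::'a. (1 + norm x) powr (min ?\<gamma> 0)"
  have low: "c * ?w x \<le> norm (x - y) powr ?\<gamma>" if y: "y \<in> E k - ball x \<rho>" for x y
  proof -
    have d: "\<rho> \<le> norm (x - y)" using y by (simp add: dist_norm)
    show ?thesis
    proof (cases "?\<gamma> \<ge> 0")
      case True
      have "1 + norm x \<noteq> 0" using norm_ge_zero[of x] by argo
      then have "c * ?w x = \<rho> powr ?\<gamma>" using True by (simp add: c_def min_def)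
      also have "\<dots> \<le> norm (x - y) powr ?\<gamma>" using True d \<rho> by (intro powr_mono2) auto
      finally show ?thesis .
    next
      case False
      have "norm (x - y) \<le> norm x + norm y" by (rule norm_triangle_ineq4)
      also have "\<dots> \<le> norm x + real k" using y by (simp add: E_def)
      also have "\<dots> \<le> (1 + real k) * (1 + norm x)" by (simp add: algebra_simps)
      finally have "((1 + real k) * (1 + norm x)) powr ?\<gamma> \<le> norm (x - y) powr ?\<gamma>"
        using False d \<rho> by (intro powr_mono2') auto
      then show ?thesis using False by (simp add: c_def powr_mult min_def)
    qed
  qed
  have meas: "ennreal (e / 2) \<le> emeasure lborel (E k - ball x \<rho>)" for x
  proof -
    have "ennreal e \<le> emeasure lborel ((E k - ball x \<rho>) \<union> ball x \<rho>)"
      unfolding e(1)[symmetric] by (intro emeasure_mono) auto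
    also have "\<dots> \<le> emeasure lborel (E k - ball x \<rho>) + emeasure lborel (ball x \<rho>)"
      by (intro emeasure_subadditive) auto
    also have "emeasure lborel (ball x \<rho>) \<le> ennreal (e / 2)"
      using ball \<rho> by (subst emeasure_ball) (auto intro: ennreal_leI)
    finally have *: "ennreal e \<le> emeasure lborel (E k - ball x \<rho>) + ennreal (e / 2)" by (simp add: add_left_mono)
    have "ennreal (e / 2) + ennreal (e / 2) = ennreal e" using e by (subst ennreal_plus[symmetric]) auto
    with * have "ennreal (e / 2) + ennreal (e / 2) \<le> ennreal (e / 2) + emeasure lborel (E k - ball x \<rho>)" by (simp add: add.commute)
    then show ?thesis by (subst (asm) ennreal_add_left_cancel_le) auto
  qed
  let ?d = "c / (real k)\<^sup>2 * (e / 2)"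
  have d: "?d > 0" using c e k0 by simp
  have "ennreal ?d * (\<integral>\<^sup>+x. ennreal ((norm (U x))\<^sup>2 * ?w x) \<partial>lborel) = (\<integral>\<^sup>+x. ennreal ?d * ennreal ((norm (U x))\<^sup>2 * ?w x) \<partial>lborel)"
    by (rule nn_integral_cmult[symmetric]) measurable
  also have "\<dots> \<le> pair_energy b U V"
    unfolding pair_energy_iterated[OF m]
  proof (intro nn_integral_mono)
    fix x :: 'a
    let ?q = "(norm (U x))\<^sup>2 * (c / (real k)\<^sup>2 * ?w x)"
    have q: "?q \<ge> 0" using c by simp
    have "ennreal ?d * ennreal ((norm (U x))\<^sup>2 * ?w x) = ennreal ?q * ennreal (e / 2)"
      using d q e by (simp add: ennreal_mult[symmetric] mult_ac)
    also have "\<dots> \<le> ennreal ?q * emeasure lborel (E k - ball x \<rho>)" by (intro mult_left_mono meas) auto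
    also have "\<dots> = (\<integral>\<^sup>+y. ennreal ?q * indicator (E k - ball x \<rho>) y \<partial>lborel)"
      by (subst nn_integral_cmult_indicator) auto
    also have "\<dots> \<le> (\<integral>\<^sup>+y. ennreal ((norm (U x))\<^sup>2 * (norm (V y))\<^sup>2 * norm (x - y) powr ?\<gamma>) \<partial>lborel)"
    proof (intro nn_integral_mono)
      fix y
      show "ennreal ?q * indicator (E k - ball x \<rho>) y \<le> ennreal ((norm (U x))\<^sup>2 * (norm (V y))\<^sup>2 * norm (x - y) powr ?\<gamma>)"
      proof (cases "y \<in> E k - ball x \<rho>")
        case True
        have "1 / real k \<le> norm (V y)" using True k0 by (simp add: E_def divide_le_eq mult.commute)
        then have "(1 / real k)\<^sup>2 \<le> (norm (V y))\<^sup>2" by (intro power_mono) auto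
        then have "(norm (U x))\<^sup>2 * ((1 / real k)\<^sup>2 * (c * ?w x)) \<le> (norm (U x))\<^sup>2 * ((norm (V y))\<^sup>2 * norm (x - y) powr ?\<gamma>)"
          using c by (intro mult_left_mono mult_mono low True) auto
        then show ?thesis using True by (simp add: ennreal_leI power_divide mult_ac)
      qed simp
    qed
    finally show "ennreal ?d * ennreal ((norm (U x))\<^sup>2 * ?w x) \<le> (\<integral>\<^sup>+y. ennreal ((norm (U x))\<^sup>2 * (norm (V y))\<^sup>2 * norm (x - y) powr ?\<gamma>) \<partial>lborel)" .
  qed
  finally have "ennreal ?d * (\<integral>\<^sup>+x. ennreal ((norm (U x))\<^sup>2 * ?w x) \<partial>lborel) < \<infinity>" using fin by (rule le_less_trans)
  then show ?thesis using d by (auto simp: ennreal_mult_less_top ennreal_eq_0_iff)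
qed

text \<open>Split the divisor into the power K \<ge> g, which makes U square integrable, and a power
  of at least d, whose reciprocal is square integrable; then use Cauchy-Schwarz. All large M are
  allowed so that one exponent can serve two functions.\<close>

lemma polynomial_growth_integrable:
  fixes U :: "'a::euclidean_space \<Rightarrow> complex"
  assumes [measurable]: "U \<in> borel_measurable borel"
    and fin: "(\<integral>\<^sup>+x. ennreal ((norm (U x))\<^sup>2 * (1 + norm x) powr (- g)) \<partial>lborel) < \<infinity>"
  shows "\<exists>N. \<forall>M\<ge>N. integrable lborel (\<lambda>x. U x / of_real ((1 + norm x) ^ M))"
proof -
  obtain K :: nat where K: "g \<le> real K" using real_arch_simple by blast
  have p: "0 < 1 + norm x" "1 \<le> 1 + norm x" for x :: 'a using norm_ge_zero[of x] by linarith+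
  have 1: "sq_int (\<lambda>x. U x / of_real ((1 + norm x) ^ K))"
    unfolding sq_int_iff
  proof
    have "(\<integral>\<^sup>+x. ennreal ((norm (U x / of_real ((1 + norm x) ^ K)))\<^sup>2) \<partial>lborel) \<le> (\<integral>\<^sup>+x. ennreal ((norm (U x))\<^sup>2 * (1 + norm x) powr (- g)) \<partial>lborel)"
    proof (intro nn_integral_mono ennreal_leI)
      fix x :: 'a
      have "(1 + norm x) powr g \<le> (1 + norm x) powr real K" using K p[of x] by (intro powr_mono) auto
      also have "\<dots> = (1 + norm x) ^ K" by (rule powr_realpow[OF p(1)])
      also have "\<dots> \<le> ((1 + norm x) ^ K)\<^sup>2" using p[of x] by (simp add: self_le_power)
      finally have le: "(1 + norm x) powr g \<le> ((1 + norm x) ^ K)\<^sup>2" .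
      have pos: "0 < (1 + norm x) powr g" using p(1)[of x] by (metis powr_gt_zero less_irrefl)
      have "1 / ((1 + norm x) ^ K)\<^sup>2 \<le> 1 / (1 + norm x) powr g"
        by (intro divide_left_mono le mult_pos_pos zero_less_power p(1) pos) simp
      then have "(norm (U x))\<^sup>2 * (1 / ((1 + norm x) ^ K)\<^sup>2) \<le> (norm (U x))\<^sup>2 * (1 / (1 + norm x) powr g)"
        by (rule mult_left_mono) simp
      moreover have "norm (complex_of_real ((1 + norm x) ^ K)) = (1 + norm x) ^ K"
        unfolding norm_of_real using p[of x] by (intro abs_of_nonneg) auto
      ultimately show "(norm (U x / of_real ((1 + norm x) ^ K)))\<^sup>2 \<le> (norm (U x))\<^sup>2 * (1 + norm x) powr (- g)"
        by (simp only: norm_divide power_divide powr_minus inverse_eq_divide) simp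
    qed
    then show "(\<integral>\<^sup>+x. ennreal ((norm (U x / of_real ((1 + norm x) ^ K)))\<^sup>2) \<partial>lborel) < \<infinity>"
      using fin by (rule le_less_trans)
  qed measurable
  have 2: "sq_int (\<lambda>x::'a. complex_of_real (1 / (1 + norm x) ^ M))" if "M \<ge> DIM('a)" for M
    unfolding sq_int_def
  proof
    show "integrable lborel (\<lambda>x::'a. (norm (complex_of_real (1 / (1 + norm x) ^ M)))\<^sup>2)"
    proof (rule Bochner_Integration.integrable_bound[OF integrable_polynomial_decay])
      show "AE x in lborel. norm ((norm (complex_of_real (1 / (1 + norm (x::'a)) ^ M)))\<^sup>2) \<le> norm (1 / (1 + norm x) ^ (2 * DIM('a)))"
      proof (intro AE_I2)
        fix x :: 'a
        have "(1 + norm x) ^ (2 * DIM('a)) \<le> (1 + norm x) ^ (M * 2)"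
          using that p[of x] by (intro power_increasing) auto
        then have "1 / (1 + norm x) ^ (M * 2) \<le> 1 / (1 + norm x) ^ (2 * DIM('a))"
          by (intro divide_left_mono mult_pos_pos zero_less_power p(1)) auto
        moreover have "(norm (complex_of_real (1 / (1 + norm x) ^ M)))\<^sup>2 = 1 / (1 + norm x) ^ (M * 2)"
          unfolding norm_of_real by (simp only: power2_abs power_divide power_one power_mult)
        ultimately show "norm ((norm (complex_of_real (1 / (1 + norm x) ^ M)))\<^sup>2) \<le> norm (1 / (1 + norm x) ^ (2 * DIM('a)))"
          using p[of x] by simp
      qed
    qed measurable
  qed measurable
  have "integrable lborel (\<lambda>x. U x / of_real ((1 + norm x) ^ M))" if "M \<ge> K + DIM('a)" for M
  proof -
    have "integrable lborel (\<lambda>x. U x / of_real ((1 + norm x) ^ K) * complex_of_real (1 / (1 + norm x) ^ (M - K)))"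
      by (rule sq_int_Cauchy_Schwarz(1)[OF 1 2]) (use that in simp)
    also have "(\<lambda>x. U x / of_real ((1 + norm x) ^ K) * complex_of_real (1 / (1 + norm x) ^ (M - K))) = (\<lambda>x. U x / of_real ((1 + norm x) ^ M))"
    proof
      fix x :: 'a
      have "(1 + norm x) ^ K * (1 + norm x) ^ (M - K) = (1 + norm x) ^ M" using that by (simp flip: power_add)
      then have "complex_of_real ((1 + norm x) ^ K) * of_real ((1 + norm x) ^ (M - K)) = of_real ((1 + norm x) ^ M)"
        by (simp only: of_real_mult[symmetric])
      then show "U x / of_real ((1 + norm x) ^ K) * complex_of_real (1 / (1 + norm x) ^ (M - K)) = U x / of_real ((1 + norm x) ^ M)"
        by (simp only: of_real_divide times_divide_times_eq of_real_1 mult_1_right)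
    qed
    finally show ?thesis .
  qed
  then show ?thesis by blast
qed

text \<open>If neither factor vanishes, each of them bounds the other through the energy, which is
  symmetric; otherwise the tensor product is zero almost everywhere.\<close>

lemma pair_growthI:
  fixes U V :: "'a::euclidean_space \<Rightarrow> complex"
  assumes m[measurable]: "U \<in> borel_measurable borel" "V \<in> borel_measurable borel" and fin: "pair_energy b U V < \<infinity>"
  shows "pair_growth U V"
proof (cases "(AE x in lborel. U x = 0) \<or> (AE x in lborel. V x = 0)")
  case True
  have "AE p in lborel. U (fst p) * V (snd p) = 0"
  proof -
    have "(\<integral>\<^sup>+p. ennreal (norm (U (fst p) * V (snd p))) \<partial>lborel) = (\<integral>\<^sup>+x. \<integral>\<^sup>+y. ennreal (norm (U x)) * ennreal (norm (V y)) \<partial>lborel \<partial>lborel)"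
      unfolding lborel_prod[symmetric] by (subst lborel.nn_integral_fst[symmetric]) (auto simp: norm_mult ennreal_mult)
    also have "\<dots> = (\<integral>\<^sup>+x. ennreal (norm (U x)) \<partial>lborel) * (\<integral>\<^sup>+y. ennreal (norm (V y)) \<partial>lborel)"
      by (simp add: nn_integral_cmult nn_integral_multc)
    also have "\<dots> = 0"
      using True by (auto simp: nn_integral_0_iff_AE)
    finally show ?thesis by (subst (asm) nn_integral_0_iff_AE) auto
  qed
  then have "integrable lborel (\<lambda>p. U (fst p) * V (snd p) / of_real ((1 + norm (fst p)) ^ 0 * (1 + norm (snd p)) ^ 0)) \<longleftrightarrow> integrable lborel (\<lambda>p::'a \<times> 'a. 0::complex)"
    by (intro integrable_cong_AE) auto
  then show ?thesis unfolding pair_growth_def by (intro exI[of _ 0]) simp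
next
  case False
  let ?g = "- min (4 * b + real DIM('a) - 2) 0"
  obtain N1 where N1: "\<forall>M\<ge>N1. integrable lborel (\<lambda>x. U x / of_real ((1 + norm x) ^ M))"
    using polynomial_growth_integrable[OF m(1), of ?g] weighted_square_integrable[OF m _ fin] False by auto
  have "pair_energy b V U < \<infinity>" using fin pair_energy_commute[OF m] by simp
  then obtain N2 where N2: "\<forall>M\<ge>N2. integrable lborel (\<lambda>x. V x / of_real ((1 + norm x) ^ M))"
    using polynomial_growth_integrable[OF m(2), of ?g] weighted_square_integrable[OF m(2,1)] False by auto
  let ?N = "max N1 N2"
  have "integrable (lborel \<Otimes>\<^sub>M lborel) (\<lambda>(x, y). (U x / of_real ((1 + norm x) ^ ?N)) * (V y / of_real ((1 + norm y) ^ ?N)))"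
    by (intro integrable_pair_times N1[rule_format] N2[rule_format]) auto
  then have "integrable lborel (\<lambda>p. (U (fst p) / of_real ((1 + norm (fst p)) ^ ?N)) * (V (snd p) / of_real ((1 + norm (snd p)) ^ ?N)))"
    by (simp only: lborel_prod split_def)
  then show ?thesis unfolding pair_growth_def by (intro exI[of _ ?N]) (simp only: times_divide_times_eq of_real_mult)
qed

text \<open>Adding the values at x and - x removes the linear term, because exp(t) + exp(- t) \<ge>
  2. What remains exceeds a multiple of (1 + |x|)^(- g), whose integral over the ball of radius R
  grows at least like R^(d - g).\<close>

lemma gaussian_weight_infinite:
  fixes \<beta> :: "'a::euclidean_space"
  assumes A: "A \<ge> 0" and g: "0 \<le> g" "g < real DIM('a)"
  shows "(\<integral>\<^sup>+x. ennreal (exp (A * (norm x)\<^sup>2 + \<beta> \<bullet> x + C) * (1 + norm x) powr (- g)) \<partial>lborel) = \<infinity>"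
proof (rule ccontr)
  let ?f = "\<lambda>x. exp (A * (norm x)\<^sup>2 + \<beta> \<bullet> x + C) * (1 + norm x) powr (- g)"
  assume "(\<integral>\<^sup>+x. ennreal (?f x) \<partial>lborel) \<noteq> \<infinity>"
  then obtain I where I: "(\<integral>\<^sup>+x. ennreal (?f x) \<partial>lborel) = ennreal I" "I \<ge> 0"
    by (cases "\<integral>\<^sup>+x. ennreal (?f x) \<partial>lborel" rule: ennreal_cases) auto
  have I': "(\<integral>\<^sup>+x. ennreal (?f (- x)) \<partial>lborel) = ennreal I"
    using nn_integral_lborel_affine[of "\<lambda>x. ennreal (?f x)" "-1" 0] I by simp
  let ?v = "unit_ball_vol (real DIM('a))"
  have v: "?v > 0" by simp
  have ge: "2 * exp C * (1 + norm x) powr (- g) \<le> ?f x + ?f (- x)" for x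
  proof -
    have "2 \<le> exp (\<beta> \<bullet> x) + exp (- (\<beta> \<bullet> x))"
      using exp_ge_add_one_self[of "\<beta> \<bullet> x"] exp_ge_add_one_self[of "- (\<beta> \<bullet> x)"] by argo
    moreover have "1 \<le> exp (A * (norm x)\<^sup>2)" using A by simp
    ultimately have "1 * 2 \<le> exp (A * (norm x)\<^sup>2) * (exp (\<beta> \<bullet> x) + exp (- (\<beta> \<bullet> x)))"
      by (intro mult_mono) auto
    then have "2 * (exp C * (1 + norm x) powr (- g)) \<le> (exp (A * (norm x)\<^sup>2) * (exp (\<beta> \<bullet> x) + exp (- (\<beta> \<bullet> x)))) * (exp C * (1 + norm x) powr (- g))"
      by (intro mult_right_mono) auto
    then show ?thesis by (simp add: exp_add exp_diff exp_minus divide_inverse algebra_simps)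
  qed
  have bound: "2 * exp C * (2 powr (- g) * (?v * R powr (real DIM('a) - g))) \<le> 2 * I" if R: "R \<ge> 1" for R
  proof -
    have "ennreal (2 * exp C * (1 + R) powr (- g)) * ennreal (?v * R ^ DIM('a)) = (\<integral>\<^sup>+x. ennreal (2 * exp C * (1 + R) powr (- g)) * indicator (ball (0::'a) R) x \<partial>lborel)"
      using R by (subst nn_integral_cmult_indicator) (auto simp: emeasure_ball)
    also have "\<dots> \<le> (\<integral>\<^sup>+x. ennreal (?f x) + ennreal (?f (- x)) \<partial>lborel)"
    proof (intro nn_integral_mono)
      fix x :: 'a
      show "ennreal (2 * exp C * (1 + R) powr (- g)) * indicator (ball 0 R) x \<le> ennreal (?f x) + ennreal (?f (- x))"
      proof (cases "x \<in> ball 0 R")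
        case True
        then have "(1 + R) powr (- g) \<le> (1 + norm x) powr (- g)" using g
          by (intro powr_mono2') (auto intro: add_pos_nonneg)
        then have "2 * exp C * (1 + R) powr (- g) \<le> 2 * exp C * (1 + norm x) powr (- g)" by (intro mult_left_mono) auto
        also note ge[of x]
        finally have "2 * exp C * (1 + R) powr (- g) \<le> ?f x + ?f (- x)" .
        then have "ennreal (2 * exp C * (1 + R) powr (- g)) \<le> ennreal (?f x + ?f (- x))" by (rule ennreal_leI)
        also have "\<dots> = ennreal (?f x) + ennreal (?f (- x))" by (rule ennreal_plus) auto
        finally show ?thesis using True by simp
      qed simp
    qed
    also have "\<dots> = ennreal I + ennreal I" by (subst nn_integral_add) (use I I' in auto)
    also have "\<dots> = ennreal (2 * I)" using I(2) by (subst ennreal_plus[symmetric]) auto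
    finally have "2 * exp C * (1 + R) powr (- g) * (?v * R ^ DIM('a)) \<le> 2 * I"
      using R I(2) v by (simp add: ennreal_mult[symmetric])
    moreover have "2 * exp C * (2 powr (- g) * (?v * R powr (real DIM('a) - g))) \<le> 2 * exp C * (1 + R) powr (- g) * (?v * R ^ DIM('a))"
    proof -
      have "(2 * R) powr (- g) \<le> (1 + R) powr (- g)" using R g by (intro powr_mono2') auto
      then have "2 powr (- g) * R powr (- g) \<le> (1 + R) powr (- g)" using R by (simp add: powr_mult)
      then have "2 powr (- g) * R powr (- g) * (?v * R ^ DIM('a)) \<le> (1 + R) powr (- g) * (?v * R ^ DIM('a))"
        using R v by (intro mult_right_mono) auto
      moreover have "R powr (real DIM('a) - g) = R powr (- g) * R ^ DIM('a)"
        using R by (simp add: powr_realpow[symmetric] flip: powr_add)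
      ultimately have "2 powr (- g) * (?v * R powr (real DIM('a) - g)) \<le> (1 + R) powr (- g) * (?v * R ^ DIM('a))"
        by (simp add: mult_ac)
      then show ?thesis by (simp add: mult.assoc)
    qed
    ultimately show ?thesis by (rule order_trans[rotated])
  qed
  let ?q = "exp C * (2 powr (- g) * ?v)"
  have q: "?q > 0" using v by simp
  \<comment> \<open>R is chosen so that R^(d - g) = I / q + 1, for which the lower bound exceeds the
    supposed value I of the integral by q.\<close>
  define R where "R = (I / ?q + 1) powr (1 / (real DIM('a) - g))"
  have "R \<ge> 1" unfolding R_def using I(2) q g by (intro ge_one_powr_ge_zero) auto
  moreover have "R powr (real DIM('a) - g) = I / ?q + 1"
    unfolding R_def powr_powr using I(2) q g by (simp add: add_nonneg_pos)
  ultimately have "2 * exp C * (2 powr (- g) * (?v * (I / ?q + 1))) \<le> 2 * I" using bound[of R] by simp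
  then have "?q * (I / ?q + 1) \<le> I" by (simp add: mult_ac)
  moreover have "r * (I / r + 1) = I + r" if "r > 0" for r
    using that by (simp add: field_simps)
  ultimately show False using q by fastforce
qed

section \<open>The functional equation of the extremisers\<close>

text \<open>The reflection in the hyperplane orthogonal to w; division by zero makes it the identity
  for w = 0. A single reflection, with w = y - y', carries y to any y' of the same norm, so these
  maps suffice to test dependence on the norm only.\<close>

definition reflect :: "'a::euclidean_space \<Rightarrow> 'a \<Rightarrow> 'a" where
  "reflect w x = x - (2 * (x \<bullet> w) / (w \<bullet> w)) *\<^sub>R w"

lemma reflect_inner: "reflect w x \<bullet> reflect w y = x \<bullet> y"
proof (cases "w = 0")
  case False
  define k where "k = 2 / (w \<bullet> w)"
  have k: "k * (w \<bullet> w) = 2" using False by (simp add: k_def)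
  have r: "reflect w x = x - (k * (x \<bullet> w)) *\<^sub>R w" for x by (simp add: reflect_def k_def)
  have "(x - p *\<^sub>R w) \<bullet> (y - q *\<^sub>R w) = x \<bullet> y - q * (x \<bullet> w) - p * (y \<bullet> w) + p * q * (w \<bullet> w)" for p q
    by (simp add: inner_diff_left inner_diff_right inner_commute[of w y] algebra_simps)
  then have "reflect w x \<bullet> reflect w y = x \<bullet> y - k * (y \<bullet> w) * (x \<bullet> w) - k * (x \<bullet> w) * (y \<bullet> w) + k * (x \<bullet> w) * (k * (y \<bullet> w)) * (w \<bullet> w)"
    unfolding r .
  moreover have "k * (x \<bullet> w) * (k * (y \<bullet> w)) * (w \<bullet> w) = (k * (w \<bullet> w)) * (k * (x \<bullet> w) * (y \<bullet> w))"
    by (simp only: mult_ac)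
  ultimately show ?thesis unfolding k by simp
qed (simp add: reflect_def)

lemma reflect_norm: "norm (reflect w x) = norm x"
  by (simp add: norm_eq_sqrt_inner reflect_inner)

lemma reflect_self_adjoint: "reflect w x \<bullet> y = x \<bullet> reflect w y"
  by (simp add: reflect_def inner_diff inner_commute)

lemma reflect_reflect: "reflect w (reflect w x) = x"
  by (cases "w = 0") (auto simp: reflect_def inner_diff algebra_simps)

lemma reflect_swap:
  assumes "norm x = norm y"
  shows "reflect (x - y) x = y"
proof (cases "x = y")
  case False
  have e: "x \<bullet> x = y \<bullet> y" using assms by (simp add: norm_eq_sqrt_inner)
  have "(x - y) \<bullet> (x - y) = 2 * (x \<bullet> (x - y))" using e by (simp add: inner_diff inner_commute)
  moreover have "(x - y) \<bullet> (x - y) \<noteq> 0" using False by simp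
  ultimately have "2 * (x \<bullet> (x - y)) / ((x - y) \<bullet> (x - y)) = 1" by (metis divide_self)
  then show ?thesis by (simp only: reflect_def scaleR_one) simp
qed (simp add: reflect_def)

lemma orthogonal_transformation_reflect: "orthogonal_transformation (reflect w)"
proof -
  have "linear (reflect w)"
    by (rule linearI) (auto simp: reflect_def inner_add_left add_divide_distrib algebra_simps)
  then show ?thesis by (simp add: orthogonal_transformation_def reflect_inner)
qed

lemma reflect_continuous: "continuous_on S (reflect w)"
  unfolding reflect_def by (cases "w = 0") (auto intro!: continuous_intros)

lemma reflect_measurable [measurable]: "reflect w \<in> borel_measurable borel"
  by (intro borel_measurable_continuous_onI reflect_continuous)

lemma reflect_add: "reflect w (x + y) = reflect w x + reflect w y"
  using orthogonal_transformation_linear[OF orthogonal_transformation_reflect] by (rule linear_add)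

lemma nn_integral_lborel_translate:
  fixes f :: "'a::euclidean_space \<Rightarrow> ennreal"
  assumes "f \<in> borel_measurable borel"
  shows "(\<integral>\<^sup>+x. f (t + x) \<partial>lborel) = (\<integral>\<^sup>+x. f x \<partial>lborel)"
  using nn_integral_lborel_affine[OF assms, of 1 t] by simp

text \<open>Only translation invariance and Fubini are used. Multiply by the integral of the
  Gaussian, shift the Gaussian by the reflected point, exchange the integrals and shift the other
  variable. The Gaussian is even and invariant under reflections, and its integral cancels at the
  end.\<close>

lemma nn_integral_reflect:
  fixes f :: "'a::euclidean_space \<Rightarrow> ennreal"
  assumes f[measurable]: "f \<in> borel_measurable borel"
  shows "(\<integral>\<^sup>+x. f (reflect w x) \<partial>lborel) = (\<integral>\<^sup>+x. f x \<partial>lborel)"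
proof -
  let ?g = "\<lambda>x::'a. ennreal (gaussian x)" and ?T = "reflect w :: 'a \<Rightarrow> 'a"
  have gT: "gaussian (?T x) = gaussian x" for x by (simp add: gaussian_def reflect_norm)
  have gm: "gaussian (- x) = gaussian x" for x :: 'a by (simp add: gaussian_def)
  define G where "G = (\<integral>\<^sup>+x. ?g x \<partial>lborel)"
  have "G = ennreal (LINT x|lborel. gaussian (x::'a))"
    unfolding G_def by (rule nn_integral_eq_integral[OF gaussian_integrable]) (simp add: gaussian_pos less_imp_le)
  then have G: "G \<noteq> 0" "G \<noteq> \<top>" by (simp_all add: gaussian_integral ennreal_eq_0_iff)
  have "(\<integral>\<^sup>+x. f (?T x) \<partial>lborel) * G = (\<integral>\<^sup>+x. \<integral>\<^sup>+y. f (?T x) * ?g y \<partial>lborel \<partial>lborel)"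
    by (simp add: G_def nn_integral_cmult nn_integral_multc)
  also have "\<dots> = (\<integral>\<^sup>+x. \<integral>\<^sup>+y. f (?T x) * ?g (- ?T x + y) \<partial>lborel \<partial>lborel)"
    by (rule nn_integral_cong, subst nn_integral_lborel_translate) auto
  also have "\<dots> = (\<integral>\<^sup>+y. \<integral>\<^sup>+x. f (?T x) * ?g (- ?T x + y) \<partial>lborel \<partial>lborel)"
    by (rule lborel_pair.Fubini') measurable
  also have "\<dots> = (\<integral>\<^sup>+y. \<integral>\<^sup>+x. f (?T (?T y + x)) * ?g (- ?T (?T y + x) + y) \<partial>lborel \<partial>lborel)"
  proof (rule nn_integral_cong)
    fix y
    show "(\<integral>\<^sup>+x. f (?T x) * ?g (- ?T x + y) \<partial>lborel) = (\<integral>\<^sup>+x. f (?T (?T y + x)) * ?g (- ?T (?T y + x) + y) \<partial>lborel)"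
      using nn_integral_lborel_translate[of "\<lambda>x. f (?T x) * ?g (- ?T x + y)" "?T y"] by simp
  qed
  also have "\<dots> = (\<integral>\<^sup>+y. \<integral>\<^sup>+x. f (?T x + y) * ?g x \<partial>lborel \<partial>lborel)"
    by (simp add: reflect_add reflect_reflect gT gm add.commute)
  also have "\<dots> = (\<integral>\<^sup>+x. \<integral>\<^sup>+y. f (?T x + y) * ?g x \<partial>lborel \<partial>lborel)"
    by (rule lborel_pair.Fubini') measurable
  also have "\<dots> = (\<integral>\<^sup>+x. (\<integral>\<^sup>+y. f y \<partial>lborel) * ?g x \<partial>lborel)"
    by (rule nn_integral_cong, subst nn_integral_multc) (auto simp: nn_integral_lborel_translate)
  also have "\<dots> = (\<integral>\<^sup>+y. f y \<partial>lborel) * G"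
    unfolding G_def by (rule nn_integral_cmult) measurable
  finally have "G * (\<integral>\<^sup>+x. f (?T x) \<partial>lborel) = G * (\<integral>\<^sup>+y. f y \<partial>lborel)" by (simp only: mult.commute)
  then show ?thesis using G by (simp add: ennreal_mult_cancel_left)
qed

lemma lborel_reflect: "distr lborel borel (reflect w) = (lborel :: 'a::euclidean_space measure)"
proof (rule measure_eqI)
  fix A assume "A \<in> sets (distr lborel borel (reflect w) :: 'a measure)"
  then have [measurable]: "A \<in> sets borel" by simp
  have "emeasure (distr lborel borel (reflect w)) A = (\<integral>\<^sup>+x. indicator A x \<partial>distr lborel borel (reflect w))" by simp
  also have "\<dots> = (\<integral>\<^sup>+x. indicator A (reflect w x) \<partial>lborel)" by (rule nn_integral_distr) auto
  also have "\<dots> = (\<integral>\<^sup>+x. indicator A x \<partial>lborel)" by (rule nn_integral_reflect) measurable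
  finally show "emeasure (distr lborel borel (reflect w)) A = emeasure lborel A" by simp
qed simp

section \<open>The functional equation under the Fourier transform\<close>

lemma centre_measure:
  "distr lborel borel (\<lambda>q. ((1 / 2) *\<^sub>R fst q + snd q, (1 / 2) *\<^sub>R fst q - snd q)) = (lborel :: ('a::euclidean_space \<times> 'a) measure)"
  (is "distr lborel borel ?c = _")
proof (rule measure_eqI)
  fix A assume "A \<in> sets (distr lborel borel ?c)"
  then have [measurable]: "A \<in> sets borel" by simp
  have [measurable]: "?c \<in> borel_measurable borel"
    by (intro borel_measurable_continuous_onI continuous_intros)
  have "emeasure lborel A = (\<integral>\<^sup>+p. indicator A p \<partial>lborel)" by simp
  also have "\<dots> = (\<integral>\<^sup>+\<xi>. \<integral>\<^sup>+y. indicator A (?c (\<xi>, y)) \<partial>lborel \<partial>lborel)"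
    by (subst nn_integral_centre) auto
  also have "\<dots> = (\<integral>\<^sup>+q. indicator A (?c q) \<partial>(lborel \<Otimes>\<^sub>M lborel))"
    by (rule lborel.nn_integral_fst) (unfold lborel_prod, measurable)
  also have "\<dots> = (\<integral>\<^sup>+p. indicator A p \<partial>distr lborel borel ?c)"
    unfolding lborel_prod by (rule nn_integral_distr[symmetric]) measurable
  finally show "emeasure (distr lborel borel ?c) A = emeasure lborel A" by simp
qed simp

text \<open>In the coordinates \<zeta> = \<xi>/2 + v, \<eta> = \<xi>/2 - v the tensor product is a
  function K of \<xi> and |v|, while the phase at (m + y, m - y) is \<xi> \<bullet> m + 2 v
  \<bullet> y. Reflecting v leaves K unchanged and replaces y by any y' of the same norm.\<close>

lemma fourier_tensor_invariant:
  fixes f g :: "'a::euclidean_space \<Rightarrow> complex"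
  assumes f: "integrable lborel f" and g: "integrable lborel g" and L[measurable]: "L \<in> borel_measurable borel"
    and eq: "AE p in lborel. f (fst p) * g (snd p) = L (frequency p)" and y: "norm y = norm y'"
  shows "fourier_integral f (m + y) * fourier_integral g (m - y) = fourier_integral f (m + y') * fourier_integral g (m - y')"
proof -
  note [measurable] = borel_measurable_integrable[OF f, simplified] borel_measurable_integrable[OF g, simplified]
  let ?c = "\<lambda>q::('a) \<times> ('a). ((1 / 2) *\<^sub>R fst q + snd q, (1 / 2) *\<^sub>R fst q - snd q)"
  have cm[measurable]: "?c \<in> borel_measurable borel"
    by (intro borel_measurable_continuous_onI continuous_intros)
  have cmm: "?c \<in> lborel \<rightarrow>\<^sub>M borel" by simp
  define K where "K q = L (frequency (?c q))" for q
  have Km[measurable]: "K \<in> borel_measurable borel" unfolding K_def by measurable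
  have fr: "frequency (?c (\<xi>, v)) = (- (norm \<xi>)\<^sup>2 / 2 - 2 * (norm v)\<^sup>2, \<xi>)" for \<xi> v :: "'a"
  proof -
    have "(norm ((1 / 2) *\<^sub>R \<xi> + v))\<^sup>2 + (norm ((1 / 2) *\<^sub>R \<xi> - v))\<^sup>2 = (norm \<xi>)\<^sup>2 / 2 + 2 * (norm v)\<^sup>2"
      unfolding power2_norm_eq_inner by (simp add: inner_add inner_diff inner_commute field_simps)
    moreover have "(1 / 2) *\<^sub>R \<xi> + v + ((1 / 2) *\<^sub>R \<xi> - v) = \<xi>" by (simp flip: scaleR_add_left)
    ultimately show ?thesis by (simp add: frequency_def)
  qed
  have Kr: "K (\<xi>, reflect w v) = K (\<xi>, v)" for \<xi> v w by (simp only: K_def fr reflect_norm)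
  have fg: "integrable lborel (\<lambda>p. f (fst p) * g (snd p))"
    using integrable_pair_times[OF f g] by (simp add: split_def lborel_prod)
  have Li: "integrable lborel (\<lambda>p. L (frequency p))"
    using fg by (subst integrable_cong_AE[OF _ _ eq, symmetric]) auto
  have Ki: "integrable lborel K"
    using Li unfolding K_def by (subst (asm) centre_measure[symmetric], subst (asm) integrable_distr_eq[OF cmm]) auto
  have main: "fourier_integral f (m + y) * fourier_integral g (m - y) =
    (LINT \<xi>|lborel. exp (- \<i> * of_real (\<xi> \<bullet> m)) * (LINT v|lborel. K (\<xi>, v) * exp (- \<i> * of_real (v \<bullet> (2 *\<^sub>R y)))))" for y
  proof -
    let ?e = "\<lambda>a x. exp (- \<i> * complex_of_real (x \<bullet> a))"
    have fm[measurable]: "(\<lambda>p::('a) \<times> ('a). f (fst p)) \<in> borel_measurable borel"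
      "(\<lambda>p::('a) \<times> ('a). g (snd p)) \<in> borel_measurable borel"
      unfolding borel_prod[symmetric] by measurable
    have em[measurable]: "(\<lambda>p::('a) \<times> ('a). ?e a (fst p)) \<in> borel_measurable borel"
      "(\<lambda>p::('a) \<times> ('a). ?e a (snd p)) \<in> borel_measurable borel" for a
      by (intro borel_measurable_continuous_onI continuous_intros)+
    have ip: "integrable (lborel \<Otimes>\<^sub>M lborel) (\<lambda>(\<zeta>, \<eta>). (f \<zeta> * ?e (m + y) \<zeta>) * (g \<eta> * ?e (m - y) \<eta>))"
      by (intro integrable_pair_times fourier_integrand_integrable f g)
    have ex: "?e (m + y) (fst (?c q)) * ?e (m - y) (snd (?c q)) = ?e m (fst q) * ?e (2 *\<^sub>R y) (snd q)" for q
      by (simp add: mult_exp_exp inner_add inner_diff) (simp add: algebra_simps)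
    have "fourier_integral f (m + y) * fourier_integral g (m - y) =
      (LINT \<zeta>|lborel. LINT \<eta>|lborel. (f \<zeta> * ?e (m + y) \<zeta>) * (g \<eta> * ?e (m - y) \<eta>))"
      unfolding fourier_integral_def by (simp only: integral_mult_right_zero integral_mult_left_zero)
    also have "\<dots> = (LINT p|lborel. (f (fst p) * ?e (m + y) (fst p)) * (g (snd p) * ?e (m - y) (snd p)))"
      using lborel_pair.integral_fst'[OF ip] by (simp add: lborel_prod split_def)
    also have "\<dots> = (LINT p|lborel. L (frequency p) * (?e (m + y) (fst p) * ?e (m - y) (snd p)))"
    proof (rule integral_cong_AE)
      show "AE p in lborel. (f (fst p) * ?e (m + y) (fst p)) * (g (snd p) * ?e (m - y) (snd p)) = L (frequency p) * (?e (m + y) (fst p) * ?e (m - y) (snd p))"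
        using eq
      proof eventually_elim
        case (elim p)
        have "(f (fst p) * ?e (m + y) (fst p)) * (g (snd p) * ?e (m - y) (snd p)) = (f (fst p) * g (snd p)) * (?e (m + y) (fst p) * ?e (m - y) (snd p))"
          by (simp only: mult_ac)
        then show ?case unfolding elim .
      qed
    qed (auto intro!: borel_measurable_times fm em)
    also have "\<dots> = (LINT q|lborel. K q * (?e m (fst q) * ?e (2 *\<^sub>R y) (snd q)))"
      unfolding K_def ex[symmetric]
      by (subst centre_measure[symmetric], rule integral_distr[OF cmm]) (intro borel_measurable_times em, measurable)
    also have "\<dots> = (LINT \<xi>|lborel. LINT v|lborel. K (\<xi>, v) * (?e m \<xi> * ?e (2 *\<^sub>R y) v))"
    proof -
      have "integrable (lborel \<Otimes>\<^sub>M lborel) (\<lambda>q. K q * (?e m (fst q) * ?e (2 *\<^sub>R y) (snd q)))"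
        unfolding lborel_prod
        by (rule Bochner_Integration.integrable_bound[OF Ki]) (auto simp: norm_mult intro!: borel_measurable_times em)
      from lborel_pair.integral_fst'[OF this] show ?thesis by (simp add: lborel_prod)
    qed
    also have "\<dots> = (LINT \<xi>|lborel. ?e m \<xi> * (LINT v|lborel. K (\<xi>, v) * ?e (2 *\<^sub>R y) v))"
      by (rule Bochner_Integration.integral_cong[OF refl], subst integral_mult_right_zero[symmetric])
        (simp only: mult.left_commute)
    finally show ?thesis .
  qed
  let ?w = "y - y'"
  have "(LINT v|lborel. K (\<xi>, v) * exp (- \<i> * of_real (v \<bullet> (2 *\<^sub>R y')))) = (LINT v|lborel. K (\<xi>, v) * exp (- \<i> * of_real (v \<bullet> (2 *\<^sub>R y))))" for \<xi>
  proof -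
    have [measurable]: "(\<lambda>v. K (\<xi>, v)) \<in> borel_measurable borel"
      by (rule measurable_compose[OF _ Km]) (intro borel_measurable_continuous_onI continuous_intros)
    have ry: "reflect ?w (2 *\<^sub>R y) = 2 *\<^sub>R y'"
      using reflect_swap[OF y] linear_scale[OF orthogonal_transformation_linear[OF orthogonal_transformation_reflect]] by metis
    have "(LINT v|lborel. K (\<xi>, v) * exp (- \<i> * of_real (v \<bullet> (2 *\<^sub>R y)))) =
      (LINT v|lborel. K (\<xi>, reflect ?w v) * exp (- \<i> * of_real (reflect ?w v \<bullet> (2 *\<^sub>R y))))"
      by (subst lborel_reflect[of ?w, symmetric], subst integral_distr) auto
    also have "\<dots> = (LINT v|lborel. K (\<xi>, v) * exp (- \<i> * of_real (v \<bullet> (2 *\<^sub>R y'))))"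
      by (simp only: Kr reflect_self_adjoint ry)
    finally show ?thesis ..
  qed
  then show ?thesis unfolding main by simp
qed

section \<open>Continuous solutions of the rectangle equation\<close>

lemma orthogonal_unit_exists:
  fixes u :: "'a::euclidean_space"
  assumes "DIM('a) \<ge> 2"
  obtains e where "norm e = 1" "e \<bullet> u = 0"
proof -
  obtain y where "y \<noteq> 0" "orthogonal u y" using orthogonal_to_vector_exists[OF assms] by blast
  then have "norm (sgn y) = 1" "sgn y \<bullet> u = 0" by (auto simp: norm_sgn sgn_div_norm orthogonal_def inner_commute)
  then show ?thesis using that by blast
qed

text \<open>The two pairs of opposite vertices of a square: two inside the ball, and the centre with a point outside.\<close>

lemma nonvanishing_if_rectangle_equation:
  fixes Q :: "'a::euclidean_space \<Rightarrow> complex"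
  assumes dim: "DIM('a) \<ge> 2" and cont: "continuous_on UNIV Q"
    and eq: "\<And>m y y'. norm y = norm y' \<Longrightarrow> Q (m + y) * Q (m - y) = Q (m + y') * Q (m - y')"
    and x0: "Q x0 \<noteq> 0"
  shows "Q x \<noteq> 0"
proof -
  have "open {x. Q x \<noteq> 0}" by (intro open_Collect_neq cont continuous_intros)
  then obtain \<delta> where \<delta>: "\<delta> > 0" "ball x0 \<delta> \<subseteq> {x. Q x \<noteq> 0}"
    using x0 open_contains_ball by blast
  \<comment> \<open>The other two vertices of the square with diagonal from x0 to x are closer to x0
    than x by the factor 1 / \<open>sqrt 2\<close>, so each application enlarges the zero-free ball
    by \<open>sqrt 2\<close>.\<close>
  have "\<forall>x. norm (x - x0) < (sqrt 2) ^ k * \<delta> \<longrightarrow> Q x \<noteq> 0" for k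
  proof (induction k)
    case 0
    then show ?case using \<delta>(2) by (auto simp: subset_iff dist_norm norm_minus_commute)
  next
    case (Suc k)
    show ?case
    proof (intro allI impI)
      fix x assume x: "norm (x - x0) < sqrt 2 ^ Suc k * \<delta>"
      let ?r = "norm (x - x0)"
      show "Q x \<noteq> 0"
      proof (cases "x = x0")
        case False
        obtain e where e: "norm e = 1" "e \<bullet> (x - x0) = 0" using orthogonal_unit_exists[OF dim] by blast
        \<comment> \<open>With m the midpoint of x0 and x, the points m - y' and m + y' are x0 and
          x, and y is a half diagonal of the same length orthogonal to y'.\<close>
        define y' where "y' = (1 / 2) *\<^sub>R (x - x0)"
        define y where "y = (?r / 2) *\<^sub>R e"
        define m where "m = x0 + y'"
        have ny: "norm y = norm y'" using e by (simp add: y_def y'_def)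
        have o: "y' \<bullet> y = 0" "y \<bullet> y' = 0" using e(2) by (simp_all add: y_def y'_def inner_commute)
        have near: "(norm (y' + y))\<^sup>2 = ?r\<^sup>2 / 2" "(norm (y' - y))\<^sup>2 = ?r\<^sup>2 / 2"
        proof -
          have "(norm y')\<^sup>2 = ?r\<^sup>2 / 4" by (simp add: y'_def power_divide)
          moreover have "(norm y)\<^sup>2 = ?r\<^sup>2 / 4" using calculation ny by simp
          ultimately have "y' \<bullet> y' = ?r\<^sup>2 / 4" "y \<bullet> y = ?r\<^sup>2 / 4" by (simp_all add: power2_norm_eq_inner[symmetric])
          then show "(norm (y' + y))\<^sup>2 = ?r\<^sup>2 / 2" "(norm (y' - y))\<^sup>2 = ?r\<^sup>2 / 2"
            unfolding power2_norm_eq_inner[of "y' + y"] power2_norm_eq_inner[of "y' - y"]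
            by (simp_all add: inner_add inner_diff o)
        qed
        have lt: "?r\<^sup>2 / 2 < (sqrt 2 ^ k * \<delta>)\<^sup>2"
        proof -
          have "?r\<^sup>2 < (sqrt 2 ^ Suc k * \<delta>)\<^sup>2" using x by (intro power_strict_mono) auto
          also have "\<dots> = 2 * (sqrt 2 ^ k * \<delta>)\<^sup>2" by (simp add: power_mult_distrib)
          finally show ?thesis by simp
        qed
        have "norm (y' + y) < sqrt 2 ^ k * \<delta>" "norm (y' - y) < sqrt 2 ^ k * \<delta>"
          using lt near \<delta>(1) by (auto intro!: power2_less_imp_less[of _ "sqrt 2 ^ k * \<delta>"])
        moreover have s: "m + y - x0 = y' + y" "m - y - x0 = y' - y" by (simp_all add: m_def)
        ultimately have "Q (m + y) \<noteq> 0" "Q (m - y) \<noteq> 0"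
          using Suc.IH[rule_format, of "m + y", unfolded s] Suc.IH[rule_format, of "m - y", unfolded s] by blast+
        then have "Q (m + y') * Q (m - y') \<noteq> 0" using eq[OF ny, of m] by auto
        moreover have "m + y' = x" by (simp add: m_def y'_def algebra_simps flip: scaleR_add_left)
        ultimately show ?thesis by auto
      qed (use x0 in simp)
    qed
  qed
  moreover obtain k where "norm (x - x0) / \<delta> < sqrt 2 ^ k"
    using real_arch_pow[of "sqrt 2"] by auto
  then have "norm (x - x0) < sqrt 2 ^ k * \<delta>" using \<delta>(1) by (simp add: pos_divide_less_eq)
  ultimately show ?thesis by blast
qed

text \<open>Cauchy's equation: additivity settles rational arguments, and continuity extends the
  identity to their closure.\<close>

lemma continuous_additive_real:
  fixes f :: "real \<Rightarrow> complex"
  assumes cont: "continuous_on UNIV f" and add: "\<And>s t. f (s + t) = f s + f t"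
  shows "f s = of_real s * f 1"
proof -
  interpret additive f by standard (rule add)
  have nat: "f (of_nat n * x) = of_nat n * f x" for n x
    by (induction n) (simp_all add: zero algebra_simps add)
  have int: "f (of_int k * x) = of_int k * f x" for k x
    by (cases k rule: int_cases2) (simp_all add: nat minus)
  have rat: "f q = of_real q * f 1" if q: "q \<in> \<rat>" for q
  proof -
    obtain a b :: int where ab: "b \<noteq> 0" "q = of_int a / of_int b"
      using q unfolding Rats_eq_int_div_int by blast
    have "of_int b * f q = f (of_int a * 1)" unfolding int[symmetric] using ab by simp
    also have "\<dots> = of_int a * f 1" by (rule int)
    finally have "f q = of_int a / of_int b * f 1" using ab(1) by (simp add: field_simps)
    moreover have "complex_of_real q = of_int a / of_int b" by (simp add: ab(2))
    ultimately show ?thesis by simp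
  qed
  have "f s - of_real s * f 1 = 0"
  proof (rule continuous_constant_on_closure[where S="\<rat>" and f="\<lambda>s. f s - of_real s * f 1" and a=0 and x=s])
    show "continuous_on (closure \<rat>) (\<lambda>s. f s - of_real s * f 1)"
      by (intro continuous_intros continuous_on_subset[OF cont]) auto
    show "s \<in> closure \<rat>" by (simp add: Rats_closure_real)
    show "f x - of_real x * f 1 = 0" if "x \<in> \<rat>" for x
      using rat[OF that] by (simp only: diff_self)
  qed
  then show ?thesis by simp
qed

text \<open>The points m + y, m - y and m + y', m - y' are the ends of the two diagonals of a
  rectangle with centre m. This is the equation for a logarithm, normalised to vanish at 0; it
  passes to even and odd parts, which are solved separately.\<close>

locale rectangle_additive =
  fixes F :: "'a::euclidean_space \<Rightarrow> complex"
  assumes dim: "DIM('a) \<ge> 2" and cont: "continuous_on UNIV F" and zero: "F 0 = 0"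
    and rect: "\<And>m y y'. norm y = norm y' \<Longrightarrow> F (m + y) + F (m - y) = F (m + y') + F (m - y')"
begin

text \<open>The rectangle with vertices 0, p, p + q, q.\<close>

lemma orthogonal_add:
  assumes "p \<bullet> q = 0"
  shows "F (p + q) = F p + F q"
proof -
  let ?h = "\<lambda>x. (1 / 2) *\<^sub>R x"
  have "norm (?h (p + q)) = norm (?h (p - q))"
    using assms by (simp add: norm_eq_sqrt_inner inner_add inner_diff inner_commute)
  from rect[OF this, of "?h (p + q)"]
  have "F (?h (p + q) + ?h (p + q)) + F (?h (p + q) - ?h (p + q)) = F (?h (p + q) + ?h (p - q)) + F (?h (p + q) - ?h (p - q))" .
  moreover have "?h (p + q) + ?h (p + q) = p + q" by (simp flip: scaleR_add_left)
  moreover have "?h (p + q) + ?h (p - q) = p" by (simp add: algebra_simps flip: scaleR_add_left)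
  moreover have "?h (p + q) - ?h (p - q) = q" by (simp add: algebra_simps flip: scaleR_add_left)
  ultimately show ?thesis by (simp add: zero)
qed

text \<open>The rectangle with centre 0 shows that an even solution is radial. As a function of the
  squared norm it is additive by Pythagoras.\<close>

lemma even_quadratic:
  assumes even: "\<And>x. F (- x) = F x"
  shows "\<exists>a. \<forall>x. F x = a * of_real ((norm x)\<^sup>2)"
proof -
  have radial: "F x = F y" if "norm x = norm y" for x y
    using rect[OF that, of 0] by (simp add: even)
  obtain e :: 'a where e: "norm e = 1" using norm_Basis nonempty_Basis by blast
  obtain f where f: "norm f = 1" "f \<bullet> e = 0" using orthogonal_unit_exists[OF dim] by blast
  define \<psi> where "\<psi> s = F (sqrt s *\<^sub>R e)" for s
  have \<psi>0: "\<psi> 0 = 0" by (simp add: \<psi>_def zero)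
  have add: "\<psi> (s + t) = \<psi> s + \<psi> t" if "s \<ge> 0" "t \<ge> 0" for s t
  proof -
    have "(norm (sqrt s *\<^sub>R e + sqrt t *\<^sub>R f))\<^sup>2 = s + t"
    proof -
      have "e \<bullet> e = 1" "f \<bullet> f = 1" "e \<bullet> f = 0" using e f by (simp_all add: power2_norm_eq_inner[symmetric] inner_commute)
      then show ?thesis unfolding power2_norm_eq_inner using f(2) that
        by (simp add: inner_add)
    qed
    then have "norm (sqrt s *\<^sub>R e + sqrt t *\<^sub>R f) = norm (sqrt (s + t) *\<^sub>R e)"
      using e that by (simp add: real_sqrt_unique)
    then have "\<psi> (s + t) = F (sqrt s *\<^sub>R e + sqrt t *\<^sub>R f)" unfolding \<psi>_def by (rule radial[symmetric])
    also have "\<dots> = F (sqrt s *\<^sub>R e) + F (sqrt t *\<^sub>R f)" by (rule orthogonal_add) (simp add: f(2) inner_commute[of e f])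
    also have "F (sqrt t *\<^sub>R f) = \<psi> t" unfolding \<psi>_def by (rule radial) (simp add: e f)
    finally show ?thesis by (simp add: \<psi>_def)
  qed
  \<comment> \<open>The odd extension of \<psi> to the whole line, where Cauchy's equation is
    available.\<close>
  define \<Psi> where "\<Psi> s = \<psi> (max s 0) - \<psi> (max (- s) 0)" for s
  have c: "continuous_on UNIV \<Psi>"
    unfolding \<Psi>_def \<psi>_def
    by (intro continuous_intros continuous_on_compose2[OF cont]) auto
  have "\<Psi> (s + t) = \<Psi> s + \<Psi> t" for s t
  proof -
    \<comment> \<open>Negative parts are moved across so that both sides are sums of nonnegative
      numbers, on which \<psi> is additive.\<close>
    have 1: "max (s + t) 0 + (max (- s) 0 + max (- t) 0) = max (- (s + t)) 0 + (max s 0 + max t 0)"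
      by (auto simp: max_def)
    have "\<psi> (max (s + t) 0) + (\<psi> (max (- s) 0) + \<psi> (max (- t) 0)) = \<psi> (max (- (s + t)) 0) + (\<psi> (max s 0) + \<psi> (max t 0))"
      using arg_cong[OF 1, of \<psi>] by (simp add: add)
    then show ?thesis by (simp add: \<Psi>_def algebra_simps)
  qed
  from continuous_additive_real[OF c this] have \<Psi>: "\<Psi> s = of_real s * \<Psi> 1" for s .
  have "F x = \<Psi> 1 * of_real ((norm x)\<^sup>2)" for x
  proof -
    have "F x = F (norm x *\<^sub>R e)" by (rule radial) (simp add: e)
    also have "\<dots> = \<psi> ((norm x)\<^sup>2)" by (simp add: \<psi>_def)
    also have "\<dots> = \<Psi> ((norm x)\<^sup>2)" by (simp add: \<Psi>_def \<psi>0 max_def)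
    finally show ?thesis using \<Psi>[of "(norm x)\<^sup>2"] by (simp add: mult.commute)
  qed
  then show ?thesis by blast
qed

text \<open>Additivity on each line is obtained from a second orthogonal direction; additivity
  across the basis is \<open>orthogonal_add\<close>.\<close>

lemma odd_linear:
  assumes odd: "\<And>x. F (- x) = - F x"
  shows "F x = (\<Sum>b\<in>Basis. of_real (x \<bullet> b) * F b)"
proof -
  have unit: "F (s *\<^sub>R e) = of_real s * F e" if e: "norm e = 1" for e s
  proof -
    obtain f where f: "norm f = 1" "f \<bullet> e = 0" using orthogonal_unit_exists[OF dim] by blast
    have ee: "e \<bullet> e = 1" "f \<bullet> f = 1" "e \<bullet> f = 0" using e f by (simp_all add: power2_norm_eq_inner[symmetric] inner_commute)
    \<comment> \<open>The same vector is decomposed along e, f and along the diagonals e + f, e - f.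
      Adding the identity with s and t exchanged cancels all terms in f, because F is odd.\<close>
    have step: "F ((s + t) *\<^sub>R e) + F ((s - t) *\<^sub>R f) = F (s *\<^sub>R e) + F (s *\<^sub>R f) + (F (t *\<^sub>R e) - F (t *\<^sub>R f))" for s t
    proof -
      have "F ((s + t) *\<^sub>R e) + F ((s - t) *\<^sub>R f) = F ((s + t) *\<^sub>R e + (s - t) *\<^sub>R f)"
        by (rule orthogonal_add[symmetric]) (simp add: ee)
      also have "(s + t) *\<^sub>R e + (s - t) *\<^sub>R f = (s *\<^sub>R e + s *\<^sub>R f) + (t *\<^sub>R e + - (t *\<^sub>R f))"
        by (simp add: algebra_simps)
      also have "F \<dots> = F (s *\<^sub>R e + s *\<^sub>R f) + F (t *\<^sub>R e + - (t *\<^sub>R f))"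
        by (rule orthogonal_add) (simp add: ee inner_add inner_diff f(2))
      also have "F (s *\<^sub>R e + s *\<^sub>R f) = F (s *\<^sub>R e) + F (s *\<^sub>R f)" by (rule orthogonal_add) (simp add: ee)
      also have "F (t *\<^sub>R e + - (t *\<^sub>R f)) = F (t *\<^sub>R e) + F (- (t *\<^sub>R f))" by (rule orthogonal_add) (simp add: ee)
      finally show ?thesis by (simp add: odd)
    qed
    have "F ((s + t) *\<^sub>R e) = F (s *\<^sub>R e) + F (t *\<^sub>R e)" for s t
    proof -
      have n: "F ((t - s) *\<^sub>R f) = - F ((s - t) *\<^sub>R f)" using odd[of "(s - t) *\<^sub>R f"] by (simp flip: scaleR_minus_left)
      have "F ((s + t) *\<^sub>R e) + - F ((s - t) *\<^sub>R f) = F (t *\<^sub>R e) + F (t *\<^sub>R f) + (F (s *\<^sub>R e) - F (s *\<^sub>R f))"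
        using step[of t s] unfolding n add.commute[of t s] .
      moreover have "2 * F ((s + t) *\<^sub>R e) = (F ((s + t) *\<^sub>R e) + F ((s - t) *\<^sub>R f)) + (F ((s + t) *\<^sub>R e) + - F ((s - t) *\<^sub>R f))"
        by (simp only: mult_2 add.assoc add.left_commute add.right_inverse add_0_right)
      ultimately have "2 * F ((s + t) *\<^sub>R e) = 2 * (F (s *\<^sub>R e) + F (t *\<^sub>R e))"
        unfolding step by simp
      then show ?thesis by (simp only: mult_cancel_left) simp
    qed
    moreover have "continuous_on UNIV (\<lambda>s. F (s *\<^sub>R e))"
      by (intro continuous_on_compose2[OF cont] continuous_intros) auto
    ultimately show ?thesis
      using continuous_additive_real[of "\<lambda>s. F (s *\<^sub>R e)" s] by simp
  qed
  have "F (\<Sum>b\<in>S. (x \<bullet> b) *\<^sub>R b) = (\<Sum>b\<in>S. of_real (x \<bullet> b) * F b)" if "S \<subseteq> Basis" for S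
    using finite_subset[OF that finite_Basis] that
  proof (induction S rule: finite_induct)
    case (insert b S)
    have "b \<bullet> (\<Sum>c\<in>S. (x \<bullet> c) *\<^sub>R c) = 0"
      unfolding inner_sum_right
    proof (intro sum.neutral ballI)
      fix c assume "c \<in> S"
      then have "b \<bullet> c = 0" using insert.hyps insert.prems inner_not_same_Basis[of b c] by auto
      then show "b \<bullet> (x \<bullet> c) *\<^sub>R c = 0" by simp
    qed
    then have "F ((x \<bullet> b) *\<^sub>R b + (\<Sum>c\<in>S. (x \<bullet> c) *\<^sub>R c)) = F ((x \<bullet> b) *\<^sub>R b) + F (\<Sum>c\<in>S. (x \<bullet> c) *\<^sub>R c)"
      by (intro orthogonal_add) simp
    then show ?case using insert unit[of b] by simp
  qed (simp add: zero)
  from this[of Basis] show ?thesis by (simp add: euclidean_representation)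
qed

end

lemma rectangle_equation_quadratic:
  fixes h :: "'a::euclidean_space \<Rightarrow> complex"
  assumes dim: "DIM('a) \<ge> 2" and cont: "continuous_on UNIV h"
    and rect: "\<And>m y y'. norm y = norm y' \<Longrightarrow> h (m + y) + h (m - y) = h (m + y') + h (m - y')"
  shows "\<exists>a B. \<forall>x. h x = a * of_real ((norm x)\<^sup>2) + (\<Sum>b\<in>Basis. B b * of_real (x \<bullet> b)) + h 0"
proof -
  let ?E = "\<lambda>x. (h x + h (- x)) / 2 - h 0" and ?O = "\<lambda>x. (h x - h (- x)) / 2"
  have E: "(a + a') / 2 - z + ((b + b') / 2 - z) = ((a + b) + (a' + b')) / 2 - 2 * z" for a a' b b' z :: complex
    by (simp add: field_simps)
  have O: "(a - a') / 2 + (b - b') / 2 = ((a + b) - (a' + b')) / 2" for a a' b b' :: complex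
    by (simp add: field_simps)
  have rect': "h (- (m + y)) + h (- (m - y)) = h (- (m + y')) + h (- (m - y'))" if "norm y = norm y'" for m y y'
    using rect[OF that, of "- m"] by (simp add: algebra_simps)
  have ch: "continuous_on UNIV (\<lambda>x. h (- x))" by (rule continuous_on_compose2[OF cont]) (auto intro: continuous_intros)
  interpret E: rectangle_additive ?E
  proof
    show "?E (m + y) + ?E (m - y) = ?E (m + y') + ?E (m - y')" if "norm y = norm y'" for m y y'
      unfolding E rect[OF that] rect'[OF that] ..
  qed (use dim cont ch in \<open>auto intro!: continuous_intros\<close>)
  interpret O: rectangle_additive ?O
  proof
    show "?O (m + y) + ?O (m - y) = ?O (m + y') + ?O (m - y')" if "norm y = norm y'" for m y y'
      unfolding O rect[OF that] rect'[OF that] ..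
  qed (use dim cont ch in \<open>auto intro!: continuous_intros\<close>)
  obtain a where a: "\<And>x. ?E x = a * of_real ((norm x)\<^sup>2)"
    using E.even_quadratic by (auto simp: add.commute)
  have o: "?O x = (\<Sum>b\<in>Basis. of_real (x \<bullet> b) * ?O b)" for x
    by (rule O.odd_linear) (simp add: field_simps)
  have "h x = a * of_real ((norm x)\<^sup>2) + (\<Sum>b\<in>Basis. ?O b * of_real (x \<bullet> b)) + h 0" for x
  proof -
    have "h x = ?E x + ?O x + h 0" by (simp add: field_simps)
    also have "\<dots> = a * of_real ((norm x)\<^sup>2) + (\<Sum>b\<in>Basis. of_real (x \<bullet> b) * ?O b) + h 0"
      unfolding a o[of x, symmetric] ..
    finally show ?thesis by (simp only: mult.commute)
  qed
  then show ?thesis by (intro exI[of _ a] exI[of _ "\<lambda>b. ?O b"] allI)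
qed

text \<open>Opposite choices of y show that P and Q are proportional, so Q satisfies the equation
  with itself. A continuous Q without zeros has a continuous logarithm, which satisfies the additive
  equation.\<close>

lemma rectangle_equation_exponential:
  fixes P Q :: "'a::euclidean_space \<Rightarrow> complex"
  assumes dim: "DIM('a) \<ge> 2" and cont: "continuous_on UNIV Q"
    and eq: "\<And>m y y'. norm y = norm y' \<Longrightarrow> P (m + y) * Q (m - y) = P (m + y') * Q (m - y')"
    and nz: "P x1 \<noteq> 0" "Q x2 \<noteq> 0"
  shows "\<exists>c a B C. c \<noteq> 0 \<and> (\<forall>x. P x = c * Q x) \<and>
    (\<forall>x. Q x = exp (a * of_real ((norm x)\<^sup>2) + (\<Sum>b\<in>Basis. B b * of_real (x \<bullet> b)) + C))"
proof -
  \<comment> \<open>The choice y' = - y exchanges the two arguments.\<close>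
  have swap: "P x * Q y = P y * Q x" for x y
  proof -
    have 1: "(1 / 2) *\<^sub>R (x + y) + (1 / 2) *\<^sub>R (x - y) = x" "(1 / 2) *\<^sub>R (x + y) - (1 / 2) *\<^sub>R (x - y) = y"
      by (simp_all add: algebra_simps flip: scaleR_add_left)
    show ?thesis using eq[of "(1 / 2) *\<^sub>R (x - y)" "- ((1 / 2) *\<^sub>R (x - y))" "(1 / 2) *\<^sub>R (x + y)"]
      by (simp only: norm_minus_cancel 1 diff_minus_eq_add add_uminus_conv_diff)
  qed
  define c where "c = P x2 / Q x2"
  have PQ: "P x = c * Q x" for x using swap[of x x2] nz(2) by (simp add: c_def field_simps)
  have c: "c \<noteq> 0" using PQ[of x1] nz(1) by auto
  have eqQ: "Q (m + y) * Q (m - y) = Q (m + y') * Q (m - y')" if "norm y = norm y'" for m y y'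
    using eq[OF that, of m] c by (simp add: PQ)
  have Q0: "Q x \<noteq> 0" for x by (rule nonvanishing_if_rectangle_equation[OF dim cont eqQ nz(2)])
  obtain h where h: "continuous_on UNIV h" "\<And>x. Q x = exp (h x)"
    using continuous_logarithm_on_contractible[OF cont contractible_UNIV] Q0 by auto
  have rect: "h (m + y) + h (m - y) = h (m + y') + h (m - y')" if y: "norm y = norm y'" for m y y'
  proof -
    let ?k = "\<lambda>v. h (m + v) + h (m - v)"
    let ?S = "sphere (0::'a) (norm y)"
    have ck: "continuous_on ?S ?k"
      by (intro continuous_intros continuous_on_compose2[OF h(1)]) auto
    have ek: "exp (?k v) = exp (?k w)" if "v \<in> ?S" "w \<in> ?S" for v w
      using eqQ[of v w m] that by (simp add: exp_add h(2))
    \<comment> \<open>The exponential of \<open>?k\<close> is constant on the sphere, so the values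
      of \<open>?k\<close> differ by multiples of 2 \<pi> i; the sphere is connected because the
      dimension is at least 2.\<close>
    have "?k constant_on ?S"
    proof (rule continuous_discrete_range_constant[OF connected_sphere[OF dim] ck])
      fix v assume v: "v \<in> ?S"
      show "\<exists>e>0. \<forall>w. w \<in> ?S \<and> ?k w \<noteq> ?k v \<longrightarrow> e \<le> norm (?k w - ?k v)"
      proof (intro exI[of _ "2 * pi"] conjI allI impI)
        fix w assume w: "w \<in> ?S \<and> ?k w \<noteq> ?k v"
        then obtain n :: int where n: "?k w = ?k v + of_int (2 * n) * of_real pi * \<i>"
          using ek[of w v] v complex_exp_exists by (auto simp: exp_eq)
        then have "n \<noteq> 0" using w by auto
        have "norm (?k w - ?k v) = 2 * \<bar>of_int n\<bar> * pi" unfolding n by (simp add: norm_mult abs_mult)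
        also have "\<dots> \<ge> 2 * 1 * pi" using \<open>n \<noteq> 0\<close> by (intro mult_right_mono mult_left_mono) auto
        finally show "2 * pi \<le> norm (?k w - ?k v)" by simp
      qed simp
    qed
    then show ?thesis unfolding constant_on_def using y by (metis dist_0_norm mem_sphere)
  qed
  obtain a B where aB: "\<forall>x. h x = a * of_real ((norm x)\<^sup>2) + (\<Sum>b\<in>Basis. B b * of_real (x \<bullet> b)) + h 0"
    using rectangle_equation_quadratic[OF dim h(1) rect] by blast
  have "Q x = exp (a * of_real ((norm x)\<^sup>2) + (\<Sum>b\<in>Basis. B b * of_real (x \<bullet> b)) + h 0)" for x
    unfolding h(2)[of x] aB[rule_format, of x] ..
  then show ?thesis using c PQ by blast
qed

section \<open>Gaussian solutions of the functional equation\<close>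

text \<open>The class of the Gaussians without the sign condition on a, over any Euclidean space.
  The functional equation yields this form; \<open>Re a < 0\<close> is deduced afterwards from
  integrability.\<close>

definition quad_exp :: "complex \<Rightarrow> ('a::euclidean_space \<Rightarrow> complex) \<Rightarrow> complex \<Rightarrow> 'a \<Rightarrow> complex" where
  "quad_exp a B C x = exp (a * of_real ((norm x)\<^sup>2) + (\<Sum>b\<in>Basis. B b * of_real (x \<bullet> b)) + C)"

lemma quad_exp_continuous: "continuous_on S (quad_exp a B C)"
  unfolding quad_exp_def by (intro continuous_intros)

lemma quad_exp_measurable [measurable]: "quad_exp a B C \<in> borel_measurable borel"
  by (intro borel_measurable_continuous_onI quad_exp_continuous)

lemma norm_quad_exp:
  fixes B :: "'a::euclidean_space \<Rightarrow> complex"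
  shows "norm (quad_exp a B C x) = exp (Re a * (norm x)\<^sup>2 + (\<Sum>b\<in>Basis. Re (B b) *\<^sub>R b) \<bullet> x + Re C)"
proof -
  have "Re (\<Sum>b\<in>Basis. B b * of_real (x \<bullet> b)) = (\<Sum>b\<in>Basis. Re (B b) *\<^sub>R b) \<bullet> x"
    unfolding inner_sum_left by (simp add: Re_sum inner_commute)
  moreover have "Re (a * of_real ((norm x)\<^sup>2)) = Re a * (norm x)\<^sup>2" by (simp del: of_real_power)
  ultimately show ?thesis by (simp only: quad_exp_def norm_exp_eq_Re plus_complex.sel)
qed

text \<open>The squared modulus is a real quadratic exponential, whose weighted integral diverges
  when the quadratic coefficient is nonnegative.\<close>

lemma quad_exp_Re_neg:
  fixes B :: "'a::euclidean_space \<Rightarrow> complex"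
  assumes g: "0 \<le> g" "g < real DIM('a)"
    and fin: "(\<integral>\<^sup>+x. ennreal ((norm (quad_exp a B C x))\<^sup>2 * (1 + norm x) powr (- g)) \<partial>lborel) < \<infinity>"
  shows "Re a < 0"
proof (rule ccontr)
  assume "\<not> Re a < 0"
  let ?\<beta> = "\<Sum>b\<in>Basis. Re (B b) *\<^sub>R b"
  have "(norm (quad_exp a B C x))\<^sup>2 = exp (2 * Re a * (norm x)\<^sup>2 + (2 *\<^sub>R ?\<beta>) \<bullet> x + 2 * Re C)" for x
    unfolding norm_quad_exp exp_double[symmetric] by (simp add: algebra_simps)
  with gaussian_weight_infinite[OF _ g, of "2 * Re a" "2 *\<^sub>R ?\<beta>" "2 * Re C"] \<open>\<not> Re a < 0\<close> fin
  show False by simp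
qed

text \<open>Half of the quadratic decay absorbs the linear term, by completing the square.\<close>

lemma quad_exp_integrable:
  fixes B :: "'a::euclidean_space \<Rightarrow> complex"
  assumes a: "Re a < 0"
  shows "integrable lborel (quad_exp a B C)"
proof -
  define s where "s = - Re a"
  have s: "s > 0" using a by (simp add: s_def)
  let ?\<beta> = "\<Sum>b\<in>Basis. Re (B b) *\<^sub>R b"
  let ?k = "exp ((norm ?\<beta>)\<^sup>2 / (2 * s) + Re C)"
  show ?thesis
  proof (rule Bochner_Integration.integrable_bound)
    show "integrable lborel (\<lambda>x::'a. ?k * exp (- (s * (norm x)\<^sup>2 / 2)))"
      by (intro integrable_mult_right integrable_gaussian s)
    show "AE x in lborel. norm (quad_exp a B C x) \<le> norm (?k * exp (- (s * (norm x)\<^sup>2 / 2)))"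
    proof (intro AE_I2)
      fix x
      have "?\<beta> \<bullet> x \<le> norm ?\<beta> * norm x" by (rule norm_cauchy_schwarz)
      moreover have "0 \<le> (s * norm x - norm ?\<beta>)\<^sup>2 / (2 * s)" using s by simp
      then have "norm ?\<beta> * norm x \<le> s * (norm x)\<^sup>2 / 2 + (norm ?\<beta>)\<^sup>2 / (2 * s)"
        using s by (simp add: power2_eq_square field_simps)
      ultimately have "?\<beta> \<bullet> x \<le> s * (norm x)\<^sup>2 / 2 + (norm ?\<beta>)\<^sup>2 / (2 * s)" by (rule order_trans)
      then have "Re a * (norm x)\<^sup>2 + ?\<beta> \<bullet> x + Re C \<le> ((norm ?\<beta>)\<^sup>2 / (2 * s) + Re C) + - (s * (norm x)\<^sup>2 / 2)"
        by (simp add: s_def field_simps)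
      then show "norm (quad_exp a B C x) \<le> norm (?k * exp (- (s * (norm x)\<^sup>2 / 2)))"
        by (simp add: norm_quad_exp exp_add[symmetric])
    qed
  qed measurable
qed

text \<open>The squared norms add up to minus the first component of the frequency, and the linear
  terms to a linear form in the second.\<close>

lemma quad_exp_tensor:
  "quad_exp a B C (fst p) * quad_exp a B C (snd p) =
    (\<lambda>z. exp (- a * of_real (fst z) + (\<Sum>b\<in>Basis. B b * of_real (snd z \<bullet> b)) + 2 * C)) (frequency p)"
  by (simp add: quad_exp_def mult_exp_exp frequency_def inner_add_left sum.distrib algebra_simps)

lemma quad_exp_times_gaussian:
  "quad_exp a B C x = of_real (gaussian x) * quad_exp (a + 1 / 2) B C x"
  by (simp add: quad_exp_def gaussian_def mult_exp_exp algebra_simps flip: exp_of_real)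

lemma quad_exp_reflect: "quad_exp a B C (- x) = quad_exp a (\<lambda>b. - B b) C x"
  by (simp add: quad_exp_def sum_negf)

lemma quad_exp_scale: "c \<noteq> 0 \<Longrightarrow> c * quad_exp a B C x = quad_exp a B (Ln c + C) x"
  by (simp add: quad_exp_def exp_add)

text \<open>\<open>inv_fourier g\<close> is bounded, hence tempered, and on transforms of Schwartz
  functions it agrees with the L^2 preimage of g; by uniqueness of preimages the two coincide almost
  everywhere.\<close>

lemma inv_fourier_square_integrable:
  fixes g :: "'a::euclidean_space \<Rightarrow> complex"
  assumes g: "integrable lborel g" "sq_int g"
  shows "sq_int (inv_fourier g)"
proof -
  obtain G where G: "sq_int G" "has_fourier (distr_of G) g" using l2_inverse_fourier[OF g(2)] by blast
  have [measurable]: "inv_fourier g \<in> borel_measurable borel"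
    by (intro borel_measurable_continuous_onI inv_fourier_continuous g)
  have "norm (inv_fourier g x) \<le> (2 * pi) powr (- real DIM('a)) * (LINT x|lborel. norm (g x))" for x
    unfolding inv_fourier_eq norm_mult by (intro mult_mono norm_fourier_integral_le) auto
  then have t: "tempered (inv_fourier g)" by (rule tempered_bounded[rotated]) measurable
  have tG: "tempered G" using G(1) by (intro tempered_square_integrable) (auto simp: sq_int_iff)
  have "AE x in lborel. inv_fourier g x = G x"
  proof (rule fourier_unique_preimage[OF t tG])
    fix \<phi> :: "'a \<Rightarrow> complex" assume \<phi>: "schwartz \<phi>"
    show "distr_of (inv_fourier g) (fourier_integral \<phi>) = distr_of G (fourier_integral \<phi>)"
      using inv_fourier_multiplication_formula[OF g(1) fourier_schwartz_integrable[OF \<phi>]] G(2) \<phi>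
      unfolding schwartz_inversion[OF \<phi>] has_fourier_def distr_of_def by simp
  qed
  then have "(\<integral>\<^sup>+x. ennreal ((norm (inv_fourier g x))\<^sup>2) \<partial>lborel) = (\<integral>\<^sup>+x. ennreal ((norm (G x))\<^sup>2) \<partial>lborel)"
    by (rule nn_integral_cong_AE[OF eventually_mono]) simp
  then show ?thesis using G(1) by (simp add: sq_int_iff)
qed

text \<open>The Gaussian beats every polynomial. The constant
  \<open>fact M * exp (1 + 1 / 2)\<close> is the decay bound for
  \<open>cgaussian 0 0\<close>.\<close>

lemma gaussian_damping:
  fixes U :: "'a::euclidean_space \<Rightarrow> complex"
  assumes m[measurable]: "U \<in> borel_measurable borel" and g: "g \<ge> 0"
    and w: "(\<integral>\<^sup>+x. ennreal ((norm (U x))\<^sup>2 * (1 + norm x) powr (- g)) \<partial>lborel) < \<infinity>"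
  shows "integrable lborel (\<lambda>x. U x * of_real (gaussian x))" "sq_int (\<lambda>x. U x * of_real (gaussian x))"
proof -
  have p: "0 < 1 + norm x" for x :: 'a using norm_ge_zero[of x] by linarith
  have dec: "(1 + norm x) ^ M * gaussian x \<le> fact M * exp (1 + 1 / 2)" for x :: 'a and M
    using cgaussian_decay[of x M 0 0] by (simp add: cgaussian_0_0 gaussian_pos less_imp_le)
  obtain M where M: "integrable lborel (\<lambda>x. U x / of_real ((1 + norm x) ^ M))"
    using polynomial_growth_integrable[OF m w] by blast
  have "integrable lborel (\<lambda>x. U x / of_real ((1 + norm x) ^ M) * of_real ((1 + norm x) ^ M * gaussian x))"
    by (rule integrable_mult_bounded[OF M, where C="fact M * exp (1 + 1 / 2)"])
      (use dec p in \<open>auto simp: abs_mult gaussian_pos less_imp_le abs_of_pos simp del: of_real_mult of_real_power\<close>)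
  moreover have "U x / of_real ((1 + norm x) ^ M) * of_real ((1 + norm x) ^ M * gaussian x) = U x * of_real (gaussian x)" for x
  proof -
    have "complex_of_real ((1 + norm x) ^ M) \<noteq> 0" using p[of x] by (simp only: of_real_eq_0_iff) simp
    moreover have "u / v * (v * w) = u * w" if "v \<noteq> 0" for u v w :: complex using that by simp
    ultimately show ?thesis unfolding of_real_mult by blast
  qed
  ultimately show "integrable lborel (\<lambda>x. U x * of_real (gaussian x))" by simp
  obtain K :: nat where K: "g \<le> real K" using real_arch_simple by blast
  let ?k = "fact K * exp (1 + 1 / 2) :: real"
  have "(\<integral>\<^sup>+x. ennreal ((norm (U x * of_real (gaussian x)))\<^sup>2) \<partial>lborel) \<le> (\<integral>\<^sup>+x. ennreal ?k * ennreal ((norm (U x))\<^sup>2 * (1 + norm x) powr (- g)) \<partial>lborel)"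
  proof (rule nn_integral_mono)
    fix x :: 'a
    have "(gaussian x)\<^sup>2 \<le> gaussian x"
      using mult_left_mono[OF gaussian_le_1[of x], of "gaussian x"] by (simp add: power2_eq_square gaussian_pos less_imp_le)
    also have "gaussian x = gaussian x * ((1 + norm x) powr g * (1 + norm x) powr (- g))"
      using p[of x] by (simp flip: powr_add)
    also have "\<dots> \<le> ?k * (1 + norm x) powr (- g)"
    proof -
      have "(1 + norm x) powr g \<le> (1 + norm x) powr real K" using K by (intro powr_mono) auto
      also have "\<dots> = (1 + norm x) ^ K" by (rule powr_realpow[OF p])
      finally have "(1 + norm x) powr g * gaussian x \<le> (1 + norm x) ^ K * gaussian x"
        by (intro mult_right_mono) (auto simp: gaussian_pos less_imp_le)
      also have "\<dots> \<le> ?k" by (rule dec)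
      finally have "((1 + norm x) powr g * gaussian x) * (1 + norm x) powr (- g) \<le> ?k * (1 + norm x) powr (- g)"
        by (intro mult_right_mono) auto
      then show ?thesis by (simp only: mult_ac)
    qed
    finally have "(norm (U x))\<^sup>2 * (gaussian x)\<^sup>2 \<le> (norm (U x))\<^sup>2 * (?k * (1 + norm x) powr (- g))"
      by (rule mult_left_mono) simp
    then have "(norm (U x * of_real (gaussian x)))\<^sup>2 \<le> ?k * ((norm (U x))\<^sup>2 * (1 + norm x) powr (- g))"
      by (simp add: norm_mult power_mult_distrib mult.left_commute)
    then show "ennreal ((norm (U x * of_real (gaussian x)))\<^sup>2) \<le> ennreal ?k * ennreal ((norm (U x))\<^sup>2 * (1 + norm x) powr (- g))"
      by (subst ennreal_mult[symmetric]) (auto intro: ennreal_leI)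
  qed
  also have "\<dots> = ennreal ?k * (\<integral>\<^sup>+x. ennreal ((norm (U x))\<^sup>2 * (1 + norm x) powr (- g)) \<partial>lborel)"
    by (rule nn_integral_cmult) measurable
  also have "\<dots> < \<infinity>" using w by (simp add: ennreal_mult_less_top)
  finally show "sq_int (\<lambda>x. U x * of_real (gaussian x))"
    unfolding sq_int_iff by (intro conjI) measurable
qed

text \<open>Multiplying by a Gaussian and taking Fourier transforms turns the equation, valid almost everywhere, into one for
  continuous functions valid everywhere.\<close>

theorem gaussian_of_tensor:
  fixes U V :: "'a::euclidean_space \<Rightarrow> complex"
  assumes dim: "DIM('a) \<ge> 2" and m[measurable]: "U \<in> borel_measurable borel" "V \<in> borel_measurable borel" "L \<in> borel_measurable borel"
    and g: "0 \<le> g" "g < real DIM('a)"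
    and wU: "(\<integral>\<^sup>+x. ennreal ((norm (U x))\<^sup>2 * (1 + norm x) powr (- g)) \<partial>lborel) < \<infinity>"
    and wV: "(\<integral>\<^sup>+x. ennreal ((norm (V x))\<^sup>2 * (1 + norm x) powr (- g)) \<partial>lborel) < \<infinity>"
    and nz: "\<not> (AE x in lborel. U x = 0)" "\<not> (AE x in lborel. V x = 0)"
    and eq: "AE p in lborel. U (fst p) * V (snd p) = L (frequency p)"
  shows "\<exists>a B C c. Re a < 0 \<and> c \<noteq> 0 \<and> (AE x in lborel. V x = quad_exp a B C x) \<and> (AE x in lborel. U x = c * V x)"
proof -
  define f where "f x = U x * of_real (gaussian x)" for x
  define h where "h x = V x * of_real (gaussian x)" for x
  have gn: "gaussian x \<noteq> 0" for x :: 'a using gaussian_pos[of x] by simp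
  then have gp: "complex_of_real (gaussian x) \<noteq> 0" for x :: 'a by simp
  have f: "integrable lborel f" "sq_int f" unfolding f_def by (rule gaussian_damping[OF m(1) g(1) wU])+
  have h: "integrable lborel h" "sq_int h" unfolding h_def by (rule gaussian_damping[OF m(2) g(1) wV])+
  note [measurable] = sq_int_measurable[OF f(2)] sq_int_measurable[OF h(2)]
  have fz: "\<exists>x. fourier_integral f x \<noteq> 0"
  proof (rule ccontr)
    assume "\<nexists>x. fourier_integral f x \<noteq> 0"
    then have "AE x in lborel. f x = 0" by (intro fourier_integral_injective f) auto
    then have "AE x in lborel. U x = 0" by eventually_elim (simp add: f_def gn)
    then show False using nz by blast
  qed
  have hz: "\<exists>x. fourier_integral h x \<noteq> 0"
  proof (rule ccontr)
    assume "\<nexists>x. fourier_integral h x \<noteq> 0"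
    then have "AE x in lborel. h x = 0" by (intro fourier_integral_injective h) auto
    then have "AE x in lborel. V x = 0" by eventually_elim (simp add: h_def gn)
    then show False using nz by blast
  qed
  \<comment> \<open>The product of the Gaussian factors at \<zeta> and \<eta> is exp(\<tau> / 2)
    with \<tau> = - |\<zeta>|^2 - |\<eta>|^2, a function of the frequency.\<close>
  define L' where "L' z = L z * of_real (exp (fst z / 2))" for z
  have [measurable]: "(\<lambda>z::real \<times> 'a. complex_of_real (exp (fst z / 2))) \<in> borel_measurable borel"
    by (intro borel_measurable_continuous_onI continuous_intros) auto
  have [measurable]: "L' \<in> borel_measurable borel" unfolding L'_def by measurable
  have eq': "AE p in lborel. f (fst p) * h (snd p) = L' (frequency p)"
    using eq
  proof eventually_elim
    case (elim p)
    have "gaussian (fst p) * gaussian (snd p) = exp (fst (frequency p) / 2)"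
      by (simp add: gaussian_def mult_exp_exp frequency_def diff_divide_distrib)
    then have "complex_of_real (gaussian (fst p)) * of_real (gaussian (snd p)) = of_real (exp (fst (frequency p) / 2))"
      by (simp only: of_real_mult[symmetric])
    then show ?case unfolding f_def h_def L'_def elim[symmetric] by (metis mult.assoc mult.left_commute)
  qed
  obtain x1 x2 where x: "fourier_integral f x1 \<noteq> 0" "fourier_integral h x2 \<noteq> 0" using fz hz by blast
  note inv = fourier_tensor_invariant[OF f(1) h(1) \<open>L' \<in> borel_measurable borel\<close> eq']
  obtain c a B C where c: "c \<noteq> 0" and fh: "\<And>x. fourier_integral f x = c * fourier_integral h x"
    and hq: "\<And>x. fourier_integral h x = quad_exp a B C x"
    using rectangle_equation_exponential[OF dim continuous_fourier_integral[OF h(1)] inv x, folded quad_exp_def] by blast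
  have UV: "AE x in lborel. U x = c * V x"
  proof -
    have "AE x in lborel. f x - c * h x = 0"
    proof (rule fourier_integral_injective)
      show "integrable lborel (\<lambda>x. f x - c * h x)" using f h by auto
      fix \<xi>
      have "fourier_integral (\<lambda>x. f x - c * h x) \<xi> = fourier_integral f \<xi> - c * fourier_integral h \<xi>"
        unfolding fourier_integral_def
        by (subst integral_mult_right_zero[symmetric], subst Bochner_Integration.integral_diff[symmetric])
          (auto intro!: integrable_mult_right fourier_integrand_integrable[simplified] f h simp: algebra_simps)
      then show "fourier_integral (\<lambda>x. f x - c * h x) \<xi> = 0" by (simp add: fh)
    qed
    then show ?thesis
    proof eventually_elim
      case (elim x)
      then have "(U x - c * V x) * of_real (gaussian x) = 0" by (simp add: f_def h_def algebra_simps)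
      then show ?case using gp[of x] by simp
    qed
  qed
  let ?u = "quad_exp a B C :: 'a \<Rightarrow> complex"
  have hu: "fourier_integral h = ?u" using hq by auto
  \<comment> \<open>Up to a constant and a reflection \<open>?u\<close> is the inverse transform of
    the square-integrable h, hence square integrable itself; this is the criterion with weight
    exponent 0.\<close>
  have a: "Re a < 0"
  proof (rule quad_exp_Re_neg[of 0])
    note [measurable] = sq_int_measurable[OF inv_fourier_square_integrable[OF h]]
    have inv: "norm (?u x) = (2 * pi) powr real DIM('a) * norm (inv_fourier h (- x))" for x
    proof -
      have "norm (inv_fourier h (- x)) = (2 * pi) powr (- real DIM('a)) * norm (?u x)"
        unfolding inv_fourier_eq hu norm_mult norm_of_real by simp
      then show ?thesis by (simp add: powr_minus)
    qed
    have "(\<integral>\<^sup>+x. ennreal ((norm (?u x))\<^sup>2 * (1 + norm x) powr (- 0)) \<partial>lborel) =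
       (\<integral>\<^sup>+x. ennreal (((2 * pi) powr real DIM('a))\<^sup>2) * ennreal ((norm (inv_fourier h (- x)))\<^sup>2) \<partial>lborel)"
      by (intro nn_integral_cong) (auto simp: inv power_mult_distrib ennreal_mult add_nonneg_eq_0_iff)
    also have "\<dots> = ennreal (((2 * pi) powr real DIM('a))\<^sup>2) * (\<integral>\<^sup>+x. ennreal ((norm (inv_fourier h (- x)))\<^sup>2) \<partial>lborel)"
      by (rule nn_integral_cmult) measurable
    also have "(\<integral>\<^sup>+x. ennreal ((norm (inv_fourier h (- x)))\<^sup>2) \<partial>lborel) = (\<integral>\<^sup>+x. ennreal ((norm (inv_fourier h x))\<^sup>2) \<partial>lborel)"
      using nn_integral_lborel_affine[of "\<lambda>x. ennreal ((norm (inv_fourier h x))\<^sup>2)" "-1" 0] by simp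
    also have "ennreal (((2 * pi) powr real DIM('a))\<^sup>2) * (\<integral>\<^sup>+x. ennreal ((norm (inv_fourier h x))\<^sup>2) \<partial>lborel) < \<infinity>"
      using inv_fourier_square_integrable[OF h] by (simp add: sq_int_iff ennreal_mult_less_top)
    finally show "(\<integral>\<^sup>+x. ennreal ((norm (?u x))\<^sup>2 * (1 + norm x) powr (- 0)) \<partial>lborel) < \<infinity>" .
  qed auto
  have ui: "integrable lborel ?u" by (rule quad_exp_integrable[OF a])
  have uz: "\<exists>x. fourier_integral ?u x \<noteq> 0"
  proof (rule ccontr)
    assume "\<nexists>x. fourier_integral ?u x \<noteq> 0"
    then have "AE x in lborel. ?u x = 0" by (intro fourier_integral_injective ui) auto
    then have "AE x in lborel. h x = 0" using fourier_inversion_AE[OF h(1)] ui unfolding hu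
      by (auto simp: quad_exp_def inv_fourier_def)
    then have "AE x in lborel. V x = 0" by eventually_elim (simp add: h_def gn)
    then show False using nz by blast
  qed
  \<comment> \<open>Being a quadratic exponential, \<open>?u\<close> satisfies the functional
    equation with itself, so its own Fourier transform is again a quadratic exponential. Inversion
    then gives h.\<close>
  let ?L = "\<lambda>z::real \<times> 'a. exp (- a * of_real (fst z) + (\<Sum>b\<in>Basis. B b * of_real (snd z \<bullet> b)) + 2 * C)"
  have Lm: "?L \<in> borel_measurable borel"
    by (intro borel_measurable_continuous_onI continuous_intros)
  have "AE p in lborel. ?u (fst p) * ?u (snd p) = ?L (frequency p)"
    by (intro AE_I2) (rule quad_exp_tensor)
  note inv = fourier_tensor_invariant[OF ui ui Lm this]
  obtain x3 where x3: "fourier_integral ?u x3 \<noteq> 0" using uz by blast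
  obtain a' B' C' where uq: "\<And>x. fourier_integral ?u x = quad_exp a' B' C' x"
    using rectangle_equation_exponential[OF dim continuous_fourier_integral[OF ui] inv x3 x3, folded quad_exp_def] by blast
  let ?k = "complex_of_real ((2 * pi) powr (- real DIM('a)))"
  have k: "?k \<noteq> 0" by simp
  \<comment> \<open>Inversion evaluates the second transform at - x, which flips the sign of the
    linear part; removing the damping adds 1/2 to the quadratic coefficient.\<close>
  have "AE x in lborel. V x = quad_exp (a' + 1 / 2) (\<lambda>b. - B' b) (Ln ?k + C') x"
    using fourier_inversion_AE[OF h(1) ui[folded hu]]
  proof eventually_elim
    case (elim x)
    have "h x = ?k * quad_exp a' B' C' (- x)"
      unfolding elim hu inv_fourier_eq uq ..
    also have "\<dots> = of_real (gaussian x) * quad_exp (a' + 1 / 2) (\<lambda>b. - B' b) (Ln ?k + C') x"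
      unfolding quad_exp_reflect quad_exp_scale[OF k] by (rule quad_exp_times_gaussian)
    finally show ?case using gp[of x] by (simp add: h_def mult.commute)
  qed
  \<comment> \<open>The decay of the undamped function comes from the weighted bound on V, and this
    is where g < d enters.\<close>
  moreover have "Re (a' + 1 / 2) < 0"
  proof (rule quad_exp_Re_neg[OF g])
    show "(\<integral>\<^sup>+x. ennreal ((norm (quad_exp (a' + 1 / 2) (\<lambda>b. - B' b) (Ln ?k + C') x))\<^sup>2 * (1 + norm x) powr (- g)) \<partial>(lborel :: 'a measure)) < \<infinity>"
      using wV by (subst nn_integral_cong_AE[OF eventually_mono[OF calculation]]) auto
  qed
  ultimately show ?thesis using UV c by blast
qed

section \<open>Extremal data\<close>

lemma AE_lborel_fst:
  fixes P :: "'a::euclidean_space \<Rightarrow> bool"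
  assumes [measurable]: "Measurable.pred borel P" and AE: "AE x in lborel. P x"
  shows "AE p in (lborel :: ('a \<times> 'b::euclidean_space) measure). P (fst p)"
    and "AE p in (lborel :: ('b \<times> 'a) measure). P (snd p)"
proof -
  have z: "(\<integral>\<^sup>+x. indicator {x. \<not> P x} x \<partial>lborel) = 0"
    using AE by (subst nn_integral_0_iff_AE) (auto simp: indicator_def)
  have "(\<integral>\<^sup>+p. indicator {x. \<not> P x} (fst p) \<partial>(lborel :: ('a \<times> 'b) measure)) =
    (\<integral>\<^sup>+y. \<integral>\<^sup>+x. indicator {x. \<not> P x} x \<partial>lborel \<partial>(lborel :: 'b measure))"
    unfolding lborel_prod[symmetric] by (subst lborel_pair.nn_integral_snd[symmetric]) auto
  then have "(\<integral>\<^sup>+p. indicator {x. \<not> P x} (fst p) \<partial>(lborel :: ('a \<times> 'b) measure)) = 0" by (simp only: z) simp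
  then show "AE p in (lborel :: ('a \<times> 'b) measure). P (fst p)"
    unfolding lborel_prod[symmetric] by (subst (asm) nn_integral_0_iff_AE) (auto simp: indicator_def)
  have "(\<integral>\<^sup>+p. indicator {x. \<not> P x} (snd p) \<partial>(lborel :: ('b \<times> 'a) measure)) =
    (\<integral>\<^sup>+y. \<integral>\<^sup>+x. indicator {x. \<not> P x} x \<partial>lborel \<partial>(lborel :: 'b measure))"
    unfolding lborel_prod[symmetric] by (subst lborel.nn_integral_fst[symmetric]) auto
  then have "(\<integral>\<^sup>+p. indicator {x. \<not> P x} (snd p) \<partial>(lborel :: ('b \<times> 'a) measure)) = 0" by (simp only: z) simp
  then show "AE p in (lborel :: ('b \<times> 'a) measure). P (snd p)"
    unfolding lborel_prod[symmetric] by (subst (asm) nn_integral_0_iff_AE) (auto simp: indicator_def)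
qed

lemma Upsilon_fourier:
  assumes "(u0, v0) \<in> Upsilon b"
  shows "tempered u0" "tempered v0" "has_fourier (distr_of u0) (fourier u0)" "has_fourier (distr_of v0) (fourier v0)"
    "tempered (fourier u0)" "tempered (fourier v0)" "pair_energy b (fourier u0) (fourier v0) < \<infinity>"
  using assms has_fourier_fourier[of u0] has_fourier_fourier[of v0]
  by (auto simp: Upsilon_def I_fun_eq has_fourier_def)

lemma D_power_norm_sq_Upsilon:
  fixes u0 v0 :: "'a::euclidean_space \<Rightarrow> complex"
  assumes u: "(u0, v0) \<in> Upsilon b"
  shows "D_power_norm_sq b (solution_product u0 v0) =
    ennreal (2 powr (- 2 * b) * sharp_const DIM('a)) * product_energy b (fourier u0) (fourier v0)"
proof (rule D_power_norm_sq_solution_product)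
  note U = Upsilon_fourier[OF u]
  show "pair_growth (fourier u0) (fourier v0)"
    using U by (intro pair_growthI tempered_measurable)
  show "product_energy b (fourier u0) (fourier v0) < \<infinity>"
    using product_energy_le[OF tempered_measurable[OF U(5)] tempered_measurable[OF U(6)]] U(7) by (rule le_less_trans)
qed (use Upsilon_fourier[OF u] in auto)

lemma sharp_const_pos: "d > 0 \<Longrightarrow> sharp_const d > 0"
  unfolding sharp_const_def by (intro mult_pos_pos divide_pos_pos Gamma_real_pos) auto

lemma fourier_AE_0_iff:
  fixes u :: "'a::euclidean_space \<Rightarrow> complex"
  assumes u: "tempered u" "has_fourier (distr_of u) U" and U: "AE x in lborel. U x = 0"
  shows "AE x in lborel. u x = 0"
proof (rule fourier_unique_preimage[OF u(1)])
  show "tempered (\<lambda>x::'a. 0)" by (rule tempered_bounded[of _ 0]) auto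
  fix \<phi> :: "'a \<Rightarrow> complex" assume \<phi>: "schwartz \<phi>"
  have "distr_of u (fourier_integral \<phi>) = (LINT x|lborel. U x * \<phi> x)"
    using u(2) \<phi> by (simp add: has_fourier_def distr_of_def)
  also have "\<dots> = (LINT x|(lborel :: 'a measure). 0)"
    using U u(2) schwartz_integrable0(2)[OF \<phi>]
    by (intro integral_cong_AE) (auto simp: has_fourier_def tempered_def elim!: eventually_mono)
  finally show "distr_of u (fourier_integral \<phi>) = distr_of (\<lambda>x. 0) (fourier_integral \<phi>)"
    by (simp add: distr_of_def)
qed

lemma has_fourier_scale:
  assumes "has_fourier (distr_of u) U"
  shows "has_fourier (distr_of (\<lambda>x. c * u x)) (\<lambda>x. c * U x)"
proof -
  have "integrable lborel (\<lambda>x. c * U x * \<phi> x)" if "schwartz \<phi>" for \<phi>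
    using assms that integrable_mult_right[of c lborel "\<lambda>x. U x * \<phi> x"] by (auto simp: has_fourier_def tempered_def mult.assoc)
  then show ?thesis
    using assms by (auto simp: has_fourier_def tempered_def distr_of_def mult.assoc)
qed

lemma tempered_scale: "tempered u \<Longrightarrow> tempered (\<lambda>x. c * u x)"
  by (auto simp: tempered_def mult.assoc)

lemma distr_of_cong_AE:
  assumes "tempered u" "tempered v" "AE x in lborel. u x = v x" and [measurable]: "\<psi> \<in> borel_measurable borel"
  shows "distr_of u \<psi> = distr_of v \<psi>"
proof -
  note [measurable] = tempered_measurable[OF assms(1)] tempered_measurable[OF assms(2)]
  show ?thesis unfolding distr_of_def
    by (rule integral_cong_AE) (use assms(3) in \<open>auto elim!: eventually_mono\<close>)
qed

text \<open>Uniqueness of the transform gives one direction, uniqueness of the preimage the other.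
  It carries proportionality of transforms over to the data.\<close>

lemma fourier_scaled_AE:
  fixes u v :: "'a::euclidean_space \<Rightarrow> complex"
  assumes u: "tempered u" "has_fourier (distr_of u) U" and v: "tempered v" "has_fourier (distr_of v) V"
  shows "(AE x in lborel. v x = c * u x) \<longleftrightarrow> (AE x in lborel. V x = c * U x)"
proof
  have s: "has_fourier (distr_of (\<lambda>x. c * u x)) (\<lambda>x. c * U x)" by (rule has_fourier_scale[OF u(2)])
  have tU: "tempered U" "tempered V" using u v by (auto simp: has_fourier_def)
  {
    assume AE: "AE x in lborel. v x = c * u x"
    have "has_fourier (distr_of v) (\<lambda>x. c * U x)"
      unfolding has_fourier_def
    proof (intro conjI allI impI)
      show "tempered (\<lambda>x. c * U x)" by (rule tempered_scale[OF tU(1)])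
      fix \<phi> :: "'a \<Rightarrow> complex" assume \<phi>: "schwartz \<phi>"
      have "distr_of v (fourier_integral \<phi>) = distr_of (\<lambda>x. c * u x) (fourier_integral \<phi>)"
        using schwartz_integrable0(2)[OF \<phi>] by (intro distr_of_cong_AE v tempered_scale u AE) measurable
      then show "distr_of v (fourier_integral \<phi>) = distr_of (\<lambda>x. c * U x) \<phi>"
        using s \<phi> by (simp add: has_fourier_def)
    qed
    then show "AE x in lborel. V x = c * U x" by (rule has_fourier_unique[OF v(2)])
  }
  {
    assume AE: "AE x in lborel. V x = c * U x"
    show "AE x in lborel. v x = c * u x"
    proof (rule fourier_unique_preimage[OF v(1) tempered_scale[OF u(1)]])
      fix \<phi> :: "'a \<Rightarrow> complex" assume \<phi>: "schwartz \<phi>"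
      have "distr_of v (fourier_integral \<phi>) = distr_of V \<phi>" using v(2) \<phi> by (simp add: has_fourier_def)
      also have "\<dots> = distr_of (\<lambda>x. c * U x) \<phi>"
        by (intro distr_of_cong_AE tU tempered_scale AE schwartz_integrable0(2)[OF \<phi>])
      also have "\<dots> = distr_of (\<lambda>x. c * u x) (fourier_integral \<phi>)" using s \<phi> by (simp add: has_fourier_def)
      finally show "distr_of v (fourier_integral \<phi>) = distr_of (\<lambda>x. c * u x) (fourier_integral \<phi>)" .
    qed
  }
qed

lemma quad_exp_vec:
  fixes B :: "real ^ 'n \<Rightarrow> complex"
  shows "(\<Sum>b\<in>Basis. B b * of_real (x \<bullet> b)) = (\<Sum>i\<in>UNIV. B (axis i 1) * of_real (x $ i))"
proof -
  have B: "(Basis :: (real ^ 'n) set) = (\<lambda>i. axis i 1) ` UNIV" by (auto simp: Basis_vec_def)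
  have i: "inj (\<lambda>i::'n. axis i (1::real))" by (auto simp: inj_on_def axis_eq_axis)
  show ?thesis unfolding B sum.reindex[OF i] by (simp add: inner_axis)
qed

lemma quad_exp_in_gaussians:
  fixes B :: "real ^ 'n \<Rightarrow> complex"
  assumes "Re a < 0"
  shows "quad_exp a B C \<in> gaussians"
  unfolding gaussians_def quad_exp_def[abs_def] quad_exp_vec
  using assms by (intro CollectI exI[of _ a] exI[of _ "\<chi> i. B (axis i 1)"] exI[of _ C]) simp

lemma gaussians_quad_exp:
  fixes h :: "real ^ 'n \<Rightarrow> complex"
  assumes "h \<in> gaussians"
  obtains a B C where "h = quad_exp a B C"
proof -
  obtain a b c where h: "h = (\<lambda>\<eta>. exp (a * of_real ((norm \<eta>)\<^sup>2) + (\<Sum>i\<in>UNIV. b $ i * of_real (\<eta> $ i)) + c))"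
    using assms unfolding gaussians_def by blast
  define B where "B v = (\<Sum>i\<in>UNIV. b $ i * of_real (v $ i))" for v :: "real ^ 'n"
  have "B (axis i 1) = b $ i" for i
    unfolding B_def axis_def by (simp add: if_distrib[of "\<lambda>x. _ * complex_of_real x"] cong: if_cong)
  then have "h = quad_exp a B c"
    unfolding h quad_exp_def[abs_def] quad_exp_vec by simp
  then show ?thesis using that by blast
qed

text \<open>Equality gives the functional equation, and finite energy gives the weighted bounds for
  both factors that \<open>gaussian_of_tensor\<close> asks for.\<close>

theorem gaussian_if_equality:
  fixes U V :: "'a::euclidean_space \<Rightarrow> complex"
  assumes dim: "DIM('a) \<ge> 2" and b: "b > (1 - real DIM('a)) / 2"
    and m: "U \<in> borel_measurable borel" "V \<in> borel_measurable borel"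
    and fin: "pair_energy b U V < \<infinity>"
    and nz: "\<not> (AE x in lborel. U x = 0)" "\<not> (AE x in lborel. V x = 0)"
    and eq: "product_energy b U V = pair_energy b U V"
  shows "\<exists>a B C c. Re a < 0 \<and> c \<noteq> 0 \<and> (AE x in lborel. V x = quad_exp a B C x) \<and> (AE x in lborel. U x = c * V x)"
proof -
  obtain L where L: "L \<in> borel_measurable borel" "AE p in lborel. U (fst p) * V (snd p) = L (frequency p)"
    using product_energy_eq_iff[OF m fin] eq by blast
  let ?g = "- min (4 * b + real DIM('a) - 2) 0"
  \<comment> \<open>The bound \<open>?g < d\<close> amounts to 4 b + d - 2 > - d, that is, to the
    hypothesis on b.\<close>
  have g: "0 \<le> ?g" "?g < real DIM('a)" using b DIM_positive[where 'a='a] by (auto simp: min_def field_simps)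
  have fin': "pair_energy b V U < \<infinity>" using fin pair_energy_commute[OF m] by simp
  show ?thesis
    using weighted_square_integrable[OF m nz(2) fin] weighted_square_integrable[OF m(2,1) nz(1) fin']
    by (intro gaussian_of_tensor[OF dim m L(1) g _ _ nz L(2)]) simp_all
qed

lemma equality_if_gaussian:
  fixes U V :: "'a::euclidean_space \<Rightarrow> complex"
  assumes m[measurable]: "U \<in> borel_measurable borel" "V \<in> borel_measurable borel"
    and fin: "pair_energy b U V < \<infinity>"
    and U: "AE x in lborel. U x = quad_exp a B C x" and V: "AE x in lborel. V x = c * U x"
  shows "product_energy b U V = pair_energy b U V"
proof -
  let ?L = "\<lambda>z::real \<times> 'a. exp (- a * of_real (fst z) + (\<Sum>b\<in>Basis. B b * of_real (snd z \<bullet> b)) + 2 * C)"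
  have Lm: "?L \<in> borel_measurable borel"
    by (intro borel_measurable_continuous_onI continuous_intros)
  have V': "AE x in lborel. V x = c * quad_exp a B C x" using U V by eventually_elim simp
  have "AE p in (lborel :: ('a \<times> 'a) measure). U (fst p) = quad_exp a B C (fst p)"
    by (rule AE_lborel_fst(1)[OF _ U]) measurable
  moreover have "AE p in (lborel :: ('a \<times> 'a) measure). V (snd p) = c * quad_exp a B C (snd p)"
    by (rule AE_lborel_fst(2)[OF _ V']) measurable
  ultimately have "AE p in lborel. U (fst p) * V (snd p) = c * ?L (frequency p)"
  proof eventually_elim
    case (elim p)
    have "U (fst p) * V (snd p) = c * (quad_exp a B C (fst p) * quad_exp a B C (snd p))" by (simp add: elim)
    then show ?case unfolding quad_exp_tensor .
  qed
  moreover have "(\<lambda>z. c * ?L z) \<in> borel_measurable borel"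
    by (rule borel_measurable_times[OF borel_measurable_const Lm])
  ultimately have "\<exists>L. L \<in> borel_measurable borel \<and> (AE p in lborel. U (fst p) * V (snd p) = L (frequency p))"
    by (intro exI[of _ "\<lambda>z. c * ?L z"] conjI)
  then show ?thesis by (rule product_energy_eq_iff[OF m fin, THEN iffD2])
qed

section \<open>Finite energy of Gaussian data\<close>

text \<open>With s = 2 |y|^2 as radial variable the integral becomes a constant times the Gamma
  integral at (d + p) / 2, which converges because p > - d.\<close>

lemma nn_integral_radial_power_gaussian:
  assumes p: "p > - real DIM('a::euclidean_space)"
  shows "(\<integral>\<^sup>+y. ennreal (exp (- 2 * (norm (y::'a))\<^sup>2) * norm (2 *\<^sub>R y) powr p) \<partial>lborel) < \<infinity>"
proof -
  let ?n = "real DIM('a)"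
  interpret S: prob_space "sphere_measure :: 'a measure" by (rule prob_space_sphere_measure)
  let ?f = "\<lambda>y::'a. ennreal (exp (- 2 * (norm y)\<^sup>2) * norm (2 *\<^sub>R y) powr p)"
  let ?q = "?n / 2 + p / 2"
  let ?c = "unit_ball_vol ?n * (?n / 4) * 2 powr (- (?n / 2 - 1)) * 2 powr (p / 2)"
  have q: "?q > 0" using p by simp
  have "(\<integral>\<^sup>+y. ?f y \<partial>lborel) = (\<integral>\<^sup>+s. ennreal (radial_density ?n s) * (\<integral>\<^sup>+w. ?f (sqrt (s / 2) *\<^sub>R w) \<partial>sphere_measure) \<partial>lborel)"
    by (rule nn_integral_polar) measurable
  also have "\<dots> = (\<integral>\<^sup>+s. ennreal ?c * ennreal (indicator {0..} s * (s powr (?q - 1) / exp s)) \<partial>lborel)"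
  proof (rule nn_integral_cong_AE)
    show "AE s in lborel. ennreal (radial_density ?n s) * (\<integral>\<^sup>+w. ?f (sqrt (s / 2) *\<^sub>R w) \<partial>sphere_measure) =
      ennreal ?c * ennreal (indicator {0..} s * (s powr (?q - 1) / exp s))"
      using AE_lborel_singleton[of "0::real"]
    proof eventually_elim
      case (elim s)
      show ?case
      proof (cases "s > 0")
        case True
        have "(\<integral>\<^sup>+w. ?f (sqrt (s / 2) *\<^sub>R w) \<partial>(sphere_measure :: 'a measure)) = (\<integral>\<^sup>+w. ennreal (exp (- s) * (2 * s) powr (p / 2)) \<partial>(sphere_measure :: 'a measure))"
        proof (rule nn_integral_cong_AE)
          show "AE w in sphere_measure. ?f (sqrt (s / 2) *\<^sub>R w) = ennreal (exp (- s) * (2 * s) powr (p / 2))"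
            using AE_sphere_measure_norm
          proof eventually_elim
            case (elim w)
            have "norm (2 *\<^sub>R (sqrt (s / 2) *\<^sub>R w)) = sqrt (2 * s)"
              using True elim by (simp add: real_sqrt_mult real_sqrt_divide field_simps)
            also have "\<dots> = (2 * s) powr (1 / 2)" using True by (simp add: powr_half_sqrt)
            finally have 1: "norm (2 *\<^sub>R (sqrt (s / 2) *\<^sub>R w)) powr p = (2 * s) powr (p / 2)" by (simp add: powr_powr)
            have 2: "- 2 * (norm (sqrt (s / 2) *\<^sub>R w))\<^sup>2 = - s" using True elim by simp
            show ?case unfolding 1 2 ..
          qed
        qed
        also have "\<dots> = ennreal (exp (- s) * (2 * s) powr (p / 2))" using S.emeasure_space_1 by simp
        also have "ennreal (radial_density ?n s) * \<dots> = ennreal (radial_density ?n s * (exp (- s) * (2 * s) powr (p / 2)))"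
          by (simp add: ennreal_mult radial_density_nonneg)
        also have "radial_density ?n s * (exp (- s) * (2 * s) powr (p / 2)) = ?c * (s powr (?q - 1) / exp s)"
        proof -
          have "s powr (?n / 2 - 1) * s powr (p / 2) = s powr (?q - 1)"
            by (subst powr_add[symmetric]) (simp add: algebra_simps)
          then have "?c * (s powr (?q - 1) / exp s) = ?c * (s powr (?n / 2 - 1) * s powr (p / 2)) / exp s" by simp
          also have "\<dots> = radial_density ?n s * (exp (- s) * (2 * s) powr (p / 2))"
            using True by (simp add: radial_density_def powr_divide powr_mult powr_minus exp_minus field_simps)
          finally show ?thesis ..
        qed
        also have "ennreal (?c * (s powr (?q - 1) / exp s)) = ennreal ?c * ennreal (indicator {0..} s * (s powr (?q - 1) / exp s))"
          using True by (subst ennreal_mult) auto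
        finally show ?thesis .
      qed (use elim in \<open>simp add: radial_density_def\<close>)
    qed
  qed
  also have "\<dots> = ennreal ?c * (\<integral>\<^sup>+s. ennreal (indicator {0..} s * (s powr (?q - 1) / exp s)) \<partial>lborel)"
    by (rule nn_integral_cmult) measurable
  also have "(\<integral>\<^sup>+s. ennreal (indicator {0..} s * (s powr (?q - 1) / exp s)) \<partial>lborel) = ennreal (Gamma ?q)"
    by (rule nn_integral_has_integral_lebesgue[OF _ Gamma_integral_real[OF q]]) simp
  also have "ennreal ?c * ennreal (Gamma ?q) < \<infinity>" by (simp add: ennreal_mult_less_top)
  finally show ?thesis .
qed

text \<open>In the sum and half difference of \<zeta> and \<eta> the energy factorises into a
  Gaussian integral and the radial integral with p = 4 b + d - 2.\<close>

lemma pair_energy_gaussian: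
  fixes c :: real
  assumes b: "b > (1 - real DIM('a)) / 2" and c: "c > 0"
  defines "h \<equiv> \<lambda>x::'a::euclidean_space. complex_of_real (c * gaussian x)"
  shows "pair_energy b h h < \<infinity>" "pair_energy b h h \<noteq> 0"
proof -
  let ?p = "4 * b + real DIM('a) - 2"
  have hm[measurable]: "h \<in> borel_measurable borel" unfolding h_def by measurable
  let ?A = "\<lambda>\<xi>::'a. exp (- (1 * (norm \<xi>)\<^sup>2 / 2))"
  let ?B = "\<lambda>y::'a. exp (- 2 * (norm y)\<^sup>2) * norm (2 *\<^sub>R y) powr ?p"
  have e: "(norm (h ((1 / 2) *\<^sub>R \<xi> + y)))\<^sup>2 * (norm (h ((1 / 2) *\<^sub>R \<xi> - y)))\<^sup>2 * norm (((1 / 2) *\<^sub>R \<xi> + y) - ((1 / 2) *\<^sub>R \<xi> - y)) powr ?p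
     = c ^ 4 * (?A \<xi> * ?B y)" for \<xi> y :: 'a
  proof -
    have n: "(norm (h x))\<^sup>2 = c\<^sup>2 * exp (- (norm x)\<^sup>2)" for x
    proof -
      have "norm (h x) = c * exp (- ((norm x)\<^sup>2 / 2))"
        using c unfolding h_def norm_of_real by (simp add: gaussian_def)
      then show ?thesis by (simp add: power_mult_distrib flip: exp_double)
    qed
    have "(norm ((1 / 2) *\<^sub>R \<xi> + y))\<^sup>2 + (norm ((1 / 2) *\<^sub>R \<xi> - y))\<^sup>2 = (norm \<xi>)\<^sup>2 / 2 + 2 * (norm y)\<^sup>2"
      unfolding power2_norm_eq_inner by (simp add: inner_add inner_diff inner_commute field_simps)
    then have "exp (- (norm ((1 / 2) *\<^sub>R \<xi> + y))\<^sup>2) * exp (- (norm ((1 / 2) *\<^sub>R \<xi> - y))\<^sup>2) = ?A \<xi> * exp (- 2 * (norm y)\<^sup>2)"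
      unfolding mult_exp_exp by (intro arg_cong[where f=exp]) argo
    moreover have "((1 / 2) *\<^sub>R \<xi> + y) - ((1 / 2) *\<^sub>R \<xi> - y) = 2 *\<^sub>R y" by (simp add: scaleR_2)
    ultimately show ?thesis unfolding n
      by (simp add: power4_eq_xxxx power2_eq_square[of c] mult_ac)
  qed
  have mp: "(\<lambda>p::'a \<times> 'a. ennreal ((norm (h (fst p)))\<^sup>2 * (norm (h (snd p)))\<^sup>2 * norm (fst p - snd p) powr ?p)) \<in> borel_measurable borel"
    unfolding borel_prod[symmetric] by measurable
  have "pair_energy b h h = (\<integral>\<^sup>+p. ennreal ((norm (h (fst p)))\<^sup>2 * (norm (h (snd p)))\<^sup>2 * norm (fst p - snd p) powr ?p) \<partial>lborel)"
    unfolding pair_energy_def by (simp add: split_def)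
  also have "\<dots> = (\<integral>\<^sup>+\<xi>. \<integral>\<^sup>+y. ennreal (c ^ 4 * (?A \<xi> * ?B y)) \<partial>lborel \<partial>lborel)"
    unfolding nn_integral_centre[OF mp] by (simp only: fst_conv snd_conv e)
  also have "\<dots> = (\<integral>\<^sup>+\<xi>. \<integral>\<^sup>+y. ennreal (c ^ 4 * ?A \<xi>) * ennreal (?B y) \<partial>lborel \<partial>lborel)"
    using c by (simp add: ennreal_mult[symmetric] mult.assoc)
  also have "\<dots> = (\<integral>\<^sup>+\<xi>. ennreal (c ^ 4 * ?A \<xi>) \<partial>lborel) * (\<integral>\<^sup>+y. ennreal (?B y) \<partial>lborel)"
    by (simp add: nn_integral_cmult nn_integral_multc)
  also have "(\<integral>\<^sup>+\<xi>. ennreal (c ^ 4 * ?A \<xi>) \<partial>lborel) = ennreal (c ^ 4 * (2 * pi / 1) powr (DIM('a) / 2))"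
    using c integrable_gaussian[of 1, where 'a='a]
    by (subst nn_integral_eq_integral) auto
  finally have eq: "pair_energy b h h = ennreal (c ^ 4 * (2 * pi / 1) powr (DIM('a) / 2)) * (\<integral>\<^sup>+y. ennreal (?B y) \<partial>lborel)" .
  have "?p > - real DIM('a)" using b by (simp add: field_simps)
  then show "pair_energy b h h < \<infinity>"
    unfolding eq using nn_integral_radial_power_gaussian[of ?p, where 'a='a] by (simp add: ennreal_mult_less_top)
  have "(\<integral>\<^sup>+y. ennreal (?B y) \<partial>lborel) \<noteq> 0"
  proof
    assume "(\<integral>\<^sup>+y. ennreal (?B y) \<partial>lborel) = 0"
    then have "AE y in lborel. ennreal (?B y) = 0" by (subst (asm) nn_integral_0_iff_AE) auto
    then have "AE y in (lborel :: 'a measure). False"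
      using AE_lborel_singleton[of "0::'a"] by eventually_elim (simp add: ennreal_eq_0_iff mult_le_0_iff not_le)
    then have "emeasure (lborel :: 'a measure) UNIV = 0"
      using AE_iff_measurable[of UNIV "lborel :: 'a measure" "\<lambda>_. False"] by simp
    then show False by simp
  qed
  then show "pair_energy b h h \<noteq> 0"
    unfolding eq using c by (auto simp: ennreal_eq_0_iff mult_le_0_iff not_le)
qed

text \<open>An admissible pair with finite nonzero energy, on which the constant is tested. The
  constant of its transform is written as an exponential so as to fit
  \<open>quad_exp\<close>.\<close>

lemma gaussian_Upsilon:
  assumes b: "b > (1 - real DIM('a)) / 2"
  defines "u \<equiv> \<lambda>x::'a::euclidean_space. complex_of_real (gaussian x)"
  shows "(u, u) \<in> Upsilon b" "I_fun b u u \<noteq> 0"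
    "AE x in lborel. fourier u x = quad_exp (- 1 / 2) (\<lambda>_. 0) (of_real (ln ((2 * pi) powr (DIM('a) / 2)))) x"
proof -
  let ?c = "(2 * pi) powr (real DIM('a) / 2)"
  let ?h = "\<lambda>x::'a. complex_of_real (?c * gaussian x)"
  have ui: "integrable lborel u" unfolding u_def by (rule gaussian_of_real_integrable)
  have um[measurable]: "u \<in> borel_measurable borel" unfolding u_def by measurable
  have ut: "tempered u"
    by (rule tempered_bounded[of _ 1]) (auto simp: u_def gaussian_pos less_imp_le gaussian_le_1)
  have fu: "fourier_integral u = ?h"
    using fourier_integral_cgaussian_shift[of "0::'a"] by (simp add: cgaussian_0_0 u_def fun_eq_iff)
  have hf: "has_fourier (distr_of u) ?h" using has_fourier_integrable[OF ui] unfolding fu .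
  then have hF: "has_fourier (distr_of u) (fourier u)" by (intro has_fourier_fourier) blast
  have AE: "AE x in lborel. fourier u x = ?h x" by (rule has_fourier_unique[OF hF hf])
  have Fm[measurable]: "fourier u \<in> borel_measurable borel" using hF by (simp add: has_fourier_def tempered_def)
  have "?h \<in> borel_measurable borel" by measurable
  then have pm: "Measurable.pred borel (\<lambda>x. fourier u x = ?h x)"
    using Fm by (subst right_minus_eq[symmetric]) measurable
  have pe: "pair_energy b (fourier u) (fourier u) = pair_energy b ?h ?h"
    unfolding pair_energy_def
  proof (rule nn_integral_cong_AE)
    have "AE p in (lborel :: ('a \<times> 'a) measure). fourier u (fst p) = ?h (fst p)"
      by (rule AE_lborel_fst(1)[OF pm AE])
    moreover have "AE p in (lborel :: ('a \<times> 'a) measure). fourier u (snd p) = ?h (snd p)"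
      by (rule AE_lborel_fst(2)[OF pm AE])
    ultimately show "AE x in lborel. (case x of (\<zeta>, \<eta>) \<Rightarrow> ennreal ((norm (fourier u \<zeta>))\<^sup>2 * (norm (fourier u \<eta>))\<^sup>2 * norm (\<zeta> - \<eta>) powr (4 * b + real DIM('a) - 2))) =
      (case x of (\<zeta>, \<eta>) \<Rightarrow> ennreal ((norm (?h \<zeta>))\<^sup>2 * (norm (?h \<eta>))\<^sup>2 * norm (\<zeta> - \<eta>) powr (4 * b + real DIM('a) - 2)))"
    proof eventually_elim
      case (elim p)
      show ?case unfolding split_def elim ..
    qed
  qed
  have "I_fun b u u < \<infinity>" "I_fun b u u \<noteq> 0"
    unfolding I_fun_eq pe using pair_energy_gaussian[OF b, of ?c] by simp_all
  then show "(u, u) \<in> Upsilon b" "I_fun b u u \<noteq> 0"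
    using ut hF by (auto simp: Upsilon_def)
  show "AE x in lborel. fourier u x = quad_exp (- 1 / 2) (\<lambda>_. 0) (of_real (ln ?c)) x"
    using AE
  proof eventually_elim
    case (elim x)
    have "exp (- 1 / 2 * complex_of_real ((norm x)\<^sup>2) + complex_of_real (ln ?c)) = of_real (exp (- (norm x)\<^sup>2 / 2 + ln ?c))"
      by (simp flip: exp_of_real)
    also have "exp (- (norm x)\<^sup>2 / 2 + ln ?c) = ?c * gaussian x" unfolding exp_add by (simp add: gaussian_def powr_def)
    finally show ?case unfolding elim quad_exp_def by simp
  qed
qed

theorem theorem1p4:
  fixes \<beta> :: real
  assumes "CARD('n::finite) \<ge> 2" and "\<beta> > (1 - real CARD('n)) / 2"
  shows
    "(\<forall>u0 v0 :: real ^ 'n \<Rightarrow> complex. (u0, v0) \<in> Upsilon \<beta> \<longrightarrow>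
        D_power_norm_sq \<beta> (solution_product u0 v0) \<le>
          ennreal (2 powr (- 2 * \<beta>) * sharp_const CARD('n)) * I_fun \<beta> u0 v0) \<and>
     (\<forall>K::real. (\<forall>u0 v0 :: real ^ 'n \<Rightarrow> complex. (u0, v0) \<in> Upsilon \<beta> \<longrightarrow>
        D_power_norm_sq \<beta> (solution_product u0 v0) \<le> ennreal K * I_fun \<beta> u0 v0) \<longrightarrow>
        2 powr (- 2 * \<beta>) * sharp_const CARD('n) \<le> K) \<and>
     (\<forall>u0 v0 :: real ^ 'n \<Rightarrow> complex. (u0, v0) \<in> Upsilon \<beta> \<longrightarrow>
        \<not> (AE x in lborel. u0 x = 0) \<longrightarrow> \<not> (AE x in lborel. v0 x = 0) \<longrightarrow>
        (D_power_norm_sq \<beta> (solution_product u0 v0) =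
            ennreal (2 powr (- 2 * \<beta>) * sharp_const CARD('n)) * I_fun \<beta> u0 v0 \<longleftrightarrow>
          (\<exists>h\<in>gaussians. AE \<xi> in lborel. fourier u0 \<xi> = h \<xi>) \<and>
          (\<exists>c. c \<noteq> 0 \<and> (AE x in lborel. v0 x = c * u0 x))))"
proof -
  let ?B = "2 powr (- 2 * \<beta>) * sharp_const CARD('n)"
  have B: "?B > 0" using assms(1) by (intro mult_pos_pos sharp_const_pos) auto
  then have B': "ennreal ?B \<noteq> 0" "ennreal ?B \<noteq> \<top>" by (simp_all add: ennreal_eq_0_iff not_le)
  have dim: "DIM(real ^ 'n) \<ge> 2" and b: "\<beta> > (1 - real DIM(real ^ 'n)) / 2" using assms by simp_all
  have D: "D_power_norm_sq \<beta> (solution_product u0 v0) = ennreal ?B * product_energy \<beta> (fourier u0) (fourier v0)"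
    if "(u0, v0) \<in> Upsilon \<beta>" for u0 v0 :: "real ^ 'n \<Rightarrow> complex"
    using D_power_norm_sq_Upsilon[OF that] by simp
  have meas: "fourier u0 \<in> borel_measurable borel" "fourier v0 \<in> borel_measurable borel"
    if "(u0, v0) \<in> Upsilon \<beta>" for u0 v0 :: "real ^ 'n \<Rightarrow> complex"
    using Upsilon_fourier[OF that] by (simp_all add: tempered_measurable)
  have eq_iff: "D_power_norm_sq \<beta> (solution_product u0 v0) = ennreal ?B * I_fun \<beta> u0 v0 \<longleftrightarrow>
      product_energy \<beta> (fourier u0) (fourier v0) = pair_energy \<beta> (fourier u0) (fourier v0)"
    if "(u0, v0) \<in> Upsilon \<beta>" for u0 v0 :: "real ^ 'n \<Rightarrow> complex"
    unfolding D[OF that] I_fun_eq using B' by (simp add: ennreal_mult_cancel_left)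
  have 1: "D_power_norm_sq \<beta> (solution_product u0 v0) \<le> ennreal ?B * I_fun \<beta> u0 v0"
    if "(u0, v0) \<in> Upsilon \<beta>" for u0 v0 :: "real ^ 'n \<Rightarrow> complex"
    unfolding D[OF that] I_fun_eq by (intro mult_left_mono product_energy_le meas[OF that]) auto
  \<comment> \<open>The standard Gaussian paired with itself gives equality, and its finite nonzero
    energy can be cancelled. A negative K is excluded because then
    \<open>ennreal K = 0\<close>.\<close>
  have 2: "?B \<le> K"
    if K: "\<forall>u0 v0 :: real ^ 'n \<Rightarrow> complex. (u0, v0) \<in> Upsilon \<beta> \<longrightarrow> D_power_norm_sq \<beta> (solution_product u0 v0) \<le> ennreal K * I_fun \<beta> u0 v0" for K
  proof -
    let ?u = "\<lambda>x::real ^ 'n. complex_of_real (gaussian x)"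
    note G = gaussian_Upsilon[OF b]
    note F = Upsilon_fourier[OF G(1)]
    have "product_energy \<beta> (fourier ?u) (fourier ?u) = pair_energy \<beta> (fourier ?u) (fourier ?u)"
      by (rule equality_if_gaussian[OF meas[OF G(1)] F(7) G(3), of 1]) simp
    then have "ennreal ?B * I_fun \<beta> ?u ?u = D_power_norm_sq \<beta> (solution_product ?u ?u)"
      using eq_iff[OF G(1)] by simp
    also have "\<dots> \<le> ennreal K * I_fun \<beta> ?u ?u" using K G(1) by blast
    finally have le: "I_fun \<beta> ?u ?u * ennreal ?B \<le> I_fun \<beta> ?u ?u * ennreal K" by (simp only: mult.commute)
    have "I_fun \<beta> ?u ?u \<noteq> \<top>" using F(7) unfolding I_fun_eq by simp
    then have "ennreal ?B \<le> ennreal K"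
      using le G(2) by (simp add: ennreal_mult_le_mult_iff)
    then show ?thesis using B by (cases "K \<ge> 0") (auto simp: ennreal_neg)
  qed
  have 3: "D_power_norm_sq \<beta> (solution_product u0 v0) = ennreal ?B * I_fun \<beta> u0 v0 \<longleftrightarrow>
      (\<exists>h\<in>gaussians. AE \<xi> in lborel. fourier u0 \<xi> = h \<xi>) \<and> (\<exists>c. c \<noteq> 0 \<and> (AE x in lborel. v0 x = c * u0 x))"
    if U: "(u0, v0) \<in> Upsilon \<beta>" and nz: "\<not> (AE x in lborel. u0 x = 0)" "\<not> (AE x in lborel. v0 x = 0)"
    for u0 v0 :: "real ^ 'n \<Rightarrow> complex"
  proof -
    note F = Upsilon_fourier[OF U] and m = meas[OF U]
    \<comment> \<open>Data that are nonzero as functions have nonzero transforms, again by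
      uniqueness of preimages.\<close>
    have nz': "\<not> (AE x in lborel. fourier u0 x = 0)" "\<not> (AE x in lborel. fourier v0 x = 0)"
      using nz fourier_AE_0_iff[OF F(1,3)] fourier_AE_0_iff[OF F(2,4)] by blast+
    show ?thesis unfolding eq_iff[OF U]
    proof (intro iffI conjI)
      assume e: "product_energy \<beta> (fourier u0) (fourier v0) = pair_energy \<beta> (fourier u0) (fourier v0)"
      obtain a B C c where q: "Re a < 0" "c \<noteq> 0" "AE x in lborel. fourier v0 x = quad_exp a B C x"
        "AE x in lborel. fourier u0 x = c * fourier v0 x"
        using gaussian_if_equality[OF dim b m F(7) nz' e] by blast
      have "AE x in lborel. fourier u0 x = quad_exp a B (Ln c + C) x"
        using q(3,4) by eventually_elim (simp add: quad_exp_scale[OF q(2)])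
      then show "\<exists>h\<in>gaussians. AE \<xi> in lborel. fourier u0 \<xi> = h \<xi>"
        using quad_exp_in_gaussians[OF q(1)] by blast
      have "AE x in lborel. fourier v0 x = (1 / c) * fourier u0 x"
        using q(4) by eventually_elim (simp add: q(2))
      then have "AE x in lborel. v0 x = (1 / c) * u0 x"
        using fourier_scaled_AE[OF F(1,3) F(2,4)] by blast
      then show "\<exists>c. c \<noteq> 0 \<and> (AE x in lborel. v0 x = c * u0 x)" using q(2) by (intro exI[of _ "1 / c"]) simp
    next
      assume "(\<exists>h\<in>gaussians. AE \<xi> in lborel. fourier u0 \<xi> = h \<xi>) \<and> (\<exists>c. c \<noteq> 0 \<and> (AE x in lborel. v0 x = c * u0 x))"
      then obtain h c where h: "h \<in> gaussians" "AE \<xi> in lborel. fourier u0 \<xi> = h \<xi>" and c: "AE x in lborel. v0 x = c * u0 x"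
        by blast
      obtain a B C where q: "h = quad_exp a B C" using gaussians_quad_exp[OF h(1)] .
      have "AE x in lborel. fourier v0 x = c * fourier u0 x"
        using fourier_scaled_AE[OF F(1,3) F(2,4)] c by blast
      then show "product_energy \<beta> (fourier u0) (fourier v0) = pair_energy \<beta> (fourier u0) (fourier v0)"
        by (rule equality_if_gaussian[OF m F(7) h(2)[unfolded q]])
    qed
  qed
  show ?thesis using 1 2 3 by blast
qed

end
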